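(* Let $\{\lambda_j\}_{j\in J}$, $J=\{n,\dots,n+N\}$, be a cluster of eigenvalues of $-\Delta_\gamma$ with $\lambda_{n-1}<\lambda_n$ and $\lambda_{n+N}<\lambda_{n+N+1}$, and let the discrete eigenvalues $\{\Lambda_j\}_{j=1}^{\dim\mathbb V_\#}$ be such that $\mu(J)<\infty$. Fix $i\in J$ and let $u_i\in H^1_\#(\gamma)$ be any eigenfunction associated with $\lambda_i$. Then for any $\alpha\in\mathbb R$, $$ \|u_i-\mathbf Z u_i\|_{\widetilde A}\le\|u_i-\mathbf G u_i\|_{\widetilde A}+C\sqrt{\lambda_i}\,(1+\mu(J))\,\|u_i-\mathbf G u_i-\alpha\|_{\widetilde M}+C\sqrt{\lambda_i}\,(1+\mu(J))\,h^{k+1}\|u_i\|_{\widetilde M}, $$ with a constant $C$ of the type described in the context.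
   Context: Surface. $\gamma\subset\mathbb R^{D+1}$ is a connected, compact, orientable, $C^\infty$, $D$-dimensional embedded surface without boundary; $d$ is its signed distance function (negative inside), $\nu=\nabla d$, and $\mathcal N$ is a sufficiently narrow strip about $\gamma$ in which every $x$ is uniquely $x=\psi(x)+d(x)\nu(x)$ with $\psi(x)\in\gamma$ the closest-point projection. Approximate surface. $\overline\Gamma$ is a polyhedron with simplicial $D$-dimensional faces $\overline T\in\overline{\mathcal T}$. Fix $k\ge1$. On each $\overline T$ with degree-$k$ Lagrange nodes $x^1,\dots,x^{n_k}$ and basis functions $\phi_j$, set $L(x)=\sum_j L(x^j)\phi_j(x)$, where $|L(x^j)-\psi(x^j)|\le Ch^{k+1}$; $L:\overline\Gamma\to\Gamma:=L(\overline\Gamma)$ is a continuous bijection, $\mathcal T=\{L(\overline T)\}$, $h=\max_{T\in\mathcal T}\mathrm{diam}(T)$. Assume $\Gamma\subset\mathcal N$ and $\psi|_\Gamma:\Gamma\to\gamma$ is a bijection. With $F_T=L\circ\overline F_T$ ($\overline F_T$ the affine map from a reference simplex $\widehat T$ to $\overline T$), the shape-regularity constant $\rho$ is the largest number with $\rho\,\mathrm{diam}(T)|\xi|\le|DF_T(\hat x)\xi|\le\rho^{-1}\mathrm{diam}(T)|\xi|$ for all $T$, $\hat x\in\widehat T$, $\xi\in\mathbb R^D$; the quasi-uniformity constant $\eta$ is the smallest with $h\le\eta\min_T\mathrm{diam}(T)$. With $\mathbf N$ the unit normal of $\Gamma$, the following standing bounds hold: $\|d\|_{L_\infty(\Gamma)}\le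 Ch^{k+1}$, $\|\nu-\mathbf N\|_{L_\infty(\Gamma)}\le Ch^k$, $\|L-\psi\|_{W^{i,\infty}(\overline T)}\le Ch^{k+1-i}$ for $0\le i\le k+1$. Lifts and forms. Functions on $\Gamma$ and on $\gamma$ are identified through $\psi|_\Gamma$: $v$ on $\Gamma$ corresponds to $\tilde v=v\circ(\psi|_\Gamma)^{-1}$ on $\gamma$ (tildes are dropped). $\tilde a(u,v)=\int_\gamma\nabla_\gamma u\cdot\nabla_\gamma v\,d\sigma$, $\tilde m(u,v)=\int_\gamma uv\,d\sigma$; $\widetilde A(\tilde u,\tilde v)=\int_\Gamma\nabla_\Gamma u\cdot\nabla_\Gamma v\,d\Sigma$, $\widetilde M(\tilde u,\tilde v)=\int_\Gamma uv\,d\Sigma$; $\|\cdot\|_{\widetilde A},\|\cdot\|_{\widetilde M}$ are the associated (semi)norms. Finite elements. For $r\ge1$, $\mathbb V=\{V\in H^1(\Gamma): V=\overline V\circ L^{-1},\ \overline V|_{\overline T}\in\mathbb P^r(\overline T)\ \forall\overline T\}$ and $\mathbb V_\#=\{V\in\mathbb V:\int_\Gamma V\,d\Sigma=0\}$. Eigenproblems. $H^1_\#(\gamma)=\{v\in H^1(\gamma):\int_\gamma v\,d\sigma=0\}$; $0=\lambda_0<\lambda_1\le\lambda_2\le\dots$ are the eigenvalues of $-\Delta_\gamma$, and $u_i\in H^1_\#(\gamma)$ is an eigenfunction for $\lambda_i$, $i\ge1$, if $u_i\ne0$ and $\tilde a(u_i,v)=\lambda_i\tilde m(u_i,v)$ for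 all $v\in H^1_\#(\gamma)$. $0<\Lambda_1\le\dots\le\Lambda_{\dim\mathbb V_\#}$ and $\{U_j\}\subset\mathbb V_\#$ are the discrete eigenvalues and $\widetilde M$-orthonormal eigenfunctions: $\widetilde A(U_j,V)=\Lambda_j\widetilde M(U_j,V)$ for all $V\in\mathbb V_\#$. For $J=\{n,\dots,n+N\}$ ($n\ge1$, $N\ge0$, $n+N\le\dim\mathbb V_\#$), $\mathbb W_\#=\mathrm{span}\{U_j:j\in J\}$ and $\mu(J)=\max_{\ell\in J}\max_{j\in\{1,\dots,\dim\mathbb V_\#\}\setminus J}\left|\frac{\lambda_\ell}{\Lambda_j-\lambda_\ell}\right|$. Projections on $H^1(\gamma)$. $\mathbf Gv\in\mathbb V_\#$: $\widetilde A(\mathbf Gv,V)=\widetilde A(v,V)$ for all $V\in\mathbb V_\#$. $\mathbf Zv\in\mathbb W_\#$: $\widetilde A(\mathbf Zv,V)=\widetilde A(v,V)$ for all $V\in\mathbb W_\#$. Constants. $C$ depends only on $\gamma$ (including its Poincaré–Friedrichs constant), $D,k,r$, $\rho$, $\eta$ and the constants in the standing bounds, but not on $h$ nor otherwise on the spectrum of $-\Delta_\gamma$. *)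

theory Defs
  imports "HOL-Analysis.Analysis" "HOL-Library.Function_Algebras"
begin

(* The parameter domain is R^D = real^'d with D = CARD('d); the ambient space is R^(D+1). *)
type_synonym 'd ambient = "real ^ ('d option)"


section \<open>Smooth maps and hypersurfaces\<close>

(* Meant for open S. *)
fun Ck_on :: "nat \<Rightarrow> ('a::real_normed_vector \<Rightarrow> 'b::real_normed_vector) \<Rightarrow> 'a set \<Rightarrow> bool" where
  "Ck_on 0 f S \<longleftrightarrow> continuous_on S f"
| "Ck_on (Suc m) f S \<longleftrightarrow> (\<forall>x\<in>S. f differentiable (at x)) \<and>
     (\<forall>v. Ck_on m (\<lambda>x. frechet_derivative f (at x) v) S)"

definition smooth_on :: "('a::real_normed_vector \<Rightarrow> 'b::real_normed_vector) \<Rightarrow> 'a set \<Rightarrow> bool" where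
  "smooth_on f S \<longleftrightarrow> (\<forall>m. Ck_on m f S)"

(* Regular local parametrisations of S: smooth immersions that are homeomorphisms onto a
   relatively open part of S.  Also used for piecewise smooth S, where they only reach the
   smooth part of S. *)
definition local_params :: "('d::finite) ambient set \<Rightarrow> ((real^'d) set \<times> (real^'d \<Rightarrow> 'd ambient)) set" where
  "local_params S = {(U, X). open U \<and> smooth_on X U \<and> openin (top_of_set S) (X ` U) \<and>
     (\<exists>Y. homeomorphism U (X ` U) X Y) \<and> (\<forall>x\<in>U. inj (frechet_derivative X (at x)))}"

definition unit_normal :: "('d::finite) ambient set \<Rightarrow> ('d ambient \<Rightarrow> 'd ambient) \<Rightarrow> bool" where
  "unit_normal S n \<longleftrightarrow> (\<forall>(U, X)\<in>local_params S. \<forall>x\<in>U.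
     norm (n (X x)) = 1 \<and> (\<forall>v. n (X x) \<bullet> frechet_derivative X (at x) v = 0))"

definition closed_surface :: "('d::finite) ambient set \<Rightarrow> bool" where
  "closed_surface \<gamma> \<longleftrightarrow> \<gamma> \<noteq> {} \<and> compact \<gamma> \<and> connected \<gamma> \<and>
     (\<forall>p\<in>\<gamma>. \<exists>(U, X)\<in>local_params \<gamma>. p \<in> X ` U) \<and>
     (\<exists>n. continuous_on \<gamma> n \<and> unit_normal \<gamma> n)"

definition area_factor :: "(real^'d::finite \<Rightarrow> 'd ambient) \<Rightarrow> real^'d \<Rightarrow> real" where
  "area_factor X x = sqrt (det (\<chi> i j.
     frechet_derivative X (at x) (axis i 1) \<bullet> frechet_derivative X (at x) (axis j 1)))"

(* M is the D-dimensional surface measure of S.  These conditions determine M uniquely; the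
   last one says that the part of S without tangent planes (the skeleton, for a piecewise
   smooth S; nothing, for a smooth S) does not count. *)
definition surface_measure :: "('d::finite) ambient set \<Rightarrow> 'd ambient measure \<Rightarrow> bool" where
  "surface_measure S M \<longleftrightarrow> sets M = sets (restrict_space borel S) \<and>
     (\<forall>(U, X)\<in>local_params S. \<forall>A\<in>sets borel. A \<subseteq> U \<longrightarrow>
        emeasure M (X ` A) = (\<integral>\<^sup>+x\<in>A. ennreal (area_factor X x) \<partial>lborel)) \<and>
     S - (\<Union>(U, X)\<in>local_params S. X ` U) \<in> null_sets M"


section \<open>Distance function and strip\<close>

definition grad :: "('a::real_inner \<Rightarrow> real) \<Rightarrow> 'a \<Rightarrow> 'a" where
  "grad f x = (THE g. GDERIV f x :> g)"

definition signed_dist :: "('d::finite) ambient set \<Rightarrow> 'd ambient \<Rightarrow> real" where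
  "signed_dist \<gamma> x = (if x \<in> inside \<gamma> then - infdist x \<gamma> else infdist x \<gamma>)"

abbreviation normal_ext :: "('d::finite) ambient set \<Rightarrow> 'd ambient \<Rightarrow> 'd ambient" where
  "normal_ext \<gamma> \<equiv> grad (signed_dist \<gamma>)"

definition strip :: "('d::finite) ambient set \<Rightarrow> real \<Rightarrow> 'd ambient set" where
  "strip \<gamma> \<delta> = {x. \<bar>signed_dist \<gamma> x\<bar> < \<delta>}"

definition projection_strip :: "('d::finite) ambient set \<Rightarrow> real \<Rightarrow> bool" where
  "projection_strip \<gamma> \<delta> \<longleftrightarrow> (\<forall>x\<in>strip \<gamma> \<delta>.
     signed_dist \<gamma> differentiable (at x) \<and>
     (\<exists>!p. p \<in> \<gamma> \<and> dist x p = infdist x \<gamma>) \<and>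
     x = closest_point \<gamma> x + signed_dist \<gamma> x *\<^sub>R normal_ext \<gamma> x)"


section \<open>Sobolev spaces and bilinear forms on a surface\<close>

(* M is the surface measure and n a unit normal field; the sign of n is irrelevant here. *)

definition tangential_grad :: "('a::real_inner \<Rightarrow> 'a) \<Rightarrow> ('a \<Rightarrow> real) \<Rightarrow> 'a \<Rightarrow> 'a" where
  "tangential_grad n f x = grad f x - (grad f x \<bullet> n x) *\<^sub>R n x"

(* H^1 is the closure, in the H^1 norm, of the restrictions of smooth functions. *)
definition has_weak_grad :: "('d::finite) ambient measure \<Rightarrow> ('d ambient \<Rightarrow> 'd ambient) \<Rightarrow>
    ('d ambient \<Rightarrow> real) \<Rightarrow> ('d ambient \<Rightarrow> 'd ambient) \<Rightarrow> bool" where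
  "has_weak_grad M n u g \<longleftrightarrow>
     u \<in> borel_measurable M \<and> integrable M (\<lambda>x. (u x)\<^sup>2) \<and>
     g \<in> borel_measurable M \<and> integrable M (\<lambda>x. (norm (g x))\<^sup>2) \<and>
     (\<exists>f. (\<forall>m. smooth_on (f m) UNIV) \<and>
        (\<lambda>m::nat. \<integral>\<^sup>+x. ennreal ((f m x - u x)\<^sup>2) \<partial>M) \<longlonglongrightarrow> 0 \<and>
        (\<lambda>m. \<integral>\<^sup>+x. ennreal ((norm (tangential_grad n (f m) x - g x))\<^sup>2) \<partial>M) \<longlonglongrightarrow> 0)"

definition H1 :: "('d::finite) ambient measure \<Rightarrow> ('d ambient \<Rightarrow> 'd ambient) \<Rightarrow> ('d ambient \<Rightarrow> real) set" where
  "H1 M n = {u. \<exists>g. has_weak_grad M n u g}"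

definition weak_grad :: "('d::finite) ambient measure \<Rightarrow> ('d ambient \<Rightarrow> 'd ambient) \<Rightarrow>
    ('d ambient \<Rightarrow> real) \<Rightarrow> 'd ambient \<Rightarrow> 'd ambient" where
  "weak_grad M n u = (SOME g. has_weak_grad M n u g)"

definition mass_form :: "'a measure \<Rightarrow> ('a \<Rightarrow> real) \<Rightarrow> ('a \<Rightarrow> real) \<Rightarrow> real" where
  "mass_form M u v = (\<integral>x. u x * v x \<partial>M)"

definition energy_form :: "('d::finite) ambient measure \<Rightarrow> ('d ambient \<Rightarrow> 'd ambient) \<Rightarrow>
    ('d ambient \<Rightarrow> real) \<Rightarrow> ('d ambient \<Rightarrow> real) \<Rightarrow> real" where
  "energy_form M n u v = (\<integral>x. weak_grad M n u x \<bullet> weak_grad M n v x \<partial>M)"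

definition mass_norm :: "'a measure \<Rightarrow> ('a \<Rightarrow> real) \<Rightarrow> real" where
  "mass_norm M u = sqrt (mass_form M u u)"

definition energy_norm :: "('d::finite) ambient measure \<Rightarrow> ('d ambient \<Rightarrow> 'd ambient) \<Rightarrow>
    ('d ambient \<Rightarrow> real) \<Rightarrow> real" where
  "energy_norm M n u = sqrt (energy_form M n u u)"

definition H1_mean_zero :: "('d::finite) ambient measure \<Rightarrow> ('d ambient \<Rightarrow> 'd ambient) \<Rightarrow>
    ('d ambient \<Rightarrow> real) set" where
  "H1_mean_zero M n = {u \<in> H1 M n. (\<integral>x. u x \<partial>M) = 0}"

definition eigenfunction :: "('d::finite) ambient measure \<Rightarrow> ('d ambient \<Rightarrow> 'd ambient) \<Rightarrow>
    real \<Rightarrow> ('d ambient \<Rightarrow> real) \<Rightarrow> bool" where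
  "eigenfunction M n l u \<longleftrightarrow> u \<in> H1_mean_zero M n \<and> \<not> (AE x in M. u x = 0) \<and>
     (\<forall>v\<in>H1_mean_zero M n. energy_form M n u v = l * mass_form M u v)"

(* lam enumerates the eigenvalues in increasing order with multiplicity: for every l, the
   e j with lam j = l form a (finite, orthonormal) basis of the eigenspace of l.  The
   eigenfunctions for lam 0 = 0 are the constants, which are not in H1_mean_zero. *)
definition laplace_spectrum :: "('d::finite) ambient measure \<Rightarrow> ('d ambient \<Rightarrow> 'd ambient) \<Rightarrow>
    (nat \<Rightarrow> real) \<Rightarrow> bool" where
  "laplace_spectrum M n lam \<longleftrightarrow> lam 0 = 0 \<and> 0 < lam 1 \<and> mono lam \<and>
     (\<exists>e. (\<forall>j\<ge>1. eigenfunction M n (lam j) (e j)) \<and>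
        (\<forall>i\<ge>1. \<forall>j\<ge>1. mass_form M (e i) (e j) = (if i = j then 1 else 0)) \<and>
        (\<forall>l u. eigenfunction M n l u \<longrightarrow> finite {j. 1 \<le> j \<and> lam j = l} \<and>
           (\<exists>c. AE x in M. u x = (\<Sum>j | 1 \<le> j \<and> lam j = l. c j * e j x))))"


section \<open>Approximate surface\<close>

definition poly_space :: "nat \<Rightarrow> (real^'m::finite \<Rightarrow> real) set" where
  "poly_space r = {p. \<exists>c. \<forall>x. p x =
     (\<Sum>a | (\<Sum>i\<in>UNIV. a i) \<le> r. c a * (\<Prod>i\<in>UNIV. (x $ i) ^ a i))}"

(* P^r on a simplex: restrictions of polynomials in the ambient coordinates. *)
definition poly_on :: "nat \<Rightarrow> (real^'m::finite) set \<Rightarrow> (real^'m \<Rightarrow> real) set" where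
  "poly_on r T = {f. \<exists>p\<in>poly_space r. \<forall>x\<in>T. f x = p x}"

(* The points of T whose barycentric coordinates are multiples of 1/k. *)
definition lagrange_nodes :: "nat \<Rightarrow> 'a::real_vector set \<Rightarrow> 'a set" where
  "lagrange_nodes k T = {y. \<exists>a::'a \<Rightarrow> nat. (\<Sum>v | v extreme_point_of T. a v) = k \<and>
     y = (\<Sum>v | v extreme_point_of T. (real (a v) / real k) *\<^sub>R v)}"

definition lagrange_basis :: "nat \<Rightarrow> (real^'m::finite) set \<Rightarrow> (real^'m \<Rightarrow> real^'m \<Rightarrow> real) \<Rightarrow> bool" where
  "lagrange_basis k T \<phi> \<longleftrightarrow> (\<forall>y\<in>lagrange_nodes k T. \<phi> y \<in> poly_on k T \<and>
     (\<forall>z\<in>lagrange_nodes k T. \<phi> y z = (if z = y then 1 else 0)))"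

definition ref_simplex :: "(real^'d::finite) set" where
  "ref_simplex = convex hull (insert 0 Basis)"

definition mesh_size :: "'a::metric_space set set \<Rightarrow> ('a \<Rightarrow> 'a) \<Rightarrow> real" where
  "mesh_size \<T> L = Max ((\<lambda>T. diameter (L ` T)) ` \<T>)"

fun iterated_deriv :: "'a::real_normed_vector list \<Rightarrow> ('a \<Rightarrow> 'b::real_normed_vector) \<Rightarrow> 'a \<Rightarrow> 'b" where
  "iterated_deriv [] f x = f x"
| "iterated_deriv (v # vs) f x =
     vector_derivative (\<lambda>t. iterated_deriv vs f (x + t *\<^sub>R v)) (at (0::real))"

(* The W^(i,infinity) norm on a flat simplex T is at most B, for f smooth on T: only
   derivatives in directions v tangent to T occur. *)
definition W_inf_le :: "nat \<Rightarrow> 'a::euclidean_space set \<Rightarrow> ('a \<Rightarrow> 'b::real_normed_vector) \<Rightarrow> real \<Rightarrow> bool" where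
  "W_inf_le i T f B \<longleftrightarrow> (\<forall>x\<in>rel_interior T. \<forall>vs. length vs \<le> i \<and>
     (\<forall>v\<in>set vs. norm v = 1 \<and> (\<exists>y\<in>T. \<exists>z\<in>T. \<exists>c. v = c *\<^sub>R (y - z)))
     \<longrightarrow> norm (iterated_deriv vs f x) \<le> B)"

(* \<T> is the triangulation of the polyhedron, F T the affine map from the reference simplex
   onto T, L the lift, and N the unit normal of L ` \<Union>\<T>.  The constants \<rho> and \<eta> enter
   as a lower and an upper bound for the shape regularity and quasi-uniformity constants of
   the mesh, and c is a common constant for all the standing bounds.  Containment of \<Union>\<T> in
   the strip is what gives a meaning to the projection and to its derivatives there. *)
definition approx_surface ::
  "('d::finite) ambient set \<Rightarrow> real \<Rightarrow> nat \<Rightarrow> real \<Rightarrow> real \<Rightarrow> real \<Rightarrow> 'd ambient set set \<Rightarrow>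
   ('d ambient set \<Rightarrow> real^'d \<Rightarrow> 'd ambient) \<Rightarrow> ('d ambient \<Rightarrow> 'd ambient) \<Rightarrow>
   ('d ambient \<Rightarrow> 'd ambient) \<Rightarrow> 'd ambient measure \<Rightarrow> bool" where
  "approx_surface \<gamma> \<delta> k \<rho> \<eta> c \<T> F L N \<Sigma> \<longleftrightarrow>
    (let \<psi> = closest_point \<gamma>; \<Gamma> = L ` \<Union>\<T>; h = mesh_size \<T> L in
       triangulation \<T> \<and> (\<forall>T\<in>\<T>. int CARD('d) simplex T) \<and>
       (\<forall>T\<in>\<T>. (\<exists>b A. linear A \<and> F T = (\<lambda>x. b + A x)) \<and> F T ` ref_simplex = T) \<and>
       continuous_on (\<Union>\<T>) L \<and> inj_on L (\<Union>\<T>) \<and>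
       (\<forall>T\<in>\<T>. \<exists>\<phi>. lagrange_basis k T \<phi> \<and>
          (\<forall>x\<in>T. L x = (\<Sum>y\<in>lagrange_nodes k T. \<phi> y x *\<^sub>R L y))) \<and>
       \<Union>\<T> \<subseteq> strip \<gamma> \<delta> \<and> \<Gamma> \<subseteq> strip \<gamma> \<delta> \<and> bij_betw \<psi> \<Gamma> \<gamma> \<and>
       (\<forall>T\<in>\<T>. \<forall>x\<in>ref_simplex. \<forall>\<xi>.
          \<rho> * diameter (L ` T) * norm \<xi>
            \<le> norm (frechet_derivative (L \<circ> F T) (at x within ref_simplex) \<xi>) \<and>
          norm (frechet_derivative (L \<circ> F T) (at x within ref_simplex) \<xi>)
            \<le> inverse \<rho> * diameter (L ` T) * norm \<xi>) \<and>
       (\<forall>T\<in>\<T>. h \<le> \<eta> * diameter (L ` T)) \<and>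
       unit_normal \<Gamma> N \<and> surface_measure \<Gamma> \<Sigma> \<and>
       (\<forall>T\<in>\<T>. \<forall>y\<in>lagrange_nodes k T. norm (L y - \<psi> y) \<le> c * h ^ (k + 1)) \<and>
       (AE x in \<Sigma>. \<bar>signed_dist \<gamma> x\<bar> \<le> c * h ^ (k + 1)) \<and>
       (AE x in \<Sigma>. norm (normal_ext \<gamma> x - N x) \<le> c * h ^ k) \<and>
       (\<forall>T\<in>\<T>. \<forall>i\<le>k + 1. W_inf_le i T (\<lambda>x. L x - \<psi> x) (c * h ^ (k + 1 - i))))"


section \<open>Finite elements and discrete eigenproblem\<close>

(* Functions on the approximate surface are represented by their extension by zero, so that
   the space has its true dimension. *)
definition fe_space :: "nat \<Rightarrow> ('d::finite) ambient set set \<Rightarrow> ('d ambient \<Rightarrow> 'd ambient) \<Rightarrow>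
    ('d ambient \<Rightarrow> 'd ambient) \<Rightarrow> 'd ambient measure \<Rightarrow> ('d ambient \<Rightarrow> real) set" where
  "fe_space r \<T> L N \<Sigma> = {V \<in> H1 \<Sigma> N. (\<forall>x. x \<notin> L ` \<Union>\<T> \<longrightarrow> V x = 0) \<and>
     (\<exists>Vbar. (\<forall>x\<in>L ` \<Union>\<T>. V x = Vbar (inv_into (\<Union>\<T>) L x)) \<and> (\<forall>T\<in>\<T>. Vbar \<in> poly_on r T))}"

definition fe_mean_zero :: "nat \<Rightarrow> ('d::finite) ambient set set \<Rightarrow> ('d ambient \<Rightarrow> 'd ambient) \<Rightarrow>
    ('d ambient \<Rightarrow> 'd ambient) \<Rightarrow> 'd ambient measure \<Rightarrow> ('d ambient \<Rightarrow> real) set" where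
  "fe_mean_zero r \<T> L N \<Sigma> = {V \<in> fe_space r \<T> L N \<Sigma>. (\<integral>x. V x \<partial>\<Sigma>) = 0}"

definition fun_dim :: "('a \<Rightarrow> real) set \<Rightarrow> nat" where
  "fun_dim S = vector_space.dim (\<lambda>c f x. c * f x) S"

definition discrete_spectrum :: "('d::finite) ambient measure \<Rightarrow> ('d ambient \<Rightarrow> 'd ambient) \<Rightarrow>
    ('d ambient \<Rightarrow> real) set \<Rightarrow> (nat \<Rightarrow> real) \<Rightarrow> (nat \<Rightarrow> 'd ambient \<Rightarrow> real) \<Rightarrow> bool" where
  "discrete_spectrum \<Sigma> N V \<Lambda> U \<longleftrightarrow> (let I = {1..fun_dim V} in
     (\<forall>j\<in>I. 0 < \<Lambda> j) \<and> mono_on I \<Lambda> \<and> (\<forall>j\<in>I. U j \<in> V) \<and>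
     (\<forall>i\<in>I. \<forall>j\<in>I. mass_form \<Sigma> (U i) (U j) = (if i = j then 1 else 0)) \<and>
     (\<forall>j\<in>I. \<forall>W\<in>V. energy_form \<Sigma> N (U j) W = \<Lambda> j * mass_form \<Sigma> (U j) W))"

definition cluster_space :: "(nat \<Rightarrow> 'a \<Rightarrow> real) \<Rightarrow> nat set \<Rightarrow> ('a \<Rightarrow> real) set" where
  "cluster_space U J = {V. \<exists>c. V = (\<lambda>x. \<Sum>j\<in>J. c j * U j x)}"

(* In ennreal, division of a positive number by 0 gives infinity, and the supremum over the
   empty set is 0.  m is the dimension of the discrete space. *)
definition cluster_sep :: "(nat \<Rightarrow> real) \<Rightarrow> (nat \<Rightarrow> real) \<Rightarrow> nat \<Rightarrow> nat set \<Rightarrow> ennreal" where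
  "cluster_sep lam \<Lambda> m J =
     (SUP l\<in>J. SUP j\<in>{1..m} - J. ennreal \<bar>lam l\<bar> / ennreal \<bar>\<Lambda> j - lam l\<bar>)"

definition energy_projection :: "('d::finite) ambient measure \<Rightarrow> ('d ambient \<Rightarrow> 'd ambient) \<Rightarrow>
    ('d ambient \<Rightarrow> real) set \<Rightarrow> ('d ambient \<Rightarrow> real) \<Rightarrow> ('d ambient \<Rightarrow> real) \<Rightarrow> bool" where
  "energy_projection \<Sigma> N S v w \<longleftrightarrow>
     w \<in> S \<and> (\<forall>V\<in>S. energy_form \<Sigma> N w V = energy_form \<Sigma> N v V)"

end

theory Submission
  imports Defs
begin

text \<open>The surfaces are compared element by element through the closest point projection. Its differential
 is an isometry of the tangent spaces up to order \<open>h^(k+1)\<close>, so the energy and mass forms of the two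
 surfaces differ by relative errors of that order; on coarse meshes, where the bound on the normals is void,
 a Markov inequality in a thin strip keeps the elements transversal to the normal.
 Let \<open>W = Gu - Zu\<close>, a combination of the \<open>U j\<close>, \<open>j\<close> not in \<open>J\<close>, with coefficients \<open>w j\<close>, and let \<open>Y\<close> have
 the coefficients \<open>Lam j / (Lam j - lam i) * w j\<close>. The squared energy of \<open>W\<close> is the consistency error of
 the forms tested with \<open>Y\<close> plus \<open>lam i * M(u - Gu - \<alpha>, Y)\<close>, and the energy norm of \<open>Y\<close> and
 \<open>sqrt (lam i)\<close> times its mass norm are at most \<open>1 + \<mu>\<close> times the energy norm of \<open>W\<close>.

 Notation: \<open>Sg\<close>, \<open>Sh\<close> are \<open>\<gamma>\<close>, \<open>\<Gamma>\<close> with measures \<open>mg\<close>, \<open>mh\<close>; \<open>cp\<close> is \<open>\<psi>\<close>.\<close>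

text \<open>Constant and strip width must be fixed before the mesh. So \<open>h0\<close>, depending
  on c only, separates fine meshes, where \<open>c * h^k <= 1/2\<close>, from coarse ones, where
  quasi-uniformity bounds the diameters below and a thin strip has to replace the bound on the
  normals. The order comes from the defects being quadratic in the angle between the normals: h^(2k)
  is at most a constant times h^(k+1) because k >= 1. Two obstacles shape the analytic part. H^1 is
  a closure of smooth functions and \<open>weak_grad\<close> a choice, so weak gradients must be
  shown unique on both surfaces, and functions smooth only piecewise or only near the surface must
  be approximated by globally smooth ones; averaging with a polynomial kernel does that. And
  discrete functions live on \<Gamma>, so testing the eigenvalue equation with \<open>Y\<close>
  requires lifting it to an H^1 function on \<gamma>. Its mean need not vanish there, which is
  harmless because constants are orthogonal to an eigenfunction in both forms. The number \<alpha>
  is free because every \<open>U j\<close> has mean zero on \<Gamma>.\<close>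

abbreviation fderiv :: "('a::real_normed_vector => 'b::real_normed_vector) => 'a => 'a => 'b" where
 "fderiv f x == frechet_derivative f (at x)"

section \<open>Calculus of smooth maps\<close>

lemma frechet_derivative_at_eqI:
 "(f has_derivative f') (at x) ==> fderiv f x = f'"
 by (metis frechet_derivative_at)

text \<open>Openness makes this work: \<open>Ck_on\<close> speaks of derivatives at points, which
  depend on the function in a whole neighbourhood of the point.\<close>

lemma Ck_on_cong:
 assumes "open S" "!!x. x : S ==> f x = g x" "Ck_on m f S"
 shows "Ck_on m g S"
 using assms(2,3)
proof (induction m arbitrary: f g)
 case 0
 thus ?case by (simp cong: continuous_on_cong)
next
 case (Suc m)
 have d: "(g has_derivative fderiv f x) (at x)" if "x : S" for x
  by (rule has_derivative_transform_within_open[of f _ x _ S g])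
   (use that Suc.prems assms(1) in \<open>auto simp: frechet_derivative_works[symmetric]\<close>)
 hence e: "fderiv g x = fderiv f x" if "x : S" for x
  using frechet_derivative_at_eqI[OF d] that by simp
 have "Ck_on m (%x. fderiv g x v) S" for v
  by (rule Suc.IH[of "%x. fderiv f x v"]) (use Suc.prems e in simp_all)
 thus ?case using d unfolding Ck_on.simps differentiable_def by blast
qed

lemma Ck_on_subset: "Ck_on m f S ==> T \<subseteq> S ==> Ck_on m f T"
 by (induction m arbitrary: f) (auto intro: continuous_on_subset)

lemma Ck_on_SucD: "Ck_on (Suc m) f S ==> Ck_on m f S"
proof (induction m arbitrary: f)
 case 0
 thus ?case
  by (simp add: continuous_at_imp_continuous_on differentiable_imp_continuous_within)
next
 case (Suc m)
 thus ?case by (metis Ck_on.simps(2))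
qed

text \<open>The form used by the closure rules below: an explicit derivative is proposed, and only
  its values in fixed directions have to be \<open>Ck_on m\<close>.\<close>

lemma Ck_on_SucI:
 assumes "open S" "!!x. x : S ==> (f has_derivative f' x) (at x)"
  "!!v. Ck_on m (%x. f' x v) S"
 shows "Ck_on (Suc m) f S"
proof -
 have "Ck_on m (%x. fderiv f x v) S" for v

  by (rule Ck_on_cong[OF assms(1) _ assms(3)[of v]])
   (use frechet_derivative_at_eqI[OF assms(2)] in simp)
 thus ?thesis using assms(2) unfolding Ck_on.simps differentiable_def by blast
qed

lemma Ck_on_has_derivative:
 "Ck_on (Suc m) f S ==> x : S ==> (f has_derivative fderiv f x) (at x)"
 by (simp add: frechet_derivative_works)

lemma Ck_on_const: "open S ==> Ck_on m (%x. c) S"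
proof (induction m arbitrary: c)
 case (Suc m)
 thus ?case by (intro Ck_on_SucI[where f'="%x v. 0"]) auto
qed simp

lemma Ck_on_linear_compose:
 assumes "open S" "bounded_linear h" "Ck_on m f S"
 shows "Ck_on m (%x. h (f x)) S"
 using assms(3)
proof (induction m arbitrary: f)
 case 0
 thus ?case using assms(2) by (auto intro: linear_continuous_on_compose bounded_linear.continuous_on)
next
 case (Suc m)
 show ?case
 proof (rule Ck_on_SucI[OF assms(1)])
  show "((%x. h (f x)) has_derivative (%v. h (fderiv f x v))) (at x)" if "x : S" for x
   using bounded_linear.has_derivative[OF assms(2) Ck_on_has_derivative[OF Suc.prems that]] .
 qed (use Suc in simp)
qed

lemma Ck_on_ident: "open S ==> Ck_on m (%x. x) S"
proof (cases m)
 case (Suc k)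
 assume "open S"
 thus ?thesis unfolding Suc
  by (intro Ck_on_SucI[where f'="%x v. v"]) (auto intro: Ck_on_const)
qed simp

lemma Ck_on_linear: "open S ==> bounded_linear h ==> Ck_on m h S"
 using Ck_on_linear_compose[OF _ _ Ck_on_ident] by blast

lemma Ck_on_add:
 assumes "open S" "Ck_on m f S" "Ck_on m g S"
 shows "Ck_on m (%x. f x + g x) S"
 using assms(2,3)
proof (induction m arbitrary: f g)
 case 0
 thus ?case by (auto intro: continuous_intros)
next
 case (Suc m)
 show ?case
 proof (rule Ck_on_SucI[OF assms(1)])
  show "((%x. f x + g x) has_derivative
    (%v. fderiv f x v + fderiv g x v)) (at x)" if "x : S" for x
   using Suc.prems that by (intro has_derivative_add Ck_on_has_derivative)
 qed (use Suc in simp)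
qed

lemma Ck_on_sum:
 assumes "open S" "!!i. i : I ==> Ck_on m (f i) S"
 shows "Ck_on m (%x. \<Sum>i\<in>I. f i x) S"
 using assms(2)
 by (induction I rule: infinite_finite_induct) (auto intro: Ck_on_const Ck_on_add assms(1))

lemma Ck_on_bilinear:
 assumes "open S" "bounded_bilinear P" "Ck_on m f S" "Ck_on m g S"
 shows "Ck_on m (%x. P (f x) (g x)) S"
 using assms(3,4)
proof (induction m arbitrary: f g)
 case 0
 thus ?case by (auto intro: bounded_bilinear.continuous_on[OF assms(2)])
next
 case (Suc m)
 show ?case
 proof (rule Ck_on_SucI[OF assms(1)])
  show "((%x. P (f x) (g x)) has_derivative
    (%v. P (f x) (fderiv g x v) + P (fderiv f x v) (g x))) (at x)"
   if "x : S" for x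
   using Suc.prems that by (intro bounded_bilinear.FDERIV[OF assms(2)] Ck_on_has_derivative)
  show "Ck_on m (%x. P (f x) (fderiv g x v) + P (fderiv f x v) (g x)) S" for v
   using Suc.prems Ck_on_SucD[OF Suc.prems(1)] Ck_on_SucD[OF Suc.prems(2)]
   by (intro Ck_on_add Suc.IH assms) auto
 qed
qed

lemmas Ck_on_mult = Ck_on_bilinear[OF _ bounded_bilinear_mult]
 and Ck_on_scaleR = Ck_on_bilinear[OF _ bounded_bilinear_scaleR]
 and Ck_on_inner = Ck_on_bilinear[OF _ bounded_bilinear_inner]

lemma Ck_on_minus: "open S ==> Ck_on m f S ==> Ck_on m (%x. - f x) S"
 using Ck_on_linear_compose[OF _ bounded_linear_minus[OF bounded_linear_ident]] by blast

lemma Ck_on_diff: "open S ==> Ck_on m f S ==> Ck_on m g S ==> Ck_on m (%x. f x - g x) S"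
 using Ck_on_add[of S m f "%x. - g x"] Ck_on_minus[of S m g] by simp

lemma Ck_on_prod:
 fixes f :: "'i => 'a::real_normed_vector => real"
 assumes "open S" "!!i. i : I ==> Ck_on m (f i) S"
 shows "Ck_on m (%x. \<Prod>i\<in>I. f i x) S"
 using assms(2)
 by (induction I rule: infinite_finite_induct) (auto intro: Ck_on_const Ck_on_mult assms(1))

lemma Ck_on_power:
 fixes f :: "'a::real_normed_vector => real"
 shows "open S ==> Ck_on m f S ==> Ck_on m (%x. f x ^ n) S"
 by (induction n) (auto intro: Ck_on_const Ck_on_mult)

lemma Ck_on_compose:
 fixes f :: "'a::real_normed_vector => 'b::euclidean_space"
 assumes "open S" "open T" "Ck_on m f S" "Ck_on m g T" "!!x. x : S ==> f x : T"
 shows "Ck_on m (%x. g (f x)) S"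
 using assms(3,4)
proof (induction m arbitrary: g)
 case 0
 thus ?case using assms(5) by (auto intro!: continuous_on_compose2[of T g S f])
next
 case (Suc m)
 note df = Ck_on_has_derivative[OF Suc.prems(1)] and dg = Ck_on_has_derivative[OF Suc.prems(2)]
 show ?case
 proof (rule Ck_on_SucI[OF assms(1)])
  fix x assume x: "x : S"
  have d: "((%x. g (f x)) has_derivative
    (%v. fderiv g (f x) (fderiv f x v))) (at x)"
   using has_derivative_compose[OF df[OF x], of g] dg[OF assms(5)[OF x]] by blast
  \<comment> \<open>The induction hypothesis covers derivatives of \<open>g\<close> in a fixed
    direction only, while the chain rule produces the moving direction \<open>fderiv f x v\<close>;
    expansion in the basis separates the two.\<close>
  have rep: "fderiv g (f x) w
    = (\<Sum>b\<in>Basis. (w \<bullet> b) *\<^sub>R fderiv g (f x) b)" for w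
  proof -
   have l: "linear (fderiv g (f x))"
    using dg[OF assms(5)[OF x]] has_derivative_linear by blast
   show ?thesis
    by (subst euclidean_representation[of w, symmetric]) (simp add: linear_sum[OF l] linear_scale[OF l])
  qed
  show "((%x. g (f x)) has_derivative
    (%v. \<Sum>b\<in>Basis. (fderiv f x v \<bullet> b) *\<^sub>R fderiv g (f x) b)) (at x)"
   by (rule has_derivative_eq_rhs[OF d]) (rule ext, rule rep)
 next
  show "Ck_on m (%x. \<Sum>b\<in>Basis. (fderiv f x v \<bullet> b) *\<^sub>R fderiv g (f x) b) S" for v
   using Suc.prems Ck_on_SucD[OF Suc.prems(1)]
   by (intro Ck_on_sum Ck_on_scaleR Ck_on_inner Ck_on_const Suc.IH assms) auto
 qed
qed

lemma Ck_on_inverse: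
 fixes f :: "'a::real_normed_vector => real"
 assumes "open S" "Ck_on m f S" "!!x. x : S ==> f x ~= 0"
 shows "Ck_on m (%x. inverse (f x)) S"
 using assms(2)
proof (induction m)
 case 0
 thus ?case using assms(3) by (auto intro: continuous_intros)
next
 case (Suc m)
 show ?case
 proof (rule Ck_on_SucI[OF assms(1)])
  show "((%x. inverse (f x)) has_derivative
    (%v. - (inverse (f x) * fderiv f x v * inverse (f x)))) (at x)" if "x : S" for x
   using Suc.prems that assms(3) by (intro Deriv.has_derivative_inverse Ck_on_has_derivative) auto
  show "Ck_on m (%x. - (inverse (f x) * fderiv f x v * inverse (f x))) S" for v
   using Suc.prems Suc.IH[OF Ck_on_SucD[OF Suc.prems]]
   by (intro Ck_on_minus Ck_on_mult assms) auto
 qed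
qed

lemma Ck_on_divide:
 fixes f g :: "'a::real_normed_vector => real"
 shows "open S ==> Ck_on m f S ==> Ck_on m g S ==> (!!x. x : S ==> g x ~= 0) ==>
  Ck_on m (%x. f x / g x) S"
 unfolding divide_inverse by (intro Ck_on_mult Ck_on_inverse)

lemma Ck_on_sqrt:
 fixes f :: "'a::real_normed_vector => real"
 assumes "open S" "Ck_on m f S" "!!x. x : S ==> f x > 0"
 shows "Ck_on m (%x. sqrt (f x)) S"
 using assms(2)
proof (induction m)
 case 0
 thus ?case by (auto intro: continuous_intros)
next
 case (Suc m)
 show ?case
 proof (rule Ck_on_SucI[OF assms(1)])
  show "((%x. sqrt (f x)) has_derivative
    (%v. fderiv f x v * inverse (2 * sqrt (f x)))) (at x)" if "x : S" for x
   using DERIV_compose_FDERIV[OF DERIV_real_sqrt[OF assms(3)[OF that]] Ck_on_has_derivative[OF Suc.prems that]]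
   by (simp add: field_simps)
  have "sqrt (f x) ~= 0" if "x : S" for x using assms(3)[OF that] by simp
  thus "Ck_on m (%x. fderiv f x v * inverse (2 * sqrt (f x))) S" for v
   using Suc.prems Suc.IH[OF Ck_on_SucD[OF Suc.prems]]
   by (intro Ck_on_mult Ck_on_inverse Ck_on_const assms) auto
 qed
qed

lemma Ck_on_vec_lambda:
 fixes f :: "'i::finite => 'a::real_normed_vector => real"
 assumes "open S" "!!i. Ck_on m (f i) S"
 shows "Ck_on m (%x. \<chi> i. f i x) S"
proof (rule Ck_on_cong[OF assms(1), of "%x. \<Sum>i\<in>UNIV. f i x *\<^sub>R axis i 1"])
 show "(\<Sum>i\<in>UNIV. f i x *\<^sub>R axis i 1) = (\<chi> i. f i x)" for x
  by (simp add: vec_eq_iff axis_def if_distrib cong: if_cong)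
 show "Ck_on m (%x. \<Sum>i\<in>UNIV. f i x *\<^sub>R axis i (1::real)) S"
  by (intro Ck_on_sum Ck_on_scaleR Ck_on_const assms)
qed

lemma Ck_on_component:
 "open S ==> Ck_on m f S ==> Ck_on m (%x. f x $ i) S"
 by (rule Ck_on_linear_compose[OF _ bounded_linear_vec_nth])

lemma Ck_on_det:
 fixes A :: "'a::real_normed_vector => real^'n^'n"
 assumes "open S" "!!i j. Ck_on m (%x. A x $ i $ j) S"
 shows "Ck_on m (%x. det (A x)) S"
 unfolding det_def by (intro Ck_on_sum Ck_on_mult Ck_on_prod Ck_on_const assms)

lemma smooth_on_subset: "smooth_on f S ==> T \<subseteq> S ==> smooth_on f T"
 unfolding smooth_on_def using Ck_on_subset by blast

lemma smooth_on_cong: "open S ==> (!!x. x : S ==> f x = g x) ==> smooth_on f S ==> smooth_on g S"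
 unfolding smooth_on_def using Ck_on_cong by blast

lemma smooth_on_const: "open S ==> smooth_on (%x. c) S"
 by (simp add: smooth_on_def Ck_on_const)

lemma smooth_on_ident: "open S ==> smooth_on (%x. x) S"
 by (simp add: smooth_on_def Ck_on_ident)

lemma smooth_on_linear: "open S ==> bounded_linear h ==> smooth_on h S"
 by (simp add: smooth_on_def Ck_on_linear)

lemma smooth_on_linear_compose:
 "open S ==> bounded_linear h ==> smooth_on f S ==> smooth_on (%x. h (f x)) S"
 by (simp add: smooth_on_def Ck_on_linear_compose)

lemma smooth_on_add: "open S ==> smooth_on f S ==> smooth_on g S ==> smooth_on (%x. f x + g x) S"
 by (simp add: smooth_on_def Ck_on_add)

lemma smooth_on_diff: "open S ==> smooth_on f S ==> smooth_on g S ==> smooth_on (%x. f x - g x) S"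
 by (simp add: smooth_on_def Ck_on_diff)

lemma smooth_on_sum: "open S ==> (!!i. i : I ==> smooth_on (f i) S) ==> smooth_on (%x. \<Sum>i\<in>I. f i x) S"
 by (simp add: smooth_on_def Ck_on_sum)

lemma smooth_on_mult:
 fixes f g :: "'a::real_normed_vector => real"
 shows "open S ==> smooth_on f S ==> smooth_on g S ==> smooth_on (%x. f x * g x) S"
 by (simp add: smooth_on_def Ck_on_mult)

lemma smooth_on_scaleR:
 "open S ==> smooth_on f S ==> smooth_on g S ==> smooth_on (%x. f x *\<^sub>R g x) S"
 by (simp add: smooth_on_def Ck_on_scaleR)

lemma smooth_on_inner:
 fixes f g :: "'a::real_normed_vector => 'b::real_inner"
 shows "open S ==> smooth_on f S ==> smooth_on g S ==> smooth_on (%x. f x \<bullet> g x) S"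
 by (simp add: smooth_on_def Ck_on_inner)

lemma smooth_on_prod:
 fixes f :: "'i => 'a::real_normed_vector => real"
 shows "open S ==> (!!i. i : I ==> smooth_on (f i) S) ==> smooth_on (%x. \<Prod>i\<in>I. f i x) S"
 by (simp add: smooth_on_def Ck_on_prod)

lemma smooth_on_power:
 fixes f :: "'a::real_normed_vector => real"
 shows "open S ==> smooth_on f S ==> smooth_on (%x. f x ^ n) S"
 by (simp add: smooth_on_def Ck_on_power)

lemma smooth_on_compose:
 fixes f :: "'a::real_normed_vector => 'b::euclidean_space"
 shows "open S ==> open T ==> smooth_on f S ==> smooth_on g T ==> (!!x. x : S ==> f x : T) ==>
  smooth_on (%x. g (f x)) S"
 unfolding smooth_on_def by (rule allI, rule Ck_on_compose[where f = f and g = g and T = T]) simp_all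

lemma smooth_on_divide:
 fixes f g :: "'a::real_normed_vector => real"
 shows "open S ==> smooth_on f S ==> smooth_on g S ==> (!!x. x : S ==> g x ~= 0) ==>
  smooth_on (%x. f x / g x) S"
 by (simp add: smooth_on_def Ck_on_divide)

lemma smooth_on_sqrt:
 fixes f :: "'a::real_normed_vector => real"
 shows "open S ==> smooth_on f S ==> (!!x. x : S ==> f x > 0) ==> smooth_on (%x. sqrt (f x)) S"
 by (simp add: smooth_on_def Ck_on_sqrt)

lemma smooth_on_vec_lambda:
 fixes f :: "'i::finite => 'a::real_normed_vector => real"
 shows "open S ==> (!!i. smooth_on (f i) S) ==> smooth_on (%x. \<chi> i. f i x) S"
 by (simp add: smooth_on_def Ck_on_vec_lambda)

lemma smooth_on_component: "open S ==> smooth_on f S ==> smooth_on (%x. f x $ i) S"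
 by (simp add: smooth_on_def Ck_on_component)

lemma smooth_on_det:
 fixes A :: "'a::real_normed_vector => real^'n^'n"
 shows "open S ==> (!!i j. smooth_on (%x. A x $ i $ j) S) ==> smooth_on (%x. det (A x)) S"
 by (simp add: smooth_on_def Ck_on_det)

lemma smooth_on_frechet_derivative:
 assumes "smooth_on f S"
 shows "smooth_on (%x. fderiv f x v) S"
 unfolding smooth_on_def
proof
 fix m
 have "Ck_on (Suc m) f S" using assms unfolding smooth_on_def by blast
 thus "Ck_on m (%x. fderiv f x v) S" by simp
qed

lemma smooth_on_has_derivative:
 "smooth_on f S ==> x : S ==> (f has_derivative fderiv f x) (at x)"
 unfolding smooth_on_def using Ck_on_has_derivative[where f = f and m = 0] by blast

lemma smooth_on_continuous_on: "smooth_on f S ==> continuous_on S f"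
 unfolding smooth_on_def by (drule spec[of _ 0]) simp

lemma smooth_on_linear_frechet_derivative:
 "smooth_on f S ==> x : S ==> linear (fderiv f x)"
 using smooth_on_has_derivative has_derivative_linear by blast

lemma smooth_on_continuous_frechet_derivative:
 "smooth_on f S ==> continuous_on S (%x. fderiv f x v)"
 using smooth_on_frechet_derivative smooth_on_continuous_on by blast

text \<open>Meant for maps such as the closest point projection, whose smoothness is seen only
  through local inverse charts.\<close>

lemma smooth_on_localI:
 assumes "!!x. x : S ==> EX W. open W & x : W & smooth_on f W"
 shows "smooth_on f S"
proof -
 have local: "Ck_on m f S" if "!!x. x : S ==> EX W. open W & x : W & Ck_on m f W" for m and f :: "'a => 'b"
  using that
 proof (induction m arbitrary: f)
  case 0
  have "isCont f x" if "x : S" for x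
   using 0[OF that] continuous_on_eq_continuous_at by auto
  thus ?case by (simp add: continuous_at_imp_continuous_on)
 next
  case (Suc m)
  have "Ck_on m (%x. fderiv f x v) S" for v
   by (rule Suc.IH) (metis Suc.prems Ck_on.simps(2))
  thus ?case using Suc.prems by (metis Ck_on.simps(2))
 qed
 show ?thesis
  unfolding smooth_on_def
 proof (intro allI local)
  fix m x assume "x : S"
  then obtain W where "open W" "x : W" "smooth_on f W" using assms by metis
  thus "EX W. open W & x : W & Ck_on m f W" unfolding smooth_on_def by metis
 qed
qed

text \<open>By Cramer's rule the derivative of the inverse is a rational expression in the first
 derivatives of the map at the inverse, so smoothness of the inverse bootstraps.\<close>

lemma smooth_on_inv_into:
 fixes f :: "real^'n => real^'n"
 assumes S: "open S" and f: "smooth_on f S" and inj: "inj_on f S"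
  and der: "!!x. x : S ==> inj (fderiv f x)"
 shows "open (f ` S)" "smooth_on (inv_into S f) (f ` S)"
proof -
 show op: "open (f ` S)"
  by (rule invariance_of_domain[OF smooth_on_continuous_on[OF f] S inj])
 define g where "g = inv_into S f"
 have gf: "g (f x) = x" if "x : S" for x using that inj by (simp add: g_def)
 have fg: "f (g y) = y" "g y : S" if "y : f ` S" for y
  using that by (auto simp: g_def f_inv_into_f inv_into_into)
 define A where "A y = matrix (fderiv f (g y))" for y
 define G where "G y v = (\<chi> k. det (\<chi> i j. if j = k then v $ i else A y $ i $ j) / det (A y))" for y v
 have A: "A y *v w = fderiv f (g y) w" if "y : f ` S" for y w
  unfolding A_def using matrix_works smooth_on_linear_frechet_derivative[OF f fg(2)[OF that]]
  by (simp add: linear_matrix_vector_mul_eq)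
 have det: "det (A y) ~= 0" if "y : f ` S" for y
 proof -
  have "inj ((*v) (A y))" using der[OF fg(2)[OF that]] A[OF that] by (simp add: inj_def)
  thus ?thesis
   by (metis invertible_det_nz matrix_left_invertible_injective invertible_left_inverse)
 qed
 have dg: "(g has_derivative G y) (at y)" if y: "y : f ` S" for y
 proof -
  have "(g has_derivative G y) (at (f (g y)))"
  proof (rule has_derivative_inverse_strong[OF S fg(2)[OF y] smooth_on_continuous_on[OF f] gf
     smooth_on_has_derivative[OF f fg(2)[OF y]]])
   have "A y *v G y v = v" for v
    using cramer[OF det[OF y], of "G y v" v] unfolding G_def by simp
   thus "fderiv f (g y) \<circ> G y = id" by (auto simp: A[OF y])
  qed
  thus ?thesis by (simp add: fg y)
 qed
 have "Ck_on m g (f ` S)" for m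
 proof (induction m)
  case 0
  show ?case using has_derivative_continuous[OF dg] by (simp add: continuous_at_imp_continuous_on)
 next
  case (Suc m)
  have "Ck_on m (%y. A y $ i $ j) (f ` S)" for i j
  proof -
   have "Ck_on m (%x. fderiv f x (axis j 1)) S"
    using smooth_on_frechet_derivative[OF f] unfolding smooth_on_def by blast
   hence "Ck_on m (%y. fderiv f (g y) (axis j 1)) (f ` S)"
    using Ck_on_compose[OF op S Suc] fg by blast
   thus ?thesis unfolding A_def matrix_def by (simp add: Ck_on_component[OF op])
  qed
  hence ent: "Ck_on m (%y. A y $ i $ j) (f ` S)"
    "Ck_on m (%y. if j = k then v $ i else A y $ i $ j) (f ` S)" for i j k v
   by (cases "j = k"; simp add: Ck_on_const[OF op])+
  have "Ck_on m (%y. G y v) (f ` S)" for v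
   unfolding G_def using det
   by (intro Ck_on_vec_lambda Ck_on_divide Ck_on_det op) (simp_all add: ent)
  thus ?case using op dg by (intro Ck_on_SucI[where f' = G])
 qed
 thus "smooth_on (inv_into S f) (f ` S)" by (simp add: smooth_on_def g_def)
qed

text \<open>Mean value inequality for \<open>f\<close> minus its linear part at \<open>x\<close>:
  near \<open>x\<close> the derivative of this difference has operator norm at most
  \<open>e\<close>.\<close>

lemma smooth_on_strictly_differentiable:
 fixes f :: "'a::euclidean_space => 'b::real_normed_vector"
 assumes S: "open S" "x : S" and f: "smooth_on f S" and e: "0 < e"
 obtains r where "0 < r" "ball x r \<subseteq> S"
  "!!y z. y : ball x r ==> z : ball x r ==>
    norm (f y - f z - fderiv f x (y - z)) <= e * norm (y - z)"
proof -
 define D where "D y = fderiv f y" for y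
 have D: "(f has_derivative D y) (at y)" if "y : S" for y
  unfolding D_def using smooth_on_has_derivative[OF f that] .
 \<comment> \<open>Continuity of the derivative is known direction by direction; summing over the
   basis costs the factor \<open>DIM('a)\<close>.\<close>
 define e' where "e' = e / real DIM('a)"
 have e': "e' > 0" using e by (simp add: e'_def)
 have "ALL b:Basis. \<forall>\<^sub>F y in at x. dist (D y b) (D x b) < e'"
 proof
  fix b :: 'a
  have "continuous (at x) (%y. D y b)"
   using smooth_on_continuous_frechet_derivative[OF f] S
   unfolding D_def by (simp add: continuous_on_eq_continuous_at)
  thus "\<forall>\<^sub>F y in at x. dist (D y b) (D x b) < e'"
   using e' by (simp add: continuous_at tendsto_iff)
 qed
 hence "\<forall>\<^sub>F y in at x. ALL b:Basis. dist (D y b) (D x b) < e'"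
  by (simp add: eventually_ball_finite)
 moreover have "\<forall>\<^sub>F y in at x. y : S"
  using S by (simp add: eventually_at_in_open')
 ultimately have "\<forall>\<^sub>F y in at x. y : S & (ALL b:Basis. dist (D y b) (D x b) < e')"
  by (rule eventually_elim2) auto
 then obtain r where r: "r > 0"
  "!!y. y ~= x ==> dist y x < r ==> y : S & (ALL b:Basis. dist (D y b) (D x b) < e')"
  unfolding eventually_at by auto
 have r': "y : S & (ALL b:Basis. dist (D y b) (D x b) < e')" if "y : ball x r" for y
  using r(2)[of y] that S e' by (cases "y = x") (auto simp: dist_commute)
 have lin: "linear (D y)" if "y : S" for y using D[OF that] has_derivative_linear by blast
 have on: "onorm (%v. D y v - D x v) <= e" if y: "y : ball x r" for y
 proof (rule onorm_bound)
  fix v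
  let ?L = "%v. D y v - D x v"
  have l: "linear ?L" using lin r'[OF y] S by (intro linear_compose_sub) auto
  have "?L v = ?L (\<Sum>b\<in>Basis. (v \<bullet> b) *\<^sub>R b)" by (simp only: euclidean_representation)
  also have "... = (\<Sum>b\<in>Basis. (v \<bullet> b) *\<^sub>R ?L b)"
   using linear_sum[OF l, of "%b. (v \<bullet> b) *\<^sub>R b" Basis] linear_scale[OF l] by simp
  finally have "norm (?L v) = norm (\<Sum>b\<in>Basis. (v \<bullet> b) *\<^sub>R ?L b)" by simp
  also have "... <= (\<Sum>b\<in>(Basis::'a set). norm v * e')"
  proof (intro sum_norm_le)
   fix b :: 'a assume "b : Basis"
   hence "\<bar>v \<bullet> b\<bar> * norm (D y b - D x b) <= norm v * e'"
    using r'[OF y] by (intro mult_mono Basis_le_norm) (auto simp: dist_norm less_imp_le)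
   thus "norm ((v \<bullet> b) *\<^sub>R (D y b - D x b)) <= norm v * e'" by simp
  qed
  also have "... = e * norm v" by (simp add: e'_def)
  finally show "norm (?L v) <= e * norm v" .
 qed (use e in simp)
 show ?thesis
 proof (rule that[OF r(1)])
  show "ball x r \<subseteq> S" using r' by blast
  fix y z assume yz: "y : ball x r" "z : ball x r"
  have dl: "(D x has_derivative D x) (at w within ball x r)" for w
   using lin[OF S(2)] by (simp add: linear_imp_has_derivative)
  have "norm ((f y - D x y) - (f z - D x z)) <= e * norm (y - z)"
  proof (rule differentiable_bound[OF convex_ball _ on yz(1) yz(2)])
   fix w assume "w : ball x r"
   thus "((%y. f y - D x y) has_derivative (%v. D w v - D x v)) (at w within ball x r)"
    using D r' by (intro has_derivative_diff dl) (auto intro: has_derivative_at_withinI)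
  qed
  thus "norm (f y - f z - fderiv f x (y - z)) <= e * norm (y - z)"
   unfolding D_def[symmetric] by (simp add: linear_diff[OF lin[OF S(2)]] algebra_simps)
 qed
qed

text \<open>An injective linear map is bounded below by some \<open>B\<close>; the remainder of
  strict differentiability, taken with \<open>e = B/2\<close>, uses up half of it.\<close>

lemma smooth_on_locally_bilipschitz:
 fixes f :: "'a::euclidean_space => 'b::euclidean_space"
 assumes S: "open S" "x : S" and f: "smooth_on f S" and inj: "inj (fderiv f x)"
 obtains r m where "0 < r" "0 < m" "ball x r \<subseteq> S"
  "!!y z. y : ball x r ==> z : ball x r ==> m * norm (y - z) <= norm (f y - f z)"
proof -
 let ?D = "fderiv f x"
 have lin: "linear ?D" using smooth_on_linear_frechet_derivative[OF f S(2)] .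
 obtain B where B: "B > 0" "!!v. B * norm v <= norm (?D v)"
  using linear_inj_bounded_below_pos[OF lin inj] by blast
 obtain r where r: "0 < r" "ball x r \<subseteq> S"
  "!!y z. y : ball x r ==> z : ball x r ==> norm (f y - f z - ?D (y - z)) <= (B/2) * norm (y - z)"
  using smooth_on_strictly_differentiable[OF S f, of "B/2"] B by auto
 show ?thesis
 proof (rule that[OF r(1) _ r(2), of "B/2"])
  fix y z assume "y : ball x r" "z : ball x r"
  hence "norm (f y - f z - ?D (y - z)) <= (B/2) * norm (y - z)" by (rule r(3))
  thus "B/2 * norm (y - z) <= norm (f y - f z)"
   using B(2)[of "y - z"] norm_triangle_ineq2[of "?D (y-z)" "?D (y-z) - (f y - f z)"]
   by (simp add: norm_minus_commute)
 qed (use B in auto)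
qed

lemma smooth_on_locally_lipschitz:
 fixes f :: "'a::euclidean_space => 'b::real_normed_vector"
 assumes S: "open S" "x : S" and f: "smooth_on f S"
 obtains r M where "0 < r" "0 < M" "ball x r \<subseteq> S"
  "!!y z. y : ball x r ==> z : ball x r ==> norm (f y - f z) <= M * norm (y - z)"
proof -
 let ?D = "fderiv f x"
 obtain B where B: "B > 0" "!!v. norm (?D v) <= B * norm v"
  using linear_bounded_pos[OF smooth_on_linear_frechet_derivative[OF f S(2)]] by blast
 obtain r where r: "0 < r" "ball x r \<subseteq> S"
  "!!y z. y : ball x r ==> z : ball x r ==> norm (f y - f z - ?D (y - z)) <= 1 * norm (y - z)"
  using smooth_on_strictly_differentiable[OF S f zero_less_one] by metis
 show ?thesis
 proof (rule that[OF r(1) _ r(2), of "B + 1"])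
  fix y z assume "y : ball x r" "z : ball x r"
  hence "norm (f y - f z - ?D (y - z)) <= 1 * norm (y - z)" by (rule r(3))
  thus "norm (f y - f z) <= (B + 1) * norm (y - z)"
   using B(2)[of "y - z"] norm_triangle_sub[of "f y - f z" "?D (y - z)"]
   by (simp add: algebra_simps)
 qed (use B in auto)
qed

section \<open>Normals and curvature bounds in charts\<close>

text \<open>The one-sided limit keeps \<open>t > 0\<close>, so that inequalities between increments
  survive the division by \<open>t\<close>.\<close>

lemma has_derivative_difference_quotient:
 assumes f: "(f has_derivative f') (at x)"
 shows "((%t. (1 / t) *\<^sub>R (f (x + t *\<^sub>R v) - f x)) \<longlongrightarrow> f' v) (at_right (0::real))"
proof -
 interpret f': bounded_linear f' using f has_derivative_bounded_linear by blast
 have "((%t. f (x + t *\<^sub>R v)) has_derivative (%t. f' (t *\<^sub>R v))) (at 0)"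
  by (rule has_derivative_compose[of "%t. x + t *\<^sub>R v" "%t. t *\<^sub>R v"])
   (auto intro!: derivative_eq_intros f)
 hence "((%t. norm (f (x + t *\<^sub>R v) - f x - t *\<^sub>R f' v) / norm t) \<longlongrightarrow> 0) (at 0)"
  by (simp add: has_derivative_iff_norm f'.scaleR)
 hence "((%t. norm (f (x + t *\<^sub>R v) - f x - t *\<^sub>R f' v) / norm t) \<longlongrightarrow> 0) (at_right 0)"
  by (rule tendsto_within_subset) auto
 moreover have "\<forall>\<^sub>F t in at_right 0. norm (f (x + t *\<^sub>R v) - f x - t *\<^sub>R f' v) / norm t
   = norm ((1 / t) *\<^sub>R (f (x + t *\<^sub>R v) - f x) - f' v)"
 proof (rule eventually_at_right_less[THEN eventually_mono])
  fix t :: real assume t: "0 < t"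
  have "(1 / t) *\<^sub>R (f (x + t *\<^sub>R v) - f x) - f' v = (1 / t) *\<^sub>R (f (x + t *\<^sub>R v) - f x - t *\<^sub>R f' v)"
   using t by (simp add: scaleR_diff_right)
  thus "norm (f (x + t *\<^sub>R v) - f x - t *\<^sub>R f' v) / norm t
   = norm ((1 / t) *\<^sub>R (f (x + t *\<^sub>R v) - f x) - f' v)"
   using t by simp
 qed
 ultimately have "((%t. norm ((1 / t) *\<^sub>R (f (x + t *\<^sub>R v) - f x) - f' v)) \<longlongrightarrow> 0) (at_right 0)"
  by (rule Lim_transform_eventually)
 thus ?thesis by (simp add: tendsto_norm_zero_iff LIM_zero_iff)
qed

lemma eventually_ray_in_ball:
 fixes x v :: "'a::real_normed_vector"
 assumes "0 < r"
 shows "\<forall>\<^sub>F t in at_right (0::real). x + t *\<^sub>R v : ball x r & 0 < t"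
proof -
 have "((%t. x + t *\<^sub>R v) \<longlongrightarrow> x + 0 *\<^sub>R v) (at_right (0::real))" by (intro tendsto_intros)
 hence "\<forall>\<^sub>F t in at_right (0::real). x + t *\<^sub>R v : ball x r"
  by (rule topological_tendstoD) (use assms in auto)
 thus ?thesis using eventually_at_right_less[of 0] by eventually_elim simp
qed

lemma has_derivative_norm_le:
 assumes f: "(f has_derivative f') (at x)" and r: "0 < r"
  and le: "!!y. y : ball x r ==> norm (f y - f x) <= M * norm (y - x)"
 shows "norm (f' v) <= M * norm v"
proof (rule tendsto_upperbound[OF tendsto_norm[OF has_derivative_difference_quotient[OF f]]])
 show "\<forall>\<^sub>F t in at_right 0. norm ((1 / t) *\<^sub>R (f (x + t *\<^sub>R v) - f x)) <= M * norm v"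
 proof (rule eventually_mono[OF eventually_ray_in_ball[OF r, of x v]])
  fix t :: real assume t: "x + t *\<^sub>R v : ball x r & 0 < t"
  hence "norm (f (x + t *\<^sub>R v) - f x) <= M * (t * norm v)" using le[of "x + t *\<^sub>R v"] by simp
  thus "norm ((1 / t) *\<^sub>R (f (x + t *\<^sub>R v) - f x)) <= M * norm v" using t by (simp only: norm_scaleR) (simp add: field_simps)
 qed
qed simp

lemma has_derivative_norm_ge:
 assumes f: "(f has_derivative f') (at x)" and r: "0 < r"
  and le: "!!y. y : ball x r ==> m * norm (y - x) <= norm (f y - f x)"
 shows "m * norm v <= norm (f' v)"
proof (rule tendsto_lowerbound[OF tendsto_norm[OF has_derivative_difference_quotient[OF f]]])
 show "\<forall>\<^sub>F t in at_right 0. m * norm v <= norm ((1 / t) *\<^sub>R (f (x + t *\<^sub>R v) - f x))"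
 proof (rule eventually_mono[OF eventually_ray_in_ball[OF r, of x v]])
  fix t :: real assume t: "x + t *\<^sub>R v : ball x r & 0 < t"
  hence "m * (t * norm v) <= norm (f (x + t *\<^sub>R v) - f x)" using le[of "x + t *\<^sub>R v"] by simp
  thus "m * norm v <= norm ((1 / t) *\<^sub>R (f (x + t *\<^sub>R v) - f x))" using t by (simp only: norm_scaleR) (simp add: field_simps)
 qed
qed simp

section \<open>Regular parametrisations, tangent spaces and unit normals\<close>

lemma local_paramsD:
 assumes "(U, X) : local_params S"
 shows "open U" "smooth_on X U" "openin (top_of_set S) (X ` U)" "EX Y. homeomorphism U (X ` U) X Y"
  "!!u. u : U ==> inj (fderiv X u)" "inj_on X U" "X ` U \<subseteq> S"
proof -
 show *: "open U" "smooth_on X U" "openin (top_of_set S) (X ` U)" "EX Y. homeomorphism U (X ` U) X Y"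
  "!!u. u : U ==> inj (fderiv X u)"
  using assms by (auto simp: local_params_def)
 show "inj_on X U" using *(4) unfolding homeomorphism_def by (metis inj_on_inverseI)
 show "X ` U \<subseteq> S" using openin_subset[OF *(3)] by simp
qed

lemma local_params_shrink:
 assumes "(U, X) : local_params S" "open V" "V \<subseteq> U"
 shows "(V, X) : local_params S"
proof -
 note c = local_paramsD[OF assms(1)]
 obtain Y where Y: "homeomorphism U (X ` U) X Y" using c(4) by blast
 have "openin (top_of_set U) V" using assms c(1) by (simp add: openin_open_eq)
 hence "openin (top_of_set (X ` U)) (X ` V)"
  using homeomorphism_imp_open_map[OF Y] by blast
 hence "openin (top_of_set S) (X ` V)" using c(3) openin_trans by blast
 moreover have "homeomorphism V (X ` V) X Y"
  by (rule homeomorphism_of_subsets[OF Y assms(3) _ refl]) (use assms in auto)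
 ultimately show ?thesis
  unfolding local_params_def using assms c smooth_on_subset by blast
qed

lemma tangent_space_eq:
 fixes A :: "real^'d::finite => 'd ambient"
 assumes "linear A" "inj A" "norm m = 1" "!!v. m \<bullet> A v = 0"
 shows "range A = {w. m \<bullet> w = 0}"
proof -
 have "m ~= 0" using assms(3) by auto
 hence "dim {w. m \<bullet> w = 0} = CARD('d)"
  by (simp add: dim_hyperplane)
 moreover have "dim (range A) = CARD('d)"
  using dim_image_eq[OF assms(1), of UNIV] assms(2) by (simp add: inj_on_def inj_def)
 ultimately show ?thesis
  using assms(4) by (intro subspace_dim_equal)
   (auto intro: linear_subspace_image[OF assms(1)] subspace_hyperplane)
qed

text \<open>The part of \<open>w\<close> orthogonal to \<open>m\<close> is tangent by the dimension
  count of \<open>tangent_space_eq\<close> and at the same time orthogonal to all tangent vectors,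
  hence zero.\<close>

lemma normal_space_eq:
 fixes A :: "real^'d::finite => 'd ambient"
 assumes "linear A" "inj A" "norm m = 1" "!!v. m \<bullet> A v = 0" and w: "!!v. w \<bullet> A v = 0"
 shows "w = (w \<bullet> m) *\<^sub>R m"
proof -
 let ?z = "w - (w \<bullet> m) *\<^sub>R m"
 have mm: "m \<bullet> m = 1" using assms(3) by (simp add: norm_eq_1)
 have "?z : range A"
  unfolding tangent_space_eq[OF assms(1-4)] using mm by (simp add: inner_diff_right inner_commute)
 then obtain v where v: "?z = A v" by blast
 have "?z \<bullet> ?z = ?z \<bullet> A v" using v by simp
 also have "... = 0" by (simp add: inner_diff_left w assms(4))
 finally show ?thesis by simp
qed

lemma unit_normalD:
 assumes "unit_normal S n" "(U, X) : local_params S" "u : U"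
 shows "norm (n (X u)) = 1" "n (X u) \<bullet> fderiv X u v = 0"
 using assms unfolding unit_normal_def by fastforce+

text \<open>The normal direction solves a linear system whose rows are the tangent vectors and a fixed
 transversal vector; Cramer's rule makes it smooth.\<close>

lemma smooth_on_unit_normal_local_param:
 fixes S :: "('d::finite) ambient set"
 assumes X: "(U, X) : local_params S" and n: "unit_normal S n" "continuous_on S n" and u0: "u0 : U"
 obtains r where "0 < r" "ball u0 r \<subseteq> U" "smooth_on (%u. n (X u)) (ball u0 r)"
proof -
 note c = local_paramsD[OF X]
 define m0 where "m0 = n (X u0)"
 define D where "D u = fderiv X u" for u
 have linD: "linear (D u)" if "u : U" for u
  unfolding D_def by (rule smooth_on_linear_frechet_derivative[OF c(2) that])
 define A where "A u = (\<chi> b. case b of None => m0 | Some i => D u (axis i 1))" for u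
 have A_None: "(A u *v x) $ None = m0 \<bullet> x" for u x
  by (simp add: A_def matrix_vector_mul_component)
 have A_Some: "(A u *v x) $ Some i = D u (axis i 1) \<bullet> x" for u x i
  by (simp add: A_def matrix_vector_mul_component)
 have smD: "smooth_on (%u. D u v) U" for v
  unfolding D_def by (rule smooth_on_frechet_derivative[OF c(2)])
 have smA: "smooth_on (%u. A u $ b $ j) U" for b j
  by (cases b) (simp_all add: A_def smooth_on_const[OF c(1)] smooth_on_component[OF c(1) smD])
 have smdet: "smooth_on (%u. det (A u)) U" by (intro smooth_on_det smA c(1))
 have orth: "x \<bullet> D u v = 0" if "u : U" "!!i. D u (axis i 1) \<bullet> x = 0" for u x v
 proof -
  have "D u v = D u (\<Sum>i\<in>UNIV. (v $ i) *\<^sub>R axis i 1)"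
   using basis_expansion[of v] by (simp add: scalar_mult_eq_scaleR)
  also have "... = (\<Sum>i\<in>UNIV. (v $ i) *\<^sub>R D u (axis i 1))"
   by (simp add: linear_sum[OF linD[OF that(1)]] linear_scale[OF linD[OF that(1)]])
  finally show ?thesis using that(2) by (simp add: inner_sum_right inner_commute)
 qed
 have det0: "det (A u0) ~= 0"
 proof -
  have "x = 0" if "A u0 *v x = 0" for x
  proof -
   have "m0 \<bullet> x = 0" "!!i. D u0 (axis i 1) \<bullet> x = 0"
    using that A_None[of u0 x] A_Some[of u0 x] by simp_all
   thus "x = 0"
    using normal_space_eq[OF linD[OF u0] _ _ _ orth[OF u0], of m0 x]
     c(5)[OF u0] unit_normalD[OF n(1) X u0]
    by (simp add: m0_def D_def inner_commute)
  qed
  hence "inj ((*v) (A u0))" by (simp add: linear_injective_0)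
  thus ?thesis
   by (metis invertible_det_nz matrix_left_invertible_injective invertible_left_inverse)
 qed
 have "continuous_on U (%u. n (X u))"
  using c by (intro continuous_on_compose2[OF n(2) smooth_on_continuous_on[OF c(2)]])
 hence cn: "continuous_on U (%u. n (X u) \<bullet> m0)" by (intro continuous_intros)
 define V where "V = (U Int (%u. n (X u) \<bullet> m0) -` {0<..}) Int (U Int (%u. det (A u)) -` (- {0}))"
 have "open V"
  unfolding V_def
  by (intro open_Int continuous_open_preimage cn smooth_on_continuous_on[OF smdet] c(1)) auto
 moreover have "n (X u0) \<bullet> m0 = 1"
  using unit_normalD(1)[OF n(1) X u0] by (simp add: m0_def norm_eq_1)
 hence "u0 : V" using u0 det0 by (simp add: V_def)
 ultimately obtain r where r: "r > 0" "ball u0 r \<subseteq> V" using openE by blast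
 have r: "r > 0" "!!u. u : ball u0 r ==> 0 < n (X u) \<bullet> m0 & det (A u) ~= 0 & u : U"
  using r by (auto simp: V_def)
 define w where "w u = (\<chi> k. det (\<chi> i j. if j = k then axis None 1 $ i else A u $ i $ j) / det (A u))" for u
 have w: "A u *v w u = axis None 1" if "u : ball u0 r" for u
  using cramer[of "A u" "w u" "axis None 1"] r(2)[OF that] by (simp add: w_def)
 have ent: "smooth_on (%u. if j = k then axis None 1 $ i else A u $ i $ j) (ball u0 r)" for i j k
  using smooth_on_subset[OF smA] r(2) by (cases "j = k") (auto simp: smooth_on_const subset_iff)
 have smw: "smooth_on w (ball u0 r)"
  unfolding w_def using r(2)
  by (intro smooth_on_vec_lambda smooth_on_divide smooth_on_det open_ball)
   (auto simp: ent intro: smooth_on_subset[OF smA])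
 have wD: "m0 \<bullet> w u = 1" "!!i. D u (axis i 1) \<bullet> w u = 0" if "u : ball u0 r" for u
  using A_None[of u "w u"] A_Some[of u "w u"] w[OF that] by (simp_all add: axis_def)
 have wpos: "w u \<bullet> w u > 0" if "u : ball u0 r" for u using wD(1)[OF that] by auto
 have neq: "(1 / sqrt (w u \<bullet> w u)) *\<^sub>R w u = n (X u)" if u: "u : ball u0 r" for u
 proof -
  have uU: "u : U" using r(2)[OF u] by simp
  have "w u = (w u \<bullet> n (X u)) *\<^sub>R n (X u)"
   by (rule normal_space_eq[OF linD[OF uU]])
    (use c(5)[OF uU] unit_normalD[OF n(1) X uU] orth[OF uU] wD[OF u] in \<open>auto simp: D_def\<close>)
  then obtain a where a: "w u = a *\<^sub>R n (X u)" by blast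
  have "a * (n (X u) \<bullet> m0) = 1" using wD(1)[OF u] by (simp add: a inner_commute)
  hence "a > 0" using r(2)[OF u] by (metis zero_less_mult_pos2 zero_less_one)
  moreover have "sqrt (w u \<bullet> w u) = norm (w u)" by (simp add: norm_eq_sqrt_inner)
  ultimately show ?thesis using a unit_normalD(1)[OF n(1) X uU] by simp
 qed
 have "smooth_on (%u. (1 / sqrt (w u \<bullet> w u)) *\<^sub>R w u) (ball u0 r)"
  using wpos by (intro smooth_on_scaleR smooth_on_divide smooth_on_sqrt smooth_on_inner smooth_on_const smw open_ball) auto
 hence "smooth_on (%u. n (X u)) (ball u0 r)"
  by (rule smooth_on_cong[OF open_ball, rotated]) (rule neq)
 thus ?thesis using that r by blast
qed

text \<open>In a small parameter ball the normal is Lipschitz and the parametrisation bilipschitz,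
  so estimates in the parameter carry over to distances on the surface.\<close>

lemma local_curvature_bound:
 fixes S :: "('d::finite) ambient set"
 assumes X: "(U, X) : local_params S" and n: "unit_normal S n" "continuous_on S n" and u0: "u0 : U"
 obtains e K where "0 < e" "0 <= K"
  "!!p q. p : S Int ball (X u0) e ==> q : S Int ball (X u0) e ==>
    norm (n p - n q) <= K * norm (p - q) & \<bar>n p \<bullet> (q - p)\<bar> <= K * (norm (p - q))^2"
proof -
 note c = local_paramsD[OF X]
 obtain r1 where r1: "0 < r1" "ball u0 r1 \<subseteq> U" "smooth_on (%u. n (X u)) (ball u0 r1)"
  using smooth_on_unit_normal_local_param[OF X n u0] .
 obtain r2 m where r2: "0 < r2" "0 < m" "!!y z. y : ball u0 r2 ==> z : ball u0 r2 ==> m * norm (y - z) <= norm (X y - X z)"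
  using smooth_on_locally_bilipschitz[OF c(1) u0 c(2) c(5)[OF u0]] by metis
 obtain r3 M where r3: "0 < r3" "0 < M" "!!y z. y : ball u0 r3 ==> z : ball u0 r3 ==> norm (X y - X z) <= M * norm (y - z)"
  using smooth_on_locally_lipschitz[OF c(1) u0 c(2)] by metis
 obtain r4 L where r4: "0 < r4" "0 < L"
  "!!y z. y : ball u0 r4 ==> z : ball u0 r4 ==> norm (n (X y) - n (X z)) <= L * norm (y - z)"
  using smooth_on_locally_lipschitz[OF open_ball _ r1(3), of u0] r1(1) by (metis centre_in_ball)
 define r where "r = min (min r1 r2) (min r3 r4)"
 have r: "0 < r" "ball u0 r \<subseteq> U" using r1 r2 r3 r4 by (auto simp: r_def)
 have sub: "u : ball u0 r1 & u : ball u0 r2 & u : ball u0 r3 & u : ball u0 r4" if "u : ball u0 r" for u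
  using that by (simp add: r_def)
 have "openin (top_of_set S) (X ` ball u0 r)"
  using local_paramsD(3)[OF local_params_shrink[OF X open_ball r(2)]] .
 moreover have "X u0 : X ` ball u0 r" using r by simp
 ultimately obtain e where e: "e > 0" "!!p. p : S ==> dist p (X u0) < e ==> p : X ` ball u0 r"
  unfolding openin_euclidean_subtopology_iff by blast
 have main: "norm (n (X u) - n (X v)) <= L * norm (u - v) & \<bar>n (X u) \<bullet> (X v - X u)\<bar> <= L * M * (norm (u - v))^2"
  if u: "u : ball u0 r" and v: "v : ball u0 r" for u v
 proof
  show "norm (n (X u) - n (X v)) <= L * norm (u - v)" using r4(3) sub u v by blast
  have seg: "closed_segment u v \<subseteq> ball u0 r" using u v by (simp add: closed_segment_subset)
  have "norm (n (X u) \<bullet> X v - n (X u) \<bullet> X u) <= (L * norm (u - v) * M) * norm (v - u)"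
  proof (rule differentiable_bound[OF convex_closed_segment])
   fix y assume y: "y : closed_segment u v"
   hence yb: "y : ball u0 r" using seg by blast
   hence yU: "y : U" using r by blast
   show "((%y. n (X u) \<bullet> X y) has_derivative (%w. n (X u) \<bullet> fderiv X y w)) (at y within closed_segment u v)"
    using smooth_on_has_derivative[OF c(2) yU] has_derivative_at_withinI
    by (intro has_derivative_inner_right) blast
   show "onorm (%w. n (X u) \<bullet> fderiv X y w) <= L * norm (u - v) * M"
   proof (rule onorm_bound)
    fix w
    have dw: "norm (fderiv X y w) <= M * norm w"
    proof (rule has_derivative_norm_le[OF smooth_on_has_derivative[OF c(2) yU]])
     show "0 < r3 - dist u0 y" using sub[OF yb] by simp
     fix z assume "z : ball y (r3 - dist u0 y)"
     hence "z : ball u0 r3" using dist_triangle[of u0 z y] by (simp add: dist_commute)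
     thus "norm (X z - X y) <= M * norm (z - y)" using r3(3) sub[OF yb] by blast
    qed
    \<comment> \<open>The normal at \<open>X y\<close> annihilates the derivative there, so it may
      be subtracted; the difference of the normals supplies a second factor
      \<open>norm (u - v)\<close>.\<close>
    have "n (X u) \<bullet> fderiv X y w = (n (X u) - n (X y)) \<bullet> fderiv X y w"
     using unit_normalD(2)[OF n(1) X yU] by (simp add: inner_diff_left)
    also have "norm ... <= norm (n (X u) - n (X y)) * norm (fderiv X y w)"
     using Cauchy_Schwarz_ineq2 by simp
    also have "... <= (L * norm (u - v)) * (M * norm w)"
    proof (rule mult_mono[OF _ dw])
     have "norm (n (X u) - n (X y)) <= L * norm (u - y)" using r4(3) sub u yb by blast
     also have "norm (u - y) <= norm (u - v)"
      using segment_bound(1)[OF y] by (simp add: norm_minus_commute)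
     finally show "norm (n (X u) - n (X y)) <= L * norm (u - v)" using r4(2) by simp
    qed (use r4 r3 in auto)
    finally show "norm (n (X u) \<bullet> fderiv X y w) <= L * norm (u - v) * M * norm w"
     by (simp add: mult.assoc)
   qed (use r3 r4 in simp)
  qed auto
  thus "\<bar>n (X u) \<bullet> (X v - X u)\<bar> <= L * M * (norm (u - v))^2"
   by (simp add: inner_diff_right norm_minus_commute power2_eq_square mult_ac)
 qed
 define K where "K = max (L / m) (L * M / m^2)"
 show ?thesis
 proof (rule that[OF e(1), of K])
  show "0 <= K" using r2 r3 r4 by (simp add: K_def le_max_iff_disj)
  fix p q assume "p : S Int ball (X u0) e" "q : S Int ball (X u0) e"
  hence "p : X ` ball u0 r" "q : X ` ball u0 r"
   using e(2)[of p] e(2)[of q] by (simp_all add: dist_commute)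
  then obtain u v where uv: "u : ball u0 r" "p = X u" "v : ball u0 r" "q = X v" by blast
  have b: "norm (u - v) <= norm (p - q) / m"
   using r2(2,3) sub uv by (simp add: field_simps)
  have "L * norm (u - v) <= L / m * norm (p - q)"
   using mult_left_mono[OF b, of L] r4 by simp
  also have "... <= K * norm (p - q)" by (intro mult_right_mono) (auto simp: K_def)
  finally have 1: "L * norm (u - v) <= K * norm (p - q)" .
  have "L * M * (norm (u - v))^2 <= L * M * (norm (p - q) / m)^2"
   using b r3 r4 by (intro mult_left_mono power_mono) auto
  also have "... = L * M / m^2 * (norm (p - q))^2" by (simp add: power_divide)
  also have "... <= K * (norm (p - q))^2" by (intro mult_right_mono) (auto simp: K_def)
  finally show "norm (n p - n q) <= K * norm (p - q) & \<bar>n p \<bullet> (q - p)\<bar> <= K * (norm (p - q))^2"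
   using main[OF uv(1,3)] 1 uv by force
 qed
qed

text \<open>A Lebesgue number argument: \<open>x\<close> lies in a half ball of a finite subcover,
  and \<open>y\<close>, closer than every half radius, then lies in the full ball with the same
  centre. Monotonicity in the constant lets the maximum over the subcover serve all pairs.\<close>

lemma compact_uniform_local:
 fixes S :: "'a::metric_space set"
 assumes S: "compact S"
  and loc: "!!p. p : S ==> EX e>0. EX K. ALL x:S Int ball p e. ALL y:S Int ball p e. P x y K"
  and mono: "!!x y K K'. P x y K ==> K <= (K'::real) ==> P x y K'"
 obtains e K where "0 < e" "!!x y. x : S ==> y : S ==> dist x y < e ==> P x y K"
proof -
 obtain e K where eK: "!!p. p : S ==> e p > (0::real)"
  "!!p x y. p : S ==> x : S Int ball p (e p) ==> y : S Int ball p (e p) ==> P x y (K p)"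
  using loc by metis
 obtain F where F: "F \<subseteq> S" "finite F" "S \<subseteq> (\<Union>p\<in>F. ball p (e p / 2))"
 proof (rule compactE_image[OF S, of S "%p. ball p (e p / 2)"])
  show "S \<subseteq> (\<Union>p\<in>S. ball p (e p / 2))" using eK(1) by force
 qed auto
 show ?thesis
 proof (cases "S = {}")
  case True
  thus ?thesis using that[of 1] by simp
 next
  case False
  hence F0: "F ~= {}" using F by auto
  show ?thesis
  proof (rule that[of "Min ((%p. e p / 2) ` F)" "Max (K ` F)"])
   show "0 < Min ((%p. e p / 2) ` F)" using F F0 eK(1) by (subst Min_gr_iff) auto
   fix x y assume xy: "x : S" "y : S" "dist x y < Min ((%p. e p / 2) ` F)"
   obtain p where p: "p : F" "dist p x < e p / 2" using F xy by auto
   have "dist x y < e p / 2" using xy(3) p F by (subst (asm) Min_gr_iff) auto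
   hence "dist p y < e p" using p dist_triangle[of p y x] by linarith
   moreover have "dist p x < e p" using p(2) eK(1)[of p] p(1) F(1) by auto
   ultimately have "P x y (K p)" using eK(2)[of p x y] p F xy by auto
   thus "P x y (Max (K ` F))" using mono p F by (meson Max_ge finite_imageI imageI)
  qed
 qed
qed

lemma closed_surface_curvature_bound:
 fixes Sg :: "('d::finite) ambient set"
 assumes g: "closed_surface Sg" and n: "unit_normal Sg n" "continuous_on Sg n"
 obtains K where "0 < K"
  "!!p q. p : Sg ==> q : Sg ==> norm (n p - n q) <= K * norm (p - q)"
  "!!p q. p : Sg ==> q : Sg ==> \<bar>n p \<bullet> (q - p)\<bar> <= K * (norm (p - q))^2"
proof -
 have cpt: "compact Sg" using g by (simp add: closed_surface_def)
 have ch: "EX U X u. (U, X) : local_params Sg & u : U & p = X u" if "p : Sg" for p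
  using g that unfolding closed_surface_def by fast
 define P where "P p q K \<longleftrightarrow> norm (n p - n q) <= K * norm (p - q) & \<bar>n p \<bullet> (q - p)\<bar> <= K * (norm (p - q))^2"
  for p q K
 have mono: "P x y K ==> K <= K' ==> P x y K'" for x y K K'
  unfolding P_def by (meson mult_right_mono norm_ge_zero order_trans zero_le_power2)
 obtain e K where e: "0 < e" "!!x y. x : Sg ==> y : Sg ==> dist x y < e ==> P x y K"
 proof (rule compact_uniform_local[OF cpt _ mono])
  fix p assume "p : Sg"
  then obtain U X u where *: "(U, X) : local_params Sg" "u : U" "p = X u" using ch by blast
  show "EX e>0. EX K. ALL x:Sg Int ball p e. ALL y:Sg Int ball p e. P x y K"
   using local_curvature_bound[OF *(1) n *(2)] unfolding P_def *(3) by metis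
 qed auto
 \<comment> \<open>For distant pairs the unit normals differ by at most 2 while
   \<open>norm (p - q) / e >= 1\<close>; this is the origin of \<open>2 / e\<close>.\<close>
 define K' where "K' = max (max K 1) (2 / e)"
 have nn: "norm (n p) = 1" if "p : Sg" for p using ch[OF that] unit_normalD(1)[OF n(1)] by blast
 have P': "P p q K'" if pq: "p : Sg" "q : Sg" for p q
 proof (cases "dist p q < e")
  case True
  thus ?thesis using e(2)[OF pq] mono by (simp add: K'_def)
 next
  case False
  hence d: "1 <= norm (p - q) / e" using e(1) by (simp add: dist_norm field_simps)
  have "norm (n p - n q) <= 2" using norm_triangle_ineq4[of "n p" "n q"] nn pq by simp
  also have "2 <= 2 / e * norm (p - q)" using d by simp
  finally have 1: "norm (n p - n q) <= 2 / e * norm (p - q)" .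
  have "\<bar>n p \<bullet> (q - p)\<bar> <= norm (p - q)"
   using Cauchy_Schwarz_ineq2[of "n p" "q - p"] nn[OF pq(1)] by (simp add: norm_minus_commute)
  also have "... <= norm (p - q) * (norm (p - q) / e)"
   using mult_left_mono[OF d, of "norm (p - q)"] by simp
  also have "... <= 2 / e * (norm (p - q))^2" using e(1) by (simp add: power2_eq_square field_simps)
  finally have "P p q (2 / e)" using 1 by (simp add: P_def)
  thus ?thesis using mono by (simp add: K'_def)
 qed
 show ?thesis
  by (rule that[of K']) (use P' in \<open>auto simp: P_def K'_def less_max_iff_disj\<close>)
qed

section \<open>The tubular neighbourhood\<close>

lemma grad_eqI:
 assumes "GDERIV f x :> g"
 shows "grad f x = g"
 unfolding grad_def
proof (rule the_equality)
 show "GDERIV f x :> g" by (rule assms)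
 fix g' assume "GDERIV f x :> g'"
 hence "(%h. h \<bullet> g') = (%h. h \<bullet> g)"
  using assms has_derivative_unique unfolding gderiv_def by blast
 thus "g' = g" by (metis vector_eq_ldot)
qed

section \<open>Closest points and signed height over a surface of bounded curvature\<close>

locale tubular =
 fixes Sg :: "('d::finite) ambient set" and n :: "'d ambient => 'd ambient" and K :: real
 assumes surface: "closed_surface Sg" and normal: "unit_normal Sg n" and K_pos: "0 < K"
  and n_lipschitz: "!!p q. p : Sg ==> q : Sg ==> norm (n p - n q) <= K * norm (p - q)"
  and n_curvature: "!!p q. p : Sg ==> q : Sg ==> \<bar>n p \<bullet> (q - p)\<bar> <= K * (norm (p - q))^2"
begin

abbreviation cp :: "'d ambient => 'd ambient" where "cp \<equiv> closest_point Sg"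

text \<open>Up to \<open>1 / (2 * K)\<close> the inequality \<open>dist_offset\<close> makes closest
  points unique; half of that leaves the room that makes the projection Lipschitz with constant
  2.\<close>

definition reach :: real where "reach = 1 / (4 * K)"

definition tube :: "'d ambient set" where "tube = {x. infdist x Sg < reach}"

text \<open>The signed distance in the sense of the given normal field. Whether its sign agrees with
  inside and outside is a global question, settled in \<open>signed_dist_eq_height\<close>.\<close>

definition height :: "'d ambient => real" where "height x = (x - cp x) \<bullet> n (cp x)"

lemma reach_pos: "0 < reach" and reach_K: "reach * K = 1/4"
 using K_pos by (auto simp: reach_def)

lemma compact: "compact Sg" and nonempty: "Sg ~= {}" and connected: "connected Sg" and closed: "closed Sg"
 using surface compact_imp_closed by (auto simp: closed_surface_def)

lemma chart: 
 assumes "p : Sg"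
 obtains U X u where "(U, X) : local_params Sg" "u : U" "X u = p"
 using surface assms unfolding closed_surface_def by fast

lemma norm_n: "p : Sg ==> norm (n p) = 1"
 using unit_normalD(1)[OF normal] chart by metis

lemma n_n: "p : Sg ==> n p \<bullet> n p = 1"
 using norm_n by (simp add: norm_eq_1)

lemma continuous_n: "continuous_on Sg n"
proof -
 have "K-lipschitz_on Sg n"
  using n_lipschitz K_pos by (auto simp: lipschitz_on_def dist_norm)
 thus ?thesis by (rule lipschitz_on_continuous_on)
qed

lemma cp_in: "cp x : Sg"
 using closest_point_in_set[OF closed nonempty] .

lemma cp_le: "q : Sg ==> dist x (cp x) <= dist x q"
 using closest_point_exists(2)[OF closed nonempty] by blast

lemma infdist_eq: "infdist x Sg = dist x (cp x)"
proof (rule antisym)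
 show "infdist x Sg <= dist x (cp x)" by (rule infdist_le[OF cp_in])
 show "dist x (cp x) <= infdist x Sg"
  unfolding infdist_notempty[OF nonempty] by (rule cINF_greatest[OF nonempty]) (rule cp_le)
qed

text \<open>Expanding the square leaves the cross term
  \<open>2 * s * (n p \<bullet> (q - p))\<close>, which the curvature bound makes quadratic in
  \<open>p - q\<close>.\<close>

lemma dist_offset:
 assumes "p : Sg" "q : Sg"
 shows "s^2 + (1 - 2 * K * \<bar>s\<bar>) * (norm (p - q))^2 <= (norm (p + s *\<^sub>R n p - q))^2"
proof -
 have "(norm (p + s *\<^sub>R n p - q))^2 = (norm (p - q))^2 + s^2 - 2 * s * (n p \<bullet> (q - p))"
  unfolding power2_norm_eq_inner using n_n[OF assms(1)]
  by (simp add: inner_add_left inner_add_right inner_diff_left inner_diff_right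
    inner_commute power2_eq_square algebra_simps)
 moreover have "s * (n p \<bullet> (q - p)) <= \<bar>s\<bar> * (K * (norm (p - q))^2)"
  using mult_left_mono[OF n_curvature[OF assms], of "\<bar>s\<bar>"] by (simp add: abs_mult[symmetric])
 ultimately show ?thesis by (simp add: algebra_simps)
qed

text \<open>First-order condition: in a chart around \<open>cp x\<close> the squared distance to
  \<open>x\<close> has an interior minimum, so \<open>x - cp x\<close> is orthogonal to the tangent
  space.\<close>

lemma normal_decomp: "x - cp x = height x *\<^sub>R n (cp x)"
proof -
 obtain U X u where c: "(U, X) : local_params Sg" "u : U" "X u = cp x"
  using chart[OF cp_in] by metis
 note X = local_paramsD[OF c(1)]
 let ?D = "fderiv X u"
 have "(%v. - 2 * ((x - X u) \<bullet> ?D v)) = (%v. 0)"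
 proof (rule differential_zero_maxmin[OF c(2) X(1)])
  show "((%u. (x - X u) \<bullet> (x - X u)) has_derivative (%v. - 2 * ((x - X u) \<bullet> ?D v))) (at u)"
   by (rule derivative_eq_intros smooth_on_has_derivative[OF X(2) c(2)] refl)+
    (simp add: fun_eq_iff inner_commute)
  have "(x - X u) \<bullet> (x - X u) <= (x - X y) \<bullet> (x - X y)" if "y : U" for y
  proof -
   have "X y : Sg" using X(7) that by blast
   hence "norm (x - X u) <= norm (x - X y)" using cp_le[of "X y" x] by (simp add: c(3) dist_norm)
   thus ?thesis by (simp add: norm_le)
  qed
  thus "(ALL y:U. (x - X y) \<bullet> (x - X y) <= (x - X u) \<bullet> (x - X u)) \<or>
   (ALL y:U. (x - X u) \<bullet> (x - X u) <= (x - X y) \<bullet> (x - X y))" by blast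
 qed
 hence o: "(x - cp x) \<bullet> ?D v = 0" for v unfolding c(3) by (simp add: fun_eq_iff)
 show ?thesis
  unfolding height_def
  using normal_space_eq[OF smooth_on_linear_frechet_derivative[OF X(2) c(2)] X(5)[OF c(2)] _ _ o, of "n (cp x)"]
   unit_normalD[OF normal c(1,2)] unfolding c(3) by blast
qed

lemma abs_height: "\<bar>height x\<bar> = infdist x Sg"
 using arg_cong[OF normal_decomp[of x], of norm] norm_n[OF cp_in] by (simp add: infdist_eq dist_norm)

lemma decomp: "x = cp x + height x *\<^sub>R n (cp x)"
 using normal_decomp[of x] by (simp add: algebra_simps)

lemma offset:
 assumes p: "p : Sg" and s: "\<bar>s\<bar> < 2 * reach"
 shows "cp (p + s *\<^sub>R n p) = p" "height (p + s *\<^sub>R n p) = s" "infdist (p + s *\<^sub>R n p) Sg = \<bar>s\<bar>"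
  "!!q. q : Sg ==> dist (p + s *\<^sub>R n p) q = \<bar>s\<bar> ==> q = p"
proof -
 let ?x = "p + s *\<^sub>R n p"
 have a: "0 < 1 - 2 * K * \<bar>s\<bar>"
  using mult_strict_right_mono[OF s K_pos] reach_K by (simp add: mult_ac)
 \<comment> \<open>For \<open>\<bar>s\<bar> < 2 * reach\<close> the coefficient of
   \<open>(norm (p - q))^2\<close> in \<open>dist_offset\<close> is positive, so a competitor at
   least as close as \<open>p\<close> must be \<open>p\<close> itself.\<close>
 have key: "q = p" if q: "q : Sg" "dist ?x q <= \<bar>s\<bar>" for q
 proof -
  have "(norm (?x - q))^2 <= s^2"
   using power_mono[OF q(2), of 2] by (simp add: dist_norm)
  hence "(1 - 2 * K * \<bar>s\<bar>) * (norm (p - q))^2 <= 0" using dist_offset[OF p q(1), of s] by simp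
  hence "(norm (p - q))^2 <= 0" using a by (simp add: mult_le_0_iff)
  thus "q = p" by simp
 qed
 have d: "dist ?x p = \<bar>s\<bar>" using norm_n[OF p] by (simp add: dist_norm)
 show cp: "cp ?x = p" using key[OF cp_in] cp_le[OF p, of ?x] d by simp
 show "height ?x = s" unfolding height_def cp using n_n[OF p] by simp
 show "infdist ?x Sg = \<bar>s\<bar>" unfolding infdist_eq cp d ..
 show "q = p" if "q : Sg" "dist ?x q = \<bar>s\<bar>" for q using key that by simp
qed

lemma cp_on: "p : Sg ==> cp p = p"
 using closest_point_self by blast

lemma open_tube: "open tube"
 unfolding tube_def by (intro open_Collect_less continuous_intros)

lemma Sg_subset_tube: "Sg \<subseteq> tube"
 using reach_pos by (auto simp: tube_def)

text \<open>For a convex set the vectors from \<open>cp x\<close> to \<open>x\<close> and to the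
  other foot point would enclose an angle of at least 90 degrees. Here this fails by at most
  \<open>reach * K = 1/4\<close> times the squared distance of the foot points; adding the two
  inequalities leaves half of that square.\<close>

lemma cp_lipschitz:
 assumes "x : tube" "y : tube"
 shows "norm (cp x - cp y) <= 2 * norm (x - y)"
proof -
 let ?p = "cp x" and ?q = "cp y"
 have b: "(z - cp z) \<bullet> (w - cp z) <= 1/4 * (norm (cp z - w))^2" if "z : tube" "w : Sg" for z w
 proof -
  have "(z - cp z) \<bullet> (w - cp z) = height z * (n (cp z) \<bullet> (w - cp z))"
   by (subst normal_decomp) simp
  also have "... <= \<bar>height z\<bar> * \<bar>n (cp z) \<bullet> (w - cp z)\<bar>" by (simp add: abs_mult[symmetric])
  also have "... <= reach * (K * (norm (cp z - w))^2)"
   using that abs_height[of z] reach_pos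
   by (intro mult_mono n_curvature cp_in) (auto simp: tube_def)
  finally show ?thesis by (simp add: mult.assoc[symmetric] reach_K)
 qed
 have "(x - ?p) \<bullet> (?q - ?p) + (y - ?q) \<bullet> (?p - ?q) <= 1/2 * (norm (?p - ?q))^2"
  using b[OF assms(1) cp_in, of y] b[OF assms(2) cp_in, of x] by (simp add: norm_minus_commute)
 moreover have "(x - ?p) \<bullet> (?q - ?p) + (y - ?q) \<bullet> (?p - ?q) = (norm (?p - ?q))^2 - (x - y) \<bullet> (?p - ?q)"
  by (simp add: power2_norm_eq_inner inner_diff_left inner_diff_right inner_commute)
 moreover have "(x - y) \<bullet> (?p - ?q) <= norm (x - y) * norm (?p - ?q)" by (rule norm_cauchy_schwarz)
 ultimately have "norm (?p - ?q) * norm (?p - ?q) <= (2 * norm (x - y)) * norm (?p - ?q)"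
  by (simp add: power2_eq_square)
 thus ?thesis
  by (cases "norm (?p - ?q) = 0") (simp_all add: mult_le_cancel_right)
qed

text \<open>The change of the normal enters quadratically because
  \<open>n p \<bullet> n q = 1 - (norm (n p - n q))^2 / 2\<close> for unit vectors. Thus
  \<open>height\<close> is differentiable before anything is known about a derivative of
  \<open>cp\<close>.\<close>

lemma height_taylor:
 assumes x: "x : tube" and y: "y : tube"
 shows "\<bar>height y - height x - n (cp x) \<bullet> (y - x)\<bar> <= 5 * K * (norm (y - x))^2"
proof -
 let ?p = "cp x" and ?q = "cp y"
 have sy: "\<bar>height y\<bar> <= reach" using y abs_height[of y] by (simp add: tube_def)
 have yx: "y - x = (?q - ?p) + (height y *\<^sub>R n ?q - height x *\<^sub>R n ?p)"
  using decomp[of x] decomp[of y] by (simp add: algebra_simps)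
 have nn: "(norm (n ?p - n ?q))^2 = 2 - 2 * (n ?p \<bullet> n ?q)"
  using n_n[OF cp_in[of x]] n_n[OF cp_in[of y]]
  by (simp add: power2_norm_eq_inner inner_diff_left inner_diff_right inner_commute)
 have "n ?p \<bullet> (y - x) = n ?p \<bullet> (?q - ?p) + height y * (n ?p \<bullet> n ?q) - height x"
  by (subst yx) (simp add: inner_add_right inner_diff_right n_n[OF cp_in])
 hence "height y - height x - n ?p \<bullet> (y - x)
   = height y * ((norm (n ?p - n ?q))^2 / 2) - n ?p \<bullet> (?q - ?p)"
  unfolding nn by (simp add: right_diff_distrib diff_divide_distrib)
 also have "\<bar>...\<bar> <= \<bar>height y\<bar> * ((norm (n ?p - n ?q))^2 / 2) + \<bar>n ?p \<bullet> (?q - ?p)\<bar>"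
  by (rule order_trans[OF abs_triangle_ineq4]) (simp add: abs_mult)
 also have "... <= reach * ((K * norm (?p - ?q))^2 / 2) + K * (norm (?p - ?q))^2"
  using sy reach_pos
  by (intro add_mono mult_mono n_curvature cp_in divide_right_mono power_mono n_lipschitz) auto
 also have "... = (9/8 * K) * (norm (?p - ?q))^2"
  using reach_K by (simp add: power2_eq_square algebra_simps)
 also have "... <= (9/8 * K) * (2 * norm (x - y))^2"
  using K_pos by (intro mult_left_mono power_mono cp_lipschitz x y) auto
 also have "... <= 5 * K * (norm (y - x))^2"
  using K_pos by (simp add: power_mult_distrib norm_minus_commute mult_right_mono)
 finally show ?thesis .
qed

lemma height_has_derivative:
 assumes x: "x : tube"
 shows "(height has_derivative (%v. n (cp x) \<bullet> v)) (at x)"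
 unfolding has_derivative_iff_norm
proof
 show "bounded_linear (%v. n (cp x) \<bullet> v)" by (rule bounded_linear_inner_right)
 have ev: "\<forall>\<^sub>F y in at x. norm (norm (height y - height x - n (cp x) \<bullet> (y - x)) / norm (y - x)) <= 5 * K * norm (y - x)"
 proof -
  have "\<forall>\<^sub>F y in at x. y : tube" using open_tube x by (simp add: eventually_at_in_open')
  thus ?thesis
  proof (rule eventually_mono)
   fix y assume "y : tube"
   hence "\<bar>height y - height x - n (cp x) \<bullet> (y - x)\<bar> <= 5 * K * (norm (y - x))^2"
    by (rule height_taylor[OF x])
   thus "norm (norm (height y - height x - n (cp x) \<bullet> (y - x)) / norm (y - x)) <= 5 * K * norm (y - x)"
    by (cases "y = x") (simp_all add: divide_le_eq power2_eq_square mult.assoc)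
  qed
 qed
 have "((%y. 5 * K * norm (y - x)) \<longlongrightarrow> 5 * K * norm (x - x)) (at x)" by (intro tendsto_intros)
 thus "((%y. norm (height y - height x - n (cp x) \<bullet> (y - x)) / norm (y - x)) \<longlongrightarrow> 0) (at x)"
  by (intro Lim_null_comparison[OF ev]) simp
qed

lemma continuous_height: "continuous_on tube height"
 using height_has_derivative has_derivative_continuous
 by (meson continuous_at_imp_continuous_on)

lemma continuous_cp: "continuous_on tube cp"
proof -
 have "2-lipschitz_on tube cp" using cp_lipschitz by (auto simp: lipschitz_on_def dist_norm)
 thus ?thesis by (rule lipschitz_on_continuous_on)
qed

text \<open>Wrapping the tube once around the unit circle and collapsing its complement to a point gives a
 map into the punctured plane; the imaginary part of its square root is a continuous function that
 vanishes exactly on the surface and carries the sign of the height near it.\<close>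

lemma sign_function:
 obtains \<iota> :: "'d ambient => real" where "continuous_on UNIV \<iota>" "!!x. \<iota> x = 0 \<longleftrightarrow> x : Sg"
  "!!x. infdist x Sg <= reach / 2 ==> sgn (\<iota> x) = sgn (height x)"
proof -
 define r where "r = reach / 2"
 have r: "0 < r" "r < reach" using reach_pos by (auto simp: r_def)
 define T where "T = {x. infdist x Sg <= r}"
 define E where "E = {x. r <= infdist x Sg}"
 have TE: "closed T" "closed E" "T Un E = UNIV" and Tt: "T \<subseteq> tube"
  using r unfolding T_def E_def tube_def
  by (auto intro!: closed_Collect_le continuous_intros)
 have cT: "continuous_on T height" using continuous_on_subset[OF continuous_height Tt] .
 \<comment> \<open>At distance \<open>r\<close> the exponent is \<pi> times the imaginary unit up to
   sign, so both ends of the tube are mapped to -1 and fit the constant on the complement.\<close>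
 define w where "w x = \<i> * complex_of_real (pi * height x / r)" for x
 define f where "f x = (if infdist x Sg <= r then exp (w x) else - 1)" for x
 have edge: "exp (w x) = -1" if "infdist x Sg = r" for x
 proof -
  have "height x = r \<or> height x = - r" using abs_height[of x] that by auto
  thus ?thesis using r by (auto simp: w_def exp_minus mult.commute[of \<i>])
 qed
 have "continuous_on (T Un E) f"
  unfolding f_def
  by (rule continuous_on_If[OF TE(1,2)])
   (use edge r in \<open>auto simp: T_def E_def w_def intro!: continuous_intros cT[unfolded T_def]\<close>)
 hence cf: "continuous_on UNIV f" using TE by simp
 have f0: "f z ~= 0" for z by (simp add: f_def)
 obtain e where e: "continuous_on UNIV e" "!!x. f x = (e x)^2"
  by (rule continuous_sqrt_on_contractible[OF cf convex_imp_contractible[OF convex_UNIV] f0]) auto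
 \<comment> \<open>The root that is known explicitly in the tube. The quotient of the global root
   \<open>e\<close> by \<open>v\<close> takes only the values 1 and -1, and it is constant because
   the tube is connected.\<close>
 define v where "v x = exp (\<i> * complex_of_real (pi * height x / (2 * r)))" for x
 have v2: "(v x)^2 = exp (w x)" for x
  unfolding v_def w_def exp_double[symmetric] using r by (simp add: field_simps)
 have v0: "v x ~= 0" for x by (simp add: v_def)
 have q: "e x / v x = 1 \<or> e x / v x = -1" if "x : T" for x
 proof -
  have "(e x)^2 = (v x)^2" using e(2)[of x] that by (simp add: f_def T_def v2)
  thus ?thesis using v0[of x] by (auto simp: power2_eq_iff)
 qed
 have "connected T"
 proof -
  have T: "T = (%(p, s). p + s *\<^sub>R n p) ` (Sg \<times> {-r..r})"
  proof (intro equalityI subsetI)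
   fix x assume "x : T"
   hence "\<bar>height x\<bar> <= r" by (simp add: T_def abs_height)
   hence "(cp x, height x) : Sg \<times> {-r..r}" using cp_in by auto
   thus "x : (%(p, s). p + s *\<^sub>R n p) ` (Sg \<times> {-r..r})"
    by (rule rev_image_eqI) (simp add: decomp[symmetric])
  next
   fix x assume "x : (%(p, s). p + s *\<^sub>R n p) ` (Sg \<times> {-r..r})"
   then obtain q where q: "q : Sg \<times> {-r..r}" "x = (%(p, s). p + s *\<^sub>R n p) q" by blast
   obtain p s where "q = (p, s)" by (cases q)
   hence ps: "p : Sg" "\<bar>s\<bar> <= r" "x = p + s *\<^sub>R n p" using q by auto
   thus "x : T" using offset(3)[OF ps(1), of s] r by (simp add: T_def)
  qed
  have "connected (Sg \<times> {-r..r})" using connected by (intro connected_Times) auto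
  moreover have "continuous_on (Sg \<times> {-r..r}) (%(p, s). p + s *\<^sub>R n p)"
   unfolding case_prod_beta
   by (intro continuous_intros continuous_on_compose2[OF continuous_n]) auto
  ultimately show ?thesis unfolding T by (intro connected_continuous_image)
 qed
 moreover have "continuous_on T (%x. e x / v x)"
  using v0 r unfolding v_def
  by (intro continuous_intros cT continuous_on_subset[OF e(1)]) auto
 moreover have "finite ((%x. e x / v x) ` T)"
  by (rule finite_subset[of _ "{1, -1}"]) (use q in blast, simp)
 ultimately have "(%x. e x / v x) constant_on T" by (rule continuous_finite_range_constant)
 then obtain c where c: "!!x. x : T ==> e x / v x = c" unfolding constant_on_def by blast
 obtain p where p: "p : Sg" using nonempty by blast
 hence "p : T" using r by (simp add: T_def)
 hence c1: "c = 1 \<or> c = -1" using q c by metis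
 have cc: "c * c = 1" using c1 by auto
 \<comment> \<open>Off the tube \<open>e\<close> squares to -1, so its imaginary part is nonzero
   there; in the tube it is, after multiplication by the sign \<open>c\<close>, the sine of an angle
   with the sign of the height.\<close>
 define \<iota> where "\<iota> x = Im (c * e x)" for x
 have onT: "\<iota> x = sin (pi * height x / (2 * r))" if "x : T" for x
 proof -
  have "c * e x = v x" using c[OF that] v0[of x] cc by (auto simp: field_simps)
  thus ?thesis unfolding \<iota>_def v_def by (simp add: Im_exp)
 qed
 have sgT: "sgn (\<iota> x) = sgn (height x)" if "x : T" for x
 proof -
  have h: "\<bar>height x\<bar> <= r" using that by (simp add: T_def abs_height)
  have b: "\<bar>pi * height x / (2 * r)\<bar> < pi"
  proof -
   have "\<bar>pi * height x / (2 * r)\<bar> = pi * (\<bar>height x\<bar> / (2 * r))" using r by (simp add: abs_mult)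
   also have "... < pi * 1" using h r by (intro mult_strict_left_mono) auto
   finally show ?thesis by simp
  qed
  consider "height x = 0" | "height x > 0" | "height x < 0" by linarith
  thus ?thesis
  proof cases
   case 2
   hence "0 < pi * height x / (2 * r)" using r by simp
   hence "0 < sin (pi * height x / (2 * r))" using b by (intro sin_gt_zero) linarith+
   thus ?thesis using onT[OF that] 2 by simp
  next
   case 3
   hence "0 < - (pi * height x / (2 * r))" using r by (simp add: field_simps mult_pos_neg)
   hence "0 < sin (- (pi * height x / (2 * r)))" using b by (intro sin_gt_zero) linarith+
   thus ?thesis using onT[OF that] 3 by simp
  qed (simp add: onT[OF that])
 qed
 show ?thesis
 proof (rule that[of \<iota>])
  show "continuous_on UNIV \<iota>" unfolding \<iota>_def by (intro continuous_intros e)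
  show "\<iota> x = 0 \<longleftrightarrow> x : Sg" for x
  proof (cases "x : T")
   case True
   have "\<iota> x = 0 \<longleftrightarrow> height x = 0" using sgT[OF True] by (metis sgn_0_0)
   also have "... \<longleftrightarrow> infdist x Sg = 0" using abs_height[of x] by auto
   also have "... \<longleftrightarrow> x : Sg" using in_closed_iff_infdist_zero[OF closed nonempty] by blast
   finally show ?thesis .
  next
   case False
   hence "(e x)^2 = -1" using e(2)[of x] by (simp add: f_def T_def)
   hence "(e x - \<i>) * (e x + \<i>) = 0" by (simp add: power2_eq_square algebra_simps)
   hence "e x = \<i> \<or> e x = - \<i>" by (auto simp: eq_neg_iff_add_eq_0)
   hence "\<iota> x ~= 0" using c1 by (auto simp: \<iota>_def)
   moreover have "x ~: Sg" using False r by (auto simp: T_def)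
   ultimately show ?thesis by simp
  qed
  show "sgn (\<iota> x) = sgn (height x)" if "infdist x Sg <= reach / 2" for x
   using sgT that by (simp add: T_def r_def)
 qed
qed

text \<open>The outside is connected because the ambient dimension is at least 2, so the sign
  function is constant on it. The collar on that side of the surface is connected, misses the
  surface and contains an outside point, so it lies outside altogether. Hence near the surface the
  sign of the height alone decides between inside and outside.\<close>

lemma signed_dist_eq_height:
 obtains \<epsilon> :: real where "\<epsilon> = 1 \<or> \<epsilon> = - 1"
  "!!x. infdist x Sg <= reach / 2 ==> signed_dist Sg x = \<epsilon> * height x"
proof -
 define r where "r = reach / 2"
 have r: "0 < r" "r < reach" using reach_pos by (auto simp: r_def)
 obtain \<iota> :: "'d ambient => real" where \<iota>: "continuous_on UNIV \<iota>" "!!x. \<iota> x = 0 \<longleftrightarrow> x : Sg"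
  "!!x. infdist x Sg <= r ==> sgn (\<iota> x) = sgn (height x)"
  using sign_function unfolding r_def by blast
 have bd: "bounded Sg" using compact compact_imp_bounded by blast
 have "2 <= DIM('d ambient)" by (simp add: Suc_le_eq)
 hence conn: "connected (outside Sg)" using connected_outside[OF bd] by blast
 have const: "sgn (\<iota> x) = sgn (\<iota> y)" if C: "connected C" "C Int Sg = {}" "x : C" "y : C" for C x y
 proof -
  have *: "~ (\<iota> a < 0 & 0 < \<iota> b)" if "a : C" "b : C" for a b
  proof
   assume ab: "\<iota> a < 0 & 0 < \<iota> b"
   have "connected (\<iota> ` C)"
    using C(1) continuous_on_subset[OF \<iota>(1)] connected_continuous_image by blast
   hence "0 : \<iota> ` C"
    using ab that connectedD_interval[of "\<iota> ` C" "\<iota> a" "\<iota> b" 0] by (auto simp: less_imp_le)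
   thus False using \<iota>(2) C(2) by (metis IntI empty_iff imageE)
  qed
  have "\<iota> x ~= 0" "\<iota> y ~= 0" using \<iota>(2) C by blast+
  thus ?thesis using *[of x y] *[of y x] C(3,4) by (auto simp: sgn_if)
 qed
 have side: "connected ((%(p, s). p + (a * s) *\<^sub>R n p) ` (Sg \<times> {0<..r}))" for a
  unfolding case_prod_beta using connected
  by (intro connected_continuous_image connected_Times continuous_intros
    continuous_on_compose2[OF continuous_n]) auto
 \<comment> \<open>The outside is neither empty nor everything, so it has a frontier point; this
   lies on the surface, and outside points close to it lie in the collar.\<close>
 obtain y where y: "y : outside Sg" "infdist y Sg <= r"
 proof -
  have "outside Sg ~= {}" by (rule outside_bounded_nonempty[OF bd])
  moreover have "outside Sg ~= UNIV" using nonempty outside_no_overlap[of Sg] by (metis Int_UNIV_left)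
  ultimately obtain p where p: "p : frontier (outside Sg)" using frontier_not_empty by blast
  hence "p : Sg" using frontier_outside_subset[OF closed] by blast
  have "p : closure (outside Sg)" using p by (simp add: frontier_def)
  then obtain y where y: "y : outside Sg" "dist y p < r" using r(1) closure_approachable by blast
  have "infdist y Sg <= dist y p" by (rule infdist_le[OF \<open>p : Sg\<close>])
  thus ?thesis using that y by simp
 qed
 have y0: "y ~: Sg" using y outside_no_overlap by blast
 define \<epsilon> where "\<epsilon> = sgn (\<iota> y)"
 have \<epsilon>: "\<epsilon> = 1 \<or> \<epsilon> = -1" using y0 \<iota>(2) by (auto simp: \<epsilon>_def sgn_if)
 have out: "sgn (\<iota> x) = \<epsilon>" if "x : outside Sg" for x
  unfolding \<epsilon>_def by (rule const[OF conn outside_no_overlap that y(1)])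
 have hy: "sgn (height y) = \<epsilon>" using \<iota>(3)[OF y(2)] by (simp add: \<epsilon>_def)
 have inout: "x : outside Sg" if x: "infdist x Sg <= r" "sgn (height x) = \<epsilon>" for x
 proof -
  let ?C = "(%(p, s). p + (\<epsilon> * s) *\<^sub>R n p) ` (Sg \<times> {0<..r})"
  have in_C: "z : ?C" if z: "infdist z Sg <= r" "sgn (height z) = \<epsilon>" for z
  proof -
   have "height z = \<epsilon> * \<bar>height z\<bar>" using z(2) by (metis abs_mult_sgn mult.commute)
   moreover have "height z ~= 0" using z(2) \<epsilon> by auto
   hence "0 < \<bar>height z\<bar>" by simp
   moreover have "\<bar>height z\<bar> <= r" using z(1) abs_height[of z] by simp
   ultimately have "(cp z, \<bar>height z\<bar>) : Sg \<times> {0<..r}" "z = cp z + (\<epsilon> * \<bar>height z\<bar>) *\<^sub>R n (cp z)"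
    using decomp[of z] cp_in[of z] by simp_all
   thus ?thesis by (intro image_eqI[where x = "(cp z, \<bar>height z\<bar>)"]) simp_all
  qed
  have "?C \<subseteq> - Sg"
  proof
   fix z assume "z : ?C"
   then obtain q where q: "q : Sg \<times> {0<..r}" "z = (%(p, s). p + (\<epsilon> * s) *\<^sub>R n p) q" by blast
   obtain p s where "q = (p, s)" by (cases q)
   hence ps: "p : Sg" "0 < s" "s <= r" "z = p + (\<epsilon> * s) *\<^sub>R n p" using q by auto
   hence "infdist z Sg = s" using offset(3)[OF ps(1), of "\<epsilon> * s"] r \<epsilon> by (auto simp: abs_mult)
   thus "z : - Sg" using ps(2) by auto
  qed
  hence "connected_component (- Sg) y x"
   using side in_C[OF x] in_C[OF y(2) hy] unfolding connected_component_def by blast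
  thus ?thesis using outside_same_component y(1) by blast
 qed
 show ?thesis
 proof (rule that[OF \<epsilon>])
  fix x assume "infdist x Sg <= reach / 2"
  hence x: "infdist x Sg <= r" by (simp add: r_def)
  show "signed_dist Sg x = \<epsilon> * height x"
  proof (cases "x : inside Sg")
   case True
   hence "x ~: outside Sg" "x ~: Sg" using inside_Int_outside inside_no_overlap by blast+
   hence "sgn (height x) ~= \<epsilon>" "sgn (height x) ~= 0" using inout[OF x] \<iota>(2,3)[of x] x by (auto simp: sgn_zero_iff)
   hence "\<epsilon> * height x = - \<bar>height x\<bar>" using \<epsilon> by (auto simp: sgn_if split: if_splits)
   thus ?thesis using True by (simp add: signed_dist_def abs_height)
  next
   case False
   hence "x : outside Sg \<or> x : Sg" using union_with_outside[of Sg] by blast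
   hence "sgn (height x) = \<epsilon> \<or> height x = 0"
    using out[of x] \<iota>(3)[OF x] abs_height[of x] by auto
   hence "\<epsilon> * height x = \<bar>height x\<bar>" using \<epsilon> by (auto simp: sgn_if split: if_splits)
   thus ?thesis using False by (simp add: signed_dist_def abs_height)
  qed
 qed
qed

end

locale oriented_tubular = tubular +
 assumes signed_dist_height: "!!x. infdist x Sg < reach ==> signed_dist Sg x = height x"

lemma closed_surface_oriented_tubular:
 assumes "closed_surface Sg"
 obtains n K where "oriented_tubular Sg n K"
proof -
 obtain n0 where n0: "continuous_on Sg n0" "unit_normal Sg n0"
  using assms by (auto simp: closed_surface_def)
 obtain K where K: "0 < K"
  "!!p q. p : Sg ==> q : Sg ==> norm (n0 p - n0 q) <= K * norm (p - q)"
  "!!p q. p : Sg ==> q : Sg ==> \<bar>n0 p \<bullet> (q - p)\<bar> <= K * (norm (p - q))^2"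
  using closed_surface_curvature_bound[OF assms n0(2,1)] by metis
 interpret t: tubular Sg n0 K using assms n0 K by unfold_locales auto
 obtain \<epsilon> :: real where \<epsilon>: "\<epsilon> = 1 \<or> \<epsilon> = - 1"
  "!!x. infdist x Sg <= t.reach / 2 ==> signed_dist Sg x = \<epsilon> * t.height x"
  using t.signed_dist_eq_height by blast
 have KK: "K * a <= (2 * K) * a" if "0 <= a" for a using K(1) that by simp
 \<comment> \<open>Doubling \<open>K\<close> halves the reach, down to the range in which the signed
   distance is known to be the height up to the global sign.\<close>
 interpret o: tubular Sg "%x. \<epsilon> *\<^sub>R n0 x" "2 * K"
 proof
  show "unit_normal Sg (%x. \<epsilon> *\<^sub>R n0 x)" using n0(2) \<epsilon>(1) by (auto simp: unit_normal_def)
  fix p q assume pq: "p : Sg" "q : Sg"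
  have "norm (\<epsilon> *\<^sub>R n0 p - \<epsilon> *\<^sub>R n0 q) = norm (n0 p - n0 q)"
   using \<epsilon>(1) by (auto simp: norm_minus_commute)
  thus "norm (\<epsilon> *\<^sub>R n0 p - \<epsilon> *\<^sub>R n0 q) <= 2 * K * norm (p - q)"
   using K(2)[OF pq] KK[of "norm (p - q)"] by simp
  have "\<bar>(\<epsilon> *\<^sub>R n0 p) \<bullet> (q - p)\<bar> = \<bar>n0 p \<bullet> (q - p)\<bar>" using \<epsilon>(1) by auto
  thus "\<bar>(\<epsilon> *\<^sub>R n0 p) \<bullet> (q - p)\<bar> <= 2 * K * (norm (p - q))^2"
   using K(3)[OF pq] KK[of "(norm (p - q))^2"] by simp
 qed (use K assms in auto)
 have "oriented_tubular Sg (%x. \<epsilon> *\<^sub>R n0 x) (2 * K)"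
 proof
  fix x assume "infdist x Sg < o.reach"
  hence "infdist x Sg <= t.reach / 2" by (simp add: o.reach_def t.reach_def)
  thus "signed_dist Sg x = o.height x" using \<epsilon>(2) by (simp add: o.height_def t.height_def)
 qed
 thus ?thesis by (rule that)
qed

context oriented_tubular
begin

lemma signed_dist_gderiv:
 assumes "x : tube"
 shows "GDERIV (signed_dist Sg) x :> n (cp x)"
proof -
 have "(signed_dist Sg has_derivative (%v. n (cp x) \<bullet> v)) (at x)"
  by (rule has_derivative_transform_within_open[OF height_has_derivative[OF assms] open_tube assms])
   (simp add: signed_dist_height tube_def)
 thus ?thesis by (simp add: gderiv_def inner_commute)
qed

lemma normal_ext_eq:
 assumes "x : tube"
 shows "normal_ext Sg x = n (cp x)"
 by (rule grad_eqI[OF signed_dist_gderiv[OF assms]])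

lemma projection_strip:
 assumes "\<delta> <= reach"
 shows "projection_strip Sg \<delta>"
 unfolding projection_strip_def
proof (intro ballI conjI)
 fix x assume "x : strip Sg \<delta>"
 hence x: "x : tube"
  using assms by (auto simp: strip_def tube_def signed_dist_def infdist_nonneg split: if_splits)
 show "signed_dist Sg differentiable (at x)"
  using signed_dist_gderiv[OF x] by (auto simp: gderiv_def differentiable_def)
 show "\<exists>!p. p : Sg & dist x p = infdist x Sg"
 proof (rule ex1I[of _ "cp x"])
  show "cp x : Sg & dist x (cp x) = infdist x Sg" by (simp add: cp_in infdist_eq)
  fix p assume "p : Sg & dist x p = infdist x Sg"
  thus "p = cp x"
   using offset(4)[OF cp_in[of x], of "height x" p] decomp[of x] abs_height[of x] x reach_pos
   by (simp add: tube_def)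
 qed
 show "x = cp x + signed_dist Sg x *\<^sub>R normal_ext Sg x"
  using decomp[of x] signed_dist_height[of x] normal_ext_eq[OF x] x by (simp add: tube_def)
qed

end

section \<open>Smoothness of the closest point projection\<close>

lemma norm_le_option:
 fixes z :: "real ^ ('d::finite option)"
 shows "norm z <= \<bar>z $ None\<bar> + real CARD('d) * norm (\<chi> i. z $ Some i)"
proof -
 have "norm z <= (\<Sum>i\<in>UNIV. \<bar>z $ i\<bar>)" by (rule norm_le_l1_cart)
 also have "... = \<bar>z $ None\<bar> + (\<Sum>i\<in>UNIV. \<bar>z $ Some i\<bar>)"
  by (simp add: UNIV_option_conv sum.reindex)
 also have "(\<Sum>i\<in>UNIV. \<bar>z $ Some i\<bar>) <= (\<Sum>i\<in>(UNIV::'d set). norm (\<chi> i. z $ Some i))"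
 proof (rule sum_mono)
  fix i
  show "\<bar>z $ Some i\<bar> <= norm (\<chi> i. z $ Some i)"
   using component_le_norm_cart[of "\<chi> i. z $ Some i" i] by simp
 qed
 finally show ?thesis by simp
qed

context tubular
begin

lemma height_lipschitz:
 assumes x: "x : tube" and y: "y : tube"
 shows "\<bar>height x - height y\<bar> <= 4 * norm (x - y)"
proof -
 let ?p = "cp x" and ?q = "cp y"
 have sy: "\<bar>height y\<bar> <= reach" using y abs_height[of y] by (simp add: tube_def)
 have "(height x - height y) *\<^sub>R n ?p = (x - y) - (?p - ?q) - height y *\<^sub>R (n ?p - n ?q)"
  using decomp[of x] decomp[of y] by (simp add: algebra_simps)
 hence "\<bar>height x - height y\<bar> * norm (n ?p) = norm ((x - y) - (?p - ?q) - height y *\<^sub>R (n ?p - n ?q))"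
  by (metis norm_scaleR)
 also have "... <= norm (x - y) + norm (?p - ?q) + \<bar>height y\<bar> * norm (n ?p - n ?q)"
  using norm_triangle_ineq4[of "(x - y) - (?p - ?q)" "height y *\<^sub>R (n ?p - n ?q)"]
   norm_triangle_ineq4[of "x - y" "?p - ?q"] by simp
 also have "... <= norm (x - y) + norm (?p - ?q) + reach * (K * norm (?p - ?q))"
  using sy reach_pos by (intro add_mono mult_mono n_lipschitz cp_in order_refl) auto
 also have "... = norm (x - y) + 5/4 * norm (?p - ?q)"
  by (simp add: mult.assoc[symmetric] reach_K)
 also have "... <= 4 * norm (x - y)" using cp_lipschitz[OF x y] norm_ge_zero[of "x - y"] by linarith
 finally show ?thesis by (simp add: norm_n[OF cp_in])
qed

text \<open>Fermi coordinates: \<open>\<Phi>\<close> sends a parameter and a height to the point at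
  this height over the chart. The parameter part of its smooth inverse is \<open>\<kappa>\<close>,
  which makes \<open>cp\<close> a composition of smooth maps near \<open>x\<close>.\<close>

lemma chart_tube_inverse:
 assumes Y: "(U, Y) : local_params Sg" "u0 : U" and x: "x : tube" "cp x = Y u0"
 obtains W \<kappa> where "open W" "x : W" "W \<subseteq> tube" "smooth_on \<kappa> W" "\<kappa> x = u0"
  "!!y. y : W ==> \<kappa> y : U & Y (\<kappa> y) = cp y"
proof -
 note c = local_paramsD[OF Y(1)]
 obtain r1 where r1: "0 < r1" "ball u0 r1 \<subseteq> U" "smooth_on (%u. n (Y u)) (ball u0 r1)"
  using smooth_on_unit_normal_local_param[OF Y(1) normal continuous_n Y(2)] .
 obtain r2 m where r2: "0 < r2" "0 < m" "!!y z. y : ball u0 r2 ==> z : ball u0 r2 ==> m * norm (y - z) <= norm (Y y - Y z)"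
  using smooth_on_locally_bilipschitz[OF c(1) Y(2) c(2) c(5)[OF Y(2)]] by metis
 define r where "r = min r1 r2"
 have r: "0 < r" "ball u0 r \<subseteq> U" "ball u0 r \<subseteq> ball u0 r1" "ball u0 r \<subseteq> ball u0 r2"
  using r1 r2 by (auto simp: r_def)
 define pr where "pr z = (\<chi> i. z $ Some i)" for z :: "'d ambient"
 have pr_lin: "bounded_linear pr"
  unfolding pr_def linear_conv_bounded_linear[symmetric]
  by (rule linearI) (simp_all add: vec_eq_iff)
 define S where "S = {z. pr z : ball u0 r} Int {z. \<bar>z $ None\<bar> < reach}"
 have "{z. pr z : ball u0 r} = pr -` ball u0 r" by auto
 hence opS: "open S"
  unfolding S_def
  by (auto intro!: open_Int open_Collect_less continuous_intros open_vimage linear_continuous_on[OF pr_lin])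
 define \<Phi> where "\<Phi> z = Y (pr z) + (z $ None) *\<^sub>R n (Y (pr z))" for z
 have sm_pr: "smooth_on pr S" by (rule smooth_on_linear[OF opS pr_lin])
 have sm\<Phi>: "smooth_on \<Phi> S"
  unfolding \<Phi>_def
 proof (intro smooth_on_add smooth_on_scaleR smooth_on_component smooth_on_ident opS)
  show "smooth_on (%z. Y (pr z)) S"
   by (rule smooth_on_compose[OF opS c(1) sm_pr c(2)]) (use r in \<open>auto simp: S_def\<close>)
  show "smooth_on (%z. n (Y (pr z))) S"
   by (rule smooth_on_compose[OF opS open_ball sm_pr r1(3)]) (use r in \<open>auto simp: S_def\<close>)
 qed
 have \<Phi>: "cp (\<Phi> z) = Y (pr z)" "height (\<Phi> z) = z $ None" "\<Phi> z : tube" "pr z : ball u0 r" if "z : S" for z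
 proof -
  show pz: "pr z : ball u0 r" using that by (simp add: S_def)
  hence "Y (pr z) : Sg" using r c by blast
  moreover have "\<bar>z $ None\<bar> < reach" using that by (simp add: S_def)
  ultimately show "cp (\<Phi> z) = Y (pr z)" "height (\<Phi> z) = z $ None" "\<Phi> z : tube"
   using offset[of "Y (pr z)" "z $ None"] reach_pos unfolding \<Phi>_def tube_def by auto
 qed
 define M where "M = 4 + real CARD('d) * (2 / m)"
 have M: "M > 0" using r2 by (simp add: M_def add_pos_nonneg)
 \<comment> \<open>Injectivity of the derivative of \<open>\<Phi>\<close> comes from this bound and
   not from computing it: both coordinates, height and foot point, are Lipschitz functions of the
   image.\<close>
 have lower: "norm (y - z) <= M * norm (\<Phi> y - \<Phi> z)" if yz: "y : S" "z : S" for y z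
 proof -
  note t = \<Phi>(3)[OF yz(1)] \<Phi>(3)[OF yz(2)]
  have "(\<chi> i. (y - z) $ Some i) = pr y - pr z" by (simp add: pr_def vec_eq_iff)
  hence "norm (y - z) <= \<bar>y $ None - z $ None\<bar> + real CARD('d) * norm (pr y - pr z)"
   using norm_le_option[of "y - z"] by simp
  also have "\<bar>y $ None - z $ None\<bar> <= 4 * norm (\<Phi> y - \<Phi> z)"
   using height_lipschitz[OF t] \<Phi> yz by simp
  also have "norm (pr y - pr z) <= 2 / m * norm (\<Phi> y - \<Phi> z)"
  proof -
   have "m * norm (pr y - pr z) <= norm (Y (pr y) - Y (pr z))"
    using r2(3) \<Phi>(4) yz r(4) by blast
   also have "... <= 2 * norm (\<Phi> y - \<Phi> z)" using cp_lipschitz[OF t] \<Phi> yz by simp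
   finally show ?thesis using r2(2) by (simp add: field_simps)
  qed
  finally show ?thesis by (simp add: M_def algebra_simps mult_left_mono)
 qed
 have inj\<Phi>: "inj_on \<Phi> S"
 proof (rule inj_onI)
  fix y z assume "y : S" "z : S" "\<Phi> y = \<Phi> z"
  thus "y = z" using lower[of y z] by simp
 qed
 have injD: "inj (frechet_derivative \<Phi> (at z))" if z: "z : S" for z
 proof -
  obtain e where e: "e > 0" "ball z e \<subseteq> S" using opS z openE by blast
  have lb: "1 / M * norm v <= norm (frechet_derivative \<Phi> (at z) v)" for v
   by (rule has_derivative_norm_ge[OF smooth_on_has_derivative[OF sm\<Phi> z] e(1)])
    (use lower[OF _ z] e(2) M in \<open>auto simp: field_simps subset_iff\<close>)
  hence "v = 0" if "frechet_derivative \<Phi> (at z) v = 0" for v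
   using lb[of v] that M by (auto simp: divide_le_0_iff)
  thus ?thesis
   using smooth_on_linear_frechet_derivative[OF sm\<Phi> z] linear_injective_0 by blast
 qed
 note inv = smooth_on_inv_into[OF opS sm\<Phi> inj\<Phi> injD]
 define \<kappa> where "\<kappa> y = pr (inv_into S \<Phi> y)" for y
 define z0 where "z0 = (\<chi> b. case b of None => height x | Some i => u0 $ i)"
 have z0: "pr z0 = u0" "z0 $ None = height x" by (simp_all add: z0_def pr_def)
 have z0S: "z0 : S" using z0 x(1) r abs_height[of x] by (simp add: S_def tube_def)
 have \<Phi>z0: "\<Phi> z0 = x" using decomp[of x] x(2) by (simp add: \<Phi>_def z0)
 show ?thesis
 proof (rule that[of "\<Phi> ` S" \<kappa>])
  show "x : \<Phi> ` S" using z0S \<Phi>z0 by blast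
  show "\<Phi> ` S \<subseteq> tube" using \<Phi>(3) by blast
  show "smooth_on \<kappa> (\<Phi> ` S)"
   unfolding \<kappa>_def by (rule smooth_on_linear_compose[OF inv(1) pr_lin inv(2)])
  show "\<kappa> x = u0" unfolding \<kappa>_def using inv_into_f_f[OF inj\<Phi> z0S] z0(1) \<Phi>z0 by simp
  fix y assume "y : \<Phi> ` S"
  then obtain z where "z : S" "y = \<Phi> z" by blast
  thus "\<kappa> y : U & Y (\<kappa> y) = cp y"
   using inv_into_f_f[OF inj\<Phi>] \<Phi>[of z] r by (auto simp: \<kappa>_def)
 qed (use inv(1) in auto)
qed

lemma smooth_on_cp: "smooth_on cp tube"
proof (rule smooth_on_localI)
 fix x assume x: "x : tube"
 obtain U Y u where c: "(U, Y) : local_params Sg" "u : U" "Y u = cp x"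
  using chart[OF cp_in] by metis
 obtain W \<kappa> where W: "open W" "x : W" "W \<subseteq> tube" "smooth_on \<kappa> W"
  "!!y. y : W ==> \<kappa> y : U & Y (\<kappa> y) = cp y"
  using chart_tube_inverse[OF c(1,2) x c(3)[symmetric]] by metis
 note Y = local_paramsD[OF c(1)]
 have "smooth_on (%y. Y (\<kappa> y)) W"
  by (rule smooth_on_compose[OF W(1) Y(1) W(4) Y(2)]) (use W(5) in blast)
 hence "smooth_on cp W" by (rule smooth_on_cong[OF W(1), rotated]) (use W(5) in blast)
 thus "EX W. open W & x : W & smooth_on cp W" using W by blast
qed

definition dcp :: "'d ambient => 'd ambient => 'd ambient" where
 "dcp x = fderiv cp x"

lemma cp_has_derivative: "x : tube ==> (cp has_derivative dcp x) (at x)"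
 unfolding dcp_def by (rule smooth_on_has_derivative[OF smooth_on_cp])

lemma linear_dcp: "x : tube ==> linear (dcp x)"
 using cp_has_derivative has_derivative_linear by blast

lemma tube_ball:
 assumes "x : tube"
 obtains e where "0 < e" "ball x e \<subseteq> tube"
 using assms open_tube openE by blast

lemma dcp_norm_le:
 assumes "x : tube"
 shows "norm (dcp x v) <= 2 * norm v"
proof -
 obtain e where e: "0 < e" "ball x e \<subseteq> tube" using tube_ball[OF assms] .
 show ?thesis
  by (rule has_derivative_norm_le[OF cp_has_derivative[OF assms] e(1)])
   (use cp_lipschitz e(2) assms in blast)
qed

text \<open>Near \<open>x\<close> the projection factors through a chart of the surface, so its
  differential takes values in the tangent space.\<close>

lemma dcp_tangent:
 assumes x: "x : tube"
 shows "n (cp x) \<bullet> dcp x v = 0"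
proof -
 obtain U Y u where c: "(U, Y) : local_params Sg" "u : U" "Y u = cp x"
  using chart[OF cp_in] by metis
 obtain W \<kappa> where W: "open W" "x : W" "W \<subseteq> tube" "smooth_on \<kappa> W" "\<kappa> x = u"
  "!!y. y : W ==> \<kappa> y : U & Y (\<kappa> y) = cp y"
  using chart_tube_inverse[OF c(1,2) x c(3)[symmetric]] by metis
 note Y = local_paramsD[OF c(1)]
 have "((%y. Y (\<kappa> y)) has_derivative
   (%v. fderiv Y u (frechet_derivative \<kappa> (at x) v))) (at x)"
  using has_derivative_compose[OF smooth_on_has_derivative[OF W(4,2)]]
   smooth_on_has_derivative[OF Y(2) c(2)] W(5) by metis
 hence "(cp has_derivative
   (%v. fderiv Y u (frechet_derivative \<kappa> (at x) v))) (at x)"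
  by (rule has_derivative_transform_within_open[OF _ W(1,2)]) (use W(6) in blast)
 hence "dcp x = (%v. fderiv Y u (frechet_derivative \<kappa> (at x) v))"
  using cp_has_derivative[OF x] has_derivative_unique by blast
 thus ?thesis using unit_normalD(2)[OF normal c(1,2)] by (simp add: c(3))
qed

lemma dcp_near_projection:
 assumes x: "x : tube"
 shows "norm (dcp x v - (v - (n (cp x) \<bullet> v) *\<^sub>R n (cp x))) <= 2 * K * infdist x Sg * norm v"
proof (rule field_le_epsilon)
 fix e' :: real assume e': "0 < e'"
 define e where "e = e' / (2 * K * (norm v + 1))"
 have nv: "0 < norm v + 1" by (simp add: add_nonneg_pos)
 have e: "0 < e" using e' K_pos nv by (simp add: e_def)
 let ?h = "%y. cp y - (y - height y *\<^sub>R n (cp x))"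
 obtain e1 where e1: "0 < e1" "ball x e1 \<subseteq> tube" using tube_ball[OF x] .
 define r where "r = min e1 (e / 4)"
 have r: "0 < r" "ball x r \<subseteq> tube" using e e1 by (auto simp: r_def)
 have der: "(?h has_derivative (%v. dcp x v - (v - (n (cp x) \<bullet> v) *\<^sub>R n (cp x)))) (at x)"
  by (intro has_derivative_diff cp_has_derivative[OF x] has_derivative_ident
    has_derivative_scaleR_left height_has_derivative[OF x])
 have "norm (dcp x v - (v - (n (cp x) \<bullet> v) *\<^sub>R n (cp x))) <= (2 * K * (infdist x Sg + e)) * norm v"
 proof (rule has_derivative_norm_le[OF der r(1)])
  fix y assume y: "y : ball x r"
  hence yt: "y : tube" using r by blast
  have "norm (y - x) < e / 4" using y by (simp add: r_def dist_norm norm_minus_commute)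
  hence hy: "\<bar>height y\<bar> <= infdist x Sg + e"
   using height_lipschitz[OF yt x] abs_height[of x] by linarith
  have "?h y - ?h x = height y *\<^sub>R (n (cp x) - n (cp y))"
   using decomp[of x] decomp[of y] by (simp add: algebra_simps)
  hence "norm (?h y - ?h x) = \<bar>height y\<bar> * norm (n (cp x) - n (cp y))" by simp
  also have "... <= (infdist x Sg + e) * (K * (2 * norm (y - x)))"
  proof (rule mult_mono[OF hy])
   have "norm (n (cp x) - n (cp y)) <= K * norm (cp x - cp y)" by (rule n_lipschitz[OF cp_in cp_in])
   also have "... <= K * (2 * norm (y - x))"
    using cp_lipschitz[OF x yt] K_pos by (intro mult_left_mono) (auto simp: norm_minus_commute)
   finally show "norm (n (cp x) - n (cp y)) <= K * (2 * norm (y - x))" .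
  qed (use e infdist_nonneg[of x Sg] in auto)
  finally show "norm (?h y - ?h x) <= (2 * K * (infdist x Sg + e)) * norm (y - x)"
   by (simp add: algebra_simps)
 qed
 also have "... = 2 * K * infdist x Sg * norm v + (2 * K * e) * norm v" by (simp add: algebra_simps)
 also have "... = 2 * K * infdist x Sg * norm v + e' * (norm v / (norm v + 1))"
  using K_pos nv by (simp add: e_def)
 also have "... <= 2 * K * infdist x Sg * norm v + e' * 1"
  using e' nv by (intro add_left_mono mult_left_mono) auto
 finally show "norm (dcp x v - (v - (n (cp x) \<bullet> v) *\<^sub>R n (cp x))) <= 2 * K * infdist x Sg * norm v + e'"
  by simp
qed

end

section \<open>Gram determinants\<close>

definition gram :: "(real^'d::finite => 'a::real_inner) => real^'d^'d" where
 "gram A = (\<chi> i j. A (axis i 1) \<bullet> A (axis j 1))"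

lemma area_factor_gram: "area_factor X u = sqrt (det (gram (fderiv X u)))"
 by (simp add: area_factor_def gram_def)

lemma gram_compose:
 fixes A :: "real^'d::finite => 'a::real_inner" and S :: "real^'d => real^'d"
 assumes A: "linear A" and S: "linear S"
 shows "gram (A \<circ> S) = transpose (matrix S) ** gram A ** matrix S"
proof -
 have S': "A (S (axis j 1)) = (\<Sum>k\<in>UNIV. (matrix S $ k $ j) *\<^sub>R A (axis k 1))" for j
 proof -
  have "S (axis j 1) = (\<Sum>k\<in>UNIV. (S (axis j 1) $ k) *\<^sub>R axis k 1)"
   using basis_expansion[of "S (axis j 1)"] by (simp add: scalar_mult_eq_scaleR)
  hence "A (S (axis j 1)) = A (\<Sum>k\<in>UNIV. (S (axis j 1) $ k) *\<^sub>R axis k 1)" by simp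
  thus ?thesis by (simp add: linear_sum[OF A] linear_scale[OF A] matrix_def)
 qed
 show ?thesis
  by (simp add: vec_eq_iff gram_def S' matrix_matrix_mult_def transpose_def inner_sum_left
    inner_sum_right sum_distrib_left sum_distrib_right mult_ac)
qed

lemma det_gram_compose:
 fixes A :: "real^'d::finite => 'a::real_inner" and S :: "real^'d => real^'d"
 assumes "linear A" "linear S"
 shows "det (gram (A \<circ> S)) = (det (matrix S))^2 * det (gram A)"
 by (simp add: gram_compose[OF assms] det_mul det_transpose power2_eq_square)

lemma gram_isometry:
 fixes A :: "real^'d::finite => 'a::real_inner"
 assumes A: "linear A" "!!v. norm (A v) = norm v"
 shows "gram A = mat 1"
proof -
 have "A v \<bullet> A w = v \<bullet> w" for v w
 proof -
  have "(norm (A (v + w)))^2 = (norm (v + w))^2" using A by simp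
  hence "(A v + A w) \<bullet> (A v + A w) = (v + w) \<bullet> (v + w)"
   by (simp add: linear_add[OF A(1)] power2_norm_eq_inner)
  moreover have "A v \<bullet> A v = v \<bullet> v" "A w \<bullet> A w = w \<bullet> w"
   using A(2)[of v] A(2)[of w] by (simp_all add: norm_eq)
  ultimately show ?thesis by (simp add: inner_add_left inner_add_right inner_commute)
 qed
 thus ?thesis by (simp add: gram_def mat_def vec_eq_iff inner_axis_axis)
qed

text \<open>Reduces Gram determinants of maps into a larger space to ordinary determinants: an
  isometry has Gram matrix 1, and \<open>S\<close> contributes the square of its
  determinant.\<close>

lemma linear_isometry_factor:
 fixes A :: "real^'d::finite => 'a::euclidean_space"
 assumes A: "linear A" "inj A"
 obtains I :: "real^'d => 'a" and S :: "real^'d => real^'d"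
  where "linear I" "!!v. norm (I v) = norm v" "linear S" "A = I \<circ> S" "range I = range A"
proof -
 have d: "dim (UNIV :: (real^'d) set) = dim (range A)"
  using dim_image_eq[OF A(1), of UNIV] A(2) by (simp add: inj_on_def inj_def)
 show ?thesis
 proof (rule isometries_subspaces[OF subspace_UNIV linear_subspace_image[OF A(1) subspace_UNIV] d])
  fix f :: "real^'d => 'a" and g
  assume fg: "linear f" "linear g" "range f = range A"
   "!!x. x : UNIV ==> norm (f x) = norm x" "!!x. x : range A ==> f (g x) = x"
  show ?thesis
   by (rule that[of f "g \<circ> A"]) (use fg linear_compose[OF A(1) fg(2)] in auto)
 qed
qed

text \<open>The inverse of the square factor has entries at most \<open>1 / m\<close>, so by the
  Leibniz formula its determinant is at most D! / m^D. The bound is crude but depends on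
  \<open>m\<close> and the dimension alone.\<close>

lemma det_gram_lower:
 fixes A :: "real^'d::finite => 'a::euclidean_space"
 assumes A: "linear A" and m: "0 < m" "!!v. m * norm v <= norm (A v)"
 shows "(m ^ CARD('d) / fact CARD('d))^2 <= det (gram A)"
proof -
 have "inj A" unfolding linear_injective_0[OF A]
 proof (intro allI impI)
  fix v assume "A v = 0"
  hence "m * norm v <= 0" using m(2)[of v] by simp
  thus "v = 0" using m(1) by (simp add: mult_le_0_iff)
 qed
 then obtain I :: "real^'d => 'a" and S :: "real^'d => real^'d" where IS: "linear I" "!!v. norm (I v) = norm v" "linear S" "A = I \<circ> S"
  using linear_isometry_factor[OF A] by metis
 have S: "m * norm v <= norm (S v)" for v using m(2)[of v] IS(2,4) by simp
 have "inj S" using \<open>inj A\<close> IS(4) inj_on_imageI2 by blast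
 
 obtain R where R: "linear R" "R \<circ> S = id"
  using linear_injective_left_inverse[OF IS(3) \<open>inj S\<close>] by blast
 hence "S \<circ> R = id" using linear_inverse_left[OF R(1) IS(3)] by blast
 note R = R(1) pointfree_idE[OF R(2)] pointfree_idE[OF this]
 have Rn: "norm (R v) <= norm v / m" for v using S[of "R v"] m(1) by (simp add: R field_simps)
 have "matrix (S \<circ> R) = mat 1"
  using R by (simp add: o_def matrix_id_mat_1[unfolded id_def])
 hence 1: "det (matrix S) * det (matrix R) = 1"
  using matrix_compose[OF R(1) IS(3)] det_mul by (metis det_I)
 have "\<bar>det (matrix R)\<bar> <= (\<Sum>p | p permutes (UNIV::'d set). \<bar>of_int (sign p) * (\<Prod>i\<in>UNIV. matrix R $ i $ p i)\<bar>)"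
  unfolding det_def by (rule sum_abs)
 also have "... <= (\<Sum>p | p permutes (UNIV::'d set). (1 / m) ^ CARD('d))"
 proof (rule sum_mono)
  fix p :: "'d => 'd"
  have "\<bar>of_int (sign p) * (\<Prod>i\<in>UNIV. matrix R $ i $ p i)\<bar> = (\<Prod>i\<in>UNIV. \<bar>matrix R $ i $ p i\<bar>)"
   by (simp add: abs_mult abs_prod sign_def)
  also have "... <= (\<Prod>i\<in>(UNIV::'d set). 1 / m)"
  proof (rule prod_mono, intro conjI)
   fix i
   have "\<bar>matrix R $ i $ p i\<bar> <= norm (R (axis (p i) 1))"
    unfolding matrix_def using component_le_norm_cart by simp
   also have "... <= 1 / m" using Rn[of "axis (p i) 1"] by simp
   finally show "\<bar>matrix R $ i $ p i\<bar> <= 1 / m" .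
  qed simp
  finally show "\<bar>of_int (sign p) * (\<Prod>i\<in>UNIV. matrix R $ i $ p i)\<bar> <= (1 / m) ^ CARD('d)" by simp
 qed
 also have "... = fact CARD('d) * (1 / m) ^ CARD('d)"
  by (simp add: card_permutations[OF refl finite_class.finite_UNIV])
 finally have R1: "\<bar>det (matrix R)\<bar> <= fact CARD('d) * (1 / m) ^ CARD('d)" .
 have "1 = \<bar>det (matrix S)\<bar> * \<bar>det (matrix R)\<bar>" using 1 by (metis abs_mult abs_one)
 also have "... <= \<bar>det (matrix S)\<bar> * (fact CARD('d) * (1 / m) ^ CARD('d))"
  by (intro mult_left_mono R1) auto
 finally have "m ^ CARD('d) / fact CARD('d) <= \<bar>det (matrix S)\<bar>"
  using m(1) by (simp add: field_simps)
 hence "(m ^ CARD('d) / fact CARD('d))^2 <= (\<bar>det (matrix S)\<bar>)^2"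
  using m(1) by (intro power_mono) auto
 also have "... = det (gram A)"
  using det_gram_compose[OF IS(1,3)] gram_isometry[OF IS(1,2)] IS(4) by simp
 finally show ?thesis .
qed

lemma det_gram_pos:
 fixes A :: "real^'d::finite => 'a::euclidean_space"
 assumes A: "linear A" "inj A"
 shows "0 < det (gram A)"
proof -
 obtain m where m: "m > 0" "!!v. m * norm v <= norm (A v)"
  using linear_inj_bounded_below_pos[OF A] by blast
 have "0 < (m ^ CARD('d) / fact CARD('d))^2" using m by simp
 thus ?thesis using det_gram_lower[OF A(1) m] by linarith
qed

lemma det_near_identity:
 fixes G :: "real^'d::finite^'d" and e :: real
 assumes e: "e <= 1" and G: "!!i j. \<bar>G $ i $ j - mat 1 $ i $ j\<bar> <= e"
 shows "\<bar>det G - 1\<bar> <= fact CARD('d) * 2 ^ CARD('d) * CARD('d) * e"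
proof -
 let ?N = "CARD('d)"
 have b: "\<bar>mat 1 $ i $ j\<bar> <= (1::real)" for i j :: 'd by (simp add: mat_def)
 have tm: "\<bar>of_int (sign p) * (\<Prod>i\<in>UNIV. G $ i $ p i) - of_int (sign p) * (\<Prod>i\<in>UNIV. mat 1 $ i $ p i)\<bar>
   <= 2 ^ ?N * (?N * e)" for p :: "'d => 'd"
 proof -
  have "\<bar>of_int (sign p) * (\<Prod>i\<in>UNIV. G $ i $ p i) - of_int (sign p) * (\<Prod>i\<in>UNIV. mat 1 $ i $ p i)\<bar>
   = \<bar>(\<Prod>i\<in>UNIV. 2 * (G $ i $ p i / 2)) - (\<Prod>i\<in>UNIV. 2 * (mat 1 $ i $ p i / 2))\<bar>"
   by (auto simp: sign_def abs_minus_commute)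
  \<comment> \<open>Halving makes all factors at most 1 in absolute value, as
    \<open>norm_prod_diff\<close> requires; the entries themselves are only bounded by 2.\<close>
  also have "... = 2 ^ ?N * norm ((\<Prod>i\<in>UNIV. G $ i $ p i / 2) - (\<Prod>i\<in>UNIV. mat 1 $ i $ p i / 2))"
   unfolding prod.distrib by (simp add: right_diff_distrib[symmetric] abs_mult del: prod_dividef)
  also have "... <= 2 ^ ?N * (\<Sum>i\<in>UNIV. norm (G $ i $ p i / 2 - mat 1 $ i $ p i / 2))"
  proof (intro mult_left_mono norm_prod_diff)
   fix i
   show "norm (G $ i $ p i / 2) <= 1" using G[of i "p i"] b[of i "p i"] e by simp
   show "norm (mat 1 $ i $ p i / 2 :: real) <= 1" using b[of i "p i"] by simp
  qed simp
  also have "... <= 2 ^ ?N * (\<Sum>i\<in>(UNIV::'d set). e)"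
  proof (intro mult_left_mono sum_mono)
   fix i
   show "norm (G $ i $ p i / 2 - mat 1 $ i $ p i / 2) <= e"
    using G[of i "p i"] by (simp add: diff_divide_distrib[symmetric])
  qed simp
  finally show ?thesis by simp
 qed
 have "\<bar>det G - 1\<bar> = \<bar>det G - det (mat 1 :: real^'d^'d)\<bar>" by simp
 also have "... <= (\<Sum>p | p permutes (UNIV::'d set). 2 ^ ?N * (?N * e))"
  unfolding det_def sum_subtractf[symmetric]
  by (rule order_trans[OF sum_abs]) (rule sum_mono, rule tm)
 also have "... = fact ?N * 2 ^ ?N * ?N * e"
  by (simp add: card_permutations[OF refl finite_class.finite_UNIV])
 finally show ?thesis .
qed

text \<open>On the range of \<open>A\<close>, parametrised isometrically by \<open>I\<close>, the
  map \<open>B\<close> is almost an isometry; the common factor \<open>S\<close> cancels in the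
  quotient of the two roots. The lower bound uses only that \<open>B\<close> shrinks lengths there
  by a factor of at least 1/2.\<close>

lemma gram_ratio:
 fixes A :: "real^'d::finite => 'a::euclidean_space" and B :: "'a => 'a" and e :: real
 assumes A: "linear A" "inj A" and B: "linear B" and e: "0 <= e" "e <= 1/2"
  and AB: "!!v. \<bar>(norm (B (A v)))^2 - (norm (A v))^2\<bar> <= e * (norm (A v))^2"
 obtains \<rho> where "sqrt (det (gram (B \<circ> A))) = \<rho> * sqrt (det (gram A))"
  "\<bar>\<rho> - 1\<bar> <= fact CARD('d) * 2 ^ CARD('d) * CARD('d) * e"
  "(1/2) ^ CARD('d) / fact CARD('d) <= \<rho>"
proof -
 obtain I :: "real^'d => 'a" and S :: "real^'d => real^'d" where IS: "linear I" "!!v. norm (I v) = norm v" "linear S" "A = I \<circ> S" "range I = range A"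
  using linear_isometry_factor[OF A] by metis
 define T where "T = B \<circ> I"
 have T: "linear T" unfolding T_def by (rule linear_compose[OF IS(1) B])
 have Tn: "\<bar>(norm (T v))^2 - (norm v)^2\<bar> <= e * (norm v)^2" for v
 proof -
  obtain w where "I v = A w" using IS(5) by (metis rangeE rangeI)
  thus ?thesis using AB[of w] IS(2)[of v] by (simp add: T_def)
 qed
 have low: "1/2 * norm v <= norm (T v)" for v
 proof -
  have "e * (norm v)^2 <= 1/2 * (norm v)^2" by (intro mult_right_mono e) simp
  hence "(norm v)^2 - (norm (T v))^2 <= 1/2 * (norm v)^2" using Tn[of v] by linarith
  moreover have "(1/2 * norm v)^2 <= 1/2 * (norm v)^2" by (simp add: power_mult_distrib power2_eq_square)
  ultimately have "(1/2 * norm v)^2 <= (norm (T v))^2" by linarith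
  thus ?thesis by (rule power2_le_imp_le) simp
 qed
 let ?g = "det (gram T)"
 have g1: "((1/2) ^ CARD('d) / fact CARD('d))^2 <= ?g" by (rule det_gram_lower[OF T _ low]) simp
 have g0: "0 <= ?g" using order_trans[OF zero_le_power2 g1] .
 have ent: "\<bar>gram T $ i $ j - mat 1 $ i $ j\<bar> <= e" for i j
 proof -
  let ?x = "axis i 1 :: real^'d" and ?y = "axis j 1 :: real^'d"
  \<comment> \<open>Polarisation turns the bound on squared lengths into a bound on the entries of
    the Gram matrix.\<close>
  have "4 * (T ?x \<bullet> T ?y - ?x \<bullet> ?y) = ((norm (T (?x + ?y)))^2 - (norm (?x + ?y))^2)
    - ((norm (T (?x - ?y)))^2 - (norm (?x - ?y))^2)"
   unfolding power2_norm_eq_inner linear_add[OF T] linear_diff[OF T]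
   by (simp add: inner_add_left inner_add_right inner_diff_left inner_diff_right inner_commute)
  also have "\<bar>...\<bar> <= e * (norm (?x + ?y))^2 + e * (norm (?x - ?y))^2"
   using Tn[of "?x + ?y"] Tn[of "?x - ?y"] by linarith
  also have "... = e * (2 * (?x \<bullet> ?x) + 2 * (?y \<bullet> ?y))"
   unfolding power2_norm_eq_inner
   by (simp add: inner_add_left inner_add_right inner_diff_left inner_diff_right inner_commute algebra_simps)
  also have "... = 4 * e" by (simp add: inner_axis_axis)
  finally have "\<bar>T ?x \<bullet> T ?y - ?x \<bullet> ?y\<bar> <= e" by simp
  thus ?thesis by (cases "i = j") (simp_all add: gram_def mat_def inner_axis_axis)
 qed
 show ?thesis
 proof (rule that[of "sqrt ?g"])
  have "B \<circ> A = T \<circ> S" using IS(4) by (auto simp: T_def)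
  moreover have "sqrt (det (gram A)) = \<bar>det (matrix S)\<bar>"
   using det_gram_compose[OF IS(1,3)] gram_isometry[OF IS(1,2)] IS(4) by simp
  ultimately show "sqrt (det (gram (B \<circ> A))) = sqrt ?g * sqrt (det (gram A))"
   using det_gram_compose[OF T IS(3)] by (simp add: real_sqrt_mult)
  \<comment> \<open>Since \<open>sqrt ?g + 1 >= 1\<close>, the root is at least as close to 1 as
    \<open>?g\<close> itself.\<close>
  have "\<bar>sqrt ?g - 1\<bar> * 1 <= \<bar>sqrt ?g - 1\<bar> * \<bar>sqrt ?g + 1\<bar>" using g0 by (intro mult_left_mono) auto
  also have "... = \<bar>(sqrt ?g - 1) * (sqrt ?g + 1)\<bar>" by (simp only: abs_mult)
  also have "... = \<bar>?g - 1\<bar>" using g0 by (simp add: left_diff_distrib distrib_left)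
  also have "... <= fact CARD('d) * 2 ^ CARD('d) * CARD('d) * e"
   using e by (intro det_near_identity ent) auto
  finally show "\<bar>sqrt ?g - 1\<bar> <= fact CARD('d) * 2 ^ CARD('d) * CARD('d) * e" by simp
  show "(1/2) ^ CARD('d) / fact CARD('d) <= sqrt ?g" by (rule real_le_rsqrt[OF g1])
 qed
qed

section \<open>Surface measures in charts\<close>

lemma surface_measureD:
 assumes "surface_measure S M"
 shows "sets M = sets (restrict_space borel S)" "space M = S"
  "!!U X A. (U, X) : local_params S ==> A : sets borel ==> A \<subseteq> U ==>
   emeasure M (X ` A) = (\<integral>\<^sup>+x\<in>A. ennreal (area_factor X x) \<partial>lborel)"
  "S - (\<Union>(U, X)\<in>local_params S. X ` U) : null_sets M"
proof -
 show *: "sets M = sets (restrict_space borel S)" using assms by (simp add: surface_measure_def)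
 show "space M = S" using sets_eq_imp_space_eq[OF *] by (simp add: space_restrict_space)
qed (use assms in \<open>auto simp: surface_measure_def\<close>)

lemma continuous_on_surface_measurable:
 assumes "surface_measure S M" "continuous_on S f"
 shows "f : borel_measurable M"
proof -
 have "f : borel_measurable (restrict_space borel S)"
  using borel_measurable_continuous_on_restrict[OF assms(2)] by simp
 thus ?thesis using measurable_cong_sets[OF surface_measureD(1)[OF assms(1)] refl] by blast
qed

lemma openin_sets_surface:
 assumes "surface_measure S M" "openin (top_of_set S) A"
 shows "A : sets M"
proof -
 obtain T where "open T" "A = S Int T" using assms(2) unfolding openin_open by blast
 thus ?thesis
  unfolding surface_measureD(1)[OF assms(1)] sets_restrict_space by (intro image_eqI[of _ _ T]) auto
qed

lemma continuous_on_area_factor: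
 assumes "(U, X) : local_params S"
 shows "continuous_on U (area_factor X)"
proof -
 note c = local_paramsD[OF assms]
 have "continuous_on U (%u. gram (fderiv X u) $ i $ j)" for i j
  unfolding gram_def using smooth_on_continuous_frechet_derivative[OF c(2)]
  by (simp add: continuous_on_inner)
 hence "continuous_on U (%u. det (gram (fderiv X u)))"
  unfolding det_def by (intro continuous_on_sum continuous_on_mult continuous_on_prod continuous_on_const)
 thus ?thesis
  unfolding area_factor_gram by (rule continuous_on_real_sqrt)
qed

lemma area_factor_pos:
 assumes "(U, X) : local_params S" "u : U"
 shows "0 < area_factor X u"
 unfolding area_factor_gram
 using det_gram_pos[OF smooth_on_linear_frechet_derivative local_paramsD(5)] local_paramsD(2) assms
 by (metis real_sqrt_gt_0_iff)

lemma measurable_area_factor: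
 assumes "(U, X) : local_params S"
 shows "(%u. area_factor X u * indicator U u) : borel_measurable borel"
 using borel_measurable_continuous_on_indicator[OF _ continuous_on_area_factor[OF assms]]
  local_paramsD(1)[OF assms] by (simp add: mult.commute)

lemma chart_image_sets:
 assumes M: "surface_measure S M" and X: "(U, X) : local_params S" and A: "A : sets borel" "A \<subseteq> U"
 shows "X ` A : sets M"
proof -
 note c = local_paramsD[OF X]
 obtain Y where Y: "homeomorphism U (X ` U) X Y" using c(4) by blast
 have "Y : borel_measurable (restrict_space borel (X ` U))"
  using homeomorphism_cont2[OF Y] by (rule borel_measurable_continuous_on_restrict)
 hence "Y -` A Int X ` U : sets (restrict_space borel (X ` U))"
  using measurable_sets[of Y "restrict_space borel (X ` U)" borel A] A(1)
  by (simp add: space_restrict_space)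
 moreover have "Y -` A Int X ` U = X ` A"
  using A(2) homeomorphism_apply1[OF Y] by force
 ultimately obtain B where B: "B : sets borel" "X ` A = X ` U Int B"
  by (auto simp: sets_restrict_space)
 obtain T where T: "open T" "X ` U = S Int T" using c(3) by (auto simp: openin_open)
 have "X ` A = S Int (T Int B)" using B T by auto
 thus ?thesis unfolding surface_measureD(1)[OF M] sets_restrict_space using B T by auto
qed

text \<open>The defining property of a surface measure says that Lebesgue measure weighted by the
  area factor and pushed forward by \<open>X\<close> is \<open>M\<close> restricted to the patch;
  integrals follow by the rules for image measures and densities.\<close>

lemma nn_integral_chart:
 assumes M: "surface_measure S M" and X: "(U, X) : local_params S" and f: "f : borel_measurable M"
 shows "(\<integral>\<^sup>+x. f x * indicator (X ` U) x \<partial>M)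
  = (\<integral>\<^sup>+u. f (X u) * ennreal (area_factor X u * indicator U u) \<partial>lborel)"
proof (cases "U = {}")
 case False
 note c = local_paramsD[OF X] and sp = surface_measureD[OF M]
 obtain u0 where u0: "u0 : U" using False by blast
 \<comment> \<open>A total measurable map into \<open>S\<close>; the value off \<open>U\<close> is
   arbitrary because the density \<open>w\<close> vanishes there.\<close>
 define X' where "X' u = (if u : U then X u else X u0)" for u
 have X'b: "X' : borel_measurable borel"
  unfolding X'_def using smooth_on_continuous_on[OF c(2)] c(1)
  by (intro borel_measurable_continuous_on_if) auto
 define w where "w u = ennreal (area_factor X u * indicator U u)" for u
 have w[measurable]: "w : borel_measurable borel"
  unfolding w_def using measurable_area_factor[OF X] by measurable
 have "X' : measurable lborel (restrict_space borel S)"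
  using X'b c(7) u0 by (intro measurable_restrict_space2) (auto simp: X'_def)
 hence X'm: "X' : measurable (density lborel w) M"
  using measurable_cong_sets[of "density lborel w" lborel M "restrict_space borel S"] sp(1) by simp
 have U: "X ` U : sets M" using openin_sets_surface[OF M c(3)] .
 have eq: "distr (density lborel w) M X' = density M (indicator (X ` U))"
 proof (rule measure_eqI)
  fix B assume "B : sets (distr (density lborel w) M X')"
  hence B: "B : sets M" by simp
  let ?A = "U Int X' -` B"
  have pre: "X' -` B : sets borel" using measurable_sets[OF X'm B] by simp
  hence A: "?A : sets borel" using c(1) by auto
  have "emeasure (distr (density lborel w) M X') B = emeasure (density lborel w) (X' -` B)"
   using emeasure_distr[OF X'm B] by simp
  also have "... = (\<integral>\<^sup>+u. w u * indicator (X' -` B) u \<partial>lborel)"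
   by (rule emeasure_density) (use pre in auto)
  also have "... = (\<integral>\<^sup>+u\<in>?A. ennreal (area_factor X u) \<partial>lborel)"
   by (intro nn_integral_cong) (auto simp: w_def indicator_def)
  also have "... = emeasure M (X ` ?A)" using sp(3)[OF X A] by simp
  also have "X ` ?A = X ` U Int B" by (auto simp: X'_def)
  also have "emeasure M (X ` U Int B) = emeasure (density M (indicator (X ` U))) B"
   using U B by (simp add: emeasure_density indicator_inter_arith[symmetric] nn_integral_indicator)
  finally show "emeasure (distr (density lborel w) M X') B = emeasure (density M (indicator (X ` U))) B" .
 qed simp
 have "(\<integral>\<^sup>+x. f x * indicator (X ` U) x \<partial>M) = (\<integral>\<^sup>+x. f x \<partial>density M (indicator (X ` U)))"
  using f U by (subst nn_integral_density) (auto simp: mult.commute)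
 also have "... = (\<integral>\<^sup>+u. f (X' u) \<partial>density lborel w)"
  unfolding eq[symmetric] using X'm f by (intro nn_integral_distr) auto
 also have "... = (\<integral>\<^sup>+u. w u * f (X' u) \<partial>lborel)"
 proof (rule nn_integral_density)
  have "(%u. f (X' u)) : borel_measurable (density lborel w)" using measurable_compose[OF X'm f] .
  thus "(%u. f (X' u)) : borel_measurable lborel" by simp
 qed simp
 also have "... = (\<integral>\<^sup>+u. f (X u) * ennreal (area_factor X u * indicator U u) \<partial>lborel)"
  by (intro nn_integral_cong) (auto simp: w_def X'_def indicator_def mult.commute)
 finally show ?thesis .
qed simp

text \<open>Null sets correspond in both directions because the area factor is positive.\<close>

lemma AE_chart:
 fixes S :: "('d::finite) ambient set"
 assumes M: "surface_measure S M" and X: "(U, X) : local_params S"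
 shows "(AE x in M. x : X ` U --> P x) \<longleftrightarrow> (AE u in lborel. u : U --> P (X u))"
proof
 note c = local_paramsD[OF X] and sp = surface_measureD[OF M]
 have U[measurable]: "U : sets borel" using c(1) by simp
 {
  assume ae: "AE x in M. x : X ` U --> P x"
  obtain N where N: "{x : space M. ~ (x : X ` U --> P x)} \<subseteq> N" "emeasure M N = 0" "N : sets M"
   by (rule AE_E[OF ae]) (rule that)
  obtain B where B: "B : sets borel" "N = S Int B"
   using N(3) unfolding sp(1) by (auto simp: sets_restrict_space)
  have "X -` B Int space (restrict_space borel U) : sets (restrict_space borel U)"
   using borel_measurable_continuous_on_restrict[OF smooth_on_continuous_on[OF c(2)]] B(1)
   by (rule measurable_sets)
  hence A: "U Int X -` B : sets borel"
   by (auto simp: space_restrict_space sets_restrict_space Int_commute)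
  have "X ` (U Int X -` B) \<subseteq> N" using B c(7) by auto
  hence "emeasure M (X ` (U Int X -` B)) = 0"
   using N(2,3) by (metis emeasure_mono le_zero_eq)
  hence "(\<integral>\<^sup>+u\<in>U Int X -` B. ennreal (area_factor X u) \<partial>lborel) = 0"
   using sp(3)[OF X A] by simp
  hence "AE u in lborel. ennreal (area_factor X u * indicator U u) * indicator (U Int X -` B) u = 0"
  proof (subst nn_integral_0_iff_AE[symmetric])
   show "(%u. ennreal (area_factor X u * indicator U u) * indicator (U Int X -` B) u) : borel_measurable lborel"
    using measurable_area_factor[OF X] A by measurable
   assume "(\<integral>\<^sup>+u\<in>U Int X -` B. ennreal (area_factor X u) \<partial>lborel) = 0"
   moreover have "(\<integral>\<^sup>+u. ennreal (area_factor X u * indicator U u) * indicator (U Int X -` B) u \<partial>lborel)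
    = (\<integral>\<^sup>+u\<in>U Int X -` B. ennreal (area_factor X u) \<partial>lborel)"
    by (intro nn_integral_cong) (auto simp: indicator_def)
   ultimately show "(\<integral>\<^sup>+u. ennreal (area_factor X u * indicator U u) * indicator (U Int X -` B) u \<partial>lborel) = 0"
    by simp
  qed
  thus "AE u in lborel. u : U --> P (X u)"
  proof (rule eventually_mono, intro impI)
   fix u assume u: "ennreal (area_factor X u * indicator U u) * indicator (U Int X -` B) u = 0" "u : U"
   hence "X u ~: B" using area_factor_pos[OF X u(2)] by (auto simp: indicator_def ennreal_eq_0_iff)
   hence "X u ~: N" using B by simp
   thus "P (X u)" using N(1) u(2) c(7) sp(2) by blast
  qed
 next
  assume ae: "AE u in lborel. u : U --> P (X u)"
  obtain N where N: "{u : space lborel. ~ (u : U --> P (X u))} \<subseteq> N" "emeasure lborel N = 0" "N : sets lborel"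
   by (rule AE_E[OF ae]) (rule that)
  have A: "U Int N : sets borel" using N(3) by simp
  have "AE u in lborel. u ~: N" using N(2,3) by (intro AE_not_in) (simp add: null_sets_def)
  hence "AE u in lborel. ennreal (area_factor X u) * indicator (U Int N) u = 0"
   by eventually_elim auto
  hence "(\<integral>\<^sup>+u\<in>U Int N. ennreal (area_factor X u) \<partial>lborel) = (\<integral>\<^sup>+(u::real^'d). 0 \<partial>lborel)"
   by (rule nn_integral_cong_AE)
  hence "emeasure M (X ` (U Int N)) = 0" using sp(3)[OF X A] by simp
  hence "X ` (U Int N) : null_sets M"
   using chart_image_sets[OF M X A] by (simp add: null_sets_def)
  hence "AE x in M. x ~: X ` (U Int N)" by (rule AE_not_in)
  thus "AE x in M. x : X ` U --> P x"
  proof (rule eventually_mono)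
   fix x assume "x ~: X ` (U Int N)"
   thus "x : X ` U --> P x" using N(1) by auto
  qed
 }
qed

text \<open>For the boundaries of the elements. Composed with a local inverse chart,
  \<open>f\<close> becomes a Lipschitz map between spaces of equal dimension, and such maps preserve
  negligible sets; points without a chart are null by the definition of the measure.\<close>

lemma null_lipschitz_image:
 fixes S :: "('d::finite) ambient set" and f :: "real^'d => 'd ambient"
 assumes M: "surface_measure S M" and Z: "compact Z" "negligible Z" and f: "f ` Z \<subseteq> S"
  and L: "L-lipschitz_on Z f"
 shows "f ` Z : null_sets M"
proof -
 note sp = surface_measureD[OF M]
 have cf: "compact (f ` Z)" using Z(1) lipschitz_on_continuous_on[OF L] compact_continuous_image by blast
 have meas: "f ` Z : sets M"
  unfolding sp(1) sets_restrict_space using compact_imp_closed[OF cf] f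
  by (intro image_eqI[of _ _ "f ` Z"]) auto
 have loc: "EX V. openin (top_of_set S) V & X u0 : V & V Int f ` Z : null_sets M"
  if X: "(U, X) : local_params S" "u0 : U" for U X u0
 proof -
  note c = local_paramsD[OF X(1)]
  obtain r m where r: "0 < r" "0 < m" "ball u0 r \<subseteq> U"
   "!!y z. y : ball u0 r ==> z : ball u0 r ==> m * norm (y - z) <= norm (X y - X z)"
   using smooth_on_locally_bilipschitz[OF c(1) X(2) c(2) c(5)[OF X(2)]] by metis
  have X': "(ball u0 r, X) : local_params S" using local_params_shrink[OF X(1) open_ball r(3)] .
  note c' = local_paramsD[OF X']
  define g where "g = inv_into (ball u0 r) X"
  have g: "g (X u) = u" if "u : ball u0 r" for u using that c'(6) by (simp add: g_def)
  define Z' where "Z' = Z Int f -` (X ` ball u0 r)"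
  have "negligible Z'" unfolding Z'_def using Z(2) negligible_subset by blast
  hence "negligible ((%z. g (f z)) ` Z')"
  proof (rule negligible_locally_Lipschitz_image[rotated])
   fix x assume x: "x : Z'"
   have "norm (g (f y) - g (f x)) <= L / m * norm (y - x)" if y: "y : Z'" for y
   proof -
    obtain a b where ab: "a : ball u0 r" "f x = X a" "b : ball u0 r" "f y = X b"
     using x y unfolding Z'_def by blast
    have "m * norm (b - a) <= norm (f y - f x)" using r(4)[OF ab(3,1)] ab by simp
    also have "... <= L * norm (y - x)"
     using lipschitz_onD[OF L, of y x] x y by (simp add: Z'_def dist_norm)
    finally show ?thesis using r(2) ab g by (simp add: field_simps)
   qed
   thus "EX T B. open T & x : T & (ALL y:Z' Int T. norm (g (f y) - g (f x)) <= B * norm (y - x))"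
    by (intro exI[of _ UNIV] exI[of _ "L / m"]) auto
  qed simp
  moreover have im: "(%z. g (f z)) ` Z' = ball u0 r Int X -` (f ` Z)"
   using g by (force simp: Z'_def)
  ultimately have neg: "negligible (ball u0 r Int X -` (f ` Z))" by simp
  have "X -` (f ` Z) Int space (restrict_space borel (ball u0 r)) : sets (restrict_space borel (ball u0 r))"
   using borel_measurable_continuous_on_restrict[OF smooth_on_continuous_on[OF c'(2)]]
    borel_compact[OF cf] by (rule measurable_sets)
  hence A: "ball u0 r Int X -` (f ` Z) : sets borel"
   by (auto simp: space_restrict_space sets_restrict_space Int_commute)
  let ?A = "ball u0 r Int X -` (f ` Z)"
  have "?A : null_sets lborel"
   using neg A unfolding negligible_iff_null_sets by (simp add: null_sets_completion_iff)
  hence "AE u in lborel. u ~: ?A" by (rule AE_not_in)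
  hence "AE u in lborel. ennreal (area_factor X u) * indicator ?A u = 0"
   by eventually_elim simp
  hence "(\<integral>\<^sup>+u\<in>?A. ennreal (area_factor X u) \<partial>lborel) = (\<integral>\<^sup>+(u::real^'d). 0 \<partial>lborel)"
   by (rule nn_integral_cong_AE)
  hence "emeasure M (X ` ?A) = 0" using sp(3)[OF X' A] by simp
  moreover have "X ` ?A = X ` ball u0 r Int f ` Z" by auto
  ultimately have "X ` ball u0 r Int f ` Z : null_sets M"
   using chart_image_sets[OF M X' A] by (simp add: null_sets_def)
  thus ?thesis using c'(3) r(1) by (intro exI[of _ "X ` ball u0 r"]) auto
 qed
 define \<V> where "\<V> = {V. openin (top_of_set S) V & V Int f ` Z : null_sets M}"
 define C where "C = (\<Union>(U, X)\<in>local_params S. X ` U)"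
 have cover: "C \<subseteq> \<Union>\<V>"
  using loc unfolding \<V>_def C_def by fast
 obtain \<V>' where V': "\<V>' \<subseteq> \<V>" "countable \<V>'" "\<Union>\<V>' = \<Union>\<V>"
  using Lindelof_openin[of \<V> S] unfolding \<V>_def by auto
 have "(\<Union>V\<in>\<V>'. V Int f ` Z) : null_sets M"
  using V' by (intro null_sets_UN') (auto simp: \<V>_def)
 hence "(\<Union>V\<in>\<V>'. V Int f ` Z) Un (S - C) : null_sets M"
  using sp(4)[folded C_def] by (rule null_sets.Un)
 moreover have "f ` Z \<subseteq> (\<Union>V\<in>\<V>'. V Int f ` Z) Un (S - C)"
  using cover f unfolding V'(3)[symmetric] by auto
 ultimately show ?thesis by (rule null_sets_subset[OF _ meas])
qed

section \<open>Smoothing of Lipschitz functions\<close>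

lemma differentiable_grad:
 fixes f :: "'a::euclidean_space => real"
 assumes "(f has_derivative f') (at x)"
 shows "grad f x = (\<Sum>b\<in>Basis. f' b *\<^sub>R b)" "f' v = grad f x \<bullet> v"
proof -
 interpret bounded_linear f' using assms has_derivative_bounded_linear by blast
 have eq: "f' v = v \<bullet> (\<Sum>b\<in>Basis. f' b *\<^sub>R b)" for v
 proof -
  have "f' v = f' (\<Sum>b\<in>Basis. (v \<bullet> b) *\<^sub>R b)" by (simp add: euclidean_representation)
  also have "... = (\<Sum>b\<in>Basis. (v \<bullet> b) *\<^sub>R f' b)" by (simp add: sum scaleR)
  finally show ?thesis by (simp add: inner_sum_right mult.commute)
 qed
 have "f' = (%v. v \<bullet> (\<Sum>b\<in>Basis. f' b *\<^sub>R b))" using eq by (rule ext)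
 hence "GDERIV f x :> (\<Sum>b\<in>Basis. f' b *\<^sub>R b)" using assms unfolding gderiv_def by metis
 thus g: "grad f x = (\<Sum>b\<in>Basis. f' b *\<^sub>R b)" by (rule grad_eqI)
 show "f' v = grad f x \<bullet> v" unfolding g using eq[of v] by (simp add: inner_commute)
qed

lemma norm_le_dual:
 fixes w :: "'a::euclidean_space"
 assumes "!!v. \<bar>w \<bullet> v\<bar> <= B * norm v"
 shows "norm w <= B"
proof (cases "w = 0")
 case True
 obtain b :: 'a where "b : Basis" using nonempty_Basis by blast
 thus ?thesis using assms[of b] True by simp
next
 case False
 have "norm w * norm w <= B * norm w"
  using assms[of w] by (simp add: power2_norm_eq_inner[symmetric] power2_eq_square)
 thus ?thesis using False by simp
qed

lemma grad_diff_norm_le: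
 fixes f :: "'a::euclidean_space => real"
 assumes f: "(f has_derivative f') (at x)" and r: "0 < r"
  and le: "!!y. y : ball x r ==> \<bar>f y - f x - D \<bullet> (y - x)\<bar> <= B * norm (y - x)"
 shows "norm (grad f x - D) <= B"
proof (rule norm_le_dual)
 fix v
 have d: "((%y. f y - D \<bullet> y) has_derivative (%v. f' v - D \<bullet> v)) (at x)"
  by (intro has_derivative_diff f has_derivative_inner_right has_derivative_ident)
 have "norm (f' v - D \<bullet> v) <= B * norm v"
  by (rule has_derivative_norm_le[OF d r]) (use le in \<open>simp add: inner_diff_right algebra_simps\<close>)
 thus "\<bar>(grad f x - D) \<bullet> v\<bar> <= B * norm v"
  by (simp add: differentiable_grad(2)[OF f] inner_diff_left)
qed

text \<open>Finite sums of products. Integrating such a kernel against a function of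
  \<open>y\<close> gives a finite combination of the smooth factors in \<open>x\<close>, so
  smoothness needs no differentiation under the integral.\<close>

inductive separable_kernel :: "('a::euclidean_space => 'a => real) => bool" where
 base: "smooth_on a UNIV ==> continuous_on UNIV b ==> separable_kernel (%x y. a x * b y)"
| add: "separable_kernel k ==> separable_kernel l ==> separable_kernel (%x y. k x y + l x y)"

lemma separable_kernel_mult:
 assumes "separable_kernel k" "separable_kernel l"
 shows "separable_kernel (%x y. k x y * l x y)"
 using assms(1)
proof induction
 case (base a b)
 show ?case
  using assms(2)
 proof induction
  case (base a' b')
  have "separable_kernel (%x y. (a x * a' x) * (b y * b' y))"
   using base \<open>smooth_on a UNIV\<close> \<open>continuous_on UNIV b\<close>
   by (intro separable_kernel.base smooth_on_mult continuous_on_mult open_UNIV)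
  thus ?case by (simp add: mult_ac)
 next
  case (add k l)
  show ?case using separable_kernel.add[OF add.IH] by (simp add: distrib_left)
 qed
next
 case (add k l)
 show ?case using separable_kernel.add[OF add.IH] by (simp add: distrib_right)
qed

lemma separable_kernel_power:
 "separable_kernel k ==> separable_kernel (%x y. (k x y) ^ N)"
proof (induction N)
 case 0
 show ?case using separable_kernel.base[of "%x. 1" "%y. 1"] by (simp add: smooth_on_const)
next
 case (Suc N)
 show ?case using separable_kernel_mult[OF Suc.prems Suc.IH[OF Suc.prems]] by simp
qed

lemma separable_kernel_sum:
 assumes "finite I" "!!i. i : I ==> separable_kernel (k i)"
 shows "separable_kernel (%x y. \<Sum>i\<in>I. k i x y)"
 using assms
proof (induction rule: finite_induct)
 case empty
 show ?case using separable_kernel.base[of "%x. 0" "%y. 0"] by (simp add: smooth_on_const)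
next
 case (insert i I)
 thus ?case using separable_kernel.add[of "k i" "%x y. \<Sum>i\<in>I. k i x y"] by simp
qed

text \<open>The squared distance splits into \<open>x \<bullet> x\<close>,
  \<open>y \<bullet> y\<close> and a sum of products of coordinates, and powers of separable kernels
  are separable.\<close>

lemma separable_kernel_landau:
 "separable_kernel (%x y::'a::euclidean_space. (1 - (norm (y - x))^2 / R^2) ^ N)"
proof (rule separable_kernel_power)
 have 1: "separable_kernel (%x y::'a. (1 - (x \<bullet> x) / R^2) * 1)"
  unfolding divide_inverse
  by (rule separable_kernel.base[of _ "%y. 1"])
   (intro smooth_on_diff smooth_on_mult smooth_on_const smooth_on_inner smooth_on_ident open_UNIV
    continuous_on_const)+
 have b1: "separable_kernel (%x y::'a. 1 * (- (y \<bullet> y) / R^2))"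
  unfolding divide_inverse
  by (rule separable_kernel.base[of "%x. 1"]) (intro smooth_on_const open_UNIV continuous_intros)+
 have 2: "separable_kernel (%x y::'a. \<Sum>b\<in>Basis. (x \<bullet> b) * (2 * (y \<bullet> b) / R^2))"
  by (intro separable_kernel_sum separable_kernel.base smooth_on_inner smooth_on_ident
    smooth_on_const open_UNIV) (auto intro!: continuous_intros simp: divide_inverse)
 have eq: "(1 - (x \<bullet> x) / R^2) * 1 + 1 * (- (y \<bullet> y) / R^2) + (\<Sum>b\<in>Basis. (x \<bullet> b) * (2 * (y \<bullet> b) / R^2))
   = 1 - (norm (y - x))^2 / R^2" for x y :: 'a
 proof -
  have "(\<Sum>b\<in>Basis. (x \<bullet> b) * (2 * (y \<bullet> b) / R^2)) = (2 / R^2) * (\<Sum>b\<in>Basis. (x \<bullet> b) * (y \<bullet> b))"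
   by (simp add: sum_distrib_left mult_ac)
  also have "... = 2 / R^2 * (x \<bullet> y)" by (simp add: euclidean_inner[of x y])
  finally show ?thesis
   by (simp add: power2_norm_eq_inner inner_diff_left inner_diff_right inner_commute
     add_divide_distrib diff_divide_distrib)
 qed
 show "separable_kernel (%x y::'a. 1 - (norm (y - x))^2 / R^2)"
  using separable_kernel.add[OF separable_kernel.add[OF 1 b1] 2] by (simp only: eq)
qed

lemma integrable_continuous_bounded_support:
 fixes f :: "'a::euclidean_space => real"
 assumes "continuous_on UNIV f" "!!x. r <= norm x ==> f x = 0"
 shows "integrable lborel f"
proof -
 have "integrable lborel (%x. indicator (cball 0 r) x *\<^sub>R f x)"
  by (rule borel_integrable_compact) (auto intro: continuous_on_subset[OF assms(1)])
 moreover have "(%x. indicator (cball 0 r) x *\<^sub>R f x) = f"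
  using assms(2) by (auto simp: indicator_def fun_eq_iff)
 ultimately show ?thesis by simp
qed

lemma separable_kernel_integral:
 fixes g :: "'a::euclidean_space => real"
 assumes g: "continuous_on UNIV g" "!!x. r <= norm x ==> g x = 0"
  and k: "separable_kernel k"
 shows "(ALL x. integrable lborel (%y. g y * k x y)) & smooth_on (%x. \<integral>y. g y * k x y \<partial>lborel) UNIV"
 using k
proof induction
 case (base a b)
 have i: "integrable lborel (%y. g y * b y)"
  by (rule integrable_continuous_bounded_support[of _ r])
   (auto intro!: continuous_intros base g)
 have "(%y. g y * (a x * b y)) = (%y. a x * (g y * b y))" for x by (simp add: mult_ac)
 thus ?case
  using i base by (simp add: smooth_on_mult smooth_on_const)
next
 case (add k l)
 thus ?case by (simp add: distrib_left smooth_on_add)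
qed

text \<open>The Landau kernel, truncated to the ball of radius \<open>R\<close>; the exponent
  \<open>Suc N\<close> keeps it continuous across the sphere also for \<open>N = 0\<close>.\<close>

definition landau_kernel :: "real => nat => 'a::euclidean_space => real" where
 "landau_kernel R N z = (max 0 (1 - (norm z)^2 / R^2)) ^ Suc N"

lemma landau_kernel_nonneg: "0 <= landau_kernel R N z"
 by (simp add: landau_kernel_def)

lemma landau_kernel_zero: "0 < R ==> R <= norm z ==> landau_kernel R N z = 0"
 by (simp add: landau_kernel_def max_def power_mono)

lemma continuous_landau_kernel: "continuous_on UNIV (landau_kernel R N :: 'a::euclidean_space => real)"
 unfolding landau_kernel_def divide_inverse by (intro continuous_intros)

lemma integrable_landau_kernel: "0 < R ==> integrable lborel (landau_kernel R N :: 'a::euclidean_space => real)"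
 by (rule integrable_continuous_bounded_support[OF continuous_landau_kernel landau_kernel_zero])

definition landau_mass :: "'a::euclidean_space itself => real => nat => real" where
 "landau_mass _ R N = (\<integral>(z::'a). landau_kernel R N z \<partial>lborel)"

definition landau_tail :: "'a::euclidean_space itself => real => nat => real => real" where
 "landau_tail t R N \<eta> = (\<integral>(z::'a). landau_kernel R N z * indicator {z. \<eta> <= norm z} z \<partial>lborel) / landau_mass t R N"

lemma landau_mass_lower:
 assumes "0 < \<eta>" "\<eta> < R"
 shows "(1 - \<eta>^2 / R^2) ^ Suc N * measure lborel (ball (0::'a::euclidean_space) \<eta>) <= landau_mass TYPE('a) R N"
proof -
 have "(\<integral>(z::'a). (1 - \<eta>^2 / R^2) ^ Suc N * indicator (ball 0 \<eta>) z \<partial>lborel) <= landau_mass TYPE('a) R N"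
  unfolding landau_mass_def
 proof (rule integral_mono)
  show "integrable lborel (%z::'a. (1 - \<eta>^2 / R^2) ^ Suc N * indicator (ball 0 \<eta>) z)"
   by (intro integrable_mult_right integrable_real_indicator emeasure_lborel_ball_finite) simp
  show "integrable lborel (landau_kernel R N :: 'a => real)"
   using assms by (intro integrable_landau_kernel) simp
  fix z :: 'a
  show "(1 - \<eta>^2 / R^2) ^ Suc N * indicator (ball 0 \<eta>) z <= landau_kernel R N z"
  proof (cases "z : ball 0 \<eta>")
   case True
   have "(norm z)^2 / R^2 <= \<eta>^2 / R^2" "\<eta>^2 / R^2 <= 1"
    using True assms by (auto intro!: divide_right_mono power_mono)
   hence "(1 - \<eta>^2 / R^2) ^ Suc N <= (max 0 (1 - (norm z)^2 / R^2)) ^ Suc N"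
    by (intro power_mono) auto
   thus ?thesis using True by (simp only: landau_kernel_def indicator_simps mult_1_right)
  qed (simp add: landau_kernel_nonneg)
 qed
 thus ?thesis by simp
qed

lemma landau_mass_pos:
 assumes "0 < R"
 shows "0 < landau_mass TYPE('a::euclidean_space) R N"
proof -
 have "(R/2)^2 / R^2 < 1" using assms by (simp add: power_divide)
 hence "0 < (1 - (R/2)^2 / R^2) ^ Suc N * measure lborel (ball (0::'a) (R/2))"
  using content_ball_pos[of "R/2" "0::'a"] assms by (intro mult_pos_pos zero_less_power) auto
 thus ?thesis using landau_mass_lower[of "R/2" R N, where 'a = 'a] assms by linarith
qed

text \<open>Beyond radius \<open>\<eta>\<close> the kernel is at most a power of
  \<open>1 - \<eta>^2 / R^2\<close>, while on the ball of radius \<open>\<eta> / 2\<close> it is at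
  least the same power of the larger number \<open>1 - (\<eta>/2)^2 / R^2\<close>: the quotient
  decays geometrically.\<close>

lemma landau_tail_tendsto_0:
 assumes "0 < \<eta>" "\<eta> < R"
 shows "(%N. landau_tail TYPE('a::euclidean_space) R N \<eta>) \<longlonglongrightarrow> 0"
proof -
 have R: "0 < R" using assms by simp
 define a where "a = 1 - \<eta>^2 / R^2"
 define b where "b = 1 - (\<eta>/2)^2 / R^2"
 have "\<eta>^2 < R^2" using assms by (intro power_strict_mono) auto
 hence q: "0 < \<eta>^2 / R^2" "\<eta>^2 / R^2 < 1" using assms by auto
 have "(\<eta>/2)^2 / R^2 = (\<eta>^2 / R^2) / 4" by (simp add: power_divide)
 hence ab: "0 < a" "a < b" "0 < b" using q by (auto simp: a_def b_def)
 let ?V = "measure lborel (cball (0::'a) R)" and ?v = "measure lborel (ball (0::'a) (\<eta>/2))"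
 have v: "0 < ?v" using content_ball_pos[of "\<eta>/2" "0::'a"] assms by simp
 have bound: "0 <= landau_tail TYPE('a) R N \<eta> & landau_tail TYPE('a) R N \<eta> <= (?V / ?v) * (a / b) ^ Suc N" for N
 proof
  let ?I = "\<integral>(z::'a). landau_kernel R N z * indicator {z. \<eta> <= norm z} z \<partial>lborel"
  have I0: "0 <= ?I" by (intro integral_nonneg_AE AE_I2) (simp add: landau_kernel_nonneg)
  thus "0 <= landau_tail TYPE('a) R N \<eta>"
   using landau_mass_pos[OF R, of N, where 'a = 'a] by (simp add: landau_tail_def)
  have "?I <= (\<integral>(z::'a). a ^ Suc N * indicator (cball 0 R) z \<partial>lborel)"
  proof (rule integral_mono)
   show "integrable lborel (%z::'a. landau_kernel R N z * indicator {z. \<eta> <= norm z} z)"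
    by (rule integrable_real_mult_indicator) (auto intro: integrable_landau_kernel[OF R])
   show "integrable lborel (%z::'a. a ^ Suc N * indicator (cball 0 R) z)"
    by (intro integrable_mult_right integrable_real_indicator emeasure_lborel_cball_finite) simp
   fix z :: 'a
   show "landau_kernel R N z * indicator {z. \<eta> <= norm z} z <= a ^ Suc N * indicator (cball 0 R) z"
   proof (cases "\<eta> <= norm z & norm z <= R")
    case True
    have "\<eta>^2 / R^2 <= (norm z)^2 / R^2" using True assms by (intro divide_right_mono power_mono) auto
    hence "max 0 (1 - (norm z)^2 / R^2) <= a" using ab by (simp add: a_def)
    hence "landau_kernel R N z <= a ^ Suc N"
     unfolding landau_kernel_def by (intro power_mono) auto
    thus ?thesis using True by simp
   next
    case False
    thus ?thesis using landau_kernel_zero[OF R, of z N] ab by (auto simp: indicator_def)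
   qed
  qed
  hence I: "?I <= a ^ Suc N * ?V" by simp
  have m: "b ^ Suc N * ?v <= landau_mass TYPE('a) R N"
   unfolding b_def using assms by (intro landau_mass_lower) auto
  have bv: "0 < b ^ Suc N * ?v" using ab v by simp
  have "landau_tail TYPE('a) R N \<eta> <= (a ^ Suc N * ?V) / (b ^ Suc N * ?v)"
   unfolding landau_tail_def using I m bv I0 by (intro frac_le) auto
  also have "... = (?V / ?v) * (a / b) ^ Suc N"
   by (simp only: power_divide times_divide_times_eq mult.commute)
  finally show "landau_tail TYPE('a) R N \<eta> <= (?V / ?v) * (a / b) ^ Suc N" .
 qed
 have "(%N. (a / b) ^ Suc N) \<longlonglongrightarrow> 0"
  using ab by (intro LIMSEQ_Suc LIMSEQ_power_zero) auto
 hence "(%N. (?V / ?v) * (a / b) ^ Suc N) \<longlonglongrightarrow> 0" using tendsto_mult_right_zero by blast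
 thus ?thesis
  by (rule tendsto_sandwich[rotated 2, OF tendsto_const[of 0]]) (use bound in auto)
qed

text \<open>Without truncation the kernel is separable and the result smooth everywhere. It agrees
  with a truncated convolution as long as \<open>x\<close> and the support of \<open>g\<close> stay
  in the half ball, because then \<open>norm (y - x) <= R\<close>.\<close>

definition landau_smoothing :: "real => nat => ('a::euclidean_space => real) => 'a => real" where
 "landau_smoothing R N g x =
   (\<integral>y. g y * (1 - (norm (y - x))^2 / R^2) ^ Suc N \<partial>lborel) / landau_mass TYPE('a) R N"

context
 fixes g :: "'a::euclidean_space => real" and R L :: real
 assumes R: "0 < R" and supp: "!!x. R / 2 <= norm x ==> g x = 0"
  and lip: "!!x y. \<bar>g x - g y\<bar> <= L * norm (x - y)" and L: "0 <= L"
begin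

lemma lipschitz_cont: "continuous_on UNIV g"
proof -
 have "L-lipschitz_on UNIV g" using lip L by (auto simp: lipschitz_on_def dist_norm)
 thus ?thesis by (rule lipschitz_on_continuous_on)
qed

lemma smooth_landau_smoothing: "smooth_on (landau_smoothing R N g) UNIV"
proof -
 have "smooth_on (%x. \<integral>y. g y * (1 - (norm (y - x))^2 / R^2) ^ Suc N \<partial>lborel) UNIV"
  using separable_kernel_integral[OF lipschitz_cont supp separable_kernel_landau] by blast
 moreover have "landau_mass TYPE('a) R N ~= 0" using landau_mass_pos[OF R] by (metis less_irrefl)
 ultimately show ?thesis
  unfolding landau_smoothing_def by (intro smooth_on_divide smooth_on_const) auto
qed

lemma integrable_translate_landau: "integrable lborel (%z. g (x + z) * landau_kernel R N z)"
proof (rule integrable_continuous_bounded_support[of _ R])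
 show "continuous_on UNIV (%z. g (x + z) * landau_kernel R N z)"
  by (intro continuous_intros continuous_on_compose2[OF lipschitz_cont] continuous_landau_kernel) auto
qed (simp add: landau_kernel_zero[OF R])

lemma landau_smoothing_convolution:
 assumes x: "norm x < R / 2"
 shows "landau_smoothing R N g x = (\<integral>z. g (x + z) * landau_kernel R N z \<partial>lborel) / landau_mass TYPE('a) R N"
proof -
 have "(\<integral>y. g y * (1 - (norm (y - x))^2 / R^2) ^ Suc N \<partial>lborel) = (\<integral>y. g y * landau_kernel R N (y - x) \<partial>lborel)"
 proof (rule Bochner_Integration.integral_cong[OF refl])
  fix y
  show "g y * (1 - (norm (y - x))^2 / R^2) ^ Suc N = g y * landau_kernel R N (y - x)"
  proof (cases "R / 2 <= norm y")
   case False
   hence "norm (y - x) <= R" using x norm_triangle_ineq4[of y x] by linarith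
   hence "(norm (y - x))^2 / R^2 <= 1" using R by (simp add: power_mono)
   thus ?thesis by (simp add: landau_kernel_def)
  qed (simp add: supp)
 qed
 also have "... = (\<integral>y. g y * landau_kernel R N (y - x) \<partial>distr lborel borel ((+) x))"
  by (simp add: lborel_distr_plus)
 also have "... = (\<integral>z. g (x + z) * landau_kernel R N z \<partial>lborel)"
 proof (subst integral_distr)
  show "(%y. g y * landau_kernel R N (y - x)) : borel_measurable borel"
   by (intro borel_measurable_continuous_onI continuous_intros lipschitz_cont
     continuous_on_compose2[OF continuous_landau_kernel]) auto
 qed auto
 finally show ?thesis by (simp add: landau_smoothing_def)
qed

text \<open>The Lipschitz bound and the convergence of the gradients both compare an increment of
  the smoothing with a number \<open>c\<close>: translates by small \<open>z\<close> contribute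
  \<open>A\<close>, the others \<open>B\<close> weighted by the tail mass.\<close>

lemma landau_smoothing_remainder:
 assumes x: "norm x < R / 2" and y: "norm y < R / 2"
  and near: "!!z. norm z < \<eta> ==> \<bar>g (y + z) - g (x + z) - c\<bar> <= A"
  and far: "!!z. \<bar>g (y + z) - g (x + z) - c\<bar> <= B" and AB: "0 <= A" "0 <= B"
 shows "\<bar>landau_smoothing R N g y - landau_smoothing R N g x - c\<bar> <= A + B * landau_tail TYPE('a) R N \<eta>"
proof -
 let ?m = "landau_mass TYPE('a) R N" and ?k = "landau_kernel R N :: 'a => real"
 have m: "0 < ?m" by (rule landau_mass_pos[OF R])
 note ik = integrable_landau_kernel[OF R, of N, where 'a = 'a] and ig = integrable_translate_landau[of _ N]
 let ?f = "%z. (g (y + z) - g (x + z) - c) * ?k z"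
 have if': "integrable lborel ?f"
  unfolding left_diff_distrib by (intro Bochner_Integration.integrable_diff ig integrable_mult_right ik)
 have ii: "integrable lborel (%z. ?k z * indicator {z. \<eta> <= norm z} z)"
  by (rule integrable_real_mult_indicator) (auto intro: ik)
 have "(landau_smoothing R N g y - landau_smoothing R N g x - c) * ?m = (\<integral>z. ?f z \<partial>lborel)"
 proof -
  have "(\<integral>z. ?f z \<partial>lborel) = (\<integral>z. g (y + z) * ?k z \<partial>lborel) - (\<integral>z. g (x + z) * ?k z \<partial>lborel) - c * ?m"
   unfolding left_diff_distrib landau_mass_def using ig ik
   by (simp add: Bochner_Integration.integral_diff Bochner_Integration.integrable_diff)
  thus ?thesis
   unfolding landau_smoothing_convolution[OF x] landau_smoothing_convolution[OF y]
   using m by (simp only:) (simp add: left_diff_distrib)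
 qed
 also have "\<bar>...\<bar> <= (\<integral>z. \<bar>?f z\<bar> \<partial>lborel)" by (rule integral_abs_bound)
 also have "... <= (\<integral>z. A * ?k z + B * (?k z * indicator {z. \<eta> <= norm z} z) \<partial>lborel)"
 proof (rule integral_mono)
  show "integrable lborel (%z. \<bar>?f z\<bar>)" using if' by (rule integrable_abs)
  show "integrable lborel (%z. A * ?k z + B * (?k z * indicator {z. \<eta> <= norm z} z))"
   by (intro Bochner_Integration.integrable_add integrable_mult_right ik ii)
  fix z :: 'a
  have k: "0 <= ?k z" by (rule landau_kernel_nonneg)
  show "\<bar>?f z\<bar> <= A * ?k z + B * (?k z * indicator {z. \<eta> <= norm z} z)"
  proof (cases "norm z < \<eta>")
   case True
   thus ?thesis using mult_right_mono[OF near[OF True] k] k by (simp add: abs_mult)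
  next
   case False
   hence "indicator {z. \<eta> <= norm z} z = (1::real)" by simp
   moreover have "0 <= A * ?k z" using AB k by simp
   ultimately show ?thesis using mult_right_mono[OF far[of z] k] k by (simp add: abs_mult)
  qed
 qed
 also have "... = A * ?m + B * (landau_tail TYPE('a) R N \<eta> * ?m)"
  using m ik ii by (simp add: landau_mass_def[symmetric] landau_tail_def Bochner_Integration.integral_add)
 finally have "\<bar>landau_smoothing R N g y - landau_smoothing R N g x - c\<bar> * ?m
   <= (A + B * landau_tail TYPE('a) R N \<eta>) * ?m"
  by (simp only: abs_mult abs_of_pos[OF m] distrib_right mult.assoc)
 thus ?thesis using m by (simp add: mult_le_cancel_right)
qed

lemma landau_smoothing_has_derivative:
 "(landau_smoothing R N g has_derivative fderiv (landau_smoothing R N g) x) (at x)"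
 using smooth_on_has_derivative[OF smooth_landau_smoothing] by simp

lemma ball_in_half:
 assumes "norm (x::'a) < R / 2" "y : ball x (R / 2 - norm x)"
 shows "norm y < R / 2"
 using assms(2) norm_triangle_sub[of y x] by (simp add: dist_norm norm_minus_commute)

lemma landau_smoothing_lipschitz:
 assumes x: "norm x < R / 2" and y: "norm y < R / 2"
 shows "\<bar>landau_smoothing R N g y - landau_smoothing R N g x\<bar> <= L * norm (y - x)"
proof (rule field_le_epsilon)
 fix e :: real assume e: "0 < e"
 have le: "\<bar>g (y + z) - g (x + z) - 0\<bar> <= L * norm (y - x)" for z using lip[of "y + z" "x + z"] by simp
 \<comment> \<open>The radius \<open>R + 1\<close> lies beyond the support of the kernel, so there
   is no tail and the smoothing inherits the Lipschitz constant \<open>L\<close> exactly.\<close>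
 have "landau_tail TYPE('a) R N (R + 1) = 0"
 proof -
  have "(%z::'a. landau_kernel R N z * indicator {z. R + 1 <= norm z} z) = (%z. 0)"
  proof (rule ext)
   fix z :: 'a
   show "landau_kernel R N z * indicator {z. R + 1 <= norm z} z = 0"
   proof (cases "R + 1 <= norm z")
    case True
    thus ?thesis using landau_kernel_zero[OF R, of z N] by simp
   qed simp
  qed
  thus ?thesis by (simp add: landau_tail_def)
 qed
 thus "\<bar>landau_smoothing R N g y - landau_smoothing R N g x\<bar> <= L * norm (y - x) + e"
  using landau_smoothing_remainder[OF x y le le, where \<eta> = "R + 1" and N = N] L e by simp
qed

lemma norm_grad_landau_smoothing:
 assumes x: "norm x < R / 2"
 shows "norm (grad (landau_smoothing R N g) x) <= L"
proof -
 have "norm (grad (landau_smoothing R N g) x - 0) <= L"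
  by (rule grad_diff_norm_le[OF landau_smoothing_has_derivative, of "R / 2 - norm x"])
   (use x landau_smoothing_lipschitz[OF x ball_in_half[OF x]] in auto)
 thus ?thesis by simp
qed

lemma landau_smoothing_tendsto:
 assumes x: "norm x < R / 2"
 shows "(%N. landau_smoothing R N g x) \<longlonglongrightarrow> g x"
proof (rule LIMSEQ_I)
 fix e :: real assume e: "0 < e"
 \<comment> \<open>Makes \<open>L * \<eta>\<close> at most \<open>e / 2\<close>; adding 1 to
   \<open>L\<close> covers the case \<open>L = 0\<close>.\<close>
 define \<eta> where "\<eta> = min (R / 2) (e / (2 * (L + 1)))"
 have \<eta>: "0 < \<eta>" "\<eta> < R" using R e L by (auto simp: \<eta>_def)
 have L\<eta>: "L * \<eta> <= e / 2"
 proof -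
  have "L * \<eta> <= (L + 1) * (e / (2 * (L + 1)))" using L e \<eta> by (intro mult_mono) (auto simp: \<eta>_def)
  also have "... = e / 2" using L by (simp add: field_simps)
  finally show ?thesis .
 qed
 define B where "B = 2 * L * R"
 have B: "0 <= B" using L R by (simp add: B_def)
 have lim: "(%N. B * landau_tail TYPE('a) R N \<eta>) \<longlonglongrightarrow> 0"
  using tendsto_mult_right_zero[OF landau_tail_tendsto_0[OF \<eta>, where 'a = 'a]] .
 obtain N0 where N0: "!!N. N \<ge> N0 ==> \<bar>B * landau_tail TYPE('a) R N \<eta>\<bar> < e / 2"
  using LIMSEQ_D[OF lim, of "e / 2"] e by auto
 have far: "\<bar>g (x + z) - g x\<bar> <= B" for z
 proof -
  obtain b :: 'a where b: "b : Basis" using nonempty_Basis by blast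
  have gb: "\<bar>g w\<bar> <= L * R" for w
  proof (cases "R / 2 <= norm w")
   case True
   thus ?thesis using supp L R by simp
  next
   case False
   let ?w = "(R / 2) *\<^sub>R b"
   have "norm ?w = R / 2" using b R by simp
   hence "g ?w = 0" "norm (w - ?w) <= R"
    using supp[of ?w] False norm_triangle_ineq4[of w ?w] by auto
   hence "\<bar>g w\<bar> <= L * norm (w - ?w)" using lip[of w ?w] by simp
   also have "... <= L * R" using \<open>norm (w - ?w) <= R\<close> L by (intro mult_left_mono)
   finally show ?thesis .
  qed
  show ?thesis using gb[of "x + z"] gb[of x] by (simp add: B_def)
 qed
 show "EX N0. ALL N>=N0. norm (landau_smoothing R N g x - g x) < e"
 proof (intro exI allI impI)
  fix N assume "N0 <= N"
  let ?m = "landau_mass TYPE('a) R N" and ?k = "landau_kernel R N :: 'a => real"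
  have m: "0 < ?m" by (rule landau_mass_pos[OF R])
  note ik = integrable_landau_kernel[OF R, of N, where 'a = 'a] and ig = integrable_translate_landau[of x N]
  have ii: "integrable lborel (%z. ?k z * indicator {z. \<eta> <= norm z} z)"
   by (rule integrable_real_mult_indicator) (auto intro: ik)
  let ?f = "%z. (g (x + z) - g x) * ?k z"
  have if': "integrable lborel ?f"
   unfolding left_diff_distrib by (intro Bochner_Integration.integrable_diff ig integrable_mult_right ik)
  have "(landau_smoothing R N g x - g x) * ?m = (\<integral>z. ?f z \<partial>lborel)"
  proof -
   have "(\<integral>z. ?f z \<partial>lborel) = (\<integral>z. g (x + z) * ?k z \<partial>lborel) - g x * ?m"
    unfolding left_diff_distrib landau_mass_def using ig ik
    by (simp add: Bochner_Integration.integral_diff)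
   thus ?thesis
    unfolding landau_smoothing_convolution[OF x]
    using m by (simp only:) (simp add: left_diff_distrib)
  qed
  also have "\<bar>...\<bar> <= (\<integral>z. \<bar>?f z\<bar> \<partial>lborel)" by (rule integral_abs_bound)
  also have "... <= (\<integral>z. (L * \<eta>) * ?k z + B * (?k z * indicator {z. \<eta> <= norm z} z) \<partial>lborel)"
  proof (rule integral_mono)
   show "integrable lborel (%z. \<bar>?f z\<bar>)" using if' by (rule integrable_abs)
   show "integrable lborel (%z. (L * \<eta>) * ?k z + B * (?k z * indicator {z. \<eta> <= norm z} z))"
    by (intro Bochner_Integration.integrable_add integrable_mult_right ik ii)
   fix z :: 'a
   have k: "0 <= ?k z" by (rule landau_kernel_nonneg)
   show "\<bar>?f z\<bar> <= (L * \<eta>) * ?k z + B * (?k z * indicator {z. \<eta> <= norm z} z)"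
   proof (cases "norm z < \<eta>")
    case True
    have "\<bar>g (x + z) - g x\<bar> <= L * norm z" using lip[of "x + z" x] by simp
    also have "... <= L * \<eta>" using True L by (intro mult_left_mono) auto
    finally have "\<bar>g (x + z) - g x\<bar> * ?k z <= (L * \<eta>) * ?k z" using k by (rule mult_right_mono)
    moreover have "0 <= B * (?k z * indicator {z. \<eta> <= norm z} z)" using B k by simp
    ultimately show ?thesis using k by (simp add: abs_mult)
   next
    case False
    hence "indicator {z. \<eta> <= norm z} z = (1::real)" by simp
    moreover have "0 <= (L * \<eta>) * ?k z" using L \<eta> k by simp
    ultimately show ?thesis using mult_right_mono[OF far[of z] k] k by (simp add: abs_mult)
   qed
  qed
  also have "... = (L * \<eta>) * ?m + B * (landau_tail TYPE('a) R N \<eta> * ?m)"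
   using m ik ii by (simp add: landau_mass_def[symmetric] landau_tail_def Bochner_Integration.integral_add)
  finally have "\<bar>landau_smoothing R N g x - g x\<bar> * ?m <= (L * \<eta> + B * landau_tail TYPE('a) R N \<eta>) * ?m"
   by (simp only: abs_mult abs_of_pos[OF m] distrib_right mult.assoc)
  hence "\<bar>landau_smoothing R N g x - g x\<bar> <= L * \<eta> + B * landau_tail TYPE('a) R N \<eta>"
   using m by (simp add: mult_le_cancel_right)
  thus "norm (landau_smoothing R N g x - g x) < e" using L\<eta> N0[OF \<open>N0 <= N\<close>] by simp
 qed
qed

text \<open>Strict differentiability is what the averaging calls for: it compares \<open>g\<close>
  at \<open>y + z\<close> and at \<open>x + z\<close> for all small \<open>z\<close>, so neither
  argument is the point \<open>x\<close> itself.\<close>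

lemma grad_landau_smoothing_tendsto:
 assumes x: "norm x < R / 2"
  and strict: "!!e. 0 < e ==> EX r>0. ALL y:ball x r. ALL z:ball x r. \<bar>g y - g z - D \<bullet> (y - z)\<bar> <= e * norm (y - z)"
 shows "(%N. grad (landau_smoothing R N g) x) \<longlonglongrightarrow> D"
proof (rule LIMSEQ_I)
 fix e :: real assume e: "0 < e"
 obtain r where r: "0 < r" "!!y z. y : ball x r ==> z : ball x r ==> \<bar>g y - g z - D \<bullet> (y - z)\<bar> <= (e/2) * norm (y - z)"
  using strict[of "e/2"] e by auto
 define \<eta> where "\<eta> = min (R / 2) (r / 2)"
 have \<eta>: "0 < \<eta>" "\<eta> < R" "\<eta> <= r / 2" using R r by (auto simp: \<eta>_def)
 define B where "B = L + norm D"
 have B: "0 <= B" using L by (simp add: B_def)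
 have lim: "(%N. B * landau_tail TYPE('a) R N \<eta>) \<longlonglongrightarrow> 0"
  using tendsto_mult_right_zero[OF landau_tail_tendsto_0[OF \<eta>(1,2), where 'a = 'a]] .
 obtain N0 where N0: "!!N. N \<ge> N0 ==> \<bar>B * landau_tail TYPE('a) R N \<eta>\<bar> < e / 2"
  using LIMSEQ_D[OF lim, of "e / 2"] e by auto
 show "EX N0. ALL N>=N0. norm (grad (landau_smoothing R N g) x - D) < e"
 proof (intro exI allI impI)
  fix N assume N: "N0 <= N"
  have "norm (grad (landau_smoothing R N g) x - D) <= e / 2 + B * landau_tail TYPE('a) R N \<eta>"
  proof (rule grad_diff_norm_le[OF landau_smoothing_has_derivative, of "min \<eta> (R / 2 - norm x)"])
   show "0 < min \<eta> (R / 2 - norm x)" using \<eta> x by simp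
   fix y assume y: "y : ball x (min \<eta> (R / 2 - norm x))"
   have "\<bar>landau_smoothing R N g y - landau_smoothing R N g x - D \<bullet> (y - x)\<bar>
     <= e / 2 * norm (y - x) + B * norm (y - x) * landau_tail TYPE('a) R N \<eta>"
   proof (rule landau_smoothing_remainder[OF x])
    show "norm y < R / 2" using ball_in_half[OF x] y by simp
    fix z :: 'a
    show "\<bar>g (y + z) - g (x + z) - D \<bullet> (y - x)\<bar> <= B * norm (y - x)"
     using lip[of "y + z" "x + z"] Cauchy_Schwarz_ineq2[of D "y - x"] by (simp add: B_def algebra_simps)
    assume z: "norm z < \<eta>"
    have "x + z : ball x r" using z \<eta> r by (simp add: dist_norm)
    moreover have "y + z : ball x r"
    proof -
     have "norm (x - (y + z)) <= norm (x - y) + norm z"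
      using norm_triangle_ineq4[of "x - y" z] by (simp add: diff_diff_eq)
     thus ?thesis using y z \<eta> by (simp add: dist_norm)
    qed
    ultimately show "\<bar>g (y + z) - g (x + z) - D \<bullet> (y - x)\<bar> <= e / 2 * norm (y - x)"
     using r(2)[of "y + z" "x + z"] by simp
   qed (use e B in auto)
   thus "\<bar>landau_smoothing R N g y - landau_smoothing R N g x - D \<bullet> (y - x)\<bar>
     <= (e / 2 + B * landau_tail TYPE('a) R N \<eta>) * norm (y - x)" by (simp add: algebra_simps)
  qed
  thus "norm (grad (landau_smoothing R N g) x - D) < e" using N0[OF N] by simp
 qed
qed

end

section \<open>Weak gradients\<close>

definition tang :: "'a::real_inner => 'a => 'a" where
 "tang m w = w - (w \<bullet> m) *\<^sub>R m"

lemma tangential_grad_tang: "tangential_grad n f x = tang (n x) (grad f x)"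
 by (simp add: tangential_grad_def tang_def)

lemma linear_tang: "linear (tang m)"
 by (rule linearI) (simp_all add: tang_def inner_add_left algebra_simps)

lemmas tang_simps = linear_add[OF linear_tang] linear_diff[OF linear_tang] linear_scale[OF linear_tang]

lemma tang_inner: "norm m = 1 ==> tang m w \<bullet> m = 0"
 by (simp add: tang_def inner_diff_left norm_eq_1)

lemma norm_tang_sq: "norm m = 1 ==> (norm (tang m w))^2 = (norm w)^2 - (w \<bullet> m)^2"
 unfolding power2_norm_eq_inner
 by (simp add: tang_def inner_diff_left inner_diff_right norm_eq_1 inner_commute power2_eq_square)

lemma norm_tang_le:
 assumes "norm m <= 1"
 shows "norm (tang m w) <= norm w"
proof -
 have "(norm (tang m w))^2 = (norm w)^2 - 2 * (w \<bullet> m)^2 + (w \<bullet> m)^2 * (norm m)^2"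
  unfolding power2_norm_eq_inner
  by (simp add: tang_def inner_diff_left inner_diff_right inner_commute power2_eq_square algebra_simps)
 also have "... <= (norm w)^2 - 2 * (w \<bullet> m)^2 + (w \<bullet> m)^2 * 1"
  using assms by (intro add_left_mono mult_left_mono) (auto simp: power_le_one)
 finally have "(norm (tang m w))^2 <= (norm w)^2" using zero_le_power2[of "w \<bullet> m"] by linarith
 thus ?thesis by (rule power2_le_imp_le) simp
qed

lemma tang_minus: "tang (- m) w = tang m w"
 by (simp add: tang_def)

text \<open>Extended-valued, so that convergence to zero can be stated before any integrability is
  known.\<close>

definition L2sq :: "'a measure => ('a => 'b::real_normed_vector) => ennreal" where
 "L2sq M f = (\<integral>\<^sup>+x. ennreal ((norm (f x))^2) \<partial>M)"

lemma has_weak_grad_altdef: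
 "has_weak_grad M n u g \<longleftrightarrow>
   u : borel_measurable M & integrable M (%x. (u x)^2) \<and>
   g : borel_measurable M & integrable M (%x. (norm (g x))^2) \<and>
   (EX f. (ALL m. smooth_on (f m) UNIV) \<and>
    (%m::nat. L2sq M (%x. f m x - u x)) \<longlonglongrightarrow> 0 \<and>
    (%m. L2sq M (%x. tang (n x) (grad (f m) x) - g x)) \<longlonglongrightarrow> 0)"
 by (simp add: has_weak_grad_def L2sq_def tangential_grad_tang)

lemma L2sq_add_le:
 fixes f g :: "'a => 'b::{real_normed_vector, second_countable_topology}"
 assumes [measurable]: "f : borel_measurable M" "g : borel_measurable M"
 shows "L2sq M (%x. f x + g x) <= 2 * L2sq M f + 2 * L2sq M g"
proof -
 have "L2sq M (%x. f x + g x) <= (\<integral>\<^sup>+x. 2 * ennreal ((norm (f x))^2) + 2 * ennreal ((norm (g x))^2) \<partial>M)"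
  unfolding L2sq_def
 proof (rule nn_integral_mono)
  fix x
  have "(norm (f x + g x))^2 <= (norm (f x) + norm (g x))^2"
   by (intro power_mono norm_triangle_ineq) simp
  also have "... <= 2 * (norm (f x))^2 + 2 * (norm (g x))^2"
   using sum_squares_bound[of "norm (f x)" "norm (g x)"] by (simp add: power2_sum)
  finally have "ennreal ((norm (f x + g x))^2) <= ennreal (2 * (norm (f x))^2 + 2 * (norm (g x))^2)"
   by (rule ennreal_leI)
  thus "ennreal ((norm (f x + g x))^2) <= 2 * ennreal ((norm (f x))^2) + 2 * ennreal ((norm (g x))^2)"
   by (simp add: ennreal_plus ennreal_mult)
 qed
 also have "... = 2 * L2sq M f + 2 * L2sq M g"
  unfolding L2sq_def by (simp add: nn_integral_add nn_integral_cmult)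
 finally show ?thesis .
qed

lemma L2sq_scaleR: 
 assumes [measurable]: "(f :: 'a => 'b::{real_normed_vector, second_countable_topology}) : borel_measurable M"
 shows "L2sq M (%x. c *\<^sub>R f x) = ennreal (c^2) * L2sq M f"
 unfolding L2sq_def by (simp add: power_mult_distrib ennreal_mult nn_integral_cmult)

lemma L2sq_add_tendsto_0:
 fixes f g :: "nat => 'a => 'b::{real_normed_vector, second_countable_topology}"
 assumes "!!m. f m : borel_measurable M" "!!m. g m : borel_measurable M"
  and "(%m. L2sq M (f m)) \<longlonglongrightarrow> 0" "(%m. L2sq M (g m)) \<longlonglongrightarrow> 0"
 shows "(%m. L2sq M (%x. f m x + g m x)) \<longlonglongrightarrow> 0"
proof (rule tendsto_sandwich[OF _ _ tendsto_const])
 have "(%m. 2 * L2sq M (f m) + 2 * L2sq M (g m)) \<longlonglongrightarrow> 2 * 0 + 2 * 0"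
  using assms by (intro tendsto_add ennreal_tendsto_cmult) auto
 thus "(%m. 2 * L2sq M (f m) + 2 * L2sq M (g m)) \<longlonglongrightarrow> 0" by simp
 show "\<forall>\<^sub>F m in sequentially. L2sq M (%x. f m x + g m x) <= 2 * L2sq M (f m) + 2 * L2sq M (g m)"
  using assms by (intro always_eventually allI L2sq_add_le)
qed simp

lemma integrable_sq_iff:
 fixes f :: "'a => 'b::{real_normed_vector, second_countable_topology}"
 assumes [measurable]: "f : borel_measurable M"
 shows "integrable M (%x. (norm (f x))^2) \<longleftrightarrow> L2sq M f < \<infinity>"
 unfolding integrable_iff_bounded L2sq_def by simp

lemma integrable_sq_add:
 fixes f g :: "'a => 'b::{real_normed_vector, second_countable_topology}"
 assumes [measurable]: "f : borel_measurable M" "g : borel_measurable M"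
  and "integrable M (%x. (norm (f x))^2)" "integrable M (%x. (norm (g x))^2)"
 shows "integrable M (%x. (norm (f x + g x))^2)"
proof -
 have "L2sq M f < \<infinity>" "L2sq M g < \<infinity>" using assms by (simp_all add: integrable_sq_iff)
 hence "2 * L2sq M f + 2 * L2sq M g < \<infinity>" by (simp add: ennreal_mult_less_top)
 hence "L2sq M (%x. f x + g x) < \<infinity>"
  using L2sq_add_le[of f M g] assms(1,2) by (meson le_less_trans)
 thus ?thesis using assms(1,2) by (subst integrable_sq_iff) auto
qed

lemma integrable_inner_sq:
 fixes f g :: "'a => 'b::euclidean_space"
 assumes [measurable]: "f : borel_measurable M" "g : borel_measurable M"
  and "integrable M (%x. (norm (f x))^2)" "integrable M (%x. (norm (g x))^2)"
 shows "integrable M (%x. f x \<bullet> g x)"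
proof (rule Bochner_Integration.integrable_bound)
 show "integrable M (%x. (norm (f x))^2 + (norm (g x))^2)" using assms by simp
 show "AE x in M. norm (f x \<bullet> g x) <= norm ((norm (f x))^2 + (norm (g x))^2)"
 proof (rule AE_I2)
  fix x
  have "\<bar>f x \<bullet> g x\<bar> <= norm (f x) * norm (g x)" by (rule Cauchy_Schwarz_ineq2)
  also have "... <= (norm (f x))^2 + (norm (g x))^2"
   using sum_squares_bound[of "norm (f x)" "norm (g x)"]
    mult_nonneg_nonneg[OF norm_ge_zero norm_ge_zero, of "f x" "g x"] by linarith
  finally show "norm (f x \<bullet> g x) <= norm ((norm (f x))^2 + (norm (g x))^2)" by simp
 qed
qed simp

lemma smooth_on_UNIV_has_derivative:
 "smooth_on f UNIV ==> (f has_derivative fderiv f x) (at x)"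
 using smooth_on_has_derivative by blast

lemma smooth_continuous_grad:
 fixes f :: "'a::euclidean_space => real"
 assumes "smooth_on f UNIV"
 shows "continuous_on UNIV (grad f)"
proof -
 have "grad f = (%x. \<Sum>b\<in>Basis. fderiv f x b *\<^sub>R b)"
  using differentiable_grad(1)[OF smooth_on_UNIV_has_derivative[OF assms]] by (rule ext)
 thus ?thesis
  using smooth_on_continuous_frechet_derivative[OF assms] by (simp add: continuous_intros)
qed

lemma grad_add_scale:
 fixes f g :: "'a::euclidean_space => real"
 assumes f: "smooth_on f UNIV" and g: "smooth_on g UNIV"
 shows "grad (%x. f x + c * g x) x = grad f x + c *\<^sub>R grad g x"
proof -
 note df = smooth_on_UNIV_has_derivative[OF f, of x] and dg = smooth_on_UNIV_has_derivative[OF g, of x]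
 have "((%x. f x + c * g x) has_derivative
   (%v. fderiv f x v + c * fderiv g x v)) (at x)"
  by (intro has_derivative_add df has_derivative_mult_right dg)
 thus ?thesis
  by (simp add: differentiable_grad(1)[OF df] differentiable_grad(1)[OF dg] differentiable_grad(1)
    scaleR_add_left sum.distrib scaleR_sum_right)
qed

text \<open>The norm of \<open>n\<close> is bounded by 1 and not fixed to 1, because the measurable
  normal field used on the approximate surface vanishes on the boundaries of the elements.\<close>

locale surface_calculus =
 fixes S :: "('d::finite) ambient set" and M :: "'d ambient measure" and n :: "'d ambient => 'd ambient"
 assumes surf: "surface_measure S M" and cpt: "compact S" and fin: "finite_measure M"
  and n_measurable: "n : borel_measurable M" and n_le: "!!x. x : S ==> norm (n x) <= 1"
begin

lemma space_M: "space M = S"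
 using surface_measureD(2)[OF surf] .

lemma continuous_measurable: "continuous_on UNIV f ==> f : borel_measurable M"
 using continuous_on_surface_measurable[OF surf] continuous_on_subset by blast

lemma smooth_measurable: "smooth_on f UNIV ==> f : borel_measurable M"
 using smooth_on_continuous_on continuous_measurable by blast

lemma grad_measurable:
 fixes f :: "'d ambient => real"
 shows "smooth_on f UNIV ==> grad f : borel_measurable M"
 using smooth_continuous_grad continuous_measurable by blast

lemma tang_measurable:
 assumes [measurable]: "f : borel_measurable M"
 shows "(%x. tang (n x) (f x)) : borel_measurable M"
 using n_measurable unfolding tang_def by measurable

lemmas tang_grad_measurable = tang_measurable[OF grad_measurable]

lemma has_weak_grad_add_scale:
 assumes u: "has_weak_grad M n u g" and v: "has_weak_grad M n v g'"
 shows "has_weak_grad M n (%x. u x + c * v x) (%x. g x + c *\<^sub>R g' x)"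
proof -
 obtain f where f: "!!m. smooth_on (f m) UNIV" "(%m::nat. L2sq M (%x. f m x - u x)) \<longlonglongrightarrow> 0"
  "(%m. L2sq M (%x. tang (n x) (grad (f m) x) - g x)) \<longlonglongrightarrow> 0"
  using u unfolding has_weak_grad_altdef by blast
 obtain f' where f': "!!m. smooth_on (f' m) UNIV" "(%m::nat. L2sq M (%x. f' m x - v x)) \<longlonglongrightarrow> 0"
  "(%m. L2sq M (%x. tang (n x) (grad (f' m) x) - g' x)) \<longlonglongrightarrow> 0"
  using v unfolding has_weak_grad_altdef by blast
 have [measurable]: "u : borel_measurable M" "v : borel_measurable M" "g : borel_measurable M" "g' : borel_measurable M"
  using u v by (auto simp: has_weak_grad_altdef)
 have iu: "integrable M (%x. (norm (u x))^2)" "integrable M (%x. (norm (c * v x))^2)"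
  "integrable M (%x. (norm (g x))^2)" "integrable M (%x. (norm (c *\<^sub>R g' x))^2)"
  using u v by (auto simp: has_weak_grad_altdef power_mult_distrib)
 note [measurable] = smooth_measurable[OF f(1)] smooth_measurable[OF f'(1)]
  tang_grad_measurable[OF f(1)] tang_grad_measurable[OF f'(1)]
 have scale: "(%m. L2sq M (%x. c *\<^sub>R F m x)) \<longlonglongrightarrow> 0"
  if "!!m. F m : borel_measurable M" "(%m. L2sq M (F m)) \<longlonglongrightarrow> 0"
  for F :: "nat => 'd ambient => 'b::{real_normed_vector, second_countable_topology}"
 proof -
  have "(%m. ennreal (c^2) * L2sq M (F m)) \<longlonglongrightarrow> ennreal (c^2) * 0"
   by (intro ennreal_tendsto_cmult that) simp
  thus ?thesis by (simp add: L2sq_scaleR[OF that(1)])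
 qed
 show ?thesis
  unfolding has_weak_grad_altdef
 proof (intro conjI exI[of _ "%m x. f m x + c * f' m x"] allI)
  show "integrable M (%x. (u x + c * v x)^2)"
   using integrable_sq_add[OF _ _ iu(1,2)] by simp
  show "integrable M (%x. (norm (g x + c *\<^sub>R g' x))^2)"
   using integrable_sq_add[OF _ _ iu(3,4)] by simp
  show "smooth_on (%x. f m x + c * f' m x) UNIV" for m
   by (intro smooth_on_add smooth_on_mult smooth_on_const f f' open_UNIV)
  have "(%m. L2sq M (%x. (f m x - u x) + c *\<^sub>R (f' m x - v x))) \<longlonglongrightarrow> 0"
   by (rule L2sq_add_tendsto_0[OF _ _ f(2) scale[OF _ f'(2)]]) measurable
  thus "(%m. L2sq M (%x. f m x + c * f' m x - (u x + c * v x))) \<longlonglongrightarrow> 0"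
   by (simp add: algebra_simps)
  have "(%m. L2sq M (%x. (tang (n x) (grad (f m) x) - g x) + c *\<^sub>R (tang (n x) (grad (f' m) x) - g' x))) \<longlonglongrightarrow> 0"
   by (rule L2sq_add_tendsto_0[OF _ _ f(3) scale[OF _ f'(3)]]) measurable
  thus "(%m. L2sq M (%x. tang (n x) (grad (%x. f m x + c * f' m x) x) - (g x + c *\<^sub>R g' x))) \<longlonglongrightarrow> 0"
   by (simp add: grad_add_scale[OF f(1) f'(1)] tang_simps algebra_simps)
 qed measurable
qed

lemma has_weak_grad_const: "has_weak_grad M n (%x. c) (%x. 0)"
proof -
 have "grad (%x. c) x = (0::'d ambient)" for x :: "'d ambient"
  by (rule grad_eqI) (simp add: gderiv_def)
 thus ?thesis
  unfolding has_weak_grad_altdef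
  by (intro conjI exI[of _ "%m x. c"])
   (auto simp: finite_measure.integrable_const[OF fin] smooth_on_const L2sq_def tang_def)
qed

text \<open>A diagonal sequence: for each \<open>m\<close> a smooth function is chosen within
  \<open>1 / (m + 1)\<close> of the pair \<open>u m\<close>, \<open>g m\<close>.\<close>

lemma has_weak_grad_limit:
 assumes um: "!!m::nat. has_weak_grad M n (u m) (g m)"
  and [measurable]: "v : borel_measurable M" "w : borel_measurable M"
  and int: "integrable M (%x. (v x)^2)" "integrable M (%x. (norm (w x))^2)"
  and lim: "(%m. L2sq M (%x. u m x - v x)) \<longlonglongrightarrow> 0" "(%m. L2sq M (%x. g m x - w x)) \<longlonglongrightarrow> 0"
 shows "has_weak_grad M n v w"
proof -
 have [measurable]: "u m : borel_measurable M" "g m : borel_measurable M" for m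
  using um[of m] by (auto simp: has_weak_grad_altdef)
 define P where "P m f \<longleftrightarrow> smooth_on f UNIV & L2sq M (%x. f x - u m x) < ennreal (1 / real (Suc m)) \<and>
   L2sq M (%x. tang (n x) (grad f x) - g m x) < ennreal (1 / real (Suc m))" for m f
 have "EX f. P m f" for m
  unfolding P_def
 proof -
  obtain f where f: "!!k. smooth_on (f k) UNIV" "(%k::nat. L2sq M (%x. f k x - u m x)) \<longlonglongrightarrow> 0"
   "(%k. L2sq M (%x. tang (n x) (grad (f k) x) - g m x)) \<longlonglongrightarrow> 0"
   using um[of m] unfolding has_weak_grad_altdef by blast
  have "0 < ennreal (1 / real (Suc m))" by simp
  hence "\<forall>\<^sub>F k in sequentially. L2sq M (%x. f k x - u m x) < ennreal (1 / real (Suc m))"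
   "\<forall>\<^sub>F k in sequentially. L2sq M (%x. tang (n x) (grad (f k) x) - g m x) < ennreal (1 / real (Suc m))"
   using order_tendstoD(2)[OF f(2)] order_tendstoD(2)[OF f(3)] by blast+
  hence "\<forall>\<^sub>F k in sequentially. L2sq M (%x. f k x - u m x) < ennreal (1 / real (Suc m)) \<and>
    L2sq M (%x. tang (n x) (grad (f k) x) - g m x) < ennreal (1 / real (Suc m))"
   by (rule eventually_conj)
  then obtain k where "L2sq M (%x. f k x - u m x) < ennreal (1 / real (Suc m))"
    "L2sq M (%x. tang (n x) (grad (f k) x) - g m x) < ennreal (1 / real (Suc m))"
   using eventually_happens' sequentially_bot by blast
  thus "EX f. smooth_on f UNIV & L2sq M (%x. f x - u m x) < ennreal (1 / real (Suc m)) \<and>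
   L2sq M (%x. tang (n x) (grad f x) - g m x) < ennreal (1 / real (Suc m))" using f(1) by blast
 qed
 hence "EX f. ALL m. P m (f m)" by (intro choice allI)
 then obtain f where f: "!!m. smooth_on (f m) UNIV"
  "!!m. L2sq M (%x. f m x - u m x) < ennreal (1 / real (Suc m))"
  "!!m. L2sq M (%x. tang (n x) (grad (f m) x) - g m x) < ennreal (1 / real (Suc m))"
  unfolding P_def by blast
 note [measurable] = smooth_measurable[OF f(1)] tang_grad_measurable[OF f(1)]
 have "(%m. 1 / real (Suc m)) \<longlonglongrightarrow> 0" using LIMSEQ_inverse_real_of_nat by (simp add: inverse_eq_divide)
 hence z: "(%m. ennreal (1 / real (Suc m))) \<longlonglongrightarrow> 0" using tendsto_ennrealI by fastforce
 have l1: "(%m. L2sq M (%x. f m x - u m x)) \<longlonglongrightarrow> 0"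
  by (rule tendsto_sandwich[OF _ _ tendsto_const z]) (use f(2) in \<open>auto intro: always_eventually less_imp_le\<close>)
 have l2: "(%m. L2sq M (%x. tang (n x) (grad (f m) x) - g m x)) \<longlonglongrightarrow> 0"
  by (rule tendsto_sandwich[OF _ _ tendsto_const z]) (use f(3) in \<open>auto intro: always_eventually less_imp_le\<close>)
 show ?thesis
  unfolding has_weak_grad_altdef
 proof (intro conjI exI[of _ f] allI)
  have "(%m. L2sq M (%x. (f m x - u m x) + (u m x - v x))) \<longlonglongrightarrow> 0"
   by (rule L2sq_add_tendsto_0[OF _ _ l1 lim(1)]) measurable
  thus "(%m. L2sq M (%x. f m x - v x)) \<longlonglongrightarrow> 0" by simp
  have "(%m. L2sq M (%x. (tang (n x) (grad (f m) x) - g m x) + (g m x - w x))) \<longlonglongrightarrow> 0"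
   by (rule L2sq_add_tendsto_0[OF _ _ l2 lim(2)]) measurable
  thus "(%m. L2sq M (%x. tang (n x) (grad (f m) x) - w x)) \<longlonglongrightarrow> 0" by simp
 qed (use f int in measurable)
qed

text \<open>The bridge from Lipschitz functions to the closure of the smooth ones: the gradients of
  the Landau smoothings are bounded by \<open>L\<close> and converge at every point of strict
  differentiability, and dominated convergence on the finite measure does the rest.\<close>

lemma has_weak_grad_lipschitz:
 assumes lip: "!!x y. \<bar>g x - g y\<bar> <= L * norm (x - y)" and L: "0 <= L"
  and supp: "!!x. r <= norm x ==> g x = 0"
  and D[measurable]: "D : borel_measurable M"
  and strict: "AE x in M. ALL e>0. EX r>0. ALL y:ball x r. ALL z:ball x r. \<bar>g y - g z - D x \<bullet> (y - z)\<bar> <= e * norm (y - z)"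
 shows "has_weak_grad M n g (%x. tang (n x) (D x))"
proof -
 obtain b where b: "!!x. x : S ==> norm x <= b"
  using compact_imp_bounded[OF cpt] unfolding bounded_iff by blast
 define R where "R = 2 * (\<bar>b\<bar> + \<bar>r\<bar> + 1)"
 have R: "0 < R" by (simp add: R_def add_nonneg_pos)
 have suppR: "g x = 0" if "R / 2 <= norm x" for x using supp that by (auto simp: R_def)
 have SR: "norm x < R / 2" if "x : S" for x using b[OF that] by (simp add: R_def)
 define f where "f m = landau_smoothing R m g" for m
 note ctx = R suppR lip L
 have sm: "smooth_on (f m) UNIV" for m unfolding f_def by (rule smooth_landau_smoothing[OF ctx])
 have gc: "continuous_on UNIV g" by (rule lipschitz_cont[OF ctx])
 note [measurable] = smooth_measurable[OF sm] tang_grad_measurable[OF sm] continuous_measurable[OF gc]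
  tang_measurable[OF D]
 have lim0: "(%m. f m x) \<longlonglongrightarrow> g x" if "x : S" for x
  unfolding f_def by (rule landau_smoothing_tendsto[OF ctx SR[OF that]])
 have gradle: "norm (grad (f m) x) <= L" if "x : S" for x m
  unfolding f_def by (rule norm_grad_landau_smoothing[OF ctx SR[OF that]])
 have lim1: "AE x in M. (%m. grad (f m) x) \<longlonglongrightarrow> D x"
  using strict
 proof (rule AE_mp, intro AE_I2 impI)
  fix x assume x: "x : space M" and
   st: "ALL e>0. EX r>0. ALL y:ball x r. ALL z:ball x r. \<bar>g y - g z - D x \<bullet> (y - z)\<bar> <= e * norm (y - z)"
  show "(%m. grad (f m) x) \<longlonglongrightarrow> D x"
   unfolding f_def by (rule grad_landau_smoothing_tendsto[OF ctx SR]) (use x st space_M in auto)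
 qed
 have DL: "AE x in M. norm (D x) <= L"
  using lim1
 proof (rule AE_mp, intro AE_I2 impI)
  fix x assume x: "x : space M" and l: "(%m. grad (f m) x) \<longlonglongrightarrow> D x"
  show "norm (D x) <= L"
   by (rule tendsto_upperbound[OF tendsto_norm[OF l]]) (use gradle x space_M in auto)
 qed
 have R0: "norm (0::'d ambient) < R / 2" using R by simp
 \<comment> \<open>A bound uniform in \<open>m\<close>: on the half ball each \<open>f m\<close> is
   Lipschitz with constant \<open>L\<close>, and the values at the origin converge.\<close>
 obtain B where B: "0 <= B" "!!x m. x : S ==> \<bar>f m x - g x\<bar> <= B"
 proof -
  have far: "\<bar>f m x - f m 0\<bar> <= L * \<bar>b\<bar>" if "x : S" for x m
  proof -
   have "\<bar>landau_smoothing R m g x - landau_smoothing R m g 0\<bar> <= L * norm (x - 0)"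
    by (rule landau_smoothing_lipschitz[OF ctx R0 SR[OF that]])
   also have "... <= L * \<bar>b\<bar>" using L b[OF that] by (intro mult_left_mono) auto
   finally show ?thesis by (simp add: f_def)
  qed
  have "(%m. f m 0) \<longlonglongrightarrow> g 0" unfolding f_def by (rule landau_smoothing_tendsto[OF ctx R0])
  hence "Bseq (%m. f m 0)" using convergent_imp_Bseq convergentI by blast
  then obtain B0 where B0: "0 < B0" "!!m. \<bar>f m 0\<bar> <= B0" unfolding Bseq_def by auto
  have "\<bar>g x\<bar> <= \<bar>g 0\<bar> + L * \<bar>b\<bar>" if "x : S" for x
  proof -
   have "\<bar>g x - g 0\<bar> <= L * norm x" using lip[of x 0] by simp
   also have "... <= L * \<bar>b\<bar>" using L b[OF that] by (intro mult_left_mono) auto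
   finally show ?thesis by linarith
  qed
  hence "\<bar>f m x - g x\<bar> <= B0 + L * \<bar>b\<bar> + (\<bar>g 0\<bar> + L * \<bar>b\<bar>)" if "x : S" for m x
   using far[OF that, of m] B0(2)[of m] that by (smt (verit))
  moreover have "0 <= B0 + L * \<bar>b\<bar> + (\<bar>g 0\<bar> + L * \<bar>b\<bar>)" using B0 L by simp
  ultimately show ?thesis using that by blast
 qed
 have finB: "(\<integral>\<^sup>+x. ennreal c \<partial>M) < \<infinity>" for c
  using finite_measure.emeasure_finite[OF fin] by (simp add: ennreal_mult_less_top ennreal_mult_eq_top_iff less_top[symmetric])
 show ?thesis
  unfolding has_weak_grad_altdef
 proof (intro conjI exI[of _ f] allI sm)
  have "L2sq M g < \<infinity>"
  proof -
   obtain C where C: "!!x. \<bar>g x\<bar> <= C"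
   proof -
    have "\<bar>g x\<bar> <= \<bar>g 0\<bar> + L * \<bar>r\<bar>" for x
    proof (cases "r <= norm x")
     case False
     have "\<bar>g x - g 0\<bar> <= L * norm x" using lip[of x 0] by simp
     also have "... <= L * \<bar>r\<bar>" using L False by (intro mult_left_mono) auto
     finally show ?thesis by linarith
    qed (use supp L in auto)
    thus ?thesis using that by blast
   qed
   have "L2sq M g <= (\<integral>\<^sup>+x. ennreal (C^2) \<partial>M)"
    unfolding L2sq_def using C by (intro nn_integral_mono ennreal_leI) (simp add: abs_le_square_iff[symmetric] order_trans[OF C abs_ge_self])
   thus ?thesis using finB le_less_trans by blast
  qed
  thus "integrable M (%x. (g x)^2)" using integrable_sq_iff[of g M] by simp
  have "L2sq M (%x. tang (n x) (D x)) <= (\<integral>\<^sup>+x. ennreal (L^2) \<partial>M)"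
   unfolding L2sq_def
  proof (rule nn_integral_mono_AE, rule AE_mp[OF DL], intro AE_I2 impI ennreal_leI power_mono)
   fix x assume "x : space M" "norm (D x) <= L"
   thus "norm (tang (n x) (D x)) <= L" using norm_tang_le[OF n_le] space_M order_trans by blast
  qed simp
  hence "L2sq M (%x. tang (n x) (D x)) < \<infinity>" using finB le_less_trans by blast
  thus "integrable M (%x. (norm (tang (n x) (D x)))^2)"
   using integrable_sq_iff[of "%x. tang (n x) (D x)" M] by simp
  have "(%m. \<integral>\<^sup>+x. ennreal ((norm (f m x - g x))^2) \<partial>M) \<longlonglongrightarrow> (\<integral>\<^sup>+x. 0 \<partial>M)"
  proof (rule nn_integral_dominated_convergence[where w = "%x. ennreal (B^2)"])
   show "AE x in M. ennreal ((norm (f j x - g x))^2) <= ennreal (B^2)" for j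
    using B space_M by (intro AE_I2 ennreal_leI power_mono) auto
   show "AE x in M. (%m. ennreal ((norm (f m x - g x))^2)) \<longlonglongrightarrow> 0"
   proof (rule AE_I2)
    fix x assume "x : space M"
    hence "(%m. f m x) \<longlonglongrightarrow> g x" using lim0 space_M by blast
    hence "(%m. (norm (f m x - g x))^2) \<longlonglongrightarrow> (norm (g x - g x))^2" by (intro tendsto_intros)
    thus "(%m. ennreal ((norm (f m x - g x))^2)) \<longlonglongrightarrow> 0" using tendsto_ennrealI by fastforce
   qed
  qed (use finB in measurable)
  thus "(%m. L2sq M (%x. f m x - g x)) \<longlonglongrightarrow> 0" by (simp add: L2sq_def)
  have "(%m. \<integral>\<^sup>+x. ennreal ((norm (tang (n x) (grad (f m) x) - tang (n x) (D x)))^2) \<partial>M) \<longlonglongrightarrow> (\<integral>\<^sup>+x. 0 \<partial>M)"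
  proof (rule nn_integral_dominated_convergence[where w = "%x. ennreal ((2 * L)^2)"])
   show "AE x in M. ennreal ((norm (tang (n x) (grad (f j) x) - tang (n x) (D x)))^2) <= ennreal ((2 * L)^2)" for j
   proof (rule AE_mp[OF DL], intro AE_I2 impI ennreal_leI power_mono)
    fix x assume x: "x : space M" "norm (D x) <= L"
    have "norm (tang (n x) (grad (f j) x) - tang (n x) (D x)) <= norm (grad (f j) x - D x)"
     using norm_tang_le[OF n_le] x space_M by (metis tang_simps(2))
    also have "... <= L + L" using norm_triangle_ineq4[of "grad (f j) x" "D x"] gradle[of x j] x space_M by simp
    finally show "norm (tang (n x) (grad (f j) x) - tang (n x) (D x)) <= 2 * L" by simp
   qed simp
   show "AE x in M. (%m. ennreal ((norm (tang (n x) (grad (f m) x) - tang (n x) (D x)))^2)) \<longlonglongrightarrow> 0"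
    using lim1
   proof eventually_elim
    fix x assume "(%m. grad (f m) x) \<longlonglongrightarrow> D x"
    hence "(%m. (norm (tang (n x) (grad (f m) x) - tang (n x) (D x)))^2)
      \<longlonglongrightarrow> (norm (tang (n x) (D x) - tang (n x) (D x)))^2"
     unfolding tang_def by (intro tendsto_intros)
    thus "(%m. ennreal ((norm (tang (n x) (grad (f m) x) - tang (n x) (D x)))^2)) \<longlonglongrightarrow> 0"
     using tendsto_ennrealI by fastforce
   qed
  qed (use finB in measurable)
  thus "(%m. L2sq M (%x. tang (n x) (grad (f m) x) - tang (n x) (D x))) \<longlonglongrightarrow> 0"
   by (simp add: L2sq_def)
 qed measurable
qed

text \<open>The approximants have no normal component, so the normal component of \<open>g\<close>
  is bounded pointwise by the error of each approximation.\<close>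

lemma has_weak_grad_tangential:
 assumes u: "has_weak_grad M n u g" and n1: "AE x in M. norm (n x) = 1"
 shows "AE x in M. g x \<bullet> n x = 0"
proof -
 obtain f where f: "!!m. smooth_on (f m) UNIV"
  "(%m::nat. L2sq M (%x. tang (n x) (grad (f m) x) - g x)) \<longlonglongrightarrow> 0"
  using u unfolding has_weak_grad_altdef by blast
 have [measurable]: "g : borel_measurable M" using u by (auto simp: has_weak_grad_altdef)
 note [measurable] = n_measurable
 have "L2sq M (%x. g x \<bullet> n x) <= L2sq M (%x. tang (n x) (grad (f m) x) - g x)" for m
  unfolding L2sq_def
 proof (rule nn_integral_mono_AE, rule AE_mp[OF n1], intro AE_I2 impI ennreal_leI power_mono)
  fix x assume "x : space M" and n: "norm (n x) = 1"
  have "g x \<bullet> n x = - ((tang (n x) (grad (f m) x) - g x) \<bullet> n x)"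
   using tang_inner[OF n] by (simp add: inner_diff_left)
  thus "norm (g x \<bullet> n x) <= norm (tang (n x) (grad (f m) x) - g x)"
   using Cauchy_Schwarz_ineq2[of "tang (n x) (grad (f m) x) - g x" "n x"] n by simp
 qed simp
 hence "L2sq M (%x. g x \<bullet> n x) <= 0" by (intro LIMSEQ_le_const[OF f(2)]) blast
 hence "(\<integral>\<^sup>+x. ennreal ((norm (g x \<bullet> n x))^2) \<partial>M) = 0" by (simp add: L2sq_def)
 hence "AE x in M. ennreal ((norm (g x \<bullet> n x))^2) = 0" by (subst (asm) nn_integral_0_iff_AE) auto
 thus ?thesis by eventually_elim simp
qed

end

section \<open>Uniqueness of weak gradients\<close>

text \<open>The integral of every difference quotient is zero by translation invariance, and
  dominated convergence passes to the derivative.\<close>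

lemma integral_derivative_compact_support:
 fixes h :: "'a::euclidean_space => real"
 assumes d: "!!x. (h has_derivative h' x) (at x)" and c: "continuous_on UNIV (%x. h' x v)"
  and supp: "!!x. x ~: cbox a b ==> h x = 0"
 shows "(\<integral>x. h' x v \<partial>lborel) = 0"
proof -
 have ch: "continuous_on UNIV h"
  using has_derivative_continuous[OF d] by (simp add: continuous_at_imp_continuous_on)
 have supp': "h' x v = 0" if "x ~: cbox a b" for x
 proof -
  have "((%x. 0) has_derivative h' x) (at x)"
   by (rule has_derivative_transform_within_open[OF d, of "- cbox a b"]) (use that supp in auto)
  hence "h' x = (%v. 0)" using has_derivative_unique has_derivative_const by metis
  thus ?thesis by simp
 qed
 obtain r where r: "0 < r" "cbox a b \<subseteq> ball 0 r" using bounded_subset_ballD[OF bounded_cbox, of a b 0] by auto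
 have z: "h x = 0" "h' x v = 0" if "r <= norm x" for x
 proof -
  have "x ~: cbox a b" using r(2) that by (auto simp: subset_iff)
  thus "h x = 0" "h' x v = 0" using supp supp' by auto
 qed
 obtain B where B: "0 < B" "!!x. \<bar>h' x v\<bar> <= B"
 proof -
  have "compact ((%x. h' x v) ` cbox a b)"
   by (intro compact_continuous_image continuous_on_subset[OF c]) auto
  hence "bounded ((%x. h' x v) ` cbox a b)" by (rule compact_imp_bounded)
  then obtain B where B: "0 < B" "!!x. x : cbox a b ==> norm (h' x v) <= B"
   unfolding bounded_pos by auto
  have "\<bar>h' x v\<bar> <= B" for x using B supp'[of x] by (cases "x : cbox a b") auto
  thus ?thesis using that B by blast
 qed
 define t where "t k = 1 / real (Suc k)" for k :: nat
 have t: "0 < t k" "t k <= 1" for k by (auto simp: t_def)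
 define q where "q k x = (h (x + t k *\<^sub>R v) - h x) / t k" for k x
 have ih: "integrable lborel h" by (rule integrable_continuous_bounded_support[OF ch z(1)])
 have ih': "integrable lborel (%x. h (x + t k *\<^sub>R v))" for k
 proof (rule integrable_continuous_bounded_support[of _ "r + norm v"])
  show "continuous_on UNIV (%x. h (x + t k *\<^sub>R v))"
   by (intro continuous_on_compose2[OF ch] continuous_intros) auto
  fix x :: 'a assume x: "r + norm v <= norm x"
  have "norm (t k *\<^sub>R v) <= norm v" using t[of k] by (simp add: mult_left_le_one_le)
  hence "r <= norm (x + t k *\<^sub>R v)" using x norm_diff_ineq[of x "t k *\<^sub>R v"] by linarith
  thus "h (x + t k *\<^sub>R v) = 0" by (rule z)
 qed
 have q0: "(\<integral>x. q k x \<partial>lborel) = 0" for k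
 proof -
  have "(\<integral>x. h x \<partial>lborel) = (\<integral>x. h x \<partial>distr lborel borel ((+) (t k *\<^sub>R v)))"
   by (simp add: lborel_distr_plus)
  also have "... = (\<integral>x. h (t k *\<^sub>R v + x) \<partial>lborel)"
   by (rule integral_distr) (use ch in \<open>auto intro: borel_measurable_continuous_onI\<close>)
  finally have "(\<integral>x. h (x + t k *\<^sub>R v) \<partial>lborel) = (\<integral>x. h x \<partial>lborel)" by (simp add: add.commute)
  thus ?thesis
   unfolding q_def using ih ih'[of k] by (simp add: Bochner_Integration.integral_diff)
 qed
 have "(%k. \<integral>x. q k x \<partial>lborel) \<longlonglongrightarrow> (\<integral>x. h' x v \<partial>lborel)"
 proof (rule integral_dominated_convergence[where w = "%x. B * indicator (cball 0 (r + norm v)) x"])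
  show "(%x. h' x v) : borel_measurable lborel" using c borel_measurable_continuous_onI by simp
  show "q k : borel_measurable lborel" for k
   using ch unfolding q_def
   by (auto intro!: borel_measurable_continuous_onI continuous_intros continuous_on_compose2[OF ch]
     simp: less_imp_neq[OF t(1), symmetric])
  show "integrable lborel (%x. B * indicator (cball 0 (r + norm v)) x :: real)"
   by (intro integrable_mult_right integrable_real_indicator emeasure_lborel_cball_finite) simp
  show "AE x in lborel. (%k. q k x) \<longlonglongrightarrow> h' x v"
  proof (rule AE_I2)
   fix x
   have "t = (%k. inverse (real (Suc k)))" by (rule ext) (simp add: t_def inverse_eq_divide)
   hence "t \<longlonglongrightarrow> 0" using LIMSEQ_inverse_real_of_nat by simp
   hence tk: "filterlim t (at_right 0) sequentially"
    unfolding filterlim_at using t(1) by (simp add: less_imp_neq[OF t(1), symmetric])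
   have "(%k. (1 / t k) *\<^sub>R (h (x + t k *\<^sub>R v) - h x)) \<longlonglongrightarrow> h' x v"
    using filterlim_compose[OF has_derivative_difference_quotient[OF d] tk] .
   thus "(%k. q k x) \<longlonglongrightarrow> h' x v" by (simp add: q_def)
  qed
  show "AE x in lborel. norm (q k x) <= B * indicator (cball 0 (r + norm v)) x" for k
  proof (rule AE_I2)
   fix x
   show "norm (q k x) <= B * indicator (cball 0 (r + norm v)) x"
   proof (cases "norm x <= r + norm v")
    case True
    have der: "((%s. h (x + s *\<^sub>R v)) has_real_derivative h' (x + s *\<^sub>R v) v) (at s)" for s
    proof -
     have "((%s. h (x + s *\<^sub>R v)) has_derivative (%s'. h' (x + s *\<^sub>R v) (s' *\<^sub>R v))) (at s)"
      by (rule has_derivative_compose[of "%s. x + s *\<^sub>R v" "%s. s *\<^sub>R v"])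
       (auto intro!: derivative_eq_intros d)
     moreover have "h' (x + s *\<^sub>R v) (s' *\<^sub>R v) = h' (x + s *\<^sub>R v) v * s'" for s'
      using linear_scale[OF has_derivative_linear[OF d]] by simp
     ultimately show ?thesis by (simp add: has_field_derivative_def)
    qed
    have "EX z>0. z < t k & h (x + t k *\<^sub>R v) - h (x + 0 *\<^sub>R v) = (t k - 0) * h' (x + z *\<^sub>R v) v"
     by (rule MVT2[OF t(1)]) (rule der)
    then obtain s where "h (x + t k *\<^sub>R v) - h (x + 0 *\<^sub>R v) = (t k - 0) * h' (x + s *\<^sub>R v) v"
     by blast
    hence "q k x = h' (x + s *\<^sub>R v) v" using t(1)[of k] by (simp add: q_def)
    thus ?thesis using B True by simp
   next
    case False
    have "norm (t k *\<^sub>R v) <= norm v" using t[of k] by (simp add: mult_left_le_one_le)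
    hence "r <= norm (x + t k *\<^sub>R v)" "r <= norm x"
     using False norm_diff_ineq[of x "t k *\<^sub>R v"] norm_ge_zero[of v] by linarith+
    thus ?thesis using z B by (simp add: q_def)
   qed
  qed
 qed
 thus ?thesis by (simp add: q0 LIMSEQ_const_iff)
qed

section \<open>Cutoff functions of boxes and functions with vanishing box integrals\<close>

lemma Ck_on_max_square: "Ck_on (Suc 0) (%s::real. (max 0 s)^2) UNIV"
proof (rule Ck_on_SucI[OF open_UNIV])
 fix s :: real
 have "((%s::real. (max 0 s)^2) has_real_derivative 2 * max 0 s) (at s)"
 proof -
  consider "s < 0" | "0 < s" | "s = 0" by linarith
  thus ?thesis
  proof cases
   case 1
   have "((%s::real. 0) has_real_derivative 0) (at s)" by simp
   hence "((%s::real. (max 0 s)^2) has_real_derivative 0) (at s)"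
    by (rule DERIV_cong_ev[OF refl _ refl, THEN iffD1, rotated])
     (use 1 eventually_nhds_in_open[of "{..<0}" s] in \<open>auto elim!: eventually_mono\<close>)
   thus ?thesis using 1 by simp
  next
   case 2
   have "((%s::real. s^2) has_real_derivative 2 * s) (at s)" by (auto intro!: derivative_eq_intros)
   hence "((%s::real. (max 0 s)^2) has_real_derivative 2 * s) (at s)"
    by (rule DERIV_cong_ev[OF refl _ refl, THEN iffD1, rotated])
     (use 2 eventually_nhds_in_open[of "{0<..}" s] in \<open>auto elim!: eventually_mono\<close>)
   thus ?thesis using 2 by simp
  next
   case 3
   have "((%h::real. (max 0 h)^2 / h) \<longlongrightarrow> 0) (at 0)"
   proof (rule Lim_null_comparison[of _ "%h. \<bar>h\<bar>"])
    show "\<forall>\<^sub>F h in at 0. norm ((max 0 h)^2 / h) <= \<bar>h\<bar>" for h :: real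
     by (rule always_eventually) (auto simp: max_def power2_eq_square abs_mult)
    show "((%h::real. \<bar>h\<bar>) \<longlongrightarrow> 0) (at 0)" using tendsto_rabs[OF tendsto_ident_at, of 0 UNIV] by simp
   qed
   thus ?thesis unfolding 3 by (simp add: DERIV_def)
  qed
 qed
 thus "((%s::real. (max 0 s)^2) has_derivative (%v. 2 * max 0 s * v)) (at s)"
  by (simp add: has_field_derivative_def mult_commute_abs)
next
 show "Ck_on 0 (%s::real. 2 * max 0 s * v) UNIV" for v
  by (auto intro!: continuous_intros)
qed

text \<open>Squares of positive parts make the product continuously differentiable, which is all
  that integration by parts uses; the denominator scales it to at most 1.\<close>

definition box_bump :: "real^'d::finite => real^'d => real^'d => real" where
 "box_bump a b x = (\<Prod>i\<in>UNIV. (max 0 (x $ i - a $ i))^2 * (max 0 (b $ i - x $ i))^2)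
   / (\<Prod>i\<in>UNIV. (b $ i - a $ i)^2 * (b $ i - a $ i)^2)"

text \<open>Inside the box the bump is positive, so the powers tend to 0 and the cutoffs to 1, while
  off the box all cutoffs vanish.\<close>

definition box_cutoff :: "real^'d::finite => real^'d => nat => real^'d => real" where
 "box_cutoff a b j x = 1 - (1 - box_bump a b x) ^ j"

lemma Ck_on_box_cutoff: "Ck_on (Suc 0) (box_cutoff a b j) UNIV"
proof -
 have 1: "Ck_on (Suc 0) (%x. (max 0 (x $ i - a $ i))^2) UNIV" for i
  by (rule Ck_on_compose[where f = "%x. x $ i - a $ i" and g = "%s. (max 0 s)^2" and T = UNIV])
   (auto intro!: Ck_on_diff Ck_on_component Ck_on_ident Ck_on_const simp del: Ck_on.simps intro: Ck_on_max_square)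
 have 2: "Ck_on (Suc 0) (%x. (max 0 (b $ i - x $ i))^2) UNIV" for i
  by (rule Ck_on_compose[where f = "%x. b $ i - x $ i" and g = "%s. (max 0 s)^2" and T = UNIV])
   (auto intro!: Ck_on_diff Ck_on_component Ck_on_ident Ck_on_const simp del: Ck_on.simps intro: Ck_on_max_square)
 have "Ck_on (Suc 0) (box_bump a b) UNIV"
  unfolding box_bump_def divide_inverse
  by (intro Ck_on_mult Ck_on_prod Ck_on_const open_UNIV 1 2)
 thus ?thesis
  unfolding box_cutoff_def by (intro Ck_on_diff Ck_on_power Ck_on_const open_UNIV)
qed

lemma box_bump_bounds:
 assumes ab: "!!i. a $ i < b $ i"
 shows "0 <= box_bump a b x" "box_bump a b x <= 1"
  "x ~: box a b ==> box_bump a b x = 0" "x : box a b ==> 0 < box_bump a b x"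
proof -
 let ?d = "\<Prod>i\<in>UNIV. (b $ i - a $ i)^2 * (b $ i - a $ i)^2"
 have dpos: "0 < (b $ i - a $ i)^2 * (b $ i - a $ i)^2" for i using ab[of i] by simp
 hence d: "0 < ?d" by (intro prod_pos) auto
 show "0 <= box_bump a b x" unfolding box_bump_def by (intro divide_nonneg_nonneg prod_nonneg) auto
 have "(\<Prod>i\<in>UNIV. (max 0 (x $ i - a $ i))^2 * (max 0 (b $ i - x $ i))^2) <= ?d"
 proof (rule prod_mono, intro conjI)
  fix i
  show "(max 0 (x $ i - a $ i))^2 * (max 0 (b $ i - x $ i))^2 <= (b $ i - a $ i)^2 * (b $ i - a $ i)^2"
  proof (cases "a $ i <= x $ i & x $ i <= b $ i")
   case True
   thus ?thesis by (intro mult_mono power_mono) auto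
  next
   case False
   hence "max 0 (x $ i - a $ i) = 0 \<or> max 0 (b $ i - x $ i) = 0" by auto
   thus ?thesis using dpos[of i] by auto
  qed
 qed simp
 thus "box_bump a b x <= 1" unfolding box_bump_def using d by simp
 show "box_bump a b x = 0" if "x ~: box a b"
 proof -
  obtain i where "~ (a $ i < x $ i & x $ i < b $ i)" using \<open>x ~: box a b\<close> by (auto simp: mem_box_cart)
  hence "(max 0 (x $ i - a $ i))^2 * (max 0 (b $ i - x $ i))^2 = 0" by auto
  hence "(\<Prod>i\<in>UNIV. (max 0 (x $ i - a $ i))^2 * (max 0 (b $ i - x $ i))^2) = 0"
   by (intro prod_zero) auto
  thus ?thesis by (simp add: box_bump_def)
 qed
 show "0 < box_bump a b x" if "x : box a b"
  unfolding box_bump_def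
 proof (rule divide_pos_pos[OF prod_pos d])
  fix i
  have "a $ i < x $ i" "x $ i < b $ i" using that by (auto simp: mem_box_cart)
  thus "0 < (max 0 (x $ i - a $ i))^2 * (max 0 (b $ i - x $ i))^2"
   by (intro mult_pos_pos zero_less_power) auto
 qed
qed

lemma box_cutoff_bounds:
 assumes ab: "!!i. a $ i < b $ i"
 shows "0 <= box_cutoff a b j x" "box_cutoff a b j x <= 1" "x ~: box a b ==> box_cutoff a b j x = 0"
  "(%j. box_cutoff a b j x) \<longlonglongrightarrow> indicator (box a b) x"
proof -
 note B = box_bump_bounds[OF ab, of x]
 show "0 <= box_cutoff a b j x" "box_cutoff a b j x <= 1"
  unfolding box_cutoff_def using B(1,2) by (auto intro!: power_le_one)
 show z: "x ~: box a b ==> box_cutoff a b j x = 0" for j unfolding box_cutoff_def using B(3) by simp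
 show "(%j. box_cutoff a b j x) \<longlonglongrightarrow> indicator (box a b) x"
 proof (cases "x : box a b")
  case True
  have "(%j. (1 - box_bump a b x) ^ j) \<longlonglongrightarrow> 0"
   by (rule LIMSEQ_power_zero) (use B(2) B(4)[OF True] in auto)
  hence "(%j. 1 - (1 - box_bump a b x) ^ j) \<longlonglongrightarrow> 1 - 0" by (rule tendsto_diff[OF tendsto_const])
  thus ?thesis using True by (simp add: box_cutoff_def)
 qed (simp add: z)
qed

text \<open>Open boxes are stable under intersection and generate the Borel sets. The sets over
  which \<open>f\<close> integrates to zero are closed under disjoint unions, and under complements
  because the total integral is that over the box carrying \<open>f\<close>.\<close>

lemma AE_zero_of_box_integrals:
 fixes f :: "'a::euclidean_space => real"
 assumes f: "integrable lborel f" and supp: "!!x. x ~: box a b ==> f x = 0"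
  and box: "!!c d. (\<integral>x. indicator (box c d) x * f x \<partial>lborel) = 0"
 shows "AE x in lborel. f x = 0"
proof -
 have si: "set_integrable lborel A f" if "A : sets borel" for A
  unfolding set_integrable_def using integrable_mult_indicator[OF _ f, of A] that by simp
 have all: "(\<integral>x. f x \<partial>lborel) = 0"
 proof -
  have "(%x. indicator (box a b) x * f x) = f" using supp by (auto simp: indicator_def fun_eq_iff)
  thus ?thesis using box[of a b] by simp
 qed
 have E: "Int_stable (range (%(a, b). box a b :: 'a set))" by (auto simp: Int_stable_def box_Int_box)
 have "set_lebesgue_integral lborel A f = 0" if "A : sigma_sets UNIV (range (%(a, b). box a b :: 'a set))" for A
 proof (rule sigma_sets_induct_disjoint[OF E _ that])
  fix A assume "A : range (%(a, b). box a b :: 'a set)"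
  thus "set_lebesgue_integral lborel A f = 0" using box by (auto simp: set_lebesgue_integral_def)
 next
  show "set_lebesgue_integral lborel {} f = 0" by (simp add: set_lebesgue_integral_def)
 next
  fix A assume compl: "A : sigma_sets UNIV (range (%(a, b). box a b :: 'a set))" "set_lebesgue_integral lborel A f = 0"
  hence A: "A : sets borel" by (simp add: borel_eq_box)
  have "set_lebesgue_integral lborel (UNIV - A) f = (\<integral>x. f x - indicator A x *\<^sub>R f x \<partial>lborel)"
   unfolding set_lebesgue_integral_def by (intro Bochner_Integration.integral_cong) (auto simp: indicator_def)
  also have "... = 0"
   using f si[OF A] compl all
   by (simp add: Bochner_Integration.integral_diff set_integrable_def set_lebesgue_integral_def)
  finally show "set_lebesgue_integral lborel (UNIV - A) f = 0" .
 next
  fix A :: "nat => 'a set"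
  assume union: "disjoint_family A" "range A \<subseteq> sigma_sets UNIV (range (%(a, b). box a b))"
   "!!i. set_lebesgue_integral lborel (A i) f = 0"
  hence A: "A i : sets borel" for i by (auto simp: borel_eq_box)
  hence "(\<Union>i. A i) : sets borel" by auto
  hence "set_lebesgue_integral lborel (\<Union>i. A i) f = (\<Sum>i. set_lebesgue_integral lborel (A i) f)"
   using union(1) A
   by (intro lebesgue_integral_countable_add si) (auto simp: disjoint_family_on_def)
  thus "set_lebesgue_integral lborel (\<Union>i. A i) f = 0" using union by simp
 qed auto
 hence "set_lebesgue_integral lborel A f = set_lebesgue_integral lborel A (%x. 0)" if "A : sets lborel" for A
  using that by (simp add: borel_eq_box set_lebesgue_integral_def)
 thus ?thesis by (intro density_unique_real f) auto
qed

lemma measurable_chart: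
 fixes g :: "('d::finite) ambient => 'b::{real_normed_vector, second_countable_topology}"
 assumes M: "surface_measure S M" and X: "(U, X) : local_params S" and g: "g : borel_measurable M"
 shows "(%u. indicator U u *\<^sub>R g (X u)) : borel_measurable borel"
proof -
 note c = local_paramsD[OF X]
 have "X : borel_measurable (restrict_space borel U)"
  using smooth_on_continuous_on[OF c(2)] by (rule borel_measurable_continuous_on_restrict)
 hence "X : measurable (restrict_space borel U) (restrict_space borel S)"
  by (rule measurable_restrict_space2[rotated]) (use c(7) in \<open>auto simp: space_restrict_space\<close>)
 moreover have "g : borel_measurable (restrict_space borel S)"
  using g measurable_cong_sets[OF surface_measureD(1)[OF M] refl] by blast
 ultimately have "(%u. g (X u)) : borel_measurable (restrict_space borel U)"
  by (rule measurable_compose)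
 thus ?thesis using c(1) by (subst (asm) borel_measurable_restrict_space_iff) auto
qed

text \<open>The inequality \<open>t <= e + t^2 / e\<close> replaces Cauchy-Schwarz and avoids square
  roots of extended reals. The number \<open>\<alpha>\<close>, a lower bound of the area factor on
  the compact box, has to be independent of \<open>G\<close> and \<open>e\<close>, since limits are
  taken in both.\<close>

lemma chart_L1_bound:
 fixes S :: "('d::finite) ambient set"
 assumes M: "surface_measure S M" and X: "(U, X) : local_params S" and ab: "cbox a b \<subseteq> U"
 shows "EX \<alpha>>0. ALL (G :: 'd ambient => 'b::{real_normed_vector, second_countable_topology}) e.
  G : borel_measurable M --> 0 < e -->
   (\<integral>\<^sup>+u. ennreal (indicator (cbox a b) u * norm (G (X u))) \<partial>lborel)
    <= ennreal (e * measure lborel (cbox a b)) + ennreal (1 / (e * \<alpha>)) * L2sq M G"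
proof -
 have "EX \<alpha>>0. ALL u:cbox a b. \<alpha> <= area_factor X u"
 proof (cases "cbox a b = {}")
  case False
  obtain u where "u : cbox a b" "ALL v:cbox a b. area_factor X u <= area_factor X v"
   using continuous_attains_inf[OF compact_cbox False continuous_on_subset[OF continuous_on_area_factor[OF X] ab]]
   by blast
  thus ?thesis using area_factor_pos[OF X] ab by blast
 qed (auto intro: exI[of _ 1])
 then obtain \<alpha> where \<alpha>: "0 < \<alpha>" "!!u. u : cbox a b ==> \<alpha> <= area_factor X u" by blast
 show ?thesis
 proof (intro exI[of _ \<alpha>] conjI \<alpha>(1) allI impI)
  fix G :: "'d ambient => 'b" and e :: real assume G[measurable]: "G : borel_measurable M" and e: "0 < e"
  have meas: "(%u. norm (indicator U u *\<^sub>R G (X u))) : borel_measurable borel"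
   using measurable_chart[OF M X G] by measurable
  have mL: "(%u. ennreal ((norm (G (X u)))^2) * ennreal (area_factor X u * indicator U u)) : borel_measurable lborel"
  proof -
   have "(%u. ennreal ((norm (indicator U u *\<^sub>R G (X u)))^2) * ennreal (area_factor X u * indicator U u)) : borel_measurable lborel"
    using meas measurable_area_factor[OF X] by measurable
   moreover have "(%u. ennreal ((norm (indicator U u *\<^sub>R G (X u)))^2) * ennreal (area_factor X u * indicator U u))
    = (%u. ennreal ((norm (G (X u)))^2) * ennreal (area_factor X u * indicator U u))"
    by (auto simp: fun_eq_iff indicator_def)
   ultimately show ?thesis by simp
  qed
  have pt: "ennreal (indicator (cbox a b) u * norm (G (X u))) <= ennreal e * indicator (cbox a b) u
    + ennreal (1 / (e * \<alpha>)) * (ennreal ((norm (G (X u)))^2) * ennreal (area_factor X u * indicator U u))" for u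
  proof (cases "u : cbox a b")
   case True
   let ?g = "norm (G (X u))"
   have u: "u : U" "0 <= area_factor X u" using True ab \<alpha>(1) \<alpha>(2)[OF True] by auto
   have "?g <= e + ?g^2 / e"
   proof (cases "?g <= e")
    case False
    hence "?g * e <= ?g * ?g" using e by (intro mult_left_mono) auto
    hence "?g <= ?g^2 / e" using e by (simp add: field_simps power2_eq_square)
    thus ?thesis using e by simp
   qed (use e in \<open>simp add: add_increasing2\<close>)
   also have "?g^2 / e <= 1 / (e * \<alpha>) * (?g^2 * area_factor X u)"
   proof -
    have "?g^2 / e * \<alpha> <= ?g^2 / e * area_factor X u"
     using \<alpha>(2)[OF True] e by (intro mult_left_mono) auto
    thus ?thesis using \<alpha>(1) e by (simp add: field_simps)
   qed
   finally have "ennreal ?g <= ennreal (e + 1 / (e * \<alpha>) * (?g^2 * area_factor X u))"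
    by (intro ennreal_leI) simp
   also have "... = ennreal e + ennreal (1 / (e * \<alpha>)) * (ennreal (?g^2) * ennreal (area_factor X u))"
   proof -
    have eq: "ennreal (A * (B * C)) = ennreal A * (ennreal B * ennreal C)" if "0 <= A" "0 <= B" "0 <= C" for A B C
     using that by (simp add: ennreal_mult)
    have nn: "0 <= 1 / (e * \<alpha>)" "0 <= ?g^2" using e \<alpha>(1) by auto
    have "ennreal (e + 1 / (e * \<alpha>) * (?g^2 * area_factor X u))
      = ennreal e + ennreal (1 / (e * \<alpha>) * (?g^2 * area_factor X u))"
     using e nn u(2) by (intro ennreal_plus mult_nonneg_nonneg) auto
    thus ?thesis by (simp only: eq[OF nn u(2)])
   qed
   finally show ?thesis using True u by simp
  qed simp
  have "(\<integral>\<^sup>+u. ennreal (indicator (cbox a b) u * norm (G (X u))) \<partial>lborel)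
   <= (\<integral>\<^sup>+u. ennreal e * indicator (cbox a b) u
    + ennreal (1 / (e * \<alpha>)) * (ennreal ((norm (G (X u)))^2) * ennreal (area_factor X u * indicator U u)) \<partial>lborel)"
   by (intro nn_integral_mono pt)
  also have "... = ennreal e * emeasure lborel (cbox a b) + ennreal (1 / (e * \<alpha>)) *
    (\<integral>\<^sup>+u. ennreal ((norm (G (X u)))^2) * ennreal (area_factor X u * indicator U u) \<partial>lborel)"
   using mL by (simp add: nn_integral_add nn_integral_cmult)
  also have "(\<integral>\<^sup>+u. ennreal ((norm (G (X u)))^2) * ennreal (area_factor X u * indicator U u) \<partial>lborel)
    = (\<integral>\<^sup>+x. ennreal ((norm (G x))^2) * indicator (X ` U) x \<partial>M)"
   by (rule nn_integral_chart[OF M X, symmetric]) measurable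
  also have "... <= L2sq M G"
   unfolding L2sq_def by (intro nn_integral_mono) (auto simp: indicator_def)
  also have "ennreal e * emeasure lborel (cbox a b) = ennreal (e * measure lborel (cbox a b))"
   using e emeasure_lborel_cbox_finite[of a b] by (simp add: ennreal_mult emeasure_eq_ennreal_measure less_top)
  finally show "(\<integral>\<^sup>+u. ennreal (indicator (cbox a b) u * norm (G (X u))) \<partial>lborel)
    <= ennreal (e * measure lborel (cbox a b)) + ennreal (1 / (e * \<alpha>)) * L2sq M G"
   by (meson add_left_mono mult_left_mono order_trans zero_le)
 qed
qed

lemma open_Union_cbox_interiors:
 fixes U :: "(real^'d::finite) set"
 assumes "open U" "u : U"
 obtains a b where "!!i. a $ i < b $ i" "cbox a b \<subseteq> U" "u : box a b"
proof -
 obtain e where e: "0 < e" "ball u e \<subseteq> U" using assms openE by blast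
 define s where "s = e / (2 * real CARD('d))"
 have s: "0 < s" using e by (simp add: s_def)
 let ?a = "\<chi> i. u $ i - s" and ?b = "\<chi> i. u $ i + s"
 show ?thesis
 proof (rule that[of ?a ?b])
  show "?a $ i < ?b $ i" for i using s by simp
  show "u : box ?a ?b" using s by (simp add: mem_box_cart)
  show "cbox ?a ?b \<subseteq> U"
  proof
   fix x assume x: "x : cbox ?a ?b"
   have "norm (x - u) <= (\<Sum>i\<in>UNIV. \<bar>(x - u) $ i\<bar>)" by (rule norm_le_l1_cart)
   also have "... <= (\<Sum>i\<in>(UNIV::'d set). s)"
   proof (rule sum_mono)
    fix i
    have "u $ i - s <= x $ i" "x $ i <= u $ i + s" using x by (auto simp: mem_box_cart)
    thus "\<bar>(x - u) $ i\<bar> <= s" by simp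
   qed
   also have "... = e / 2" by (simp add: s_def)
   also have "... < e" using e by simp
   finally show "x : U" using e(2) by (auto simp: dist_norm norm_minus_commute subset_iff)
  qed
 qed
qed

section \<open>A weak gradient of the zero function vanishes in a chart\<close>

context surface_calculus
begin

context
 fixes U :: "(real^'d) set" and X :: "real^'d => 'd ambient" and w :: "'d ambient => 'd ambient"
 assumes X: "(U, X) : local_params S"
  and nX: "AE u in lborel. u : U --> norm (n (X u)) = 1 & (ALL v. n (X u) \<bullet> fderiv X u v = 0)"
  and w: "has_weak_grad M n (%x. 0) w"
begin

lemma w_measurable: "w : borel_measurable M"
 using w by (simp add: has_weak_grad_altdef)

lemma continuous_DX: "continuous_on U (%u. fderiv X u v)"
 by (rule smooth_on_continuous_frechet_derivative[OF local_paramsD(2)[OF X]])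

lemma pullback_measurable:
 fixes g :: "'d ambient => 'd ambient"
 assumes "g : borel_measurable M" "A : sets borel" "A \<subseteq> U"
 shows "(%u. indicator A u * (g (X u) \<bullet> fderiv X u v)) : borel_measurable borel"
proof -
 have [measurable]: "(%u. indicator U u *\<^sub>R g (X u)) : borel_measurable borel"
  by (rule measurable_chart[OF surf X assms(1)])
 have [measurable]: "(%u. indicator U u *\<^sub>R fderiv X u v) : borel_measurable borel"
  using borel_measurable_continuous_on_indicator[OF _ continuous_DX] local_paramsD(1)[OF X] by simp
 have [measurable]: "A : sets borel" by fact
 have "(%u. indicator A u * ((indicator U u *\<^sub>R g (X u)) \<bullet> (indicator U u *\<^sub>R fderiv X u v)))
   : borel_measurable borel" by measurable
 moreover have "(%u. indicator A u * ((indicator U u *\<^sub>R g (X u)) \<bullet> (indicator U u *\<^sub>R fderiv X u v)))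
  = (%u. indicator A u * (g (X u) \<bullet> fderiv X u v))"
  using assms(3) by (auto simp: fun_eq_iff indicator_def)
 ultimately show ?thesis by simp
qed

lemma DX_bound:
 assumes "cbox a b \<subseteq> U"
 obtains B where "0 < B" "!!u. u : cbox a b ==> norm (fderiv X u v) <= B"
proof -
 have "compact ((%u. fderiv X u v) ` cbox a b)"
  by (intro compact_continuous_image continuous_on_subset[OF continuous_DX assms] compact_cbox)
 hence "bounded ((%u. fderiv X u v) ` cbox a b)" by (rule compact_imp_bounded)
 thus ?thesis using that unfolding bounded_pos by auto
qed

lemma pullback_integrable:
 assumes ab: "cbox a b \<subseteq> U" and g[measurable]: "g : borel_measurable M" and fg: "L2sq M g < \<infinity>"
  and A: "A : sets borel" "A \<subseteq> cbox a b"
 shows "integrable lborel (%u. indicator A u * (g (X u) \<bullet> fderiv X u v))"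
proof -
 obtain B where B: "0 < B" "!!u. u : cbox a b ==> norm (fderiv X u v) <= B"
  using DX_bound[OF ab] by metis
 obtain \<alpha> where \<alpha>: "0 < \<alpha>" "ALL (G :: 'd ambient => 'd ambient) e. G : borel_measurable M --> 0 < e -->
   (\<integral>\<^sup>+u. ennreal (indicator (cbox a b) u * norm (G (X u))) \<partial>lborel)
    <= ennreal (e * measure lborel (cbox a b)) + ennreal (1 / (e * \<alpha>)) * L2sq M G"
  using chart_L1_bound[OF surf X ab] by blast
 have meas: "(%u. indicator A u * (g (X u) \<bullet> fderiv X u v)) : borel_measurable borel"
  by (rule pullback_measurable[OF g A(1)]) (use A ab in auto)
 have "(\<integral>\<^sup>+u. ennreal (norm (indicator A u * (g (X u) \<bullet> fderiv X u v))) \<partial>lborel)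
  <= (\<integral>\<^sup>+u. ennreal B * ennreal (indicator (cbox a b) u * norm (g (X u))) \<partial>lborel)"
 proof (rule nn_integral_mono)
  fix u
  have "norm (indicator A u * (g (X u) \<bullet> fderiv X u v)) <= B * (indicator (cbox a b) u * norm (g (X u)))"
  proof (cases "u : A")
   case True
   hence u: "u : cbox a b" using A by blast
   have "\<bar>g (X u) \<bullet> fderiv X u v\<bar> <= norm (g (X u)) * norm (fderiv X u v)"
    by (rule Cauchy_Schwarz_ineq2)
   also have "... <= norm (g (X u)) * B" by (intro mult_left_mono B u) simp
   finally show ?thesis using True u by (simp add: mult.commute)
  qed (use B in simp)
  thus "ennreal (norm (indicator A u * (g (X u) \<bullet> fderiv X u v)))
    <= ennreal B * ennreal (indicator (cbox a b) u * norm (g (X u)))"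
   using B by (simp add: ennreal_mult[symmetric] ennreal_leI)
 qed
 also have "... = ennreal B * (\<integral>\<^sup>+u. ennreal (indicator (cbox a b) u * norm (g (X u))) \<partial>lborel)"
 proof (rule nn_integral_cmult)
  have [measurable]: "(%u. norm (indicator U u *\<^sub>R g (X u))) : borel_measurable borel"
   using measurable_chart[OF surf X g] by measurable
  have eq: "(%u. ennreal (indicator (cbox a b) u * norm (g (X u))))
   = (%u. ennreal (indicator (cbox a b) u * norm (indicator U u *\<^sub>R g (X u))))"
   using ab by (auto simp: fun_eq_iff indicator_def)
  show "(%u. ennreal (indicator (cbox a b) u * norm (g (X u)))) : borel_measurable lborel"
   unfolding eq by measurable
 qed
 also have "... < \<infinity>"
 proof -
  have "(\<integral>\<^sup>+u. ennreal (indicator (cbox a b) u * norm (g (X u))) \<partial>lborel)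
   <= ennreal (1 * measure lborel (cbox a b)) + ennreal (1 / (1 * \<alpha>)) * L2sq M g" by (rule \<alpha>(2)[rule_format, OF g]) simp
  also have "... < \<infinity>" using fg by (simp add: ennreal_mult_less_top)
  finally show ?thesis by (simp add: ennreal_mult_less_top)
 qed
 finally show ?thesis using meas by (simp add: integrable_iff_bounded)
qed

text \<open>Integration by parts: \<open>f m\<close> tends to 0 and its tangential gradient to
  \<open>w\<close>. The integral of the cutoff times the derivative of the pulled-back
  \<open>f m\<close> equals minus the integral of \<open>f m\<close> times the derivative of the
  cutoff, which tends to zero.\<close>

lemma cutoff_integral_zero:
 assumes ab: "!!i. a $ i < b $ i" "cbox a b \<subseteq> U"
 shows "(\<integral>u. box_cutoff a b j u * (indicator (cbox a b) u * (w (X u) \<bullet> fderiv X u v)) \<partial>lborel) = 0"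
  (is "?I = 0")
proof -
 note c = local_paramsD[OF X]
 define \<phi> where "\<phi> = box_cutoff a b j"
 note \<phi>b = box_cutoff_bounds(1-3)[of a b, OF ab(1), where j = j, folded \<phi>_def]
 have C1: "Ck_on (Suc 0) \<phi> UNIV" unfolding \<phi>_def by (rule Ck_on_box_cutoff)
 define d\<phi> where "d\<phi> u = frechet_derivative \<phi> (at u)" for u
 have d\<phi>: "(\<phi> has_derivative d\<phi> u) (at u)" for u
  unfolding d\<phi>_def by (rule Ck_on_has_derivative[OF C1]) simp
 have cd\<phi>: "continuous_on UNIV (%u. d\<phi> u v)" using C1 unfolding d\<phi>_def by simp
 have \<phi>c: "continuous_on UNIV \<phi>" using Ck_on_SucD[OF C1] by simp
 obtain f where f: "!!m. smooth_on (f m) UNIV" "(%m::nat. L2sq M (%x. f m x - 0)) \<longlonglongrightarrow> 0"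
  "(%m. L2sq M (%x. tang (n x) (grad (f m) x) - w x)) \<longlonglongrightarrow> 0"
  using w unfolding has_weak_grad_altdef by blast
 note [measurable] = smooth_measurable[OF f(1)] tang_grad_measurable[OF f(1)] w_measurable
 let ?Q = "cbox a b" and ?DX = "%u. fderiv X u v"
 obtain B where B: "0 < B" "!!u. u : ?Q ==> norm (?DX u) <= B" using DX_bound[OF ab(2)] by metis
 obtain B' where B': "0 < B'" "!!u. u : ?Q ==> \<bar>d\<phi> u v\<bar> <= B'"
 proof -
  have "compact ((%u. d\<phi> u v) ` ?Q)"
   by (intro compact_continuous_image continuous_on_subset[OF cd\<phi>] compact_cbox) auto
  hence "bounded ((%u. d\<phi> u v) ` ?Q)" by (rule compact_imp_bounded)
  thus ?thesis using that unfolding bounded_pos by auto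
 qed
 obtain \<alpha>1 where \<alpha>1: "0 < \<alpha>1" "ALL (G :: 'd ambient => 'd ambient) e. G : borel_measurable M --> 0 < e -->
   (\<integral>\<^sup>+u. ennreal (indicator ?Q u * norm (G (X u))) \<partial>lborel)
    <= ennreal (e * measure lborel ?Q) + ennreal (1 / (e * \<alpha>1)) * L2sq M G"
  using chart_L1_bound[OF surf X ab(2)] by blast
 obtain \<alpha>2 where \<alpha>2: "0 < \<alpha>2" "ALL (G :: 'd ambient => real) e. G : borel_measurable M --> 0 < e -->
   (\<integral>\<^sup>+u. ennreal (indicator ?Q u * norm (G (X u))) \<partial>lborel)
    <= ennreal (e * measure lborel ?Q) + ennreal (1 / (e * \<alpha>2)) * L2sq M G"
  using chart_L1_bound[OF surf X ab(2)] by blast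
 define g where "g m x = tang (n x) (grad (f m) x)" for m x
 have gm[measurable]: "g m : borel_measurable M" for m unfolding g_def by measurable
 have mU: "(%u. norm (indicator U u *\<^sub>R (g m (X u) - w (X u)))) : borel_measurable borel"
   "(%u. norm (indicator U u *\<^sub>R f m (X u))) : borel_measurable borel" for m
  using measurable_chart[OF surf X, of "%x. g m x - w x"] measurable_chart[OF surf X, of "f m"] by measurable
 have mQ: "(%u. ennreal (indicator ?Q u * norm (g m (X u) - w (X u)))) : borel_measurable lborel"
   "(%u. ennreal (indicator ?Q u * norm (f m (X u)))) : borel_measurable lborel" for m
 proof -
  have "(%u. ennreal (indicator ?Q u * norm (g m (X u) - w (X u))))
   = (%u. ennreal (indicator ?Q u * norm (indicator U u *\<^sub>R (g m (X u) - w (X u)))))"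
   "(%u. ennreal (indicator ?Q u * norm (f m (X u))))
   = (%u. ennreal (indicator ?Q u * norm (indicator U u *\<^sub>R f m (X u))))"
   using ab(2) by (auto simp: fun_eq_iff indicator_def)
  thus "(%u. ennreal (indicator ?Q u * norm (g m (X u) - w (X u)))) : borel_measurable lborel"
   "(%u. ennreal (indicator ?Q u * norm (f m (X u)))) : borel_measurable lborel" using mU[of m] by simp_all
 qed
 have key: "ennreal \<bar>?I\<bar> <= ennreal B * (\<integral>\<^sup>+u. ennreal (indicator ?Q u * norm (g m (X u) - w (X u))) \<partial>lborel)
   + ennreal B' * (\<integral>\<^sup>+u. ennreal (indicator ?Q u * norm (f m (X u))) \<partial>lborel)" for m
 proof -
  define F where "F u = f m (X u)" for u
  have smF: "smooth_on F U"
   unfolding F_def by (rule smooth_on_compose[OF c(1) open_UNIV c(2) f(1)]) simp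
  define dF where "dF u = fderiv F u" for u
  have dF: "(F has_derivative dF u) (at u)" if "u : U" for u
   unfolding dF_def by (rule smooth_on_has_derivative[OF smF that])
  have dFX: "dF u v = grad (f m) (X u) \<bullet> ?DX u" if "u : U" for u
  proof -
   have fd: "(f m has_derivative fderiv (f m) (X u)) (at (X u))"
    by (rule smooth_on_UNIV_has_derivative[OF f(1)])
   have "(F has_derivative (%v. fderiv (f m) (X u) (fderiv X u v))) (at u)"
    unfolding F_def by (rule has_derivative_compose[OF smooth_on_has_derivative[OF c(2) that] fd])
   hence "dF u = (%v. fderiv (f m) (X u) (fderiv X u v))"
    using dF[OF that] has_derivative_unique by blast
   thus ?thesis by (simp add: differentiable_grad(2)[OF fd])
  qed
  \<comment> \<open>Extension by zero from \<open>U\<close> to the whole space; it stays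
    differentiable because the cutoff vanishes off the closed box contained in
    \<open>U\<close>.\<close>
  define h where "h u = (if u : U then \<phi> u * F u else 0)" for u
  define h' where "h' u v = (if u : U then \<phi> u * dF u v + d\<phi> u v * F u else 0)" for u v
  have \<phi>0: "\<phi> u = 0" if "u ~: ?Q" for u using \<phi>b(3)[of u] that box_subset_cbox[of a b] by blast
  have d\<phi>0: "d\<phi> u = (%v. 0)" if "u ~: ?Q" for u
  proof -
   have "((%x. 0) has_derivative d\<phi> u) (at u)"
    by (rule has_derivative_transform_within_open[OF d\<phi>, of "- ?Q"]) (use that \<phi>0 in auto)
   thus ?thesis using has_derivative_unique has_derivative_const by metis
  qed
  have hd: "(h has_derivative h' u) (at u)" for u
  proof (cases "u : U")
   case True
   have "((%u. \<phi> u * F u) has_derivative (%v. \<phi> u * dF u v + d\<phi> u v * F u)) (at u)"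
    by (rule has_derivative_mult[OF d\<phi> dF[OF True]])
   hence "(h has_derivative (%v. \<phi> u * dF u v + d\<phi> u v * F u)) (at u)"
    by (rule has_derivative_transform_within_open[OF _ c(1) True]) (simp add: h_def)
   moreover have "h' u = (%v. \<phi> u * dF u v + d\<phi> u v * F u)" using True by (simp add: h'_def fun_eq_iff)
   ultimately show ?thesis by (simp only:)
  next
   case False
   hence uQ: "u : - ?Q" using ab(2) by blast
   have "((%u. 0::real) has_derivative (%v. 0)) (at u)" by simp
   hence "(h has_derivative (%v. 0)) (at u)"
    by (rule has_derivative_transform_within_open[OF _ _ uQ]) (auto simp: h_def \<phi>0)
   moreover have "h' u = (%v. 0)" using False by (simp add: h'_def fun_eq_iff)
   ultimately show ?thesis by (simp only:)
  qed
  have hc: "continuous_on UNIV (%u. h' u v)"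
  proof -
   have "continuous_on U (%u. \<phi> u * dF u v + d\<phi> u v * F u)"
    using smooth_on_continuous_frechet_derivative[OF smF] smooth_on_continuous_on[OF smF]
    unfolding dF_def
    by (intro continuous_intros continuous_on_subset[OF \<phi>c] continuous_on_subset[OF cd\<phi>]) auto
   hence "continuous_on U (%u. h' u v)" by (rule continuous_on_eq) (simp add: h'_def)
   moreover have "continuous_on (- ?Q) (%u. h' u v)"
    by (rule continuous_on_eq[of _ "%u. 0"]) (auto simp: h'_def \<phi>0 d\<phi>0)
   ultimately have "continuous_on (U Un - ?Q) (%u. h' u v)"
    using c(1) by (intro continuous_on_open_Un) auto
   moreover have "U Un - ?Q = UNIV" using ab(2) by blast
   ultimately show ?thesis by simp
  qed
  have h0: "(\<integral>u. h' u v \<partial>lborel) = 0"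
   by (rule integral_derivative_compact_support[OF hd hc, of a b]) (auto simp: h_def \<phi>0)
  have hsupp: "h' u v = 0" if "u ~: ?Q" for u using that by (simp add: h'_def \<phi>0 d\<phi>0)
  have ih: "integrable lborel (%u. h' u v)"
  proof -
   obtain r where "?Q \<subseteq> ball 0 r" using bounded_subset_ballD[OF bounded_cbox, of a b 0] by auto
   thus ?thesis
    by (intro integrable_continuous_bounded_support[OF hc, of r] hsupp) (auto simp: subset_iff)
  qed
  let ?q = "%u. \<phi> u * (indicator ?Q u * (w (X u) \<bullet> ?DX u))"
  have iq: "integrable lborel ?q"
  proof (rule Bochner_Integration.integrable_bound)
   have "L2sq M w < \<infinity>" using w integrable_sq_iff[OF w_measurable] by (simp add: has_weak_grad_altdef)
   thus i: "integrable lborel (%u. indicator ?Q u * (w (X u) \<bullet> ?DX u))"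
    by (rule pullback_integrable[OF ab(2) w_measurable]) auto
   have "\<phi> : borel_measurable borel" using \<phi>c by (rule borel_measurable_continuous_onI)
   thus "?q : borel_measurable lborel" using borel_measurable_integrable[OF i] by simp
   show "AE u in lborel. norm (?q u) <= norm (indicator ?Q u * (w (X u) \<bullet> ?DX u))"
   proof (rule AE_I2)
    fix u
    show "norm (?q u) <= norm (indicator ?Q u * (w (X u) \<bullet> ?DX u))"
     using \<phi>b(1,2)[of u] by (simp add: abs_mult mult_left_le_one_le)
   qed
  qed
  \<comment> \<open>The integral of \<open>h'\<close> is zero; subtracting it leaves only the errors
    of the approximation in the integrand.\<close>
  have "?I = (\<integral>u. ?q u - h' u v \<partial>lborel)"
   using h0 iq ih by (simp add: Bochner_Integration.integral_diff \<phi>_def)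
  hence "ennreal \<bar>?I\<bar> <= (\<integral>\<^sup>+u. ennreal (norm (?q u - h' u v)) \<partial>lborel)"
   using integral_norm_bound_ennreal[of lborel "%u. ?q u - h' u v"] iq ih
   by (simp add: Bochner_Integration.integrable_diff)
  also have "... <= (\<integral>\<^sup>+u. ennreal B * ennreal (indicator ?Q u * norm (g m (X u) - w (X u)))
    + ennreal B' * ennreal (indicator ?Q u * norm (f m (X u))) \<partial>lborel)"
  proof (rule nn_integral_mono_AE, rule AE_mp[OF nX], intro AE_I2 impI)
   fix u assume nu: "u : U --> norm (n (X u)) = 1 & (ALL v. n (X u) \<bullet> fderiv X u v = 0)"
   have "norm (?q u - h' u v) <= B * (indicator ?Q u * norm (g m (X u) - w (X u)))
    + B' * (indicator ?Q u * norm (f m (X u)))"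
   proof (cases "u : ?Q")
    case True
    hence u: "u : U" using ab by blast
    have "dF u v = g m (X u) \<bullet> ?DX u"
     unfolding dFX[OF u] g_def tang_def using nu u by (simp add: inner_diff_left)
    hence "?q u - h' u v = - (\<phi> u * ((g m (X u) - w (X u)) \<bullet> ?DX u) + d\<phi> u v * f m (X u))"
     using True u by (simp add: h'_def F_def inner_diff_left algebra_simps)
    hence "norm (?q u - h' u v) = \<bar>\<phi> u * ((g m (X u) - w (X u)) \<bullet> ?DX u) + d\<phi> u v * f m (X u)\<bar>"
     by (simp only: real_norm_def abs_minus_cancel)
    also have "... <= \<bar>\<phi> u\<bar> * \<bar>(g m (X u) - w (X u)) \<bullet> ?DX u\<bar> + \<bar>d\<phi> u v\<bar> * \<bar>f m (X u)\<bar>"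
     by (rule order_trans[OF abs_triangle_ineq]) (simp add: abs_mult)
    also have "... <= 1 * (norm (g m (X u) - w (X u)) * B) + B' * \<bar>f m (X u)\<bar>"
    proof (intro add_mono mult_mono)
     show "\<bar>\<phi> u\<bar> <= 1" using \<phi>b(1,2)[of u] by simp
     have "\<bar>(g m (X u) - w (X u)) \<bullet> ?DX u\<bar> <= norm (g m (X u) - w (X u)) * norm (?DX u)"
      by (rule Cauchy_Schwarz_ineq2)
     also have "... <= norm (g m (X u) - w (X u)) * B" by (intro mult_left_mono B True) simp
     finally show "\<bar>(g m (X u) - w (X u)) \<bullet> ?DX u\<bar> <= norm (g m (X u) - w (X u)) * B" .
     show "\<bar>d\<phi> u v\<bar> <= B'" by (rule B'(2)[OF True])
    qed (use B' in auto)
    finally show ?thesis using True by (simp add: mult.commute)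
   next
    case False
    thus ?thesis using hsupp by simp
   qed
   hence "ennreal (norm (?q u - h' u v)) <= ennreal (B * (indicator ?Q u * norm (g m (X u) - w (X u)))
    + B' * (indicator ?Q u * norm (f m (X u))))" by (rule ennreal_leI)
   also have "... = ennreal B * ennreal (indicator ?Q u * norm (g m (X u) - w (X u)))
    + ennreal B' * ennreal (indicator ?Q u * norm (f m (X u)))"
    using B(1) B'(1) by (subst ennreal_plus) (auto simp: ennreal_mult)
   finally show "ennreal (norm (?q u - h' u v)) <= ennreal B * ennreal (indicator ?Q u * norm (g m (X u) - w (X u)))
    + ennreal B' * ennreal (indicator ?Q u * norm (f m (X u)))" .
  qed
  also have "... = ennreal B * (\<integral>\<^sup>+u. ennreal (indicator ?Q u * norm (g m (X u) - w (X u))) \<partial>lborel)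
   + ennreal B' * (\<integral>\<^sup>+u. ennreal (indicator ?Q u * norm (f m (X u))) \<partial>lborel)"
   using mQ[of m] by (simp add: nn_integral_add nn_integral_cmult)
  finally show ?thesis .
 qed
 define V where "V = measure lborel ?Q"
 \<comment> \<open>For fixed \<open>e\<close> the limit in \<open>m\<close> removes both error
   norms; afterwards \<open>e\<close> is arbitrary.\<close>
 have bound: "\<bar>?I\<bar> <= e * ((B + B') * V)" if e: "0 < e" for e
 proof -
  have "ennreal \<bar>?I\<bar> <= ennreal B * (ennreal (e * V) + ennreal (1 / (e * \<alpha>1)) * L2sq M (%x. g m x - w x))
   + ennreal B' * (ennreal (e * V) + ennreal (1 / (e * \<alpha>2)) * L2sq M (f m))" for m
  proof (rule order_trans[OF key[of m]], intro add_mono mult_left_mono)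
   show "(\<integral>\<^sup>+u. ennreal (indicator ?Q u * norm (g m (X u) - w (X u))) \<partial>lborel)
    <= ennreal (e * V) + ennreal (1 / (e * \<alpha>1)) * L2sq M (%x. g m x - w x)"
    unfolding V_def by (rule \<alpha>1(2)[rule_format, OF _ e]) measurable
   show "(\<integral>\<^sup>+u. ennreal (indicator ?Q u * norm (f m (X u))) \<partial>lborel)
    <= ennreal (e * V) + ennreal (1 / (e * \<alpha>2)) * L2sq M (f m)"
    unfolding V_def by (rule \<alpha>2(2)[rule_format, OF _ e]) measurable
  qed auto
  moreover have "(%m. ennreal B * (ennreal (e * V) + ennreal (1 / (e * \<alpha>1)) * L2sq M (%x. g m x - w x))
   + ennreal B' * (ennreal (e * V) + ennreal (1 / (e * \<alpha>2)) * L2sq M (f m)))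
   \<longlonglongrightarrow> ennreal B * (ennreal (e * V) + ennreal (1 / (e * \<alpha>1)) * 0)
    + ennreal B' * (ennreal (e * V) + ennreal (1 / (e * \<alpha>2)) * 0)"
   using f(2,3) unfolding g_def by (intro tendsto_add ennreal_tendsto_cmult tendsto_const) auto
  ultimately have "ennreal \<bar>?I\<bar> <= ennreal B * (ennreal (e * V) + ennreal (1 / (e * \<alpha>1)) * 0)
    + ennreal B' * (ennreal (e * V) + ennreal (1 / (e * \<alpha>2)) * 0)"
   by (intro LIMSEQ_le_const) blast+
  also have "... = ennreal (B * (e * V) + B' * (e * V))"
   using B B' e by (subst ennreal_plus) (auto simp: ennreal_mult V_def)
  finally have "\<bar>?I\<bar> <= B * (e * V) + B' * (e * V)"
   using B B' e by (subst (asm) ennreal_le_iff) (auto simp: V_def)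
  thus ?thesis by (simp add: algebra_simps)
 qed
 have "\<bar>?I\<bar> <= 0"
 proof (rule field_le_epsilon)
  fix e :: real assume e: "0 < e"
  have V: "0 <= (B + B') * V" using B B' by (simp add: V_def)
  have "\<bar>?I\<bar> <= e / ((B + B') * V + 1) * ((B + B') * V)" using V e by (intro bound) auto
  also have "... <= e" using V e by (simp add: field_simps)
  finally show "\<bar>?I\<bar> <= 0 + e" by simp
 qed
 thus ?thesis by simp
qed

lemma box_integral_zero:
 assumes ab: "cbox a b \<subseteq> U"
 shows "(\<integral>u. indicator (box a b) u * (w (X u) \<bullet> fderiv X u v) \<partial>lborel) = 0"
proof (cases "box a b = {}")
 case False
 hence lt: "!!i. a $ i < b $ i" by (auto simp: interval_ne_empty_cart)
 let ?q = "%u. indicator (cbox a b) u * (w (X u) \<bullet> fderiv X u v)"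
 have L2: "L2sq M w < \<infinity>" using w integrable_sq_iff[OF w_measurable] by (simp add: has_weak_grad_altdef)
 have iq: "integrable lborel ?q" by (rule pullback_integrable[OF ab w_measurable L2]) auto
 have "(%j. \<integral>u. box_cutoff a b j u * ?q u \<partial>lborel) \<longlonglongrightarrow> (\<integral>u. indicator (box a b) u * ?q u \<partial>lborel)"
 proof (rule integral_dominated_convergence[where w = "%u. norm (?q u)"])
  show "(%u. indicator (box a b) u * ?q u) : borel_measurable lborel"
   using borel_measurable_integrable[OF iq] by simp
  have "box_cutoff a b j : borel_measurable borel" for j
   using Ck_on_SucD[OF Ck_on_box_cutoff] by (intro borel_measurable_continuous_onI) simp
  thus "(%u. box_cutoff a b j u * ?q u) : borel_measurable lborel" for j
   using borel_measurable_integrable[OF iq] by simp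
  show "integrable lborel (%u. norm (?q u))" using iq by simp
  show "AE u in lborel. (%j. box_cutoff a b j u * ?q u) \<longlonglongrightarrow> indicator (box a b) u * ?q u"
   by (intro AE_I2 tendsto_mult tendsto_const box_cutoff_bounds lt)
  show "AE u in lborel. norm (box_cutoff a b j u * ?q u) <= norm (?q u)" for j
  proof (rule AE_I2)
   fix u
   show "norm (box_cutoff a b j u * ?q u) <= norm (?q u)"
    using box_cutoff_bounds(1,2)[of a b, OF lt, where j = j and x = u] by (simp add: abs_mult mult_left_le_one_le)
  qed
 qed
 hence "(\<integral>u. indicator (box a b) u * ?q u \<partial>lborel) = 0"
  by (simp add: cutoff_integral_zero[OF lt ab] LIMSEQ_const_iff)
 moreover have "(%u. indicator (box a b) u * ?q u) = (%u. indicator (box a b) u * (w (X u) \<bullet> fderiv X u v))"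
  using box_subset_cbox[of a b] by (auto simp: fun_eq_iff indicator_def)
 ultimately show ?thesis by simp
qed simp

text \<open>The products of \<open>w\<close> with the parameter directions have vanishing integrals
  over all small boxes, so \<open>w\<close> is orthogonal to the tangent space; as a limit of
  tangential fields it is orthogonal to the normal as well.\<close>

lemma weak_grad_zero_chart: "AE x in M. x : X ` U --> w x = 0"
proof -
 note c = local_paramsD[OF X]
 have L2: "L2sq M w < \<infinity>" using w integrable_sq_iff[OF w_measurable] by (simp add: has_weak_grad_altdef)
 have boxAE: "AE u in lborel. u : box a b --> w (X u) \<bullet> fderiv X u v = 0"
  if ab: "cbox a b \<subseteq> U" for a b v
 proof -
  let ?q = "%u. indicator (box a b) u * (w (X u) \<bullet> fderiv X u v)"
  have "AE u in lborel. ?q u = 0"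
  proof (rule AE_zero_of_box_integrals[of _ a b])
   show "integrable lborel ?q"
    by (rule pullback_integrable[OF ab w_measurable L2]) (auto simp: box_subset_cbox)
   fix l u
   obtain l' u' where lu: "box l u Int box a b = box l' u'" by (simp add: box_Int_box)
   show "(\<integral>x. indicator (box l u) x * ?q x \<partial>lborel) = 0"
   proof (cases "box l' u' = {}")
    case True
    hence "(%x. indicator (box l u) x * ?q x) = (%x. 0)" using lu by (auto simp: fun_eq_iff indicator_def)
    thus ?thesis by simp
   next
    case False
    have "box l' u' \<subseteq> cbox a b" using lu box_subset_cbox[of a b] by blast
    hence "closure (box l' u') \<subseteq> cbox a b" by (rule closure_minimal[OF _ closed_cbox])
    hence "cbox l' u' \<subseteq> U" using closure_box[OF False] ab by simp
    moreover have "(%x. indicator (box l u) x * ?q x) =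
      (%x. indicator (box l' u') x * (w (X x) \<bullet> fderiv X x v))"
     unfolding lu[symmetric] by (auto simp: fun_eq_iff indicator_def)
    ultimately show ?thesis using box_integral_zero by simp
   qed
  qed simp
  thus ?thesis by eventually_elim (auto simp: indicator_def)
 qed
 define \<F> where "\<F> = {box a b | a b. cbox a b \<subseteq> U}"
 have "\<Union>\<F> = U"
 proof
  show "\<Union>\<F> \<subseteq> U" unfolding \<F>_def using box_subset_cbox by blast
  show "U \<subseteq> \<Union>\<F>"
  proof
   fix u assume "u : U"
   then obtain a b where "cbox a b \<subseteq> U" "u : box a b" using open_Union_cbox_interiors[OF c(1)] by metis
   thus "u : \<Union>\<F>" unfolding \<F>_def by blast
  qed
 qed
 moreover obtain \<F>' where F': "\<F>' \<subseteq> \<F>" "countable \<F>'" "\<Union>\<F>' = \<Union>\<F>"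
  using Lindelof[of \<F>] unfolding \<F>_def by (auto simp: open_box)
 ultimately have U: "\<Union>\<F>' = U" by simp
 have one: "AE u in lborel. u : U --> w (X u) \<bullet> fderiv X u v = 0" for v
 proof -
  have "AE u in lborel. ALL B:\<F>'. u : B --> w (X u) \<bullet> fderiv X u v = 0"
   unfolding AE_ball_countable[OF F'(2)]
  proof
   fix B assume "B : \<F>'"
   then obtain a b where "B = box a b" "cbox a b \<subseteq> U" using F'(1) unfolding \<F>_def by blast
   thus "AE u in lborel. u : B --> w (X u) \<bullet> fderiv X u v = 0" using boxAE by simp
  qed
  thus ?thesis by eventually_elim (use U in blast)
 qed
 have all: "AE u in lborel. ALL i:(UNIV::'d set). u : U --> w (X u) \<bullet> fderiv X u (axis i 1) = 0"
  using one by (intro AE_finite_allI) auto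
 have "AE x in M. norm (n x) = 1 --> w x \<bullet> n x = 0"
 proof -
  obtain f where f: "!!m. smooth_on (f m) UNIV"
   "(%m::nat. L2sq M (%x. tang (n x) (grad (f m) x) - w x)) \<longlonglongrightarrow> 0"
   using w unfolding has_weak_grad_altdef by blast
  note [measurable] = n_measurable w_measurable
  \<comment> \<open>Inside this context the normal is known to have norm 1 only in the one chart;
    the case distinction gives a function on the whole surface to which the limit argument
    applies.\<close>
  let ?z = "%x. if norm (n x) = 1 then w x \<bullet> n x else 0"
  have "L2sq M ?z <= L2sq M (%x. tang (n x) (grad (f m) x) - w x)" for m
   unfolding L2sq_def
  proof (intro nn_integral_mono ennreal_leI power_mono)
   fix x assume "x : space M"
   show "norm (?z x) <= norm (tang (n x) (grad (f m) x) - w x)"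
   proof (cases "norm (n x) = 1")
    case True
    have "w x \<bullet> n x = - ((tang (n x) (grad (f m) x) - w x) \<bullet> n x)"
     using tang_inner[OF True] by (simp add: inner_diff_left)
    thus ?thesis
     using Cauchy_Schwarz_ineq2[of "tang (n x) (grad (f m) x) - w x" "n x"] True by simp
   qed simp
  qed simp
  hence "L2sq M ?z <= 0" by (intro LIMSEQ_le_const[OF f(2)]) blast
  hence "(\<integral>\<^sup>+x. ennreal ((norm (?z x))^2) \<partial>M) = 0" by (simp add: L2sq_def)
  hence "AE x in M. ennreal ((norm (?z x))^2) = 0" by (subst (asm) nn_integral_0_iff_AE) auto
  thus ?thesis by eventually_elim (auto split: if_splits)
 qed
 hence "AE x in M. x : X ` U --> (norm (n x) = 1 --> w x \<bullet> n x = 0)" by eventually_elim simp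
 hence tn: "AE u in lborel. u : U --> (norm (n (X u)) = 1 --> w (X u) \<bullet> n (X u) = 0)"
  by (subst (asm) AE_chart[OF surf X])
 have "AE u in lborel. u : U --> w (X u) = 0"
  using all nX tn
 proof eventually_elim
  fix u assume a: "ALL i:UNIV. u : U --> w (X u) \<bullet> fderiv X u (axis i 1) = 0"
   "u : U --> norm (n (X u)) = 1 & (ALL v. n (X u) \<bullet> fderiv X u v = 0)"
   "u : U --> norm (n (X u)) = 1 --> w (X u) \<bullet> n (X u) = 0"
  show "u : U --> w (X u) = 0"
  proof
   assume u: "u : U"
   let ?D = "fderiv X u"
   have lin: "linear ?D" by (rule smooth_on_linear_frechet_derivative[OF c(2) u])
   have o: "w (X u) \<bullet> ?D v = 0" for v
   proof -
    have "?D v = ?D (\<Sum>i\<in>UNIV. (v $ i) *\<^sub>R axis i 1)"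
     using basis_expansion[of v] by (simp add: scalar_mult_eq_scaleR)
    also have "... = (\<Sum>i\<in>UNIV. (v $ i) *\<^sub>R ?D (axis i 1))"
     by (simp add: linear_sum[OF lin] linear_scale[OF lin])
    finally show ?thesis using a(1) u by (simp add: inner_sum_right)
   qed
   have "w (X u) = (w (X u) \<bullet> n (X u)) *\<^sub>R n (X u)"
    by (rule normal_space_eq[OF lin c(5)[OF u]]) (use a(2) u o in auto)
   thus "w (X u) = 0" using a u by simp
  qed
 qed
 thus ?thesis by (subst AE_chart[OF surf X])
qed

end

end

section \<open>Polynomials along lines\<close>

text \<open>Subtracting a rescaled copy of the polynomial removes its leading coefficient.\<close>

lemma coeff_bound_unit_interval:
 "EX C>=0. ALL (p::real poly) e. degree p <= k --> (ALL t:{0..1}. \<bar>poly p t\<bar> <= e) --> (ALL j. \<bar>coeff p j\<bar> <= C * e)"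
proof (induction k)
 case 0
 show ?case
 proof (intro exI[of _ 1] conjI allI impI)
  fix p :: "real poly" and e :: real and j
  assume "degree p <= 0" and b: "ALL t:{0..1}. \<bar>poly p t\<bar> <= e"
  then obtain a where p: "p = [:a:]" by (metis degree_eq_zeroE le_zero_eq)
  have "\<bar>a\<bar> <= e" using bspec[OF b, of 0] by (simp add: p)
  thus "\<bar>coeff p j\<bar> <= 1 * e" by (cases j) (simp_all add: p)
 qed simp
next
 case (Suc k)
 then obtain C where C: "0 <= C"
  "!!(p::real poly) e. degree p <= k ==> ALL t:{0..1}. \<bar>poly p t\<bar> <= e ==> ALL j. \<bar>coeff p j\<bar> <= C * e" by blast
 define B where "B = C * (1 + 2 ^ Suc k)"
 have B: "0 <= B" using C(1) by (simp add: B_def)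
 define C' where "C' = 1 + (real (Suc k) + 1) * B"
 show ?case
 proof (intro exI[of _ C'] conjI allI impI)
  show "0 <= C'" using B by (simp add: C'_def)
  fix p :: "real poly" and e :: real and j
  assume deg: "degree p <= Suc k" and b: "ALL t:{0..1}. \<bar>poly p t\<bar> <= e"
  have e: "0 <= e" using bspec[OF b, of 0] by simp
  define r where "r = p - smult (2 ^ Suc k) (pcompose p [:0, 1/2:])"
  have cr: "coeff r i = coeff p i * (1 - 2 ^ Suc k * (1/2) ^ i)" for i
   unfolding r_def coeff_diff coeff_smult coeff_pcompose_linear
   by (simp add: algebra_simps del: power_Suc)
  have "degree r <= k"
  proof (rule degree_le, intro allI impI)
   fix i assume "k < i"
   then consider "i = Suc k" | "Suc k < i" by linarith
   thus "coeff r i = 0"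
   proof cases
    case 1
    thus ?thesis by (simp add: cr power_one_over)
   next
    case 2
    thus ?thesis using deg by (simp add: cr coeff_eq_0)
   qed
  qed
  moreover have "ALL t:{0..1}. \<bar>poly r t\<bar> <= (1 + 2 ^ Suc k) * e"
  proof
   fix t :: real assume t: "t : {0..1}"
   have "\<bar>poly r t\<bar> <= \<bar>poly p t\<bar> + 2 ^ Suc k * \<bar>poly p (t / 2)\<bar>"
    unfolding r_def using abs_triangle_ineq4[of "poly p t" "2 ^ Suc k * poly p (t / 2)"]
    by (simp add: poly_pcompose abs_mult)
   also have "... <= e + 2 ^ Suc k * e" using b t by (intro add_mono mult_left_mono) auto
   finally show "\<bar>poly r t\<bar> <= (1 + 2 ^ Suc k) * e" by (simp add: distrib_right)
  qed
  ultimately have rb: "\<bar>coeff r i\<bar> <= B * e" for i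
   using C(2)[of r "(1 + 2 ^ Suc k) * e"] by (simp add: B_def mult.assoc)
  have low: "\<bar>coeff p i\<bar> <= B * e" if "i <= k" for i
  proof -
   \<comment> \<open>Below the leading index the factor \<open>1 - 2 ^ (Suc k - i)\<close> has
     absolute value at least 1, so a coefficient of \<open>p\<close> is bounded by that of
     \<open>r\<close>.\<close>
   have "(2::real) ^ Suc k * (1/2) ^ i = 2 ^ (Suc k - i)"
    using that by (simp add: power_one_over power_diff del: power_Suc)
   moreover have "(2::real) ^ 1 <= 2 ^ (Suc k - i)" using that by (intro power_increasing) auto
   ultimately have "1 <= \<bar>1 - (2::real) ^ Suc k * (1/2) ^ i\<bar>" by (simp del: power_Suc)
   hence "\<bar>coeff p i\<bar> * 1 <= \<bar>coeff p i\<bar> * \<bar>1 - 2 ^ Suc k * (1/2) ^ i\<bar>" by (intro mult_left_mono) auto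
   also have "... = \<bar>coeff r i\<bar>" by (simp add: cr abs_mult)
   finally show ?thesis using rb[of i] by simp
  qed
  \<comment> \<open>The leading coefficient is lost in \<open>r\<close>; it is recovered from the
    value at 1, the sum of all coefficients.\<close>
  have top: "\<bar>coeff p (Suc k)\<bar> <= e + real (Suc k) * (B * e)"
  proof -
   have "poly p 1 = (\<Sum>i\<le>Suc k. coeff p i)"
   proof -
    have "poly p 1 = (\<Sum>i\<le>degree p. coeff p i)" by (simp add: poly_altdef)
    also have "... = (\<Sum>i\<le>Suc k. coeff p i)"
     using deg by (intro sum.mono_neutral_left) (auto simp: coeff_eq_0)
    finally show ?thesis .
   qed
   hence "coeff p (Suc k) = poly p 1 - (\<Sum>i\<le>k. coeff p i)" by simp
   also have "\<bar>...\<bar> <= \<bar>poly p 1\<bar> + (\<Sum>i\<le>k. \<bar>coeff p i\<bar>)"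
    by (rule order_trans[OF abs_triangle_ineq4]) (intro add_left_mono sum_abs)
   also have "... <= e + (\<Sum>i\<le>k. B * e)" using b low by (intro add_mono sum_mono) auto
   finally show ?thesis by simp
  qed
  have Be: "0 <= B * e" using B e by simp
  have C'e: "C' * e = e + real (Suc k) * (B * e) + B * e"
   by (simp only: C'_def distrib_right mult_1 mult.assoc add.assoc)
  show "\<bar>coeff p j\<bar> <= C' * e"
  proof -
   consider "j <= k" | "j = Suc k" | "Suc k < j" by linarith
   thus ?thesis
   proof cases
    case 1
    have "\<bar>coeff p j\<bar> <= B * e" by (rule low[OF 1])
    also have "... <= C' * e"
     unfolding C'e using e Be mult_nonneg_nonneg[of "real (Suc k)" "B * e"] by linarith
    finally show ?thesis .
   next
    case 2
    show ?thesis using top Be unfolding 2 C'e by linarith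
   next
    case 3
    thus ?thesis using deg e \<open>0 <= C'\<close> by (simp add: coeff_eq_0)
   qed
  qed
 qed
qed

text \<open>Rescaling the interval from 0 to \<open>s\<close> to the unit interval multiplies the
  linear coefficient, which is the derivative at the endpoint, by \<open>s\<close>.\<close>

lemma markov_at_endpoint:
 obtains C :: real where "0 < C"
  "!!(p::real poly) s e. degree p <= k ==> 0 < s ==> (!!t. 0 <= t ==> t <= s ==> \<bar>poly p t\<bar> <= e) ==>
   \<bar>coeff p 1\<bar> * s <= C * e"
proof -
 obtain C where C: "0 <= C"
  "!!(p::real poly) e. degree p <= k ==> ALL t:{0..1}. \<bar>poly p t\<bar> <= e ==> ALL j. \<bar>coeff p j\<bar> <= C * e"
  using coeff_bound_unit_interval[of k] by blast
 show ?thesis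
 proof (rule that[of "C + 1"])
  fix p :: "real poly" and s e :: real
  assume deg: "degree p <= k" and s: "0 < s" and b: "!!t. 0 <= t ==> t <= s ==> \<bar>poly p t\<bar> <= e"
  have e: "0 <= e" using b[of 0] s by simp
  let ?q = "pcompose p [:0, s:]"
  have "degree ?q <= k" using deg s by (simp add: degree_pcompose)
  moreover have "ALL t:{0..1}. \<bar>poly ?q t\<bar> <= e"
   using b s by (auto simp: poly_pcompose mult_left_le_one_le mult.commute)
  ultimately have "\<bar>coeff ?q 1\<bar> <= C * e" using C(2) by blast
  thus "\<bar>coeff p 1\<bar> * s <= (C + 1) * e"
   using s e by (simp add: coeff_pcompose_linear abs_mult algebra_simps)
 qed (use C in simp)
qed

lemma degree_sum_le_infinite:
 "(!!i. i : I ==> degree (f i) <= k) ==> degree (\<Sum>i\<in>I. f i) <= k"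
 by (cases "finite I") (auto intro: degree_sum_le)

text \<open>All that the Markov inequality asks of an element map is its degree along lines, and
  this is easily read off for polynomials composed with affine maps and for combinations with fixed
  weights.\<close>

definition line_poly :: "nat => ('a::real_vector => real) => bool" where
 "line_poly k f \<longleftrightarrow> (ALL x v. EX p. degree p <= k & (ALL t. f (x + t *\<^sub>R v) = poly p t))"

lemma line_poly_poly_space:
 fixes q :: "real^'m::finite => real" and A :: "'a::real_vector => real^'m"
 assumes q: "q : poly_space k" and A: "linear A"
 shows "line_poly k (%x. q (b + A x))"
 unfolding line_poly_def
proof (intro allI)
 fix x v
 obtain c where c: "!!x. q x = (\<Sum>a | (\<Sum>i\<in>UNIV. a i) <= k. c a * (\<Prod>i\<in>UNIV. (x $ i) ^ a i))"
  using q by (auto simp: poly_space_def)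
 define l where "l i = [:(b + A x) $ i, A v $ i:]" for i
 define p where "p = (\<Sum>a | (\<Sum>i\<in>(UNIV::'m set). a i) <= k. smult (c a) (\<Prod>i\<in>UNIV. l i ^ a i))"
 have "poly p t = q (b + A (x + t *\<^sub>R v))" for t
 proof -
  have "b + A (x + t *\<^sub>R v) = (b + A x) + t *\<^sub>R A v"
   by (simp add: linear_add[OF A] linear_scale[OF A])
  hence "(b + A (x + t *\<^sub>R v)) $ i = poly (l i) t" for i by (simp add: l_def)
  thus ?thesis unfolding c p_def by (simp add: poly_sum poly_prod)
 qed
 moreover have "degree p <= k"
  unfolding p_def
 proof (rule degree_sum_le_infinite)
  fix a :: "'m => nat" assume a: "a : {a. (\<Sum>i\<in>UNIV. a i) <= k}"
  have "degree (\<Prod>i\<in>UNIV. l i ^ a i) <= (\<Sum>i\<in>UNIV. degree (l i ^ a i))"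
   using degree_prod_sum_le[of UNIV "%i. l i ^ a i"] by (simp add: o_def)
  also have "... <= (\<Sum>i\<in>UNIV. a i)"
  proof (rule sum_mono)
   fix i
   have "degree (l i ^ a i) <= degree (l i) * a i" by (rule degree_power_le)
   also have "... <= 1 * a i" by (intro mult_right_mono) (auto simp: l_def)
   finally show "degree (l i ^ a i) <= a i" by simp
  qed
  finally show "degree (smult (c a) (\<Prod>i\<in>UNIV. l i ^ a i)) <= k"
   using a degree_smult_le[of "c a" "\<Prod>i\<in>UNIV. l i ^ a i"] by simp
 qed
 ultimately show "EX p. degree p <= k & (ALL t. q (b + A (x + t *\<^sub>R v)) = poly p t)" by metis
qed

lemma line_poly_linear_combination:
 assumes "!!i. i : I ==> line_poly k (f i)"
 shows "line_poly k (%x. \<Sum>i\<in>I. f i x * w i)"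
 unfolding line_poly_def
proof (intro allI)
 fix x v
 have "EX p. ALL i:I. degree (p i) <= k & (ALL t. f i (x + t *\<^sub>R v) = poly (p i) t)"
  by (intro bchoice ballI) (use assms in \<open>simp add: line_poly_def\<close>)
 then obtain p where p: "!!i. i : I ==> degree (p i) <= k & (ALL t. f i (x + t *\<^sub>R v) = poly (p i) t)" by blast
 have "degree (\<Sum>i\<in>I. smult (w i) (p i)) <= k"
  using p degree_smult_le order_trans by (intro degree_sum_le_infinite) blast
 moreover have "(\<Sum>i\<in>I. f i (x + t *\<^sub>R v) * w i) = poly (\<Sum>i\<in>I. smult (w i) (p i)) t" for t
  using p by (simp add: poly_sum mult.commute)
 ultimately show "EX p. degree p <= k & (ALL t. (\<Sum>i\<in>I. f i (x + t *\<^sub>R v) * w i) = poly p t)" by metis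
qed

lemma smooth_on_poly_space:
 fixes q :: "real^'m::finite => real"
 assumes "q : poly_space k"
 shows "smooth_on q UNIV"
proof -
 obtain c where c: "!!x. q x = (\<Sum>a | (\<Sum>i\<in>UNIV. a i) <= k. c a * (\<Prod>i\<in>UNIV. (x $ i) ^ a i))"
  using assms by (auto simp: poly_space_def)
 have "smooth_on (%x. \<Sum>a | (\<Sum>i\<in>UNIV. a i) <= k. c a * (\<Prod>i\<in>(UNIV::'m set). (x $ i) ^ a i)) UNIV"
  by (intro smooth_on_sum smooth_on_mult smooth_on_const smooth_on_prod smooth_on_power
    smooth_on_component smooth_on_ident open_UNIV)
 moreover have "q = (%x. \<Sum>a | (\<Sum>i\<in>UNIV. a i) <= k. c a * (\<Prod>i\<in>(UNIV::'m set). (x $ i) ^ a i))"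
  by (rule ext) (rule c)
 ultimately show ?thesis by simp
qed

section \<open>The reference simplex and the triangulation\<close>

abbreviation Tr :: "(real^'d::finite) set" where "Tr == ref_simplex"

lemma convex_ref_simplex: "convex Tr"
 and compact_ref_simplex: "compact Tr"
 and interior_ref_simplex_nonempty: "interior (Tr :: (real^'d::finite) set) ~= {}"
proof -
 show "convex Tr" by (simp add: ref_simplex_def convex_convex_hull)
 show "compact Tr" by (simp add: ref_simplex_def finite_imp_compact_convex_hull)
 have "rel_interior (convex hull (insert 0 (Basis::(real^'d) set))) ~= {}"
  by (simp add: rel_interior_eq_empty)
 show "interior (Tr :: (real^'d) set) ~= {}"
  using interior_std_simplex_nonempty[where 'a = "real^'d"] by (auto simp: ref_simplex_def)
qed

lemma closure_interior_ref_simplex: "closure (interior Tr) = (Tr :: (real^'d::finite) set)"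
 using convex_closure_interior[OF convex_ref_simplex interior_ref_simplex_nonempty]
  by (simp add: closure_closed[OF compact_imp_closed[OF compact_ref_simplex]])

lemma vertices_ref_simplex: "0 : Tr" "axis i 1 : Tr"
 unfolding ref_simplex_def by (rule hull_inc, simp add: axis_in_Basis_iff)+

lemma norm_ref_simplex: "(x :: real^'d::finite) : Tr ==> norm x <= 1"
proof -
 have "Tr \<subseteq> cball (0::real^'d) 1"
  unfolding ref_simplex_def by (rule hull_minimal) auto
 thus "x : Tr ==> norm x <= 1" by auto
qed

lemma negligible_skeleton: "negligible (Tr - interior (Tr :: (real^'d::finite) set))"
proof -
 have "negligible (frontier (Tr :: (real^'d) set))"
  by (rule negligible_convex_frontier[OF convex_ref_simplex])
 thus ?thesis
  by (simp add: frontier_def closure_closed[OF compact_imp_closed[OF compact_ref_simplex]])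
qed

lemma compact_skeleton: "compact (Tr - interior (Tr :: (real^'d::finite) set))"
 by (intro compact_diff compact_ref_simplex open_interior)

text \<open>The image has affine dimension D, so the linear part has full rank; with a kernel vector
  \<open>v\<close> already the hyperplane orthogonal to \<open>v\<close> would produce the whole
  range.\<close>

lemma simplex_map_inj:
 fixes A :: "real^'d::finite => 'd ambient"
 assumes T: "int CARD('d) simplex T" and A: "linear A" and im: "(%x. b + A x) ` Tr = T"
 shows "inj A"
proof -
 have "aff_dim T = int CARD('d)" using T by (rule aff_dim_simplex)
 have "T \<subseteq> (+) b ` range A" unfolding im[symmetric] by auto
 hence "aff_dim T <= aff_dim ((+) b ` range A)" by (rule aff_dim_subset)
 also have "... = aff_dim (range A)" by (simp add: aff_dim_translation_eq)
 also have "... = int (dim (range A))"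
  by (rule aff_dim_subspace) (rule linear_subspace_image[OF A subspace_UNIV])
 finally have "CARD('d) <= dim (range A)" using \<open>aff_dim T = int CARD('d)\<close> by simp
 hence full: "CARD('d) <= dim (range A)" by simp
 show ?thesis
  unfolding linear_injective_0[OF A]
 proof (intro allI impI, rule ccontr)
  fix v assume v: "A v = 0" "v ~= 0"
  have "range A \<subseteq> A ` {x. v \<bullet> x = 0}"
  proof (intro image_subsetI)
   fix x
   have "A x = A (x - (v \<bullet> x / (v \<bullet> v)) *\<^sub>R v)"
    using v(1) by (simp add: linear_diff[OF A] linear_scale[OF A])
   moreover have "v \<bullet> (x - (v \<bullet> x / (v \<bullet> v)) *\<^sub>R v) = 0" using v(2) by (simp add: inner_diff_right)
   ultimately show "A x : A ` {x. v \<bullet> x = 0}" by blast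
  qed
  hence "dim (range A) <= dim (A ` {x. v \<bullet> x = 0})" by (rule dim_subset)
  also have "... <= dim {x. v \<bullet> x = 0}" by (rule dim_image_le[OF A])
  also have "... < CARD('d)" using v(2) by (simp add: dim_hyperplane)
  finally show False using full by simp
 qed
qed

text \<open>The intersection is a face of both simplices. Meeting the relative interior of
  \<open>T\<close> it would be all of \<open>T\<close>, and \<open>T\<close> would be a proper face
  of \<open>T'\<close> of the same dimension.\<close>

lemma simplex_rel_interior_disjoint:
 fixes T T' :: "'a::euclidean_space set"
 assumes tr: "triangulation TT" and T: "T : TT" "T' : TT" "T ~= T'"
  and d: "d simplex T" "d simplex T'"
 shows "rel_interior T Int T' = {}"
proof (rule ccontr)
 assume ne: "rel_interior T Int T' ~= {}"
 have f: "(T Int T') face_of T" "(T' Int T) face_of T'" using tr T unfolding triangulation_def by blast+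
 have "(T Int T') Int rel_interior T ~= {}" using ne rel_interior_subset by blast
 hence eq: "T Int T' = T" using face_of_disjoint_rel_interior[OF f(1)] by blast
 hence "T face_of T'" using f(2) by (simp add: Int_commute)
 moreover have "convex T'" using d(2) by (metis simplex convex_convex_hull)
 ultimately have "aff_dim T < aff_dim T'" using T(3) face_of_aff_dim_lt by blast
 thus False using aff_dim_simplex[OF d(1)] aff_dim_simplex[OF d(2)] by simp
qed

text \<open>Turns bounds on the normals, given only almost everywhere, into bounds at every interior
  point of an element: a nonempty open set is not negligible.\<close>

lemma AE_nonneg_imp_nonneg:
 fixes f :: "'a::euclidean_space => real"
 assumes U: "open U" and f: "continuous_on U f" and ae: "AE u in lborel. u : U --> 0 <= f u" and u: "u : U"
 shows "0 <= f u"
proof (rule ccontr)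
 assume "~ 0 <= f u"
 hence ne: "u : U Int f -` {..<0}" using u by simp
 have op: "open (U Int f -` {..<0})" by (intro continuous_open_preimage f U) auto
 have "AE u in lborel. u ~: U Int f -` {..<0}" using ae by eventually_elim auto
 hence "U Int f -` {..<0} : null_sets lborel"
  using op by (subst (asm) AE_iff_null_sets[symmetric]) auto
 hence "negligible (U Int f -` {..<0})"
  unfolding negligible_iff_null_sets using op by (simp add: null_sets_completion_iff)
 thus False using open_not_negligible[OF op] ne by blast
qed

text \<open>Near pairs are handled by the immersion property, distant pairs by compactness of the
  set of such pairs together with injectivity.\<close>

lemma injective_immersion_lower_lipschitz:
 fixes f :: "'a::euclidean_space => 'b::euclidean_space"
 assumes \<Omega>: "open \<Omega>" "C \<subseteq> \<Omega>" and f: "smooth_on f \<Omega>" and C: "compact C" and inj: "inj_on f C"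
  and D: "!!x. x : C ==> inj (fderiv f x)"
 obtains m where "0 < m" "!!x y. x : C ==> y : C ==> m * norm (x - y) <= norm (f x - f y)"
proof -
 have cf: "continuous_on C f" using smooth_on_continuous_on[OF f] \<Omega>(2) continuous_on_subset by blast
 define P where "P x y M \<longleftrightarrow> 0 < M & norm (x - y) <= M * norm (f x - f y)" for x y and M :: real
 have mono: "P x y M ==> M <= M' ==> P x y M'" for x y M M'
  unfolding P_def by (meson dual_order.strict_trans1 mult_right_mono norm_ge_zero order_trans)
 obtain e M where e: "0 < e" "!!x y. x : C ==> y : C ==> dist x y < e ==> P x y M"
 proof (rule compact_uniform_local[OF C _ mono])
  fix x assume x: "x : C"
  hence "x : \<Omega>" using \<Omega> by blast
  then obtain r m where r: "0 < r" "0 < m"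
   "!!y z. y : ball x r ==> z : ball x r ==> m * norm (y - z) <= norm (f y - f z)"
   using smooth_on_locally_bilipschitz[OF \<Omega>(1) _ f D[OF x]] by metis
  have "P y z (1 / m)" if "y : ball x r" "z : ball x r" for y z
   using r(3)[OF that] r(2) by (simp add: P_def field_simps)
  thus "EX e>0. EX M. ALL y:C Int ball x e. ALL z:C Int ball x e. P y z M" using r(1) by blast
 qed auto
 define Z where "Z = {(x, y). x : C & y : C & e <= dist x y}"
 have "Z = (C \<times> C) Int {z. e <= dist (fst z) (snd z)}" by (auto simp: Z_def)
 moreover have "closed {z::'a \<times> 'a. e <= dist (fst z) (snd z)}"
  by (intro closed_Collect_le continuous_intros)
 ultimately have cZ: "compact Z" using C by (simp add: compact_Times compact_Int_closed)
 obtain B where B: "0 < B" "!!x y. x : C ==> y : C ==> norm (x - y) <= B"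
 proof -
  obtain B where "0 < B" "!!x. x : C ==> norm x <= B"
   using compact_imp_bounded[OF C] unfolding bounded_pos by blast
  thus ?thesis using that[of "2 * B"] norm_triangle_ineq4 by (smt (verit))
 qed
 have "EX \<mu>>0. ALL z:Z. \<mu> <= norm (f (fst z) - f (snd z))"
 proof (cases "Z = {}")
  case False
  have "continuous_on Z (%z. norm (f (fst z) - f (snd z)))"
   by (intro continuous_intros continuous_on_compose2[OF cf]) (auto simp: Z_def)
  then obtain z where z: "z : Z" "ALL z':Z. norm (f (fst z) - f (snd z)) <= norm (f (fst z') - f (snd z'))"
   using continuous_attains_inf[OF cZ False] by blast
  have "fst z : C" "snd z : C" "fst z ~= snd z" using z(1) e(1) by (auto simp: Z_def)
  hence "f (fst z) ~= f (snd z)" using inj_onD[OF inj] by blast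
  thus ?thesis using z(2) by (intro exI[of _ "norm (f (fst z) - f (snd z))"]) auto
 qed (auto intro: exI[of _ 1])
 then obtain \<mu> where \<mu>: "0 < \<mu>" "!!x y. x : C ==> y : C ==> e <= dist x y ==> \<mu> <= norm (f x - f y)"
  unfolding Z_def by force
 define M' where "M' = max (max M 1) (B / \<mu>)"
 have M': "0 < M'" by (simp add: M'_def less_max_iff_disj)
 have main: "norm (x - y) <= M' * norm (f x - f y)" if xy: "x : C" "y : C" for x y
 proof (cases "dist x y < e")
  case True
  thus ?thesis using mono[OF e(2)[OF xy True], of M'] by (simp add: M'_def P_def)
 next
  case False
  have "norm (x - y) <= B" by (rule B(2)[OF xy])
  also have "... = B / \<mu> * \<mu>" using \<mu>(1) by simp
  also have "... <= M' * norm (f x - f y)"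
   using \<mu> B M' False xy by (intro mult_mono) (auto simp: M'_def)
  finally show ?thesis .
 qed
 show ?thesis
  by (rule that[of "1 / M'"]) (use M' main in \<open>auto simp: field_simps\<close>)
qed

section \<open>Elements of the approximate surface\<close>

definition markov_const :: "nat => real => bool" where
 "markov_const k C \<longleftrightarrow> 0 < C & (ALL (p::real poly) s e. degree p <= k --> 0 < s -->
   (ALL t. 0 <= t --> t <= s --> \<bar>poly p t\<bar> <= e) --> \<bar>coeff p 1\<bar> * s <= C * e)"

context tubular
begin

text \<open>Bounds distances within the tube, and with them the mesh size, by a number that is
  independent of the mesh.\<close>

definition extent :: real where "extent = diameter Sg + 2 * reach"

lemma extent_pos: "0 < extent"
 using reach_pos diameter_ge_0[OF compact_imp_bounded[OF compact]] by (simp add: extent_def)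

lemma tube_diameter:
 assumes "x : tube" "y : tube"
 shows "dist x y <= extent"
proof -
 have "dist (cp x) (cp y) <= diameter Sg"
  by (rule diameter_bounded_bound[OF compact_imp_bounded[OF compact] cp_in cp_in])
 moreover have "dist x (cp x) <= reach" "dist y (cp y) <= reach"
  using assms infdist_eq by (auto simp: tube_def less_imp_le)
 ultimately show ?thesis
  using dist_triangle[of x y "cp x"] dist_triangle[of "cp x" y "cp y"]
  by (simp add: extent_def dist_commute)
qed

text \<open>A map whose image stays in a thin strip and which is polynomial along a segment is almost
 tangential: the height varies by at most \<open>2\<delta>\<close>, so the slope is of order \<open>sqrt \<delta>\<close>.\<close>

lemma thin_strip_slope:
 fixes P :: "'b::real_vector => 'd ambient"
 assumes M: "markov_const k M" and \<delta>: "0 < \<delta>" "\<delta> <= 1" "\<delta> <= reach"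
  and p: "degree p <= k" "!!t. (P (x + t *\<^sub>R v) - P x) \<bullet> n (cp (P x)) = poly p t"
  and inside: "!!t. 0 <= t ==> t <= 1 ==> infdist (P (x + t *\<^sub>R v)) Sg < \<delta>"
  and lip: "!!t. 0 <= t ==> t <= 1 ==> norm (P (x + t *\<^sub>R v) - P x) <= B * t" and B: "0 <= B"
 shows "\<bar>coeff p 1\<bar> <= M * (4 * K * B^2 + 2) * sqrt \<delta>"
proof -
 have tb: "P (x + t *\<^sub>R v) : tube" if "0 <= t" "t <= 1" for t
  using inside[OF that] \<delta>(3) by (simp add: tube_def)
 have tb0: "P x : tube" and in0: "infdist (P x) Sg < \<delta>" using tb[of 0] inside[of 0] by auto
 define s where "s = sqrt \<delta>"
 have s: "0 < s" "s <= 1" "s^2 = \<delta>" using \<delta> by (auto simp: s_def)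
 have "\<bar>poly p t\<bar> <= (4 * K * B^2 + 2) * \<delta>" if t: "0 <= t" "t <= s" for t
 proof -
  let ?y = "P (x + t *\<^sub>R v)" and ?x = "P x"
  have t1: "0 <= t" "t <= 1" using t s by auto
  note yt = tb[OF t1]
  have "?y - ?x = (cp ?y - cp ?x) + (height ?y *\<^sub>R n (cp ?y) - height ?x *\<^sub>R n (cp ?x))"
   using decomp[of ?y] decomp[of ?x] by (simp add: algebra_simps)
  hence "poly p t = (cp ?y - cp ?x) \<bullet> n (cp ?x)
    + (height ?y *\<^sub>R n (cp ?y) - height ?x *\<^sub>R n (cp ?x)) \<bullet> n (cp ?x)"
   unfolding p(2)[symmetric] by (metis inner_add_left)
  also have "\<bar>...\<bar> <= \<bar>(cp ?y - cp ?x) \<bullet> n (cp ?x)\<bar>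
    + \<bar>(height ?y *\<^sub>R n (cp ?y) - height ?x *\<^sub>R n (cp ?x)) \<bullet> n (cp ?x)\<bar>"
   by (rule abs_triangle_ineq)
  also have "\<bar>(cp ?y - cp ?x) \<bullet> n (cp ?x)\<bar> <= K * (2 * (B * s))^2"
  proof -
   have l: "norm (cp ?x - cp ?y) <= 2 * (B * s)"
   proof -
    have "norm (cp ?x - cp ?y) <= 2 * norm (?x - ?y)" by (rule cp_lipschitz[OF tb0 yt])
    also have "norm (?x - ?y) <= B * t" using lip[OF t1] by (simp add: norm_minus_commute)
    also have "B * t <= B * s" using B t by (intro mult_left_mono) auto
    finally show ?thesis by simp
   qed
   have "\<bar>(cp ?y - cp ?x) \<bullet> n (cp ?x)\<bar> <= K * (norm (cp ?x - cp ?y))^2"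
    using n_curvature[OF cp_in cp_in] by (simp add: inner_commute)
   also have "... <= K * (2 * (B * s))^2" using l K_pos by (intro mult_left_mono power_mono) auto
   finally show ?thesis .
  qed
  also have "\<bar>(height ?y *\<^sub>R n (cp ?y) - height ?x *\<^sub>R n (cp ?x)) \<bullet> n (cp ?x)\<bar> <= 2 * \<delta>"
  proof -
   have "\<bar>(height ?y *\<^sub>R n (cp ?y) - height ?x *\<^sub>R n (cp ?x)) \<bullet> n (cp ?x)\<bar>
     <= norm (height ?y *\<^sub>R n (cp ?y) - height ?x *\<^sub>R n (cp ?x)) * norm (n (cp ?x))"
    by (rule Cauchy_Schwarz_ineq2)
   also have "... <= \<bar>height ?y\<bar> + \<bar>height ?x\<bar>"
    using norm_triangle_ineq4[of "height ?y *\<^sub>R n (cp ?y)" "height ?x *\<^sub>R n (cp ?x)"]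
    by (simp add: norm_n[OF cp_in])
   also have "... <= \<delta> + \<delta>" using inside[OF t1] in0 by (simp add: abs_height)
   finally show ?thesis by simp
  qed
  finally show ?thesis using s(3) by (simp add: power_mult_distrib algebra_simps)
 qed
 hence "\<bar>coeff p 1\<bar> * s <= M * ((4 * K * B^2 + 2) * \<delta>)"
  using M p(1) s(1) unfolding markov_const_def by blast
 also have "... = (M * (4 * K * B^2 + 2) * s) * s" using s(3) by (simp add: power2_eq_square mult_ac)
 finally show ?thesis using s(1) by (simp add: s_def mult_le_cancel_right)
qed

end

text \<open>The numerical assumptions at the end serve two regimes. If \<open>h < h0\<close> then
  \<open>c * h ^ k <= 1/2\<close>. Otherwise every element has diameter at least
  \<open>h0 / \<eta>\<close>, and \<open>\<delta>_slope\<close> makes the slope that a strip of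
  width \<open>\<delta>\<close> permits at most half of the lower shape bound.\<close>

locale mesh = oriented_tubular Sg n K
 for Sg :: "('d::finite) ambient set" and n K +
 fixes \<delta> :: real and k :: nat and \<rho> \<eta> c :: real and TT :: "'d ambient set set"
  and F :: "'d ambient set => real^'d => 'd ambient" and L N :: "'d ambient => 'd ambient"
  and mh :: "'d ambient measure" and mg :: "'d ambient measure" and M h0 :: real
 assumes approx: "approx_surface Sg \<delta> k \<rho> \<eta> c TT F L N mh"
  and mg: "surface_measure Sg mg"
  and pos: "0 < \<rho>" "0 < \<eta>" "0 < c" "1 <= k"
  and markov: "markov_const k M"
  and \<delta>_small: "0 < \<delta>" "\<delta> <= 1" "\<delta> <= reach" "32 * K * \<delta> <= 1"
  and h0: "0 < h0" "h0 <= 1" "c * h0 <= 1/2"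
  and \<delta>_slope: "4 * real CARD('d) * M * (16 * K * (extent / \<rho>)^2 + 2) * sqrt \<delta> <= \<rho> * (h0 / \<eta>)"
begin

definition Sh :: "'d ambient set" where "Sh = L ` \<Union>TT"
definition h :: real where "h = mesh_size TT L"
definition Or :: "(real^'d) set" where "Or = interior Tr"

lemma approx_facts:
 shows tri: "triangulation TT" and simp: "!!T. T : TT ==> int CARD('d) simplex T"
  and aff: "!!T. T : TT ==> EX b A. linear A & F T = (%x. b + A x)"
  and F_im: "!!T. T : TT ==> F T ` Tr = T"
  and L_cont: "continuous_on (\<Union>TT) L" and L_inj: "inj_on L (\<Union>TT)"
  and L_lagrange: "!!T. T : TT ==> EX \<phi>. lagrange_basis k T \<phi> & (ALL x:T. L x = (\<Sum>y\<in>lagrange_nodes k T. \<phi> y x *\<^sub>R L y))"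
  and Sh_strip: "Sh \<subseteq> strip Sg \<delta>" and bij: "bij_betw cp Sh Sg"
  and shape: "!!T x \<xi>. T : TT ==> x : Tr ==>
    \<rho> * diameter (L ` T) * norm \<xi> <= norm (frechet_derivative (L \<circ> F T) (at x within Tr) \<xi>) \<and>
    norm (frechet_derivative (L \<circ> F T) (at x within Tr) \<xi>) <= inverse \<rho> * diameter (L ` T) * norm \<xi>"
  and quasi: "!!T. T : TT ==> h <= \<eta> * diameter (L ` T)"
  and N_normal: "unit_normal Sh N" and mh: "surface_measure Sh mh"
  and d_small: "AE x in mh. \<bar>signed_dist Sg x\<bar> <= c * h ^ (k + 1)"
  and \<nu>N: "AE x in mh. norm (normal_ext Sg x - N x) <= c * h ^ k"
 using approx unfolding approx_surface_def Let_def Sh_def[symmetric] h_def[symmetric] by blast+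

lemma finite_T: "finite TT"
 using tri by (simp add: triangulation_def)

lemma Sh_infdist: "x : Sh ==> infdist x Sg < \<delta>"
 using Sh_strip by (auto simp: strip_def signed_dist_def infdist_nonneg split: if_splits)

lemma Sh_tube: "Sh \<subseteq> tube"
 using Sh_infdist \<delta>_small(3) by (force simp: tube_def)

lemma compact_T: "T : TT ==> compact T"
 using simp compact_simplex by blast

lemma compact_Sh: "compact Sh"
 unfolding Sh_def using compact_T finite_T
 by (intro compact_continuous_image L_cont compact_Union) auto

lemma T_nonempty: "TT ~= {}"
proof
 assume "TT = {}"
 hence "Sh = {}" unfolding Sh_def by simp
 thus False using bij nonempty by (simp add: bij_betw_def)
qed

text \<open>The element map, extended from the reference simplex to the whole parameter space as a
  polynomial, so that two-sided derivatives exist at the boundary too.\<close>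

definition P :: "'d ambient set => real^'d => 'd ambient" where
 "P T = (SOME Q. smooth_on Q UNIV & (ALL x:Tr. Q x = L (F T x)) & (ALL w. line_poly k (%x. Q x \<bullet> w)))"

lemma P_props:
 assumes T: "T : TT"
 shows "smooth_on (P T) UNIV" "!!x. x : Tr ==> P T x = L (F T x)" "!!w. line_poly k (%x. P T x \<bullet> w)"
proof -
 have "EX Q. smooth_on Q UNIV & (ALL x:Tr. Q x = L (F T x)) & (ALL w. line_poly k (%x. Q x \<bullet> w))"
 proof -
  obtain \<phi> where \<phi>: "lagrange_basis k T \<phi>" "!!x. x : T ==> L x = (\<Sum>y\<in>lagrange_nodes k T. \<phi> y x *\<^sub>R L y)"
   using L_lagrange[OF T] by blast
  have "EX q. ALL y:lagrange_nodes k T. q y : poly_space k & (ALL x:T. \<phi> y x = q y x)"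
   by (intro bchoice ballI) (use \<phi>(1) in \<open>auto simp: lagrange_basis_def poly_on_def\<close>)
  then obtain q where q: "!!y. y : lagrange_nodes k T ==> q y : poly_space k"
   "!!y x. y : lagrange_nodes k T ==> x : T ==> \<phi> y x = q y x" by blast
  obtain b A where bA: "linear A" "F T = (%x. b + A x)" using aff[OF T] by blast
  define Q where "Q x = (\<Sum>y\<in>lagrange_nodes k T. q y (b + A x) *\<^sub>R L y)" for x
  have "smooth_on (%x. b + A x) UNIV"
   using bA(1) by (intro smooth_on_add smooth_on_const smooth_on_linear open_UNIV)
    (simp add: linear_conv_bounded_linear)
  hence "smooth_on (%x. q y (b + A x)) UNIV" if "y : lagrange_nodes k T" for y
   by (intro smooth_on_compose[where f = "%x. b + A x" and g = "q y" and T = UNIV] smooth_on_poly_space[OF q(1)[OF that]]) auto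
  hence "smooth_on Q UNIV" unfolding Q_def by (intro smooth_on_sum smooth_on_scaleR smooth_on_const open_UNIV)
  moreover have "Q x = L (F T x)" if "x : Tr" for x
  proof -
   have "F T x : T" using F_im[OF T] that by blast
   thus ?thesis using \<phi>(2) q(2) by (simp add: Q_def bA(2))
  qed
  moreover have "line_poly k (%x. Q x \<bullet> w)" for w
   unfolding Q_def inner_sum_left inner_scaleR_left
   by (intro line_poly_linear_combination line_poly_poly_space q bA)
  ultimately show ?thesis by blast
 qed
 hence "smooth_on (P T) UNIV & (ALL x:Tr. P T x = L (F T x)) & (ALL w. line_poly k (%x. P T x \<bullet> w))"
  unfolding P_def by (rule someI_ex)
 thus "smooth_on (P T) UNIV" "!!x. x : Tr ==> P T x = L (F T x)" "!!w. line_poly k (%x. P T x \<bullet> w)"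
  by blast+
qed

definition dP :: "'d ambient set => real^'d => real^'d => 'd ambient" where
 "dP T u = fderiv (P T) u"

lemma dP: "T : TT ==> (P T has_derivative dP T u) (at u)"
 unfolding dP_def using smooth_on_has_derivative[OF P_props(1)] by blast

lemma linear_dP: "T : TT ==> linear (dP T u)"
 using dP has_derivative_linear by blast

lemma continuous_dP: "T : TT ==> continuous_on UNIV (%u. dP T u v)"
 unfolding dP_def using smooth_on_continuous_frechet_derivative[OF P_props(1)] by blast

lemma P_in: "T : TT ==> u : Tr ==> P T u : Sh"
 using P_props(2)[of T u] F_im[of T] unfolding Sh_def by auto

lemma P_image: "T : TT ==> P T ` Tr = L ` T"
 using P_props(2)[of T] F_im[of T] by (metis (no_types, lifting) image_cong image_image)

lemma F_inj: "T : TT ==> inj (F T)"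
proof -
 assume T: "T : TT"
 obtain b A where bA: "linear A" "F T = (%x. b + A x)" using aff[OF T] by blast
 have "inj A" using simplex_map_inj[OF simp[OF T] bA(1), of b] F_im[OF T] bA(2) by simp
 thus "inj (F T)" unfolding bA(2) by (simp add: inj_def)
qed

lemma P_inj: "T : TT ==> inj_on (P T) Tr"
proof (rule inj_onI)
 fix x y assume T: "T : TT" and xy: "x : Tr" "y : Tr" "P T x = P T y"
 have "F T x : \<Union>TT" "F T y : \<Union>TT" using F_im[OF T] T xy by blast+
 hence "F T x = F T y" using inj_onD[OF L_inj] xy P_props(2)[OF T] by auto
 thus "x = y" using F_inj[OF T] by (simp add: inj_def)
qed

lemma O_subset: "Or \<subseteq> Tr" and O_open: "open Or" and O_closure: "closure Or = Tr"
 unfolding Or_def using interior_subset closure_interior_ref_simplex by auto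

lemma F_rel_interior: "T : TT ==> F T ` Or = rel_interior T"
proof -
 assume T: "T : TT"
 obtain b A where bA: "linear A" "F T = (%x. b + A x)" using aff[OF T] by blast
 have injA: "inj A" using simplex_map_inj[OF simp[OF T] bA(1), of b] F_im[OF T] bA(2) by simp
 have im: "F T ` S = (+) b ` (A ` S)" for S unfolding bA(2) by auto
 have "rel_interior T = rel_interior ((+) b ` (A ` Tr))" unfolding im[symmetric] F_im[OF T] ..
 also have "... = (+) b ` rel_interior (A ` Tr)" by (rule rel_interior_translation)
 also have "rel_interior (A ` Tr) = A ` rel_interior Tr"
  by (rule rel_interior_injective_linear_image) (use bA injA in \<open>simp_all add: linear_conv_bounded_linear\<close>)
 also have "rel_interior Tr = Or"
  unfolding Or_def by (rule rel_interior_nonempty_interior[OF interior_ref_simplex_nonempty])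
 finally show "F T ` Or = rel_interior T" using im by simp
qed

lemma O_disjoint:
 assumes "T : TT" "T' : TT" "T ~= T'"
 shows "P T ` Or Int P T' ` Tr = {}"
proof (rule ccontr)
 assume "P T ` Or Int P T' ` Tr ~= {}"
 then obtain x y where xy: "x : Or" "y : Tr" "P T x = P T' y" by blast
 have x: "x : Tr" using xy O_subset by blast
 have F: "F T x : rel_interior T" "F T' y : T'"
  using F_rel_interior[OF assms(1)] F_im[OF assms(2)] xy by blast+
 hence "F T x : \<Union>TT" "F T' y : \<Union>TT" using assms rel_interior_subset by blast+
 hence "F T x = F T' y" using inj_onD[OF L_inj] xy x P_props(2) assms by auto
 thus False
  using F simplex_rel_interior_disjoint[OF tri assms simp[OF assms(1)] simp[OF assms(2)]] by auto
qed

lemma diameter_bounds: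
 assumes T: "T : TT"
 shows "0 < diameter (L ` T)" "diameter (L ` T) <= h"
proof -
 have b: "bounded (L ` T)"
  using T compact_T by (intro compact_imp_bounded compact_continuous_image continuous_on_subset[OF L_cont]) auto
 obtain i :: 'd where "True" by blast
 have ne: "(0::real^'d) ~= axis i 1" using axis_eq_0_iff[of i "1::real"] by auto
 hence "P T 0 ~= P T (axis i 1)"
  using inj_onD[OF P_inj[OF T], of 0 "axis i 1"] vertices_ref_simplex by auto
 moreover have "P T 0 : L ` T" "P T (axis i 1) : L ` T"
  using P_image[OF T] vertices_ref_simplex by blast+
 ultimately show "0 < diameter (L ` T)"
  using diameter_bounded_bound[OF b, of "P T 0" "P T (axis i 1)"] zero_less_dist_iff[of "P T 0" "P T (axis i 1)"] by linarith
 show "diameter (L ` T) <= h" unfolding h_def mesh_size_def using finite_T T by (intro Max_ge) auto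
qed

lemma h_bounds: "0 < h" "h <= extent"
proof -
 obtain T where T: "T : TT" using T_nonempty by blast
 show "0 < h" using diameter_bounds[OF T] by linarith
 have "diameter (L ` T) <= extent" if T: "T : TT" for T
 proof (rule diameter_le)
  show "norm (x - y) <= extent" if "x : L ` T" "y : L ` T" for x y
   using tube_diameter[of x y] Sh_tube that T by (auto simp: Sh_def dist_norm subset_iff)
 qed (use extent_pos in auto)
 thus "h <= extent" unfolding h_def mesh_size_def using finite_T T_nonempty by (subst Max_le_iff) auto
qed

lemma dP_bounds_O:
 assumes T: "T : TT" and u: "u : Or"
 shows "\<rho> * diameter (L ` T) * norm \<xi> <= norm (dP T u \<xi>)" "norm (dP T u \<xi>) <= inverse \<rho> * diameter (L ` T) * norm \<xi>"
proof -
 have ur: "u : Tr" using u O_subset by blast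
 have "((L \<circ> F T) has_derivative dP T u) (at u)"
  by (rule has_derivative_transform_within_open[OF dP[OF T] O_open u])
   (use P_props(2)[OF T] O_subset in auto)
 hence "fderiv (L \<circ> F T) u = dP T u" by (rule frechet_derivative_at_eqI)
 moreover have "at u within Tr = at u" using u at_within_interior by (simp add: Or_def)
 ultimately show "\<rho> * diameter (L ` T) * norm \<xi> <= norm (dP T u \<xi>)"
  "norm (dP T u \<xi>) <= inverse \<rho> * diameter (L ` T) * norm \<xi>"
  using shape[OF T ur, of \<xi>] by simp_all
qed

lemma closure_le:
 fixes f g :: "real^'d => real"
 assumes "continuous_on Tr f" "continuous_on Tr g" "!!u. u : Or ==> f u <= g u" "u : Tr"
 shows "f u <= g u"
proof -
 have "f u - g u <= 0"
  by (rule continuous_le_on_closure[of Or "%u. f u - g u"])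
   (use assms in \<open>auto simp: O_closure intro!: continuous_intros\<close>)
 thus ?thesis by simp
qed

lemma continuous_dP_ref: "T : TT ==> continuous_on Tr (%u. dP T u v)"
 using continuous_dP continuous_on_subset by blast

text \<open>The derivative of \<open>L \<circ> F T\<close> within the simplex is identified with
  \<open>dP\<close> at interior points; continuity of \<open>dP\<close> carries the shape bounds to
  the boundary.\<close>

lemma dP_bounds:
 assumes T: "T : TT" and u: "u : Tr"
 shows "\<rho> * diameter (L ` T) * norm \<xi> <= norm (dP T u \<xi>)" "norm (dP T u \<xi>) <= inverse \<rho> * diameter (L ` T) * norm \<xi>"
proof -
 show "\<rho> * diameter (L ` T) * norm \<xi> <= norm (dP T u \<xi>)"
  by (rule closure_le[OF _ _ dP_bounds_O(1)[OF T] u]) (intro continuous_intros continuous_dP_ref[OF T])+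
 show "norm (dP T u \<xi>) <= inverse \<rho> * diameter (L ` T) * norm \<xi>"
  by (rule closure_le[OF _ _ dP_bounds_O(2)[OF T] u]) (intro continuous_intros continuous_dP_ref[OF T])+
qed

lemma dP_inj: "T : TT ==> u : Tr ==> inj (dP T u)"
 unfolding linear_injective_0[OF linear_dP]
proof (intro allI impI)
 fix v assume T: "T : TT" and u: "u : Tr" and z: "dP T u v = 0"
 have "\<rho> * diameter (L ` T) * norm v <= 0" using dP_bounds(1)[OF T u, of v] z by simp
 moreover have "0 < \<rho> * diameter (L ` T)" using pos diameter_bounds[OF T] by simp
 ultimately have "norm v <= 0" by (metis mult_pos_pos not_le)
 thus "v = 0" by simp
qed

lemma continuous_P: "T : TT ==> continuous_on S (P T)"
 using smooth_on_continuous_on[OF P_props(1)] continuous_on_subset by blast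

lemma continuous_ref_homeo:
 fixes f :: "real^'d => 'd ambient"
 assumes T: "T : TT" and f: "continuous_on Tr f" "inj_on f Tr"
 shows "EX g. homeomorphism Or (f ` Or) f g"
proof -
 have "EX g. homeomorphism Tr (f ` Tr) f g"
  by (rule homeomorphism_compact[OF compact_ref_simplex f(1) _ f(2)]) simp
 then obtain g where "homeomorphism Tr (f ` Tr) f g" ..
 thus ?thesis
  using homeomorphism_of_subsets[OF _ O_subset image_mono[OF O_subset] refl] by blast
qed

lemma Sh_eq: "Sh = (\<Union>T\<in>TT. P T ` Tr)"
 unfolding Sh_def using P_image by (auto simp: image_Union)

text \<open>The interior of an element is relatively open because its complement in the surface, the
  other elements together with its own boundary, is a finite union of compact sets.\<close>

lemma P_local_params:
 assumes T: "T : TT"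
 shows "(Or, P T) : local_params Sh"
proof -
 have "openin (top_of_set Sh) (P T ` Or)"
 proof -
  let ?C = "(\<Union>T'\<in>TT - {T}. P T' ` Tr) Un P T ` (Tr - Or)"
  have "compact ?C"
  proof (intro compact_Un compact_UN compact_continuous_image continuous_P)
   show "compact (Tr - Or)" unfolding Or_def by (rule compact_skeleton)
  qed (use finite_T T compact_ref_simplex in auto)
  hence "closed ?C" by (rule compact_imp_closed)
  moreover have "P T ` Or = Sh - ?C"
  proof
   show "P T ` Or \<subseteq> Sh - ?C"
   proof
    fix x assume x: "x : P T ` Or"
    have "x : Sh" using x P_in[OF T] O_subset by blast
    moreover have "x ~: P T' ` Tr" if "T' : TT - {T}" for T'
     using O_disjoint[OF T, of T'] that x by blast
    moreover have "x ~: P T ` (Tr - Or)"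
     using x P_inj[OF T] O_subset by (auto simp: inj_on_def)
    ultimately show "x : Sh - ?C" by blast
   qed
   show "Sh - ?C \<subseteq> P T ` Or" unfolding Sh_eq by blast
  qed
  ultimately show ?thesis by (auto simp: openin_open closed_def Diff_eq)
 qed
 thus ?thesis
  unfolding local_params_def
  using O_open smooth_on_subset[OF P_props(1)[OF T]] continuous_ref_homeo[OF T continuous_P[OF T] P_inj[OF T]]
   dP_inj[OF T] O_subset by (auto simp: dP_def[symmetric])
qed

section \<open>The angle between the elements and the normal of the smooth surface\<close>

definition \<nu> :: "'d ambient => 'd ambient" where "\<nu> x = n (cp x)"

lemma \<nu>_eq: "x : tube ==> normal_ext Sg x = \<nu> x"
 by (simp add: normal_ext_eq \<nu>_def)

lemma norm_\<nu>: "norm (\<nu> x) = 1"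
 by (simp add: \<nu>_def norm_n[OF cp_in])

lemma continuous_\<nu>: "continuous_on tube \<nu>"
 unfolding \<nu>_def by (rule continuous_on_compose2[OF continuous_n continuous_cp]) (use cp_in in auto)

lemma continuous_\<nu>P: "T : TT ==> continuous_on Tr (%u. \<nu> (P T u))"
 by (rule continuous_on_compose2[OF continuous_\<nu> continuous_P]) (use P_in Sh_tube in auto)

lemma angle_fine:
 assumes small: "h < h0" and T: "T : TT" and u: "u : Or"
 shows "\<bar>dP T u \<xi> \<bullet> \<nu> (P T u)\<bar> <= 1/2 * norm (dP T u \<xi>)"
proof -
 have ch: "c * h ^ k <= 1/2"
 proof -
  have "h <= 1" using small h0 by linarith
  hence "h ^ k <= h ^ 1" using h_bounds(1) pos(4) by (intro power_decreasing) auto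
  hence "c * h ^ k <= c * h0" using small pos(3) by (intro mult_left_mono) auto
  thus ?thesis using h0(3) by linarith
 qed
 note X = P_local_params[OF T]
 have "AE x in mh. x : P T ` Or --> norm (normal_ext Sg x - N x) <= 1/2"
  using \<nu>N by eventually_elim (use ch in linarith)
 hence "AE u in lborel. u : Or --> norm (normal_ext Sg (P T u) - N (P T u)) <= 1/2"
  by (subst (asm) AE_chart[OF mh X])
 hence ae: "AE u in lborel. u : Or --> 0 <= 1/2 * norm (dP T u \<xi>) - \<bar>dP T u \<xi> \<bullet> \<nu> (P T u)\<bar>"
 proof (rule AE_mp, intro AE_I2 impI)
  fix u assume a: "u : Or --> norm (normal_ext Sg (P T u) - N (P T u)) <= 1/2" and u: "u : Or"
  have "P T u : tube" using P_in[OF T] O_subset Sh_tube u by blast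
  hence nn: "norm (\<nu> (P T u) - N (P T u)) <= 1/2" using a u \<nu>_eq by simp
  \<comment> \<open>\<open>N\<close> is orthogonal to the element, so the slope against
    \<open>\<nu>\<close> is a slope against the small difference of \<open>\<nu>\<close> and
    \<open>N\<close>.\<close>
  have "N (P T u) \<bullet> dP T u \<xi> = 0" unfolding dP_def by (rule unit_normalD(2)[OF N_normal X u])
  hence "\<bar>dP T u \<xi> \<bullet> \<nu> (P T u)\<bar> = \<bar>dP T u \<xi> \<bullet> (\<nu> (P T u) - N (P T u))\<bar>"
   by (simp add: inner_diff_right inner_commute)
  also have "... <= norm (dP T u \<xi>) * norm (\<nu> (P T u) - N (P T u))" by (rule Cauchy_Schwarz_ineq2)
  also have "... <= norm (dP T u \<xi>) * (1/2)" by (intro mult_left_mono nn) simp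
  finally show "0 <= 1/2 * norm (dP T u \<xi>) - \<bar>dP T u \<xi> \<bullet> \<nu> (P T u)\<bar>" by simp
 qed
 have "0 <= 1/2 * norm (dP T u \<xi>) - \<bar>dP T u \<xi> \<bullet> \<nu> (P T u)\<bar>"
  by (rule AE_nonneg_imp_nonneg[OF O_open _ ae u])
   (intro continuous_intros continuous_on_subset[OF continuous_dP_ref[OF T] O_subset]
    continuous_on_subset[OF continuous_\<nu>P[OF T] O_subset])
 thus ?thesis by simp
qed

text \<open>From any point of the reference simplex the directions to the vertices stay inside it,
  and \<open>thin_strip_slope\<close> bounds the slopes along them by a multiple of
  \<open>sqrt \<delta>\<close>. Quasi-uniformity makes this small relative to the size of the
  element.\<close>

lemma angle_coarse:
 assumes coarse: "h0 <= h" and T: "T : TT" and u: "u : Tr"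
 shows "\<bar>dP T u \<xi> \<bullet> \<nu> (P T u)\<bar> <= 1/2 * norm (dP T u \<xi>)"
proof -
 \<comment> \<open>\<open>2 * extent / \<rho>\<close> is the Lipschitz constant along a segment: the
   derivative is at most \<open>extent / \<rho>\<close>, and two points of the reference simplex are
   at most 2 apart.\<close>
 define E where "E = M * (4 * K * (2 * extent / \<rho>)^2 + 2) * sqrt \<delta>"
 have M0: "0 < M" using markov by (simp add: markov_const_def)
 have E0: "0 <= E" using M0 K_pos \<delta>_small(1) by (simp add: E_def)
 have slope: "\<bar>dP T u (v - u) \<bullet> \<nu> (P T u)\<bar> <= E" if v: "v : Tr" for v
 proof -
  have seg: "u + t *\<^sub>R (v - u) : Tr" if "0 <= t" "t <= 1" for t
  proof -
   have "(1 - t) *\<^sub>R u + t *\<^sub>R v : Tr" using convexD[OF convex_ref_simplex u v, of "1 - t" t] that by simp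
   thus ?thesis by (simp add: algebra_simps)
  qed
  let ?w = "n (cp (P T u))"
  obtain p0 where p0: "degree p0 <= k" "!!t. P T (u + t *\<^sub>R (v - u)) \<bullet> ?w = poly p0 t"
   using P_props(3)[OF T, of ?w] unfolding line_poly_def by metis
  define p where "p = p0 - [:P T u \<bullet> ?w:]"
  have p: "degree p <= k" "!!t. (P T (u + t *\<^sub>R (v - u)) - P T u) \<bullet> ?w = poly p t"
   using p0 by (auto simp: p_def inner_diff_left intro: degree_diff_le)
  have lip: "norm (P T (u + t *\<^sub>R (v - u)) - P T u) <= (2 * extent / \<rho>) * t" if t: "0 <= t" "t <= 1" for t
  proof -
   have "norm (P T (u + t *\<^sub>R (v - u)) - P T u) <= (extent / \<rho>) * norm ((u + t *\<^sub>R (v - u)) - u)"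
   proof (rule differentiable_bound[OF convex_ref_simplex _ _ seg[OF t] u])
    fix x :: "real^'d" assume x: "x : Tr"
    show "(P T has_derivative dP T x) (at x within Tr)"
     by (rule has_derivative_at_withinI[OF dP[OF T]])
    show "onorm (dP T x) <= extent / \<rho>"
    proof (rule onorm_bound)
     fix w
     have "norm (dP T x w) <= inverse \<rho> * diameter (L ` T) * norm w" by (rule dP_bounds(2)[OF T x])
     also have "... <= inverse \<rho> * extent * norm w"
      using diameter_bounds(2)[OF T] h_bounds(2) pos(1) by (intro mult_right_mono mult_left_mono) auto
     finally show "norm (dP T x w) <= extent / \<rho> * norm w" by (simp add: divide_inverse mult.commute)
    qed (use extent_pos pos in simp)
   qed
   moreover have "norm ((u + t *\<^sub>R (v - u)) - u) <= 2 * t"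
   proof -
    have "norm (v - u) <= 2" using norm_ref_simplex[OF u] norm_ref_simplex[OF v] norm_triangle_ineq4[of v u] by linarith
    thus ?thesis using t mult_left_mono[of "norm (v - u)" 2 t] by (simp add: mult.commute)
   qed
   ultimately show ?thesis
    using mult_left_mono[of "norm ((u + t *\<^sub>R (v - u)) - u)" "2 * t" "extent / \<rho>"] extent_pos pos(1) by (simp add: mult_ac)
  qed
  have "\<bar>coeff p 1\<bar> <= E"
   unfolding E_def
  proof (rule thin_strip_slope[OF markov \<delta>_small(1-3) p])
   show "infdist (P T (u + t *\<^sub>R (v - u))) Sg < \<delta>" if "0 <= t" "t <= 1" for t
    using Sh_infdist P_in[OF T seg[OF that]] by blast
  qed (use lip extent_pos pos in auto)
  moreover have "dP T u (v - u) \<bullet> ?w = coeff p 1"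
  proof -
   have "((%t. (P T (u + t *\<^sub>R (v - u)) - P T u) \<bullet> ?w) has_derivative (%t. dP T u (t *\<^sub>R (v - u)) \<bullet> ?w)) (at 0)"
   proof -
    have "((%t. P T (u + t *\<^sub>R (v - u))) has_derivative (%t. dP T u (t *\<^sub>R (v - u)))) (at 0)"
     by (rule has_derivative_compose[of "%t. u + t *\<^sub>R (v - u)" "%t. t *\<^sub>R (v - u)"])
      (auto intro!: derivative_eq_intros dP[OF T])
    thus ?thesis by (auto intro!: derivative_eq_intros)
   qed
   hence 1: "(poly p has_derivative (%t. dP T u (t *\<^sub>R (v - u)) \<bullet> ?w)) (at 0)" by (simp add: p(2) fun_eq_iff)
   have 2: "(poly p has_derivative (%t. poly (pderiv p) 0 * t)) (at 0)"
    using poly_DERIV[of p 0] by (simp add: has_field_derivative_def)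
   have "dP T u (1 *\<^sub>R (v - u)) \<bullet> ?w = poly (pderiv p) 0 * 1"
    using has_derivative_unique[OF 1 2] by meson
   thus ?thesis by (simp add: poly_0_coeff_0 coeff_pderiv)
  qed
  ultimately show ?thesis by (simp add: \<nu>_def)
 qed
 have lin: "linear (dP T u)" by (rule linear_dP[OF T])
 have ax: "\<bar>dP T u (axis i 1) \<bullet> \<nu> (P T u)\<bar> <= 2 * E" for i
 proof -
  \<comment> \<open>Coordinate directions are differences of the directions from \<open>u\<close> to
    two vertices, for which the slope is known.\<close>
  have "dP T u (axis i 1) = dP T u (axis i 1 - u) - dP T u (0 - u)"
   by (simp add: linear_diff[OF lin] linear_neg[OF lin])
  hence "dP T u (axis i 1) \<bullet> \<nu> (P T u) = dP T u (axis i 1 - u) \<bullet> \<nu> (P T u) - dP T u (0 - u) \<bullet> \<nu> (P T u)"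
   by (metis inner_diff_left)
  thus ?thesis
   using slope[OF vertices_ref_simplex(2), of i] slope[OF vertices_ref_simplex(1)] by linarith
 qed
 have "\<bar>dP T u \<xi> \<bullet> \<nu> (P T u)\<bar> <= (real CARD('d) * (2 * E)) * norm \<xi>"
 proof -
  have "dP T u \<xi> = dP T u (\<Sum>i\<in>UNIV. (\<xi> $ i) *\<^sub>R axis i 1)"
   using basis_expansion[of \<xi>] by (simp add: scalar_mult_eq_scaleR)
  also have "... = (\<Sum>i\<in>UNIV. (\<xi> $ i) *\<^sub>R dP T u (axis i 1))"
   by (simp add: linear_sum[OF lin] linear_scale[OF lin])
  finally have "\<bar>dP T u \<xi> \<bullet> \<nu> (P T u)\<bar> = \<bar>\<Sum>i\<in>UNIV. (\<xi> $ i) * (dP T u (axis i 1) \<bullet> \<nu> (P T u))\<bar>"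
   by (simp add: inner_sum_left)
  also have "... <= (\<Sum>i\<in>UNIV. \<bar>\<xi> $ i\<bar> * \<bar>dP T u (axis i 1) \<bullet> \<nu> (P T u)\<bar>)"
   by (rule order_trans[OF sum_abs]) (simp add: abs_mult)
  also have "... <= (\<Sum>i\<in>(UNIV::'d set). norm \<xi> * (2 * E))"
   by (intro sum_mono mult_mono component_le_norm_cart ax) auto
  finally show ?thesis by (simp add: mult_ac)
 qed
 also have "... <= (1/2 * (\<rho> * diameter (L ` T))) * norm \<xi>"
 proof (rule mult_right_mono)
  have E: "E = M * (16 * K * (extent / \<rho>)^2 + 2) * sqrt \<delta>"
   unfolding E_def by (simp add: power_mult_distrib power_divide)
  have "4 * real CARD('d) * E <= \<rho> * (h0 / \<eta>)" using \<delta>_slope unfolding E by (simp only: mult.assoc)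
  hence "real CARD('d) * (2 * E) <= 1/2 * (\<rho> * (h0 / \<eta>))" by simp
  also have "h0 / \<eta> <= diameter (L ` T)"
   using quasi[OF T] coarse pos(2) by (simp add: pos_divide_le_eq mult.commute)
  finally show "real CARD('d) * (2 * E) <= 1/2 * (\<rho> * diameter (L ` T))" using pos(1) by simp
 qed simp
 also have "... <= 1/2 * norm (dP T u \<xi>)" using dP_bounds(1)[OF T u, of \<xi>] by simp
 finally show ?thesis .
qed

lemma angle:
 assumes T: "T : TT" and u: "u : Tr"
 shows "\<bar>dP T u \<xi> \<bullet> \<nu> (P T u)\<bar> <= 1/2 * norm (dP T u \<xi>)"
proof (cases "h < h0")
 case True
 show ?thesis
  by (rule closure_le[OF _ _ angle_fine[OF True T] u])
   (intro continuous_intros continuous_dP_ref[OF T] continuous_\<nu>P[OF T])+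
next
 case False
 thus ?thesis using angle_coarse[OF _ T u] by simp
qed

text \<open>The tangential projection loses exactly \<open>(v \<bullet> \<nu> x)^2\<close> of the
  squared length. The deviation of \<open>dcp x\<close> from it, of relative size
  \<open>2 * K * d\<close>, enters three times: twice through the cross term and once through the
  square.\<close>

lemma dcp_distortion:
 assumes x: "x : tube" and a: "\<bar>v \<bullet> \<nu> x\<bar> <= a * norm v" and d: "infdist x Sg <= d" "2 * K * d <= 1"
 shows "\<bar>(norm (dcp x v))^2 - (norm v)^2\<bar> <= (a^2 + 6 * K * d) * (norm v)^2"
proof -
 let ?p = "tang (\<nu> x) v" and ?r = "dcp x v - tang (\<nu> x) v"
 have d0: "0 <= d" using d(1) infdist_nonneg[of x Sg] by linarith
 have r: "norm ?r <= 2 * K * d * norm v"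
 proof -
  have "norm ?r <= 2 * K * infdist x Sg * norm v"
   using dcp_near_projection[OF x, of v] by (simp add: tang_def \<nu>_def inner_commute)
  also have "... <= 2 * K * d * norm v" using d(1) K_pos by (intro mult_right_mono mult_left_mono) auto
  finally show ?thesis .
 qed
 have p: "norm ?p <= norm v" by (rule norm_tang_le) (simp add: norm_\<nu>)
 have psq: "(norm ?p)^2 = (norm v)^2 - (v \<bullet> \<nu> x)^2" by (rule norm_tang_sq[OF norm_\<nu>])
 have vsq: "(v \<bullet> \<nu> x)^2 <= a^2 * (norm v)^2"
  using power_mono[OF a, of 2] by (simp add: power_mult_distrib)
 have "(norm (dcp x v))^2 - (norm ?p)^2 = 2 * (?p \<bullet> ?r) + (norm ?r)^2"
  unfolding power2_norm_eq_inner by (simp add: inner_diff_left inner_diff_right inner_commute)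
 also have "\<bar>...\<bar> <= 2 * (norm ?p * norm ?r) + norm ?r * norm ?r"
  using Cauchy_Schwarz_ineq2[of ?p ?r] unfolding power2_eq_square
  by (intro order_trans[OF abs_triangle_ineq]) (simp add: abs_mult)
 also have "... <= 2 * (norm v * (2 * K * d * norm v)) + (1 * norm v) * (2 * K * d * norm v)"
 proof (intro add_mono mult_left_mono mult_mono p r)
  show "norm ?r <= 1 * norm v" using order_trans[OF r mult_right_mono[OF d(2) norm_ge_zero]] .
 qed (use d0 K_pos in auto)
 also have "... = 6 * K * d * (norm v)^2" by (simp add: power2_eq_square algebra_simps)
 finally have "\<bar>(norm (dcp x v))^2 - (norm ?p)^2\<bar> <= 6 * K * d * (norm v)^2" .
 hence "\<bar>(norm (dcp x v))^2 - (norm v)^2\<bar> <= 6 * K * d * (norm v)^2 + (v \<bullet> \<nu> x)^2"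
  unfolding psq using zero_le_power2[of "v \<bullet> \<nu> x"] by linarith
 also have "... <= (a^2 + 6 * K * d) * (norm v)^2" using vsq by (simp add: algebra_simps)
 finally show ?thesis .
qed

section \<open>Projected elements as charts of the smooth surface\<close>

definition Y :: "'d ambient set => real^'d => 'd ambient" where
 "Y T u = cp (P T u)"

text \<open>An open neighbourhood of the reference simplex on which the projected element map is
  smooth, so that its boundary derivatives are two-sided.\<close>

definition \<Omega> :: "'d ambient set => (real^'d) set" where
 "\<Omega> T = P T -` tube"

lemma open_\<Omega>: "T : TT ==> open (\<Omega> T)"
 unfolding \<Omega>_def using continuous_P open_tube by (simp add: open_vimage)

lemma ref_\<Omega>: "T : TT ==> Tr \<subseteq> \<Omega> T"
 unfolding \<Omega>_def using P_in Sh_tube by blast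

lemma smooth_Y: "T : TT ==> smooth_on (Y T) (\<Omega> T)"
 unfolding Y_def
 by (rule smooth_on_compose[OF open_\<Omega> open_tube smooth_on_subset[OF P_props(1)] smooth_on_cp])
  (auto simp: \<Omega>_def)

lemma Y_has_derivative:
 assumes T: "T : TT" and u: "u : Tr"
 shows "(Y T has_derivative (%v. dcp (P T u) (dP T u v))) (at u)"
proof -
 have "P T u : tube" using P_in[OF T u] Sh_tube by blast
 thus ?thesis
  unfolding Y_def by (rule has_derivative_compose[OF dP[OF T] cp_has_derivative])
qed

lemma frechet_Y: "T : TT ==> u : Tr ==> fderiv (Y T) u = (%v. dcp (P T u) (dP T u v))"
 using Y_has_derivative by (rule frechet_derivative_at_eqI)

text \<open>Valid on every mesh: 1/4 from the angle and at most 6/32 from the width of the strip add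
  up to less than 1/2. It makes the projected elements immersed.\<close>

lemma distortion_coarse:
 assumes T: "T : TT" and u: "u : Tr"
 shows "\<bar>(norm (dcp (P T u) (dP T u v)))^2 - (norm (dP T u v))^2\<bar> <= 1/2 * (norm (dP T u v))^2"
proof -
 have x: "P T u : tube" "infdist (P T u) Sg <= \<delta>"
  using P_in[OF T u] Sh_tube Sh_infdist[of "P T u"] by auto
 have K\<delta>: "0 <= K * \<delta>" "K * \<delta> <= 1/32" using \<delta>_small(1,4) K_pos by auto
 have "\<bar>(norm (dcp (P T u) (dP T u v)))^2 - (norm (dP T u v))^2\<bar> <= ((1/2)^2 + 6 * K * \<delta>) * (norm (dP T u v))^2"
  by (rule dcp_distortion[OF x(1) angle[OF T u] x(2)]) (use K\<delta> in linarith)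
 also have "... <= 1/2 * (norm (dP T u v))^2"
  using K\<delta> by (intro mult_right_mono) (auto simp: power2_eq_square)
 finally show ?thesis .
qed

lemma dY_inj:
 assumes T: "T : TT" and u: "u : Tr"
 shows "inj (fderiv (Y T) u)"
proof -
 have x: "P T u : tube" using P_in[OF T u] Sh_tube by auto
 have lin: "linear (fderiv (Y T) u)"
  using smooth_on_linear_frechet_derivative[OF smooth_Y[OF T]] ref_\<Omega>[OF T] u by blast
 have "v = 0" if z: "fderiv (Y T) u v = 0" for v
 proof -
  have "dcp (P T u) (dP T u v) = 0" using z frechet_Y[OF T u] by simp
  hence "(norm (dP T u v))^2 <= 1/2 * (norm (dP T u v))^2" using distortion_coarse[OF T u, of v] by simp
  hence "dP T u v = 0" by simp
  thus "v = 0" using dP_inj[OF T u] linear_0[OF linear_dP[OF T]] by (metis injD)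
 qed
 thus ?thesis unfolding linear_injective_0[OF lin] by blast
qed

lemma Y_in: "Y T u : Sg"
 unfolding Y_def by (rule cp_in)

lemma cp_inj: "inj_on cp Sh" and cp_surj: "cp ` Sh = Sg"
 using bij by (auto simp: bij_betw_def)

lemma Y_inj: "T : TT ==> inj_on (Y T) Tr"
 unfolding Y_def using comp_inj_on[OF P_inj inj_on_subset[OF cp_inj]] P_in by (fastforce simp: comp_def)

lemma Sg_eq: "Sg = (\<Union>T\<in>TT. Y T ` Tr)"
 using cp_surj unfolding Sh_eq Y_def by (auto simp: image_UN image_image)

lemma continuous_Y: "T : TT ==> continuous_on Tr (Y T)"
 using smooth_on_continuous_on[OF smooth_Y] ref_\<Omega> continuous_on_subset by blast

lemma Y_local_params:
 assumes T: "T : TT"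
 shows "(Or, Y T) : local_params Sg"
proof -
 have "openin (top_of_set Sg) (Y T ` Or)"
 proof -
  let ?C = "(\<Union>T'\<in>TT - {T}. Y T' ` Tr) Un Y T ` (Tr - Or)"
  have "compact ?C"
  proof (intro compact_Un compact_UN compact_continuous_image)
   show "compact (Tr - Or)" unfolding Or_def by (rule compact_skeleton)
   show "continuous_on (Tr - Or) (Y T)" by (rule continuous_on_subset[OF continuous_Y[OF T]]) auto
  qed (use finite_T T compact_ref_simplex continuous_Y in auto)
  hence "closed ?C" by (rule compact_imp_closed)
  moreover have "Y T ` Or = Sg - ?C"
  proof
   show "Y T ` Or \<subseteq> Sg - ?C"
   proof
    fix x assume "x : Y T ` Or"
    then obtain u where u: "u : Or" "x = Y T u" by blast
    have ur: "u : Tr" using u O_subset by blast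
    have "x ~: Y T' ` Tr" if T': "T' : TT - {T}" for T'
    proof
     assume "x : Y T' ` Tr"
     then obtain v where v: "v : Tr" "x = Y T' v" by blast
     have "P T u = P T' v" using inj_onD[OF cp_inj] u v P_in[OF T ur] P_in[of T' v] T' unfolding Y_def by auto
     thus False using O_disjoint[OF T, of T'] T' u v by blast
    qed
    moreover have "x ~: Y T ` (Tr - Or)"
     using u ur Y_inj[OF T] by (auto simp: inj_on_def)
    ultimately show "x : Sg - ?C" using u Y_in by blast
   qed
   show "Sg - ?C \<subseteq> Y T ` Or" by (subst Sg_eq) blast
  qed
  ultimately show ?thesis by (auto simp: openin_open closed_def Diff_eq)
 qed
 thus ?thesis
  unfolding local_params_def
  using O_open smooth_on_subset[OF smooth_Y[OF T]] ref_\<Omega>[OF T] continuous_ref_homeo[OF T continuous_Y[OF T] Y_inj[OF T]]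
   dY_inj[OF T] O_subset by auto
qed

lemma lipschitz_ref:
 fixes f :: "real^'d => 'b::real_normed_vector"
 assumes \<Omega>: "open W" "Tr \<subseteq> W" and f: "smooth_on f W"
 shows "EX B. B-lipschitz_on Tr f"
proof -
 have "EX B. ALL u:Tr. onorm (fderiv f u) <= B"
 proof -
  have bd: "EX B. ALL u:Tr. norm (fderiv f u (axis i 1)) <= B" for i :: 'd
  proof -
   have "continuous_on Tr (%u. fderiv f u (axis i 1))"
    using smooth_on_continuous_frechet_derivative[OF f] \<Omega>(2) continuous_on_subset by blast
   hence "compact ((%u. fderiv f u (axis i 1)) ` Tr)"
    by (rule compact_continuous_image[OF _ compact_ref_simplex])
   hence "bounded ((%u. fderiv f u (axis i 1)) ` Tr)" by (rule compact_imp_bounded)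
   thus ?thesis by (auto simp: bounded_iff)
  qed
  then obtain B where B: "!!i u. u : Tr ==> norm (fderiv f u (axis i 1)) <= B i" by metis
  have "onorm (fderiv f u) <= (\<Sum>i\<in>UNIV. \<bar>B i\<bar>)" if u: "u : Tr" for u
  proof (rule onorm_bound)
   fix v :: "real^'d"
   have lin: "linear (fderiv f u)" using smooth_on_linear_frechet_derivative[OF f] u \<Omega>(2) by blast
   have "fderiv f u v = fderiv f u (\<Sum>i\<in>UNIV. (v $ i) *\<^sub>R axis i 1)"
    using basis_expansion[of v] by (simp add: scalar_mult_eq_scaleR)
   also have "... = (\<Sum>i\<in>UNIV. (v $ i) *\<^sub>R fderiv f u (axis i 1))"
    by (simp add: linear_sum[OF lin] linear_scale[OF lin])
   also have "norm ... <= (\<Sum>i\<in>UNIV. \<bar>B i\<bar> * norm v)"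
   proof (rule sum_norm_le)
    fix i :: 'd
    have "norm ((v $ i) *\<^sub>R fderiv f u (axis i 1)) <= norm v * \<bar>B i\<bar>"
     unfolding norm_scaleR by (intro mult_mono component_le_norm_cart order_trans[OF B[OF u]]) auto
    thus "norm ((v $ i) *\<^sub>R fderiv f u (axis i 1)) <= \<bar>B i\<bar> * norm v" by (simp add: mult.commute)
   qed
   finally show "norm (fderiv f u v) <= (\<Sum>i\<in>UNIV. \<bar>B i\<bar>) * norm v" by (simp add: sum_distrib_right)
  qed (simp add: sum_nonneg)
  thus ?thesis by blast
 qed
 then obtain B where B: "!!u. u : Tr ==> onorm (fderiv f u) <= B" by blast
 have "\<bar>B\<bar>-lipschitz_on Tr f"
 proof (rule lipschitz_onI)
  fix x y :: "real^'d" assume xy: "x : Tr" "y : Tr"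
  have "norm (f x - f y) <= \<bar>B\<bar> * norm (x - y)"
   by (rule differentiable_bound[OF convex_ref_simplex _ _ xy])
    (use smooth_on_has_derivative[OF f] \<Omega>(2) B in \<open>auto intro: has_derivative_at_withinI order_trans[OF _ abs_ge_self]\<close>)
  thus "dist (f x) (f y) <= \<bar>B\<bar> * dist x y" by (simp add: dist_norm)
 qed simp
 thus ?thesis by blast
qed

lemma skeleton_null:
 assumes T: "T : TT"
 shows "P T ` (Tr - Or) : null_sets mh" "Y T ` (Tr - Or) : null_sets mg"
proof -
 have Z: "compact (Tr - Or)" "negligible (Tr - Or)"
  unfolding Or_def by (rule compact_skeleton negligible_skeleton)+
 obtain B where "B-lipschitz_on Tr (P T)" using lipschitz_ref[OF open_UNIV _ P_props(1)[OF T]] by auto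
 hence "B-lipschitz_on (Tr - Or) (P T)" by (rule lipschitz_on_subset) auto
 thus "P T ` (Tr - Or) : null_sets mh"
  by (rule null_lipschitz_image[OF mh Z, rotated]) (use P_in[OF T] in auto)
 obtain B' where "B'-lipschitz_on Tr (Y T)" using lipschitz_ref[OF open_\<Omega>[OF T] ref_\<Omega>[OF T] smooth_Y[OF T]] by auto
 hence "B'-lipschitz_on (Tr - Or) (Y T)" by (rule lipschitz_on_subset) auto
 thus "Y T ` (Tr - Or) : null_sets mg"
  by (rule null_lipschitz_image[OF mg Z, rotated]) (use Y_in in auto)
qed

lemma AE_in_element:
 shows "AE x in mh. EX T:TT. x : P T ` Or" "AE x in mg. EX T:TT. x : Y T ` Or"
proof -
 have sp: "space mh = Sh" "space mg = Sg" using surface_measureD(2) mh mg by blast+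
 have "(\<Union>T\<in>TT. P T ` (Tr - Or)) : null_sets mh" "(\<Union>T\<in>TT. Y T ` (Tr - Or)) : null_sets mg"
  using skeleton_null finite_T by (auto intro: null_sets_UN' countable_finite)
 note n = this
 show "AE x in mh. EX T:TT. x : P T ` Or"
  by (rule AE_I'[OF n(1)], unfold sp, subst Sh_eq) blast
 show "AE x in mg. EX T:TT. x : Y T ` Or"
  by (rule AE_I'[OF n(2)], unfold sp, subst Sg_eq) blast
qed

lemma disjoint_elements:
 "disjoint_family_on (%T. P T ` Or) TT" "disjoint_family_on (%T. Y T ` Or) TT"
proof -
 have d: "P T ` Or Int P T' ` Or = {}" if "T : TT" "T' : TT" "T ~= T'" for T T'
  using O_disjoint[OF that] image_mono[OF O_subset, of "P T'"] by blast
 thus "disjoint_family_on (%T. P T ` Or) TT" by (auto simp: disjoint_family_on_def)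
 have Y: "Y T ` Or = cp ` (P T ` Or)" for T by (auto simp: Y_def)
 have s: "P T ` Or \<subseteq> Sh" if "T : TT" for T using P_in[OF that] O_subset by blast
 have "Y T ` Or Int Y T' ` Or = {}" if "T : TT" "T' : TT" "T ~= T'" for T T'
  using inj_on_image_Int[OF cp_inj s[OF that(1)] s[OF that(2)]] d[OF that] by (simp add: Y)
 thus "disjoint_family_on (%T. Y T ` Or) TT" by (auto simp: disjoint_family_on_def)
qed

lemma element_sum_indicator:
 assumes "disjoint_family_on A TT" "T : TT" "x : A T"
 shows "(\<Sum>T\<in>TT. f T * indicator (A T) x) = (f T :: 'b::semiring_1)"
proof -
 have "f T' * indicator (A T') x = (if T' = T then f T else 0)" if "T' : TT" for T'
  using assms that by (auto simp: disjoint_family_on_def indicator_def)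
 hence "(\<Sum>T\<in>TT. f T * indicator (A T) x) = (\<Sum>T'\<in>TT. if T' = T then f T else 0)" by (intro sum.cong) auto
 thus ?thesis using finite_T assms(2) by simp
qed

lemma nn_integral_elements:
 "f : borel_measurable mh ==> (\<integral>\<^sup>+x. f x \<partial>mh)
  = (\<Sum>T\<in>TT. \<integral>\<^sup>+u. f (P T u) * ennreal (area_factor (P T) u * indicator Or u) \<partial>lborel)"
 "g : borel_measurable mg ==> (\<integral>\<^sup>+x. g x \<partial>mg)
  = (\<Sum>T\<in>TT. \<integral>\<^sup>+u. g (Y T u) * ennreal (area_factor (Y T) u * indicator Or u) \<partial>lborel)"
proof -
 have s: "P T ` Or : sets mh" "Y T ` Or : sets mg" if "T : TT" for T
  using openin_sets_surface mh mg local_paramsD(3) P_local_params[OF that] Y_local_params[OF that] by blast+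
 show "(\<integral>\<^sup>+x. f x \<partial>mh) = (\<Sum>T\<in>TT. \<integral>\<^sup>+u. f (P T u) * ennreal (area_factor (P T) u * indicator Or u) \<partial>lborel)"
  if f[measurable]: "f : borel_measurable mh"
 proof -
  have "(\<integral>\<^sup>+x. f x \<partial>mh) = (\<integral>\<^sup>+x. (\<Sum>T\<in>TT. f x * indicator (P T ` Or) x) \<partial>mh)"
  proof (rule nn_integral_cong_AE, rule AE_mp[OF AE_in_element(1)], intro AE_I2 impI)
   fix x assume "EX T:TT. x : P T ` Or"
   then obtain T where "T : TT" "x : P T ` Or" by blast
   thus "f x = (\<Sum>T\<in>TT. f x * indicator (P T ` Or) x)"
    using element_sum_indicator[OF disjoint_elements(1), of T x "%_. f x"] by simp
  qed
  also have "... = (\<Sum>T\<in>TT. \<integral>\<^sup>+x. f x * indicator (P T ` Or) x \<partial>mh)"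
   by (rule nn_integral_sum) (use s in measurable)
  also have "... = (\<Sum>T\<in>TT. \<integral>\<^sup>+u. f (P T u) * ennreal (area_factor (P T) u * indicator Or u) \<partial>lborel)"
   by (rule sum.cong[OF refl nn_integral_chart[OF mh P_local_params f]])
  finally show ?thesis .
 qed
 show "(\<integral>\<^sup>+x. g x \<partial>mg) = (\<Sum>T\<in>TT. \<integral>\<^sup>+u. g (Y T u) * ennreal (area_factor (Y T) u * indicator Or u) \<partial>lborel)"
  if f[measurable]: "g : borel_measurable mg"
 proof -
  have "(\<integral>\<^sup>+x. g x \<partial>mg) = (\<integral>\<^sup>+x. (\<Sum>T\<in>TT. g x * indicator (Y T ` Or) x) \<partial>mg)"
  proof (rule nn_integral_cong_AE, rule AE_mp[OF AE_in_element(2)], intro AE_I2 impI)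
   fix x assume "EX T:TT. x : Y T ` Or"
   then obtain T where "T : TT" "x : Y T ` Or" by blast
   thus "g x = (\<Sum>T\<in>TT. g x * indicator (Y T ` Or) x)"
    using element_sum_indicator[OF disjoint_elements(2), of T x "%_. g x"] by simp
  qed
  also have "... = (\<Sum>T\<in>TT. \<integral>\<^sup>+x. g x * indicator (Y T ` Or) x \<partial>mg)"
   by (rule nn_integral_sum) (use s in measurable)
  also have "... = (\<Sum>T\<in>TT. \<integral>\<^sup>+u. g (Y T u) * ennreal (area_factor (Y T) u * indicator Or u) \<partial>lborel)"
   by (rule sum.cong[OF refl nn_integral_chart[OF mg Y_local_params f]])
  finally show ?thesis .
 qed
qed

text \<open>The Jacobian of \<open>cp\<close> as the quotient of two area factors in the same
  parameter; it is 0 off the interiors of the elements, that is, on a null set.\<close>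

definition jac :: "'d ambient => real" where
 "jac x = (\<Sum>T\<in>TT. area_factor (Y T) (inv_into Or (P T) x) / area_factor (P T) (inv_into Or (P T) x)
   * indicator (P T ` Or) x)"

lemma P_inj_O: "T : TT ==> inj_on (P T) Or"
 using P_inj O_subset inj_on_subset by blast

lemma jac_P:
 assumes T: "T : TT" and u: "u : Or"
 shows "jac (P T u) = area_factor (Y T) u / area_factor (P T) u"
 unfolding jac_def
 by (subst element_sum_indicator[OF disjoint_elements(1) T, of "P T u"]) (simp_all add: u inv_into_f_f[OF P_inj_O[OF T] u])

lemma borel_imp_surface:
 "f : borel_measurable borel ==> f : borel_measurable mh"
 unfolding measurable_cong_sets[OF surface_measureD(1)[OF mh] refl] by (rule measurable_restrict_space1)

lemma P_image_borel:
 assumes "T : TT"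
 shows "P T ` Or : sets borel"
proof -
 obtain W where "open W" "P T ` Or = Sh Int W"
  using local_paramsD(3)[OF P_local_params[OF assms]] unfolding openin_open by blast
 thus ?thesis using compact_Sh by (simp add: borel_compact borel_open sets.Int)
qed

lemma chart_inverse_measurable:
 fixes f :: "real^'d => 'b::{real_normed_vector, second_countable_topology}"
 assumes T: "T : TT" and f: "continuous_on Or f"
 shows "(%x. indicator (P T ` Or) x *\<^sub>R f (inv_into Or (P T) x)) : borel_measurable mh"
proof -
 obtain g where g: "homeomorphism Or (P T ` Or) (P T) g" using local_paramsD(4)[OF P_local_params[OF T]] by blast
 have "continuous_on (P T ` Or) (inv_into Or (P T))"
 proof (rule continuous_on_eq)
  show "continuous_on (P T ` Or) g" using g by (simp add: homeomorphism_def)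
  show "g x = inv_into Or (P T) x" if "x : P T ` Or" for x
   using that g inv_into_f_f[OF P_inj_O[OF T]] by (auto simp: homeomorphism_def)
 qed
 hence "continuous_on (P T ` Or) (%x. f (inv_into Or (P T) x))"
  by (rule continuous_on_compose2[OF f]) (auto intro: inv_into_into)
 thus ?thesis
  by (intro borel_imp_surface borel_measurable_continuous_on_indicator P_image_borel[OF T])
qed

lemma jac_measurable: "jac : borel_measurable mh"
proof -
 have "(%x. area_factor (Y T) (inv_into Or (P T) x) / area_factor (P T) (inv_into Or (P T) x)
   * indicator (P T ` Or) x) : borel_measurable mh" if T: "T : TT" for T
 proof -
  have "continuous_on Or (%u. area_factor (Y T) u / area_factor (P T) u)"
   using continuous_on_area_factor[OF P_local_params[OF T]] continuous_on_area_factor[OF Y_local_params[OF T]]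
    area_factor_pos[OF P_local_params[OF T]] by (intro continuous_on_divide) force+
  from chart_inverse_measurable[OF T this] show ?thesis by (simp add: mult.commute)
 qed
 thus ?thesis unfolding jac_def by (rule borel_measurable_sum)
qed

lemma cp_measurable: "cp : measurable mh mg"
proof -
 have "cp : measurable (restrict_space borel Sh) (restrict_space borel Sg)"
  by (rule measurable_restrict_space2)
   (use cp_in continuous_on_subset[OF continuous_cp Sh_tube] in \<open>auto intro: borel_measurable_continuous_on_restrict\<close>)
 thus ?thesis using measurable_cong_sets[OF surface_measureD(1)[OF mh] surface_measureD(1)[OF mg]] by simp
qed

lemma nn_integral_pullback:
 assumes f[measurable]: "f : borel_measurable mg"
 shows "(\<integral>\<^sup>+x. f x \<partial>mg) = (\<integral>\<^sup>+x. f (cp x) * ennreal (jac x) \<partial>mh)"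
proof -
 note [measurable] = cp_measurable jac_measurable
 have "(\<integral>\<^sup>+x. f (cp x) * ennreal (jac x) \<partial>mh)
  = (\<Sum>T\<in>TT. \<integral>\<^sup>+u. f (cp (P T u)) * ennreal (jac (P T u)) * ennreal (area_factor (P T) u * indicator Or u) \<partial>lborel)"
  by (rule nn_integral_elements(1)) measurable
 also have "... = (\<Sum>T\<in>TT. \<integral>\<^sup>+u. f (Y T u) * ennreal (area_factor (Y T) u * indicator Or u) \<partial>lborel)"
 proof (intro sum.cong refl nn_integral_cong)
  fix T u assume T: "T : TT"
  show "f (cp (P T u)) * ennreal (jac (P T u)) * ennreal (area_factor (P T) u * indicator Or u)
   = f (Y T u) * ennreal (area_factor (Y T) u * indicator Or u)"
  proof (cases "u : Or")
   case True
   have "0 < area_factor (P T) u" "0 < area_factor (Y T) u"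
    using area_factor_pos P_local_params[OF T] Y_local_params[OF T] True by blast+
   hence "ennreal (jac (P T u)) * ennreal (area_factor (P T) u) = ennreal (area_factor (Y T) u)"
    by (simp add: jac_P[OF T True] ennreal_mult[symmetric])
   thus ?thesis using True by (simp add: Y_def mult.assoc)
  qed simp
 qed
 also have "... = (\<integral>\<^sup>+x. f x \<partial>mg)" by (rule nn_integral_elements(2)[symmetric]) measurable
 finally show ?thesis by simp
qed

end

section \<open>Energy and mass forms\<close>

definition L2 :: "'a measure => ('a => real) => bool" where
 "L2 M u \<longleftrightarrow> u : borel_measurable M & integrable M (%x. (u x)^2)"

lemma integral_Cauchy_Schwarz:
 fixes a b :: "'a => real"
 assumes a: "L2 M a" and b: "L2 M b"
 shows "(\<integral>x. \<bar>a x * b x\<bar> \<partial>M) <= sqrt (\<integral>x. (a x)^2 \<partial>M) * sqrt (\<integral>x. (b x)^2 \<partial>M)"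
proof -
 have [measurable]: "a : borel_measurable M" "b : borel_measurable M" using a b by (auto simp: L2_def)
 have ab: "integrable M (%x. \<bar>a x * b x\<bar>)"
  using integrable_inner_sq[of a M b] a b by (simp add: L2_def)
 have "ennreal (\<integral>x. \<bar>a x * b x\<bar> \<partial>M) = (\<integral>\<^sup>+x. ennreal \<bar>a x\<bar> * ennreal \<bar>b x\<bar> \<partial>M)"
  using nn_integral_eq_integral[OF ab] by (simp add: ennreal_mult[symmetric] abs_mult)
 hence "ennreal ((\<integral>x. \<bar>a x * b x\<bar> \<partial>M)^2) = (\<integral>\<^sup>+x. ennreal \<bar>a x\<bar> * ennreal \<bar>b x\<bar> \<partial>M)^2"
  by (simp add: ennreal_power[symmetric])
 also have "... <= (\<integral>\<^sup>+x. (ennreal \<bar>a x\<bar>)^2 \<partial>M) * (\<integral>\<^sup>+x. (ennreal \<bar>b x\<bar>)^2 \<partial>M)"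
  by (rule Cauchy_Schwarz_nn_integral) measurable
 also have "... = ennreal (\<integral>x. (a x)^2 \<partial>M) * ennreal (\<integral>x. (b x)^2 \<partial>M)"
  using nn_integral_eq_integral[of M "%x. (a x)^2"] nn_integral_eq_integral[of M "%x. (b x)^2"] a b
  by (simp add: ennreal_power L2_def)
 finally have "(\<integral>x. \<bar>a x * b x\<bar> \<partial>M)^2 <= (\<integral>x. (a x)^2 \<partial>M) * (\<integral>x. (b x)^2 \<partial>M)"
  by (simp add: ennreal_mult[symmetric])
 thus ?thesis by (simp add: real_le_rsqrt real_sqrt_mult[symmetric])
qed

lemma L2_mult_integrable: "L2 M u ==> L2 M v ==> integrable M (%x. u x * v x)"
 using integrable_inner_sq[of u M v] by (simp add: L2_def)

lemma L2_add_scale: "L2 M u ==> L2 M v ==> L2 M (%x. u x + c * v x)"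
 using integrable_sq_add[of u M "%x. c * v x"] unfolding L2_def by (auto simp: power_mult_distrib)

lemma mass_form_commute: "mass_form M u v = mass_form M v u"
 by (simp add: mass_form_def mult.commute)

lemma mass_form_nonneg: "0 <= mass_form M u u"
 by (simp add: mass_form_def integral_nonneg)

lemma mass_form_add_scale:
 "L2 M u ==> L2 M v ==> L2 M w ==> mass_form M (%x. u x + c * v x) w = mass_form M u w + c * mass_form M v w"
 using L2_mult_integrable[of M u w] L2_mult_integrable[of M v w]
 by (simp add: mass_form_def algebra_simps)

lemma mass_form_Cauchy_Schwarz:
 "L2 M u ==> L2 M v ==> \<bar>mass_form M u v\<bar> <= mass_norm M u * mass_norm M v"
 unfolding mass_norm_def mass_form_def power2_eq_square[symmetric]
 by (rule order_trans[OF integral_abs_bound integral_Cauchy_Schwarz])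

lemma has_weak_grad_L2: "has_weak_grad M n u g ==> L2 M u"
 by (simp add: has_weak_grad_def L2_def)

text \<open>The tangential projection does not see the sign of the normal, so the orientation may be
  changed point by point.\<close>

lemma has_weak_grad_cong_normal:
 assumes "AE x in M. ALL w. tang (n x) w = tang (n' x) w"
 shows "has_weak_grad M n u g \<longleftrightarrow> has_weak_grad M n' u g"
proof -
 have "L2sq M (%x. tang (n x) (grad f x) - g x) = L2sq M (%x. tang (n' x) (grad f x) - g x)" for f
  unfolding L2sq_def by (rule nn_integral_cong_AE) (use assms in \<open>auto elim!: eventually_mono\<close>)
 thus ?thesis unfolding has_weak_grad_altdef by simp
qed

lemma forms_cong_normal:
 assumes "AE x in M. ALL w. tang (n x) w = tang (n' x) w"
 shows "H1 M n = H1 M n'" "energy_form M n = energy_form M n'" "energy_norm M n = energy_norm M n'"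
proof -
 have e: "has_weak_grad M n = has_weak_grad M n'"
  by (intro ext has_weak_grad_cong_normal[OF assms])
 show "H1 M n = H1 M n'" by (simp add: H1_def e)
 show e: "energy_form M n = energy_form M n'" by (intro ext) (simp add: energy_form_def weak_grad_def e)
 show "energy_norm M n = energy_norm M n'" by (intro ext) (simp add: energy_norm_def e)
qed

text \<open>\<open>weak_grad\<close> is a choice; uniqueness up to null sets is what makes the
  energy form bilinear.\<close>

locale surface_forms = surface_calculus +
 assumes weak_grad_zero: "has_weak_grad M n (%x. 0) w ==> AE x in M. w x = 0"
begin

lemma weak_grad_unique:
 assumes "has_weak_grad M n u g" "has_weak_grad M n u g'"
 shows "AE x in M. g x = g' x"
 using weak_grad_zero[of "%x. g x + (-1) *\<^sub>R g' x"] has_weak_grad_add_scale[OF assms, of "-1"] by simp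

lemma weak_grad: "u : H1 M n ==> has_weak_grad M n u (weak_grad M n u)"
 unfolding H1_def weak_grad_def mem_Collect_eq by (rule someI_ex[of "has_weak_grad M n u"])

lemma grad_inner_integrable:
 assumes "has_weak_grad M n u g" "has_weak_grad M n v g'"
 shows "integrable M (%x. g x \<bullet> g' x)"
 using assms unfolding has_weak_grad_def by (intro integrable_inner_sq) auto

lemma energy_form_eq:
 assumes u: "has_weak_grad M n u g" and v: "has_weak_grad M n v g'"
 shows "energy_form M n u v = (\<integral>x. g x \<bullet> g' x \<partial>M)"
proof -
 have U: "has_weak_grad M n u (weak_grad M n u)" and V: "has_weak_grad M n v (weak_grad M n v)"
  using u v weak_grad by (auto simp: H1_def)
 have [measurable]: "g : borel_measurable M" "g' : borel_measurable M"
  "weak_grad M n u : borel_measurable M" "weak_grad M n v : borel_measurable M"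
  using u v U V by (auto simp: has_weak_grad_def)
 show ?thesis
  unfolding energy_form_def
  by (rule integral_cong_AE) (use weak_grad_unique[OF U u] weak_grad_unique[OF V v] in auto)
qed

lemma energy_commute: "energy_form M n u v = energy_form M n v u"
 by (simp add: energy_form_def inner_commute)

lemma energy_nonneg: "0 <= energy_form M n u u"
 by (simp add: energy_form_def integral_nonneg)

lemma H1_L2: "u : H1 M n ==> L2 M u"
 using has_weak_grad_L2 by (auto simp: H1_def)

lemma H1_add_scale: "u : H1 M n ==> v : H1 M n ==> (%x. u x + c * v x) : H1 M n"
 unfolding H1_def using has_weak_grad_add_scale by blast

lemma H1_const: "(%x. c) : H1 M n"
 unfolding H1_def using has_weak_grad_const by blast

lemma energy_add_scale:
 assumes "u : H1 M n" "v : H1 M n" "w : H1 M n"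
 shows "energy_form M n (%x. u x + c * v x) w = energy_form M n u w + c * energy_form M n v w"
proof -
 note g = weak_grad[OF assms(1)] weak_grad[OF assms(2)] weak_grad[OF assms(3)]
 show ?thesis
  using grad_inner_integrable[OF g(1,3)] grad_inner_integrable[OF g(2,3)]
  by (simp add: energy_form_eq[OF has_weak_grad_add_scale[OF g(1,2)] g(3)] energy_form_eq[OF g(1,3)]
    energy_form_eq[OF g(2,3)] inner_add_left)
qed

lemma energy_const: "v : H1 M n ==> energy_form M n (%x. c) v = 0"
 using energy_form_eq[OF has_weak_grad_const weak_grad] by simp

lemma energy_norm_sq: "(energy_norm M n u)^2 = energy_form M n u u"
 by (simp add: energy_norm_def energy_nonneg)

lemma energy_norm_triangle:
 assumes u: "u : H1 M n" and v: "v : H1 M n"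
 shows "energy_norm M n (%x. u x + v x) <= energy_norm M n u + energy_norm M n v"
proof -
 let ?g = "weak_grad M n u" and ?g' = "weak_grad M n v"
 note gu = weak_grad[OF u] and gv = weak_grad[OF v]
 have [measurable]: "?g : borel_measurable M" "?g' : borel_measurable M"
  using gu gv by (auto simp: has_weak_grad_def)
 have n: "L2 M (%x. norm (?g x))" "L2 M (%x. norm (?g' x))"
  using gu gv by (auto simp: has_weak_grad_def L2_def)
 have "energy_form M n u v <= (\<integral>x. \<bar>norm (?g x) * norm (?g' x)\<bar> \<partial>M)"
  unfolding energy_form_eq[OF gu gv]
  by (rule integral_mono[OF grad_inner_integrable[OF gu gv] integrable_abs[OF L2_mult_integrable[OF n]]])
   (metis abs_ge_self norm_cauchy_schwarz order_trans)
 also have "... <= energy_norm M n u * energy_norm M n v"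
  using integral_Cauchy_Schwarz[OF n] by (simp add: energy_norm_def energy_form_def power2_norm_eq_inner)
 finally have "energy_form M n u v <= energy_norm M n u * energy_norm M n v" .
 moreover have "energy_form M n (%x. u x + v x) (%x. u x + v x)
   = energy_form M n u u + 2 * energy_form M n u v + energy_form M n v v"
 proof -
  have w: "(%x. u x + 1 * v x) : H1 M n" by (rule H1_add_scale[OF u v])
  have "energy_form M n w (%x. u x + v x) = energy_form M n w u + energy_form M n w v" if "w : H1 M n" for w
   using energy_add_scale[OF u v that, of 1] by (simp add: energy_commute[of w])
  thus ?thesis
   using energy_add_scale[OF u v w, of 1] u v by (simp add: energy_commute[of v u])
 qed
 ultimately have "(energy_norm M n (%x. u x + v x))^2 <= (energy_norm M n u + energy_norm M n v)^2"
  by (simp add: energy_norm_sq power2_sum)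
 thus ?thesis
  by (rule power2_le_imp_le) (simp add: energy_norm_def energy_nonneg)
qed

end

lemma (in surface_calculus) weak_grad_zero_cover:
 assumes I: "finite I" "AE x in M. EX i:I. x : X i ` U i"
  and X: "!!i. i : I ==> (U i, X i) : local_params S"
  and nX: "!!i u v. i : I ==> u : U i ==> norm (n (X i u)) = 1 & n (X i u) \<bullet> fderiv (X i) u v = 0"
  and w: "has_weak_grad M n (%x. 0) w"
 shows "AE x in M. w x = 0"
proof -
 have "AE x in M. x : X i ` U i --> w x = 0" if "i : I" for i
  by (rule weak_grad_zero_chart[OF X[OF that] _ w]) (use nX[OF that] in auto)
 hence "AE x in M. ALL i:I. x : X i ` U i --> w x = 0"
  by (rule AE_finite_allI[OF I(1)])
 thus ?thesis using I(2) by eventually_elim blast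
qed

text \<open>Since \<open>v\<close> is orthogonal to \<open>m\<close>, it only sees the part of
  \<open>n\<close> orthogonal to \<open>m\<close>, whose norm is the sine of the angle between
  \<open>m\<close> and \<open>n\<close>.\<close>

lemma tilt:
 fixes v m n :: "'a::real_inner"
 assumes "norm m = 1" "norm n = 1" "v \<bullet> m = 0"
 shows "(v \<bullet> n)^2 <= (1 - (m \<bullet> n)^2) * (norm v)^2"
proof -
 have "v \<bullet> n = v \<bullet> tang m n" using assms(3) by (simp add: tang_def inner_diff_right)
 hence "(v \<bullet> n)^2 <= (norm v)^2 * (norm (tang m n))^2"
  using Cauchy_Schwarz_ineq[of v "tang m n"] by (simp add: power2_norm_eq_inner)
 also have "(norm (tang m n))^2 = 1 - (m \<bullet> n)^2" using assms by (simp add: norm_tang_sq inner_commute)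
 finally show ?thesis by (simp add: mult.commute)
qed

section \<open>Pointwise comparison of normals and area elements\<close>

context mesh
begin

text \<open>Squared sine of the angle between the normals, quadratic in their difference and
  therefore of order h^(2k).\<close>

definition tilt_sq :: "'d ambient => real" where
 "tilt_sq x = 1 - (N x \<bullet> \<nu> x)^2"

definition defect :: "'d ambient => real" where
 "defect x = tilt_sq x + 6 * K * infdist x Sg"

text \<open>Collects the pointwise facts that hold off a null set, so that the geometry below is
  free of almost-everywhere statements.\<close>

definition good :: "'d ambient => bool" where
 "good x \<longleftrightarrow> (EX T:TT. x : P T ` Or) & norm (\<nu> x - N x) <= c * h ^ k & infdist x Sg <= c * h ^ (k + 1)"

text \<open>From \<open>(c * h ^ k)^2 = c^2 * h ^ (k - 1) * h ^ (k + 1)\<close> with the spare power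
  of \<open>h\<close> bounded by \<open>extent\<close>; the second summand comes from the distance
  to the surface.\<close>

definition ce :: real where "ce = c^2 * extent ^ (k - 1) + 6 * K * c"
text \<open>This and \<open>cl\<close> are the two dimensional constants of
  \<open>gram_ratio\<close>.\<close>

definition cJ :: real where "cJ = fact CARD('d) * 2 ^ CARD('d) * real CARD('d)"
definition cl :: real where "cl = (1/2) ^ CARD('d) / fact CARD('d)"

lemma AE_good: "AE x in mh. good x"
proof -
 have "AE x in mh. x : Sh" using surface_measureD(2)[OF mh] AE_space[of mh] by simp
 thus ?thesis
  using AE_in_element(1) d_small \<nu>N
 proof eventually_elim
  case (elim x)
  have "x : tube" using elim(1) Sh_tube by blast
  moreover have "\<bar>signed_dist Sg x\<bar> = infdist x Sg" by (simp add: signed_dist_def infdist_nonneg)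
  ultimately show ?case using elim \<nu>_eq by (simp add: good_def)
 qed
qed

lemma N_unit:
 assumes T: "T : TT" and u: "u : Or"
 shows "norm (N (P T u)) = 1" "N (P T u) \<bullet> dP T u v = 0"
 using unit_normalD[OF N_normal P_local_params[OF T] u] by (auto simp: dP_def)

lemma tangent_space_element:
 assumes T: "T : TT" and u: "u : Or"
 shows "range (dP T u) = {w. N (P T u) \<bullet> w = 0}"
 using tangent_space_eq[OF linear_dP[OF T] dP_inj[OF T] N_unit(1)[OF T u] N_unit(2)[OF T u]] O_subset u by blast

text \<open>The tangential part of \<open>\<nu>\<close> is itself a tangent vector of the element,
  and its product with \<open>\<nu>\<close> is its squared norm; for its norm t the angle bound
  reads t^2 <= t/2.\<close>

lemma tilt_sq_bound:
 assumes T: "T : TT" and u: "u : Or"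
 shows "tilt_sq (P T u) <= 1/4"
proof -
 let ?x = "P T u"
 let ?t = "tang (N ?x) (\<nu> ?x)"
 have "N ?x \<bullet> ?t = 0" using tang_inner[OF N_unit(1)[OF T u]] by (simp add: inner_commute)
 then obtain \<xi> where \<xi>: "?t = dP T u \<xi>" using tangent_space_element[OF T u] by blast
 have sq: "(norm ?t)^2 = tilt_sq ?x"
  using N_unit(1)[OF T u] norm_\<nu>[of ?x] by (simp add: norm_tang_sq tilt_sq_def inner_commute)
 moreover have "?t \<bullet> \<nu> ?x = tilt_sq ?x"
  using norm_\<nu>[of ?x] by (simp add: tang_def tilt_sq_def inner_diff_left inner_diff_right power2_eq_square inner_commute norm_eq_1)
 ultimately have "(norm ?t)^2 <= 1/2 * norm ?t"
  using angle[OF T, of u \<xi>] \<xi> O_subset u by auto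
 hence "norm ?t * norm ?t <= 1/2 * norm ?t" by (simp add: power2_eq_square)
 hence "norm ?t <= 1/2"
 proof (rule contrapos_pp)
  assume "~ norm ?t <= 1/2"
  hence "1/2 * norm ?t < norm ?t * norm ?t" by (intro mult_strict_right_mono) linarith+
  thus "~ norm ?t * norm ?t <= 1/2 * norm ?t" by linarith
 qed
 hence "(norm ?t)^2 <= (1/2)^2" by (rule power_mono) simp
 thus ?thesis using sq by (simp add: power2_eq_square)
qed

lemma goodD:
 assumes "good x"
 shows "x : Sh" "x : tube" "norm (N x) = 1" "0 <= tilt_sq x" "tilt_sq x <= 1/4" "0 <= defect x" "defect x <= 1/2"
  "defect x <= ce * h ^ (k + 1)"
proof -
 obtain T u where T: "T : TT" and u: "u : Or" and x: "x = P T u" using assms unfolding good_def by blast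
 show xG: "x : Sh" using P_in[OF T] O_subset u x by blast
 thus "x : tube" using Sh_tube by blast
 show N1: "norm (N x) = 1" using N_unit(1)[OF T u] x by simp
 show quarter: "tilt_sq x <= 1/4" using tilt_sq_bound[OF T u] x by simp
 let ?q = "N x \<bullet> \<nu> x"
 have q: "\<bar>?q\<bar> <= 1" using Cauchy_Schwarz_ineq2[of "N x" "\<nu> x"] N1 norm_\<nu>[of x] by simp
 hence "?q^2 <= 1" by (simp add: abs_square_le_1)
 thus t0: "0 <= tilt_sq x" by (simp add: tilt_sq_def)
 have K0: "0 < K" by (rule K_pos)
 have i0: "0 <= infdist x Sg" by (rule infdist_nonneg)
 show "0 <= defect x" using t0 K0 i0 by (simp add: defect_def)
 have "K * infdist x Sg <= K * \<delta>" using Sh_infdist[OF xG] K0 by simp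
 thus "defect x <= 1/2" using quarter \<delta>_small(4) by (simp add: defect_def)
 \<comment> \<open>With q the cosine of the angle, 1 - q^2 <= 2 * (1 - q) since q <= 1, and the
   right side is the squared distance of the two unit vectors.\<close>
 have "tilt_sq x <= (norm (\<nu> x - N x))^2"
 proof -
  have "(norm (\<nu> x - N x))^2 = 2 - 2 * ?q"
   using N1 norm_\<nu>[of x] by (simp add: power2_norm_eq_inner inner_diff_left inner_diff_right inner_commute norm_eq_1)
  moreover have "(1 - ?q) * (1 + ?q) <= (1 - ?q) * 2" using q by (intro mult_left_mono) auto
  ultimately show ?thesis by (simp add: tilt_sq_def power2_eq_square algebra_simps)
 qed
 also have "... <= (c * h ^ k)^2" using assms by (intro power_mono) (auto simp: good_def)
 also have "... = c^2 * (h ^ (k - 1) * h ^ (k + 1))"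
  using pos(4) by (cases k) (auto simp: power2_eq_square mult_ac)
 also have "... <= c^2 * (extent ^ (k - 1) * h ^ (k + 1))"
  using h_bounds by (intro mult_left_mono mult_right_mono power_mono) auto
 finally have 1: "tilt_sq x <= c^2 * (extent ^ (k - 1) * h ^ (k + 1))" .
 have "6 * K * infdist x Sg <= 6 * K * (c * h ^ (k + 1))" using assms K0 by (intro mult_left_mono) (auto simp: good_def)
 thus "defect x <= ce * h ^ (k + 1)" using 1 by (simp add: defect_def ce_def algebra_simps)
qed

lemma c_pos: "0 < ce" "0 < cJ" "0 < cl"
 using pos(3) extent_pos K_pos by (simp_all add: ce_def cJ_def cl_def add_pos_pos)

text \<open>\<open>gram_ratio\<close> for \<open>dcp x\<close> on the tangent space of the element,
  now with the true angle in place of the crude slope 1/2. That the defect stays below 1/2 on every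
  mesh gives the lower bound.\<close>

lemma jac_bounds:
 assumes g: "good x"
 shows "cl <= jac x" "\<bar>jac x - 1\<bar> <= cJ * defect x"
proof -
 obtain T u where T: "T : TT" and u: "u : Or" and x: "x = P T u" using g unfolding good_def by blast
 have ur: "u : Tr" using u O_subset by blast
 note G = goodD[OF g]
 have d: "\<bar>(norm (dcp x (dP T u v)))^2 - (norm (dP T u v))^2\<bar> <= defect x * (norm (dP T u v))^2" for v
 proof -
  have "(dP T u v \<bullet> \<nu> x)^2 <= tilt_sq x * (norm (dP T u v))^2"
   unfolding tilt_sq_def using N_unit(2)[OF T u, of v] x by (intro tilt G(3) norm_\<nu>) (simp add: inner_commute)
  hence "sqrt ((dP T u v \<bullet> \<nu> x)^2) <= sqrt (tilt_sq x * (norm (dP T u v))^2)" by (rule real_sqrt_le_mono)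
  hence a: "\<bar>dP T u v \<bullet> \<nu> x\<bar> <= sqrt (tilt_sq x) * norm (dP T u v)" by (simp add: real_sqrt_mult)
  have "K * infdist x Sg <= K * \<delta>" using Sh_infdist[OF G(1)] K_pos by simp
  hence "2 * K * infdist x Sg <= 1" using \<delta>_small(4) by simp
  from dcp_distortion[OF G(2) a order_refl this] show ?thesis using G(4) by (simp add: defect_def)
 qed
 obtain r where r: "sqrt (det (gram (dcp x \<circ> dP T u))) = r * sqrt (det (gram (dP T u)))"
  "\<bar>r - 1\<bar> <= fact CARD('d) * 2 ^ CARD('d) * CARD('d) * defect x" "(1/2) ^ CARD('d) / fact CARD('d) <= r"
  by (rule gram_ratio[OF linear_dP[OF T] dP_inj[OF T ur] linear_dcp[OF G(2)] G(6,7) d])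
 have "area_factor (Y T) u = r * area_factor (P T) u"
  using r(1) unfolding area_factor_gram frechet_Y[OF T ur] dP_def[symmetric] x by (simp add: comp_def)
 hence "jac x = r"
  using jac_P[OF T u] area_factor_pos[OF P_local_params[OF T] u] x by simp
 thus "cl <= jac x" "\<bar>jac x - 1\<bar> <= cJ * defect x" using r(2,3) by (simp_all add: cl_def cJ_def)
qed

lemma jac_upper: "good x ==> jac x <= 1 + cJ"
proof -
 assume g: "good x"
 have "cJ * defect x <= cJ * 1" using goodD(7)[OF g] c_pos(2) by (intro mult_left_mono) auto
 thus "jac x <= 1 + cJ" using jac_bounds(2)[OF g] by linarith
qed

text \<open>\<open>N\<close> is prescribed only up to sign at each point, so nothing makes it
  measurable; oriented along \<open>\<nu>\<close> it is continuous on each element.\<close>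

definition Nh :: "'d ambient => 'd ambient" where
 "Nh x = (\<Sum>T\<in>TT. indicator (P T ` Or) x *\<^sub>R (sgn (N x \<bullet> \<nu> x) *\<^sub>R N x))"

lemma N\<nu>_nonzero: "T : TT ==> u : Or ==> N (P T u) \<bullet> \<nu> (P T u) ~= 0"
 using tilt_sq_bound[of T u] by (auto simp: tilt_sq_def)

text \<open>Closed graph argument: the oriented normal is the only point of the unit sphere
  satisfying a family of closed conditions that vary continuously with the parameter, and a map into
  a compact space with closed graph is continuous.\<close>

lemma continuous_oriented_normal:
 assumes T: "T : TT"
 shows "continuous_on Or (%u. sgn (N (P T u) \<bullet> \<nu> (P T u)) *\<^sub>R N (P T u))" (is "continuous_on _ ?m")
proof -
 have m: "norm (?m u) = 1" "?m u \<bullet> dP T u v = 0" "0 <= ?m u \<bullet> \<nu> (P T u)" if "u : Or" for u v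
  using N_unit[OF T that] N\<nu>_nonzero[OF T that] by (auto simp: sgn_if)
 have uniq: "w = ?m u" if u: "u : Or" and w: "norm w = 1" "!!v. w \<bullet> dP T u v = 0" "0 <= w \<bullet> \<nu> (P T u)" for u w
 proof -
  have ur: "u : Tr" using u O_subset by blast
  have e: "w = (w \<bullet> N (P T u)) *\<^sub>R N (P T u)"
   by (rule normal_space_eq[OF linear_dP[OF T] dP_inj[OF T ur] N_unit(1)[OF T u] N_unit(2)[OF T u] w(2)])
  hence "\<bar>w \<bullet> N (P T u)\<bar> = 1" using w(1) N_unit(1)[OF T u] by (metis norm_scaleR mult.right_neutral)
  moreover have "w \<bullet> \<nu> (P T u) = (w \<bullet> N (P T u)) * (N (P T u) \<bullet> \<nu> (P T u))" by (subst e) simp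
  ultimately have "w \<bullet> N (P T u) = sgn (N (P T u) \<bullet> \<nu> (P T u))"
   using w(3) N\<nu>_nonzero[OF T u] by (cases "w \<bullet> N (P T u) \<ge> 0") (auto simp: sgn_if)
  thus ?thesis using e by simp
 qed
 have cP: "continuous_on Or (%u. \<nu> (P T u))" "!!v. continuous_on Or (%u. dP T u v)"
  using continuous_on_subset[OF continuous_\<nu>P[OF T] O_subset] continuous_on_subset[OF continuous_dP_ref[OF T] O_subset] by auto
 have c2: "continuous_on (Or \<times> sphere 0 1) (%z::(real^'d) \<times> 'd ambient. snd z \<bullet> g (fst z))"
  if "continuous_on Or g" for g :: "real^'d => 'd ambient"
  by (intro continuous_intros continuous_on_compose2[OF that]) auto
 have "(%u. (u, ?m u)) ` Or =
   (\<Inter>v. (Or \<times> sphere 0 1) Int (%z. snd z \<bullet> dP T (fst z) v) -` {0}) \<inter>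
   ((Or \<times> sphere 0 1) Int (%z. snd z \<bullet> \<nu> (P T (fst z))) -` {0..})" (is "?l = ?r")
 proof
  show "?l \<subseteq> ?r" using m by auto
  show "?r \<subseteq> ?l" 
  proof
   fix z assume z: "z : ?r"
   hence "snd z = ?m (fst z)" by (intro uniq) auto
   thus "z : ?l" using z by (intro image_eqI[of _ _ "fst z"]) (auto simp: prod_eq_iff)
  qed
 qed
 moreover have "closedin (top_of_set (Or \<times> sphere 0 1)) ?r"
  by (intro closedin_Int closedin_INT continuous_closedin_preimage c2 cP closed_singleton closed_real_atLeast) simp
 ultimately have "closedin (top_of_set (Or \<times> sphere 0 1)) ((%u. (u, ?m u)) ` Or)" by simp
 thus ?thesis
  by (subst continuous_closed_graph_eq[of "sphere 0 1"]) (use m(1) in auto)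
qed

lemma Nh_measurable: "Nh : borel_measurable mh"
proof -
 have "(%x. indicator (P T ` Or) x *\<^sub>R (sgn (N x \<bullet> \<nu> x) *\<^sub>R N x)) : borel_measurable mh" if T: "T : TT" for T
 proof -
  have "(%x. indicator (P T ` Or) x *\<^sub>R (sgn (N x \<bullet> \<nu> x) *\<^sub>R N x))
   = (%x. indicator (P T ` Or) x *\<^sub>R (%u. sgn (N (P T u) \<bullet> \<nu> (P T u)) *\<^sub>R N (P T u)) (inv_into Or (P T) x))"
   by (intro ext) (auto simp: indicator_def f_inv_into_f)
  thus ?thesis using chart_inverse_measurable[OF T continuous_oriented_normal[OF T]] by (simp only:)
 qed
 thus ?thesis unfolding Nh_def by (rule borel_measurable_sum)
qed

lemma Nh_eq: "T : TT ==> x : P T ` Or ==> Nh x = sgn (N x \<bullet> \<nu> x) *\<^sub>R N x"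
 unfolding Nh_def scaleR_sum_left[symmetric]
 using element_sum_indicator[OF disjoint_elements(1), of T x "%_. 1::real"] by simp

lemma Nh_sign:
 assumes T: "T : TT" and u: "u : Or"
 shows "Nh (P T u) = N (P T u) \<or> Nh (P T u) = - N (P T u)"
proof -
 have "sgn (N (P T u) \<bullet> \<nu> (P T u)) = 1 \<or> sgn (N (P T u) \<bullet> \<nu> (P T u)) = - 1"
  using N\<nu>_nonzero[OF T u] by (simp add: sgn_if)
 thus ?thesis using Nh_eq[OF T imageI[OF u]] by auto
qed

lemma finite_measures: "finite_measure mh" "finite_measure mg"
proof -
 have sp: "space mh = Sh" "space mg = Sg" using surface_measureD(2) mh mg by blast+
 have fin: "(\<integral>\<^sup>+u. ennreal (f u * indicator Or u) \<partial>lborel) < \<infinity>" if f: "continuous_on Tr f" for f :: "real^'d => real"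
 proof -
  obtain B where B: "!!u. u : Tr ==> \<bar>f u\<bar> <= B"
   using compact_imp_bounded[OF compact_continuous_image[OF f compact_ref_simplex]] unfolding bounded_iff by fastforce
  have O: "Or : sets borel" using O_open by simp
  have "(\<integral>\<^sup>+u. ennreal (f u * indicator Or u) \<partial>lborel) <= (\<integral>\<^sup>+u. ennreal B * indicator Or u \<partial>lborel)"
  proof (rule nn_integral_mono)
   fix u :: "real^'d"
   show "ennreal (f u * indicator Or u) <= ennreal B * indicator Or u"
   proof (cases "u : Or")
    case True
    hence "f u <= B" using B[of u] O_subset abs_ge_self[of "f u"] by (meson order_trans subsetD)
    thus ?thesis using True by (simp add: ennreal_leI)
   qed simp
  qed
  also have "... = ennreal B * emeasure lborel Or" using O by (simp add: nn_integral_cmult_indicator)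
  also have "... < \<infinity>"
   using emeasure_bounded_finite[OF bounded_subset[OF compact_imp_bounded[OF compact_ref_simplex] O_subset]]
   by (simp add: ennreal_mult_less_top)
  finally show ?thesis .
 qed
 have caf: "continuous_on Tr (area_factor X)" if "open W" "Tr \<subseteq> W" "smooth_on X W" for X :: "real^'d => 'd ambient" and W
 proof -
  have "continuous_on Tr (%u. fderiv X u v)" for v
   using smooth_on_continuous_frechet_derivative[OF that(3)] that(2) continuous_on_subset by blast
  thus ?thesis
   unfolding area_factor_def det_def vec_lambda_beta
   by (intro continuous_on_real_sqrt continuous_on_sum continuous_on_mult continuous_on_prod continuous_on_const continuous_on_inner)
 qed
 have "emeasure mh (space mh) = (\<Sum>T\<in>TT. \<integral>\<^sup>+u. 1 * ennreal (area_factor (P T) u * indicator Or u) \<partial>lborel)"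
  using nn_integral_elements(1)[of "%_. 1"] by simp
 also have "... < \<infinity>" using fin[OF caf[OF open_UNIV _ P_props(1)]] finite_T by (simp add: less_top[symmetric])
 finally show "finite_measure mh" by (intro finite_measureI) auto
 have "emeasure mg (space mg) = (\<Sum>T\<in>TT. \<integral>\<^sup>+u. 1 * ennreal (area_factor (Y T) u * indicator Or u) \<partial>lborel)"
  using nn_integral_elements(2)[of "%_. 1"] by simp
 also have "... < \<infinity>" using fin[OF caf[OF open_\<Omega> ref_\<Omega> smooth_Y]] finite_T by (simp add: less_top[symmetric])
 finally show "finite_measure mg" by (intro finite_measureI) auto
qed

lemma surface_calculus_Sh: "surface_calculus Sh mh Nh"
proof (rule surface_calculus.intro[OF mh compact_Sh finite_measures(1) Nh_measurable])
 show "norm (Nh x) <= 1" if "x : Sh" for x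
 proof (cases "EX T:TT. x : P T ` Or")
  case True
  then obtain T u where T: "T : TT" and u: "u : Or" and x: "x = P T u" by blast
  show ?thesis unfolding x using Nh_sign[OF T u] N_unit(1)[OF T u] by (elim disjE) simp_all
 next
  case False
  hence "Nh x = 0" unfolding Nh_def by (intro sum.neutral) (auto simp: indicator_def)
  thus ?thesis by simp
 qed
qed

lemma surface_calculus_Sg: "surface_calculus Sg mg n"
 by (rule surface_calculus.intro[OF mg compact finite_measures(2) continuous_on_surface_measurable[OF mg continuous_n]])
  (simp add: norm_n)

end

sublocale mesh \<subseteq> Sh: surface_forms Sh mh Nh
proof -
 interpret surface_calculus Sh mh Nh by (rule surface_calculus_Sh)
 show "surface_forms Sh mh Nh"
 proof
  fix w assume w: "has_weak_grad mh Nh (%x. 0) w"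
  show "AE x in mh. w x = 0"
  proof (rule weak_grad_zero_cover[OF finite_T AE_in_element(1) P_local_params _ w])
   fix T u v assume T: "T : TT" and u: "u : Or"
   show "norm (Nh (P T u)) = 1 & Nh (P T u) \<bullet> fderiv (P T) u v = 0"
    using Nh_sign[OF T u] N_unit(1)[OF T u] N_unit(2)[OF T u, of v] unfolding dP_def by (elim disjE) simp_all
  qed
 qed
qed

sublocale mesh \<subseteq> Sg: surface_forms Sg mg n
proof -
 interpret surface_calculus Sg mg n by (rule surface_calculus_Sg)
 show "surface_forms Sg mg n"
 proof
  fix w assume w: "has_weak_grad mg n (%x. 0) w"
  show "AE x in mg. w x = 0"
   by (rule weak_grad_zero_cover[OF finite_T AE_in_element(2) Y_local_params _ w])
    (use unit_normalD[OF normal Y_local_params] in auto)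
 qed
qed

context mesh
begin

lemma forms_N: "H1 mh N = H1 mh Nh" "energy_form mh N = energy_form mh Nh" "energy_norm mh N = energy_norm mh Nh"
proof -
 have "AE x in mh. ALL w. tang (N x) w = tang (Nh x) w"
  using AE_in_element(1)
 proof eventually_elim
  case (elim x)
  then obtain T u where "T : TT" "u : Or" "x = P T u" by blast
  thus ?case using Nh_sign[of T u] tang_minus[of "N x"] by auto
 qed
 from forms_cong_normal[OF this]
 show "H1 mh N = H1 mh Nh" "energy_form mh N = energy_form mh Nh" "energy_norm mh N = energy_norm mh Nh" .
qed

lemma forms_\<nu>: "H1 mg (normal_ext Sg) = H1 mg n" "energy_form mg (normal_ext Sg) = energy_form mg n"
proof -
 have "AE x in mg. ALL w. tang (normal_ext Sg x) w = tang (n x) w"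
  using AE_space[of mg]
 proof eventually_elim
  case (elim x)
  hence x: "x : Sg" using surface_measureD(2)[OF mg] by simp
  thus ?case using normal_ext_eq[of x] Sg_subset_tube cp_on[OF x] by auto
 qed
 from forms_cong_normal(1,2)[OF this]
 show "H1 mg (normal_ext Sg) = H1 mg n" "energy_form mg (normal_ext Sg) = energy_form mg n" .
qed

end

section \<open>Transfer between the surfaces\<close>

lemma has_weak_grad_cong:
 assumes "!!x. x : space M ==> u x = v x"
 shows "has_weak_grad M n u g \<longleftrightarrow> has_weak_grad M n v g"
proof -
 have "u : borel_measurable M \<longleftrightarrow> v : borel_measurable M" by (rule measurable_cong[OF assms])
 moreover have "integrable M (%x. (u x)^2) \<longleftrightarrow> integrable M (%x. (v x)^2)"
  by (rule Bochner_Integration.integrable_cong) (simp_all add: assms)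
 moreover have "(\<integral>\<^sup>+x. ennreal ((f x - u x)^2) \<partial>M) = (\<integral>\<^sup>+x. ennreal ((f x - v x)^2) \<partial>M)" for f
  by (rule nn_integral_cong) (simp add: assms)
 ultimately show ?thesis unfolding has_weak_grad_def by simp
qed

lemma smooth_near_strict:
 fixes g :: "'a::euclidean_space => real"
 assumes W: "open W" "x : W" and g: "smooth_on g W" and e: "0 < e"
 shows "EX r>0. ALL y:ball x r. ALL z:ball x r. \<bar>g y - g z - grad g x \<bullet> (y - z)\<bar> <= e * norm (y - z)"
proof (rule smooth_on_strictly_differentiable[OF W g e])
 fix r assume r: "0 < r" "!!y z. y : ball x r ==> z : ball x r ==>
   norm (g y - g z - fderiv g x (y - z)) <= e * norm (y - z)"
 have "fderiv g x v = grad g x \<bullet> v" for v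
  by (rule differentiable_grad(2)[OF smooth_on_has_derivative[OF g W(2)]])
 thus ?thesis using r by auto
qed

lemma (in surface_calculus) H1_lipschitz_piecewise_smooth:
 assumes lip: "!!x y. \<bar>g x - g y\<bar> <= L * norm (x - y)" and L: "0 <= L"
  and supp: "!!x. r <= norm x ==> g x = 0"
  and smooth: "AE x in M. EX W. open W & x : W & smooth_on g W"
 shows "g : H1 M n"
proof -
 \<comment> \<open>\<open>D\<close> is a limit of difference quotients of the continuous
   \<open>g\<close> and thus measurable; wherever \<open>g\<close> is smooth it is the
   gradient.\<close>
 define q where "q b m x = (g (x + (1 / real (Suc m)) *\<^sub>R b) - g x) * real (Suc m)" for b m x
 define D where "D x = (\<Sum>b\<in>Basis. lim (%m. q b m x) *\<^sub>R b)" for x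
 have cg: "continuous_on UNIV g"
 proof -
  have "L-lipschitz_on UNIV g" using lip L by (intro lipschitz_onI) (auto simp: dist_norm)
  thus ?thesis by (rule lipschitz_on_continuous_on)
 qed
 have "continuous_on UNIV (q b m)" for b m
  unfolding q_def by (intro continuous_intros continuous_on_compose2[OF cg]) auto
 hence [measurable]: "q b m : borel_measurable M" for b m by (rule continuous_measurable)
 have D_meas[measurable]: "D : borel_measurable M" unfolding D_def by measurable
 have "AE x in M. ALL e>0. EX r>0. ALL y:ball x r. ALL z:ball x r. \<bar>g y - g z - D x \<bullet> (y - z)\<bar> <= e * norm (y - z)"
  using smooth
 proof eventually_elim
  case (elim x)
  then obtain W where W: "open W" "x : W" "smooth_on g W" by blast
  note d = smooth_on_has_derivative[OF W(3,2)]
  have lq: "(%m. q b m x) \<longlonglongrightarrow> fderiv g x b" for b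
  proof -
   have "filterlim (%m. 1 / real (Suc m)) (at_right 0) sequentially"
    unfolding filterlim_at using LIMSEQ_Suc[OF lim_1_over_n] by (auto simp: field_simps)
   from filterlim_compose[OF has_derivative_difference_quotient[OF d, of b] this]
   show ?thesis by (simp add: q_def mult.commute)
  qed
  have "D x = grad g x" unfolding D_def differentiable_grad(1)[OF d] by (simp add: limI[OF lq])
  thus ?case using smooth_near_strict[OF W] by simp
 qed
 from has_weak_grad_lipschitz[OF lip L supp D_meas this] show ?thesis unfolding H1_def by blast
qed

section \<open>Cut-off extensions and the adjoint of the differential of the projection\<close>

context tubular
begin

text \<open>Equal to 1 up to a quarter of the reach and to 0 from half of it on. Multiplied by it, a
  Lipschitz function of the foot point becomes globally Lipschitz with bounded support.\<close>

definition cutoff :: "'d ambient => real" where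
 "cutoff x = min 1 (max 0 (2 - 4 / reach * infdist x Sg))"

lemma cutoff_bounds: "0 <= cutoff x" "cutoff x <= 1" "infdist x Sg <= reach / 4 ==> cutoff x = 1" "x ~: tube ==> cutoff x = 0"
proof -
 show "0 <= cutoff x" "cutoff x <= 1" by (simp_all add: cutoff_def)
 show "cutoff x = 1" if "infdist x Sg <= reach / 4"
  using that reach_pos by (simp add: cutoff_def field_simps)
 show "cutoff x = 0" if "x ~: tube"
  using that reach_pos by (simp add: cutoff_def tube_def field_simps)
qed

lemma cutoff_lipschitz: "\<bar>cutoff x - cutoff y\<bar> <= 4 / reach * norm (x - y)"
proof -
 have "\<bar>cutoff x - cutoff y\<bar> <= \<bar>4 / reach * infdist x Sg - 4 / reach * infdist y Sg\<bar>"
  unfolding cutoff_def by linarith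
 also have "... = 4 / reach * \<bar>infdist x Sg - infdist y Sg\<bar>"
  unfolding right_diff_distrib[symmetric] abs_mult using reach_pos by simp
 also have "... <= 4 / reach * norm (x - y)"
  using infdist_triangle_abs[of x Sg y] reach_pos by (intro mult_left_mono) (auto simp: dist_norm)
 finally show ?thesis .
qed

text \<open>The foot point is Lipschitz in the tube only; if one of the points lies outside, its
  cutoff vanishes, and the difference is carried by the cutoff alone with the bound \<open>B\<close>
  on \<open>q\<close>.\<close>

lemma cutoff_extension:
 assumes q: "!!p p'. p : Sg ==> p' : Sg ==> \<bar>q p - q p'\<bar> <= L * norm (p - p')" and L: "0 <= L"
 shows "EX L'>=0. ALL x y. \<bar>cutoff x * q (cp x) - cutoff y * q (cp y)\<bar> <= L' * norm (x - y)"
  "EX r. ALL x. r <= norm x --> cutoff x * q (cp x) = 0"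
proof -
 obtain p0 where p0: "p0 : Sg" using nonempty by blast
 define B where "B = \<bar>q p0\<bar> + L * diameter Sg"
 have B: "\<bar>q p\<bar> <= B" if "p : Sg" for p
 proof -
  have "\<bar>q p - q p0\<bar> <= L * norm (p - p0)" using q[OF that p0] .
  also have "... <= L * diameter Sg"
   using diameter_bounded_bound[OF compact_imp_bounded[OF compact] that p0] L by (intro mult_left_mono) (auto simp: dist_norm)
  finally show ?thesis unfolding B_def by linarith
 qed
 have B0: "0 <= B" using B[OF p0] by linarith
 define L' where "L' = 2 * L + B * (4 / reach)"
 have L'0: "0 <= L'" using L B0 reach_pos by (simp add: L'_def)
 have key: "\<bar>cutoff x * q (cp x) - cutoff y * q (cp y)\<bar> <= L' * norm (x - y)" if x: "x : tube" for x y
 proof -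
  have "\<bar>(cutoff x - cutoff y) * q (cp x)\<bar> <= (4 / reach * norm (x - y)) * B"
   unfolding abs_mult using cutoff_lipschitz B[OF cp_in] reach_pos by (intro mult_mono) auto
  moreover have "\<bar>cutoff y * (q (cp x) - q (cp y))\<bar> <= 2 * L * norm (x - y)"
  proof (cases "y : tube")
   case True
   have "\<bar>cutoff y * (q (cp x) - q (cp y))\<bar> <= 1 * (L * norm (cp x - cp y))"
    unfolding abs_mult using cutoff_bounds(1,2)[of y] q[OF cp_in cp_in] by (intro mult_mono) auto
   also have "... <= L * (2 * norm (x - y))" using cp_lipschitz[OF x True] L by (simp add: mult_left_mono)
   finally show ?thesis by (simp add: mult_ac)
  next
   case False
   thus ?thesis using L by (simp add: cutoff_bounds(4))
  qed
  moreover have "cutoff x * q (cp x) - cutoff y * q (cp y)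
    = (cutoff x - cutoff y) * q (cp x) + cutoff y * (q (cp x) - q (cp y))" by (simp add: algebra_simps)
  moreover have "L' * norm (x - y) = 2 * L * norm (x - y) + (4 / reach * norm (x - y)) * B"
   by (simp add: L'_def algebra_simps)
  ultimately show ?thesis by linarith
 qed
 have "\<bar>cutoff x * q (cp x) - cutoff y * q (cp y)\<bar> <= L' * norm (x - y)" for x y
 proof (cases "x : tube \<or> y : tube")
  case True
  thus ?thesis using key[of x y] key[of y x] by (auto simp: abs_minus_commute norm_minus_commute)
 next
  case False
  thus ?thesis using L'0 by (simp add: cutoff_bounds(4))
 qed
 thus "EX L'>=0. ALL x y. \<bar>cutoff x * q (cp x) - cutoff y * q (cp y)\<bar> <= L' * norm (x - y)" using L'0 by blast
 obtain b where b: "!!p. p : Sg ==> norm p <= b" using compact_imp_bounded[OF compact] by (auto simp: bounded_iff)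
 have "cutoff x * q (cp x) = 0" if "b + reach <= norm x" for x
 proof -
  have "norm x <= norm (cp x) + dist x (cp x)" using norm_triangle_ineq2[of x "cp x"] by (simp add: dist_norm)
  hence "reach <= infdist x Sg" using that b[OF cp_in, of x] infdist_eq[of x] by linarith
  thus ?thesis using cutoff_bounds(4)[of x] by (simp add: tube_def)
 qed
 thus "EX r. ALL x. r <= norm x --> cutoff x * q (cp x) = 0" by blast
qed

definition near :: "'d ambient set" where "near = {x. infdist x Sg < reach / 4}"

lemma near: "open near" "near \<subseteq> tube" "!!x. x : near ==> cutoff x = 1" "Sg \<subseteq> near"
proof -
 show "open near" unfolding near_def
  by (rule open_Collect_less) (auto intro!: continuous_intros continuous_on_infdist)
 show "near \<subseteq> tube" using reach_pos by (auto simp: near_def tube_def)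
 show "cutoff x = 1" if "x : near" for x using that by (intro cutoff_bounds(3)) (simp add: near_def)
 show "Sg \<subseteq> near" using reach_pos by (auto simp: near_def)
qed

lemma smooth_lipschitz_on_Sg:
 fixes f :: "'d ambient => real"
 assumes f: "smooth_on f UNIV"
 shows "EX L>=0. ALL p:Sg. ALL p':Sg. \<bar>f p - f p'\<bar> <= L * norm (p - p')"
proof -
 obtain b where b: "Sg \<subseteq> cball 0 b" using compact_imp_bounded[OF compact] by (auto simp: bounded_iff subset_iff)
 have "compact (grad f ` cball 0 b)"
  using smooth_continuous_grad[OF f] continuous_on_subset by (intro compact_continuous_image) auto
 hence "bounded (grad f ` cball 0 b)" by (rule compact_imp_bounded)
 then obtain B where B: "!!x. x : cball 0 b ==> norm (grad f x) <= B" unfolding bounded_iff by fastforce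
 have "\<bar>f p - f p'\<bar> <= \<bar>B\<bar> * norm (p - p')" if p: "p : Sg" "p' : Sg" for p p'
 proof -
  have "norm (f p - f p') <= \<bar>B\<bar> * norm (p - p')"
  proof (rule differentiable_bound[OF convex_cball])
   show "p : cball 0 b" "p' : cball 0 b" using b p by blast+
   fix x :: "'d ambient" assume x: "x : cball 0 b"
   note d = smooth_on_UNIV_has_derivative[OF f, of x]
   show "(f has_derivative fderiv f x) (at x within cball 0 b)" by (rule has_derivative_at_withinI[OF d])
   show "onorm (fderiv f x) <= \<bar>B\<bar>"
   proof (rule onorm_bound)
    fix v
    have "norm (fderiv f x v) <= norm (grad f x) * norm v"
     using differentiable_grad(2)[OF d, of v] Cauchy_Schwarz_ineq2[of "grad f x" v] by simp
    also have "... <= \<bar>B\<bar> * norm v" using B[OF x] by (intro mult_right_mono) auto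
    finally show "norm (fderiv f x v) <= \<bar>B\<bar> * norm v" .
   qed simp
  qed
  thus ?thesis by simp
 qed
 thus ?thesis by (intro exI[of _ "\<bar>B\<bar>"]) auto
qed

text \<open>The adjoint of \<open>dcp x\<close>. By the chain rule it sends the gradient of a
  function at \<open>cp x\<close> to the gradient at \<open>x\<close> of its composition with
  \<open>cp\<close>.\<close>

definition adj :: "'d ambient => 'd ambient => 'd ambient" where
 "adj x q = (\<Sum>b\<in>Basis. (dcp x b \<bullet> q) *\<^sub>R b)"

lemma adj_inner: "x : tube ==> adj x q \<bullet> v = q \<bullet> dcp x v"
proof -
 assume x: "x : tube"
 have "dcp x v = dcp x (\<Sum>b\<in>Basis. (v \<bullet> b) *\<^sub>R b)" by (simp add: euclidean_representation)
 also have "... = (\<Sum>b\<in>Basis. (v \<bullet> b) *\<^sub>R dcp x b)"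
  by (simp add: linear_sum[OF linear_dcp[OF x]] linear_scale[OF linear_dcp[OF x]])
 finally show ?thesis
  by (simp add: adj_def inner_sum_left inner_sum_right inner_commute mult.commute)
qed

lemma adj_norm_le: "x : tube ==> norm (adj x q) <= 2 * norm q"
proof (rule norm_le_dual)
 fix v assume x: "x : tube"
 have "\<bar>adj x q \<bullet> v\<bar> <= norm q * norm (dcp x v)" unfolding adj_inner[OF x] by (rule Cauchy_Schwarz_ineq2)
 also have "... <= norm q * (2 * norm v)" by (intro mult_left_mono dcp_norm_le x) simp
 finally show "\<bar>adj x q \<bullet> v\<bar> <= 2 * norm q * norm v" by (simp add: mult_ac)
qed

lemma adj_diff: "adj x q - adj x q' = adj x (q - q')"
 by (simp add: adj_def inner_diff_right scaleR_left_diff_distrib sum_subtractf)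

lemma adj_tang: "x : tube ==> adj x (tang (n (cp x)) q) = adj x q"
 using dcp_tangent[of x] by (simp add: adj_def tang_def inner_diff_right inner_commute)

end

context mesh
begin

lemma Sh_near: "Sh \<subseteq> near"
proof
 fix x assume "x : Sh"
 hence "infdist x Sg < \<delta>" by (rule Sh_infdist)
 moreover have "K * reach = 1/4" using reach_K by (simp add: mult.commute)
 hence "K * \<delta> <= K * (reach / 8)" using \<delta>_small(4) by linarith
 hence "\<delta> <= reach / 8" using K_pos by (simp only: mult_le_cancel_left_pos)
 ultimately show "x : near" using reach_pos by (simp add: near_def)
qed

lemma space_mh: "space mh = Sh" and space_mg: "space mg = Sg"
 using surface_measureD(2) mh mg by blast+

lemma dcp_measurable[measurable]: "(%x. dcp x v) : borel_measurable mh"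
proof (rule continuous_on_surface_measurable[OF mh])
 show "continuous_on Sh (%x. dcp x v)"
  unfolding dcp_def using continuous_on_subset[OF smooth_on_continuous_frechet_derivative[OF smooth_on_cp] Sh_tube] .
qed

lemma pullback_measurable[measurable]: "g : borel_measurable mg ==> (%x. g (cp x)) : borel_measurable mh"
 by (rule measurable_compose[OF cp_measurable])

lemma adj_measurable[measurable]:
 assumes [measurable]: "g : borel_measurable mh"
 shows "(%x. adj x (g x)) : borel_measurable mh"
 unfolding adj_def by measurable

definition lift_grad :: "('d ambient => 'd ambient) => 'd ambient => 'd ambient" where
 "lift_grad g x = tang (Nh x) (adj x (g (cp x)))"

lemma lift_grad_measurable[measurable]:
 assumes [measurable]: "g : borel_measurable mg"
 shows "lift_grad g : borel_measurable mh"
 unfolding lift_grad_def by (rule Sh.tang_measurable) measurable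

lemma L2sq_pullback:
 fixes w :: "'d ambient => 'b::{real_normed_vector, second_countable_topology}"
 assumes w[measurable]: "w : borel_measurable mg"
 shows "L2sq mh (%x. w (cp x)) <= ennreal (1 / cl) * L2sq mg w"
proof -
 have "L2sq mh (%x. w (cp x)) <= (\<integral>\<^sup>+x. ennreal (1 / cl) * (ennreal ((norm (w (cp x)))^2) * ennreal (jac x)) \<partial>mh)"
  unfolding L2sq_def
 proof (rule nn_integral_mono_AE, rule AE_mp[OF AE_good], intro AE_I2 impI)
  fix x assume "good x"
  hence j: "cl <= jac x" by (rule jac_bounds)
  hence "1 <= 1 / cl * jac x" using c_pos(3) by (simp add: pos_le_divide_eq)
  hence "(norm (w (cp x)))^2 * 1 <= (norm (w (cp x)))^2 * (1 / cl * jac x)" by (rule mult_left_mono) simp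
  hence le: "(norm (w (cp x)))^2 <= 1 / cl * ((norm (w (cp x)))^2 * jac x)" by (simp only: mult.left_commute mult_1_right)
  have "0 <= jac x" using j c_pos(3) by linarith
  hence "ennreal (1 / cl) * (ennreal ((norm (w (cp x)))^2) * ennreal (jac x)) = ennreal (1 / cl * ((norm (w (cp x)))^2 * jac x))"
   using c_pos(3) by (simp only: ennreal_mult zero_le_power2 mult_nonneg_nonneg divide_nonneg_nonneg zero_le_one less_imp_le)
  thus "ennreal ((norm (w (cp x)))^2) <= ennreal (1 / cl) * (ennreal ((norm (w (cp x)))^2) * ennreal (jac x))"
   using ennreal_leI[OF le] by simp
 qed
 also have "... = ennreal (1 / cl) * (\<integral>\<^sup>+x. ennreal ((norm (w (cp x)))^2) * ennreal (jac x) \<partial>mh)"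
  by (rule nn_integral_cmult) (use jac_measurable in measurable)
 also have "(\<integral>\<^sup>+x. ennreal ((norm (w (cp x)))^2) * ennreal (jac x) \<partial>mh) = L2sq mg w"
  unfolding L2sq_def by (rule nn_integral_pullback[symmetric]) measurable
 finally show ?thesis .
qed

lemma norm_lift_grad_le: "x : Sh ==> norm (lift_grad g x) <= 2 * norm (g (cp x))"
 unfolding lift_grad_def
 using order_trans[OF norm_tang_le[OF Sh.n_le] adj_norm_le] Sh_tube by blast

lemma L2sq_lift_grad:
 assumes w[measurable]: "w : borel_measurable mg"
 shows "L2sq mh (lift_grad w) <= ennreal (4 / cl) * L2sq mg w"
proof -
 have "L2sq mh (lift_grad w) <= (\<integral>\<^sup>+x. ennreal 4 * ennreal ((norm (w (cp x)))^2) \<partial>mh)"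
  unfolding L2sq_def
 proof (rule nn_integral_mono)
  fix x assume "x : space mh"
  hence "(norm (lift_grad w x))^2 <= (2 * norm (w (cp x)))^2"
   using norm_lift_grad_le[of x w] space_mh by (intro power_mono) auto
  thus "ennreal ((norm (lift_grad w x))^2) <= ennreal 4 * ennreal ((norm (w (cp x)))^2)"
   by (subst ennreal_mult[symmetric]) (auto simp: power_mult_distrib intro!: ennreal_leI)
 qed
 also have "... = ennreal 4 * L2sq mh (%x. w (cp x))"
  unfolding L2sq_def by (rule nn_integral_cmult) measurable
 also have "... <= ennreal 4 * (ennreal (1 / cl) * L2sq mg w)"
  by (intro mult_left_mono L2sq_pullback w) simp
 also have "... = ennreal (4 / cl) * L2sq mg w"
  using c_pos(3) ennreal_mult[of 4 "1 / cl"] by (simp add: mult.assoc)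
 finally show ?thesis .
qed

lemma integrable_sq_pullback:
 fixes w :: "'d ambient => 'b::{real_normed_vector, second_countable_topology}"
 assumes w[measurable]: "w : borel_measurable mg" and i: "integrable mg (%x. (norm (w x))^2)"
 shows "integrable mh (%x. (norm (w (cp x)))^2)"
proof -
 have "ennreal (1 / cl) * L2sq mg w < \<infinity>" using i by (simp add: integrable_sq_iff ennreal_mult_less_top)
 thus ?thesis using L2sq_pullback[OF w] by (simp add: integrable_sq_iff)
qed

lemma L2_pullback: "L2 mg u ==> L2 mh (%x. u (cp x))"
 using integrable_sq_pullback[of u] pullback_measurable[of u] by (simp add: L2_def)

text \<open>The composition with \<open>cp\<close> is smooth only in the tube, so its weak gradient
  is taken from the cut-off extension, a global Lipschitz function that is smooth near the
  surface.\<close>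

lemma has_weak_grad_smooth_pullback:
 assumes f: "smooth_on f UNIV"
 shows "has_weak_grad mh Nh (%x. f (cp x)) (lift_grad (%p. tang (n p) (grad f p)))"
proof -
 obtain L0 where L0: "0 <= L0" "!!p p'. p : Sg ==> p' : Sg ==> \<bar>f p - f p'\<bar> <= L0 * norm (p - p')"
  using smooth_lipschitz_on_Sg[OF f] by blast
 define G where "G x = cutoff x * f (cp x)" for x
 obtain L1 where L1: "0 <= L1" "!!x y. \<bar>G x - G y\<bar> <= L1 * norm (x - y)"
  unfolding G_def using cutoff_extension(1)[of f L0, OF L0(2,1)] by blast
 obtain r where r: "!!x. r <= norm x ==> G x = 0"
  unfolding G_def using cutoff_extension(2)[of f L0, OF L0(2,1)] by blast
 define D where "D x = adj x (grad f (cp x))" for x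
 have [measurable]: "grad f : borel_measurable mg" by (rule Sg.grad_measurable[OF f])
 have D: "D : borel_measurable mh" unfolding D_def by measurable
 have smG: "smooth_on G near"
 proof (rule smooth_on_cong[OF near(1)])
  show "smooth_on (%x. f (cp x)) near"
   by (rule smooth_on_compose[OF near(1) open_UNIV smooth_on_subset[OF smooth_on_cp near(2)] f]) simp
 qed (simp add: G_def near(3))
 have gradG: "grad G x = D x" if x: "x : near" for x
 proof -
  have xt: "x : tube" using x near(2) by blast
  have "((%x. f (cp x)) has_derivative (%v. fderiv f (cp x) (dcp x v))) (at x)"
   by (rule has_derivative_compose[OF cp_has_derivative[OF xt] smooth_on_UNIV_has_derivative[OF f]])
  hence "(G has_derivative (%v. fderiv f (cp x) (dcp x v))) (at x)"
   by (rule has_derivative_transform_within_open[OF _ near(1) x]) (simp add: G_def near(3))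
  hence "grad G x = (\<Sum>b\<in>Basis. fderiv f (cp x) (dcp x b) *\<^sub>R b)" by (rule differentiable_grad(1))
  also have "... = D x"
   unfolding D_def adj_def
   by (simp add: differentiable_grad(2)[OF smooth_on_UNIV_has_derivative[OF f]] inner_commute)
  finally show ?thesis .
 qed
 have "AE x in mh. ALL e>0. EX r>0. ALL y:ball x r. ALL z:ball x r. \<bar>G y - G z - D x \<bullet> (y - z)\<bar> <= e * norm (y - z)"
  using AE_space
 proof eventually_elim
  case (elim x)
  hence "x : near" using space_mh Sh_near by blast
  thus ?case using smooth_near_strict[OF near(1) _ smG] gradG by simp
 qed
 from Sh.has_weak_grad_lipschitz[OF L1(2,1) r D this]
 have "has_weak_grad mh Nh G (%x. tang (Nh x) (D x))" .
 moreover have "G x = f (cp x)" if "x : space mh" for x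
  using that Sh_near near(3)[of x] by (auto simp: G_def space_mh)
 ultimately have "has_weak_grad mh Nh (%x. f (cp x)) (%x. tang (Nh x) (D x))"
  using has_weak_grad_cong[of mh G "%x. f (cp x)"] by simp
 thus ?thesis
 \<comment> \<open>With constant sequences the limit lemma merely exchanges the gradient for one
   that agrees with it on the surface; they agree because \<open>adj\<close> ignores normal
   components.\<close>
 proof (rule Sh.has_weak_grad_limit[where u = "%_ x. f (cp x)" and g = "%_ x. tang (Nh x) (D x)"])
  have t: "(%p. tang (n p) (grad f p)) : borel_measurable mg" by (rule Sg.tang_grad_measurable[OF f])
  show m: "lift_grad (%p. tang (n p) (grad f p)) : borel_measurable mh" by (rule lift_grad_measurable[OF t])
  have e: "tang (Nh x) (D x) = lift_grad (%p. tang (n p) (grad f p)) x" if "x : space mh" for x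
   using that Sh_tube adj_tang[of x "grad f (cp x)"] by (auto simp: lift_grad_def D_def space_mh)
  note w = \<open>has_weak_grad mh Nh (%x. f (cp x)) (%x. tang (Nh x) (D x))\<close>
  show "(%x. f (cp x)) : borel_measurable mh" "integrable mh (%x. (f (cp x))^2)"
   using w by (simp_all add: has_weak_grad_def)
  have "integrable mh (%x. (norm (tang (Nh x) (D x)))^2)" using w by (simp add: has_weak_grad_def)
  thus "integrable mh (%x. (norm (lift_grad (%p. tang (n p) (grad f p)) x))^2)"
   by (rule iffD1[OF Bochner_Integration.integrable_cong[OF refl], rotated]) (simp add: e)
  have "L2sq mh (%x. tang (Nh x) (D x) - lift_grad (%p. tang (n p) (grad f p)) x) = (\<integral>\<^sup>+x. 0 \<partial>mh)"
   unfolding L2sq_def by (rule nn_integral_cong) (simp add: e)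
  thus "(%m. L2sq mh (%x. tang (Nh x) (D x) - lift_grad (%p. tang (n p) (grad f p)) x)) \<longlonglongrightarrow> 0" by simp
 qed (simp add: L2sq_def)
qed

lemma tendsto_zero_bound:
 assumes "!!m. f m <= ennreal C * g m" "g \<longlonglongrightarrow> (0::ennreal)"
 shows "f \<longlonglongrightarrow> 0"
proof -
 have "(%m. ennreal C * g m) \<longlonglongrightarrow> ennreal C * 0" by (intro ennreal_tendsto_cmult assms(2)) simp
 thus ?thesis
  by (intro tendsto_sandwich[of "%_. 0" f sequentially "%m. ennreal C * g m"]) (simp_all add: assms(1))
qed

text \<open>By density: pulling back functions and gradients is bounded in L^2, so approximations by
  smooth functions remain approximations.\<close>

lemma has_weak_grad_pullback:
 assumes u: "has_weak_grad mg n u g"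
 shows "has_weak_grad mh Nh (%x. u (cp x)) (lift_grad g)"
proof -
 obtain f where f: "!!m. smooth_on (f m) UNIV" "(%m::nat. L2sq mg (%x. f m x - u x)) \<longlonglongrightarrow> 0"
  "(%m. L2sq mg (%x. tang (n x) (grad (f m) x) - g x)) \<longlonglongrightarrow> 0"
  using u unfolding has_weak_grad_altdef by blast
 have [measurable]: "u : borel_measurable mg" "g : borel_measurable mg" and
  i: "integrable mg (%x. (u x)^2)" "integrable mg (%x. (norm (g x))^2)" using u by (auto simp: has_weak_grad_def)
 note [measurable] = Sg.smooth_measurable[OF f(1)] Sg.tang_grad_measurable[OF f(1)]
 show ?thesis
 proof (rule Sh.has_weak_grad_limit[OF has_weak_grad_smooth_pullback[OF f(1)]])
  show "(%x. u (cp x)) : borel_measurable mh" "lift_grad g : borel_measurable mh" by measurable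
  show "integrable mh (%x. (u (cp x))^2)" using integrable_sq_pullback[of u] i(1) by simp
  have "ennreal (4 / cl) * L2sq mg g < \<infinity>" using i(2) by (simp add: integrable_sq_iff ennreal_mult_less_top)
  thus "integrable mh (%x. (norm (lift_grad g x))^2)"
   using L2sq_lift_grad[of g] by (simp add: integrable_sq_iff)
  show "(%m. L2sq mh (%x. f m (cp x) - u (cp x))) \<longlonglongrightarrow> 0"
   by (rule tendsto_zero_bound[OF L2sq_pullback f(2)]) measurable
  have "lift_grad (%p. tang (n p) (grad (f m) p)) x - lift_grad g x
    = lift_grad (%p. tang (n p) (grad (f m) p) - g p) x" for m x
   by (simp add: lift_grad_def adj_diff[symmetric] tang_simps)
  thus "(%m. L2sq mh (%x. lift_grad (%p. tang (n p) (grad (f m) p)) x - lift_grad g x)) \<longlonglongrightarrow> 0"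
   by (simp only:) (rule tendsto_zero_bound[OF L2sq_lift_grad f(3)], measurable)
 qed
qed

text \<open>Lipschitz bounds on finitely many closed pieces do not combine on a general set, but
  they do on an interval. Two nearby points are therefore joined by the projection of their chord
  onto the surface, and the bounds are combined along this path.\<close>

lemma lift_lipschitz:
 assumes cont: "!!T. T : TT ==> EX B. B-lipschitz_on (Y T ` Tr) q"
 shows "EX B>=0. ALL p:Sg. ALL p':Sg. \<bar>q p - (q p' :: real)\<bar> <= B * norm (p - p')"
proof -
 obtain B where B: "!!T. T : TT ==> (B T)-lipschitz_on (Y T ` Tr) q" using cont by metis
 define B0 where "B0 = (\<Sum>T\<in>TT. B T)"
 have Bn: "0 <= B T" if "T : TT" for T using lipschitz_on_nonneg[OF B[OF that]] .
 have B0: "B0-lipschitz_on (Y T ` Tr) q" if T: "T : TT" for T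
  unfolding B0_def by (rule lipschitz_on_le[OF B[OF T]], rule member_le_sum[OF T _ finite_T]) (simp add: Bn)
 have B00: "0 <= B0" using Bn by (auto simp: B0_def intro: sum_nonneg)
 have cl: "compact (Y T ` Tr)" if "T : TT" for T
  using compact_continuous_image[OF continuous_Y[OF that] compact_ref_simplex] .
 have cq: "continuous_on Sg q"
  by (subst Sg_eq, rule continuous_on_closed_Union[OF finite_T])
   (use cl compact_imp_closed lipschitz_on_continuous_on[OF B0] in auto)
 obtain b where b: "!!p. p : Sg ==> \<bar>q p\<bar> <= b"
  using compact_imp_bounded[OF compact_continuous_image[OF cq compact]] unfolding bounded_iff by fastforce
 \<comment> \<open>The factor 2 is that of the projected chord; the second summand covers pairs at
   distance at least \<open>reach\<close>, for which boundedness of \<open>q\<close> is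
   enough.\<close>
 define B1 where "B1 = B0 * 2 + 2 * \<bar>b\<bar> / reach"
 have "\<bar>q p - q p'\<bar> <= B1 * norm (p - p')" if p: "p : Sg" "p' : Sg" for p p'
 proof (cases "norm (p - p') < reach")
  case False
  have "\<bar>q p - q p'\<bar> <= 2 * \<bar>b\<bar>" using b[OF p(1)] b[OF p(2)] by linarith
  also have "... = 2 * \<bar>b\<bar> / reach * reach" using reach_pos by simp
  also have "... <= 2 * \<bar>b\<bar> / reach * norm (p - p')" using False reach_pos by (intro mult_left_mono) auto
  also have "... <= B1 * norm (p - p')" unfolding B1_def using B00 by (intro mult_right_mono) auto
  finally show ?thesis .
 next
  case True
  define s where "s t = p + t *\<^sub>R (p' - p)" for t :: real
  have tb: "s t : tube" if "t : {0..1}" for t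
  proof -
   have "infdist (s t) Sg <= dist (s t) p" by (rule infdist_le[OF p(1)])
   also have "... <= 1 * norm (p' - p)" using that mult_right_mono[of t 1 "norm (p' - p)"] by (simp add: s_def dist_norm)
   finally show ?thesis using True by (simp add: tube_def norm_minus_commute)
  qed
  have sl: "norm (cp (s t) - cp (s t')) <= 2 * norm (p - p') * \<bar>t - t'\<bar>" if "t : {0..1}" "t' : {0..1}" for t t'
  proof -
   have "norm (cp (s t) - cp (s t')) <= 2 * norm (s t - s t')" by (rule cp_lipschitz[OF tb[OF that(1)] tb[OF that(2)]])
   also have "s t - s t' = (t - t') *\<^sub>R (p' - p)" by (simp add: s_def algebra_simps)
   finally show ?thesis by (simp add: norm_minus_commute mult_ac)
  qed
  define S where "S T = {t : {0..1}. cp (s t) : Y T ` Tr}" for T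
  have cs: "continuous_on {0..1} (%t. cp (s t))"
  proof (rule continuous_on_compose2[OF continuous_cp])
   show "continuous_on {0..1} s" unfolding s_def by (intro continuous_intros)
  qed (use tb in auto)
  have "(B0 * (2 * norm (p - p')))-lipschitz_on {0..1} (%t. q (cp (s t)))"
  proof (rule lipschitz_on_closed_Union[where I = TT and U = S])
   show "(B0 * (2 * norm (p - p')))-lipschitz_on (S T) (%t. q (cp (s t)))" if T: "T : TT" for T
   proof (rule lipschitz_onI)
    fix t t' assume t: "t : S T" "t' : S T"
    have "dist (q (cp (s t))) (q (cp (s t'))) <= B0 * dist (cp (s t)) (cp (s t'))"
     using t by (intro lipschitz_onD[OF B0[OF T]]) (auto simp: S_def)
    also have "... <= B0 * (2 * norm (p - p') * \<bar>t - t'\<bar>)"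
     using t sl[of t t'] B00 by (intro mult_left_mono) (auto simp: S_def dist_norm)
    finally show "dist (q (cp (s t))) (q (cp (s t'))) <= B0 * (2 * norm (p - p')) * dist t t'"
     by (simp add: dist_real_def mult_ac)
   qed (use B00 in simp)
   show "closed (S T)" if T: "T : TT" for T
   proof -
    have "closed ({0..1} Int (%t. cp (s t)) -` (Y T ` Tr))"
     by (rule continuous_closed_preimage[OF cs _ compact_imp_closed[OF cl[OF T]]]) simp
    moreover have "S T = {0..1} Int (%t. cp (s t)) -` (Y T ` Tr)" by (auto simp: S_def)
    ultimately show ?thesis by simp
   qed
   show "{0..1} \<subseteq> (\<Union>T\<in>TT. S T)"
   proof
    fix t :: real assume t: "t : {0..1}"
    have "cp (s t) : (\<Union>T\<in>TT. Y T ` Tr)" using cp_in Sg_eq by blast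
    thus "t : (\<Union>T\<in>TT. S T)" using t by (auto simp: S_def)
   qed
  qed (use finite_T B00 in auto)
  from lipschitz_onD[OF this, of 0 1] have "\<bar>q p - q p'\<bar> <= B0 * (2 * norm (p - p'))"
   by (simp add: s_def cp_on[OF p(1)] cp_on[OF p(2)] dist_real_def)
  also have "... <= B1 * norm (p - p')"
  proof -
   have "B0 * 2 * norm (p - p') <= B1 * norm (p - p')"
    unfolding B1_def using reach_pos by (intro mult_right_mono) auto
   thus ?thesis by (simp add: mult_ac)
  qed
  finally show ?thesis .
 qed
 moreover have "0 <= B1" using B00 reach_pos by (simp add: B1_def)
 ultimately show ?thesis by blast
qed

lemma fe_element:
 assumes V: "V : fe_space r TT L N mh" and T: "T : TT"
 shows "EX f. smooth_on f UNIV & (ALL u:Tr. V (P T u) = f u)"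
proof -
 have "EX Vb. (ALL x:L ` \<Union>TT. V x = Vb (inv_into (\<Union>TT) L x)) & (ALL T:TT. Vb : poly_on r T)"
  using V unfolding fe_space_def mem_Collect_eq by (elim conjE)
 then obtain Vb where Vb: "ALL x:L ` \<Union>TT. V x = Vb (inv_into (\<Union>TT) L x)" "ALL T:TT. Vb : poly_on r T" by (elim exE conjE)
 have "EX p:poly_space r. ALL x:T. Vb x = p x" using Vb(2) T unfolding poly_on_def by simp
 then obtain p where p: "p : poly_space r" "ALL x:T. Vb x = p x" by (elim bexE)
 obtain b A where bA: "linear A" "F T = (%x. b + A x)" using aff[OF T] by (elim exE conjE)
 have "bounded_linear A" using bA(1) by (simp add: linear_conv_bounded_linear)
 hence l: "smooth_on (%x. b + A x) UNIV"
  by (intro smooth_on_add smooth_on_const smooth_on_linear open_UNIV)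
 have "smooth_on (%u. p (F T u)) UNIV"
  unfolding bA(2) by (rule smooth_on_compose[OF open_UNIV open_UNIV l smooth_on_poly_space[OF p(1)]]) (rule UNIV_I)
 moreover have "V (P T u) = p (F T u)" if u: "u : Tr" for u
 proof -
  have FT: "F T u : T" using F_im[OF T] u by blast
  have i: "inv_into (\<Union>TT) L (L (F T u)) = F T u" by (rule inv_into_f_f[OF L_inj]) (use FT T in blast)
  have "L (F T u) : L ` \<Union>TT" using FT T by blast
  hence "V (P T u) = Vb (inv_into (\<Union>TT) L (L (F T u)))" unfolding P_props(2)[OF T u] by (rule bspec[OF Vb(1)])
  thus ?thesis using bspec[OF p(2) FT] unfolding i by (rule trans)
 qed
 ultimately show ?thesis by (intro exI[of _ "%u. p (F T u)"] conjI ballI)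
qed

text \<open>The function is Lipschitz in the parameter, and the parameter is a Lipschitz function of
  the point because \<open>Y T\<close> is an injective immersion on a compact set.\<close>

lemma lipschitz_element:
 fixes q :: "'d ambient => real"
 assumes T: "T : TT" and f: "smooth_on f UNIV" "!!u. u : Tr ==> q (Y T u) = f u"
 shows "EX B. B-lipschitz_on (Y T ` Tr) q"
proof -
 obtain B where B: "B-lipschitz_on Tr f" using lipschitz_ref[OF open_UNIV _ f(1)] by auto
 show ?thesis
 proof (rule injective_immersion_lower_lipschitz[OF open_\<Omega>[OF T] ref_\<Omega>[OF T] smooth_Y[OF T] compact_ref_simplex Y_inj[OF T] dY_inj[OF T]])
 fix m :: real
 assume m: "0 < m" "!!x y. x : Tr ==> y : Tr ==> m * norm (x - y) <= norm (Y T x - Y T y)"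
 have "(B / m)-lipschitz_on (Y T ` Tr) q"
 proof (rule lipschitz_onI)
  fix a b assume "a : Y T ` Tr" "b : Y T ` Tr"
  then obtain u v where uv: "u : Tr" "v : Tr" "a = Y T u" "b = Y T v" by blast
  have "dist (q a) (q b) <= B * dist u v" using lipschitz_onD[OF B uv(1,2)] f(2) uv by simp
  also have "... <= B * (dist a b / m)"
   using m(2)[OF uv(1,2)] m(1) lipschitz_on_nonneg[OF B] uv by (intro mult_left_mono) (auto simp: dist_norm pos_le_divide_eq mult.commute)
  finally show "dist (q a) (q b) <= B / m * dist a b" by simp
 qed (use m(1) lipschitz_on_nonneg[OF B] in simp)
 thus ?thesis by (rule exI)
 qed
qed

lemma smooth_lift_element:
 fixes q :: "'d ambient => real"
 assumes T: "T : TT" and f: "smooth_on f UNIV" "!!u. u : Tr ==> q (Y T u) = f u" and x: "x : Y T ` Or"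
 shows "EX W. open W & x : W & smooth_on (%x. cutoff x * q (cp x)) W"
proof -
 obtain u where u: "u : Or" "x = Y T u" using x by blast
 have xSg: "x : Sg" using u Y_in by blast
 hence xt: "x : tube" "cp x = Y T u" using Sg_subset_tube cp_on u by auto
 show ?thesis
 proof (rule chart_tube_inverse[OF Y_local_params[OF T] u(1) xt])
  fix W and \<kappa> :: "'d ambient => real^'d"
  assume W: "open W" "x : W" and \<kappa>: "smooth_on \<kappa> W" "!!y. y : W ==> \<kappa> y : Or & Y T (\<kappa> y) = cp y"
  have o: "open (W Int near)" using W(1) near(1) by (rule open_Int)
  have "smooth_on (%x. cutoff x * q (cp x)) (W Int near)"
  proof (rule smooth_on_cong[OF o])
   show "smooth_on (%y. f (\<kappa> y)) (W Int near)"
    by (rule smooth_on_compose[OF o open_UNIV smooth_on_subset[OF \<kappa>(1)] f(1)]) simp_all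
   fix y assume y: "y : W Int near"
   have "\<kappa> y : Tr" using \<kappa>(2)[of y] y O_subset by blast
   hence "f (\<kappa> y) = q (Y T (\<kappa> y))" using f(2)[of "\<kappa> y"] by simp
   thus "f (\<kappa> y) = cutoff y * q (cp y)" using \<kappa>(2)[of y] y near(3)[of y] by simp
  qed
  moreover have "x : W Int near" using W(2) xSg near(4) by (simp add: subset_iff)
  ultimately show ?thesis using o by (intro exI[of _ "W Int near"] conjI)
 qed
qed

text \<open>The eigenvalue equation can be tested only with H^1 functions on the smooth surface. The
  values of \<open>V\<close>, transported by \<open>cp\<close> and extended with the cutoff, give a
  Lipschitz function that is smooth near the interior points of the projected elements.\<close>

lemma fe_lift:
 assumes V: "V : fe_space r TT L N mh"
 shows "EX w:H1 mg n. ALL x:Sh. V x = w (cp x)"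
proof -
 define q where "q p = V (inv_into Sh cp p)" for p
 have qcp: "q (cp x) = V x" if "x : Sh" for x using that by (simp add: q_def inv_into_f_f[OF cp_inj])
 have elem: "EX f. smooth_on f UNIV & (ALL u:Tr. q (Y T u) = f u)" if T: "T : TT" for T
  using fe_element[OF V T] qcp[OF P_in[OF T]] unfolding Y_def by auto
 have "EX B. B-lipschitz_on (Y T ` Tr) q" if T: "T : TT" for T
  using elem[OF T] lipschitz_element[OF T, of _ q] by blast
 from lift_lipschitz[of q, OF this] obtain B where B: "0 <= B" "!!p p'. p : Sg ==> p' : Sg ==> \<bar>q p - q p'\<bar> <= B * norm (p - p')"
  by blast
 define G where "G = (%x. cutoff x * q (cp x))"
 obtain L1 where L1: "0 <= L1" "!!x y. \<bar>G x - G y\<bar> <= L1 * norm (x - y)"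
  unfolding G_def using cutoff_extension(1)[of q B, OF B(2,1)] by blast
 obtain R where R: "!!x. R <= norm x ==> G x = 0"
  unfolding G_def using cutoff_extension(2)[of q B, OF B(2,1)] by blast
 have "G : H1 mg n"
 proof (rule Sg.H1_lipschitz_piecewise_smooth[OF L1(2,1) R])
  show "AE x in mg. EX W. open W & x : W & smooth_on G W"
  proof (rule AE_mp[OF AE_in_element(2)], intro AE_I2 impI)
   fix x assume "EX T:TT. x : Y T ` Or"
   then obtain T where T: "T : TT" and x: "x : Y T ` Or" by blast
   obtain f where f: "smooth_on f UNIV" "!!u. u : Tr ==> q (Y T u) = f u" using elem[OF T] by blast
   show "EX W. open W & x : W & smooth_on G W" unfolding G_def by (rule smooth_lift_element[OF T f x])
  qed
 qed
 moreover have "V x = G (cp x)" if x: "x : Sh" for x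
 proof -
  have "cp x : near" using near(4) cp_in by blast
  thus ?thesis using qcp[OF x] near(3)[of "cp x"] cp_on[OF cp_in, of x] by (simp add: G_def)
 qed
 ultimately show ?thesis by blast
qed

section \<open>Comparison of the mass and energy forms\<close>

lemma integral_abs_le_AE:
 fixes f g :: "'a => real"
 assumes "integrable \<mu> f" "integrable \<mu> g" "AE x in \<mu>. \<bar>f x\<bar> <= g x"
 shows "\<bar>\<integral>x. f x \<partial>\<mu>\<bar> <= (\<integral>x. g x \<partial>\<mu>)"
 using order_trans[OF integral_abs_bound integral_mono_AE[OF integrable_abs[OF assms(1)] assms(2,3)]] .

text \<open>As an identity of measures the change of variables also serves integrals of functions of
  either sign.\<close>

lemma mg_eq: "distr (density mh (%x. ennreal (jac x))) mg cp = mg"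
proof (rule measure_eqI)
 note [measurable] = jac_measurable cp_measurable
 fix A assume "A : sets (distr (density mh (%x. ennreal (jac x))) mg cp)"
 hence A[measurable]: "A : sets mg" by simp
 have "emeasure (distr (density mh (%x. ennreal (jac x))) mg cp) A
   = (\<integral>\<^sup>+x. ennreal (jac x) * indicator (cp -` A Int space mh) x \<partial>mh)"
  by (simp add: emeasure_distr emeasure_density)
 also have "... = (\<integral>\<^sup>+x. indicator A (cp x) * ennreal (jac x) \<partial>mh)"
  by (rule nn_integral_cong) (simp add: indicator_def)
 also have "... = (\<integral>\<^sup>+x. indicator A x \<partial>mg)" by (rule nn_integral_pullback[symmetric]) measurable
 finally show "emeasure (distr (density mh (%x. ennreal (jac x))) mg cp) A = emeasure mg A" by simp
qed simp

lemma jac_nonneg: "AE x in mh. 0 <= jac x"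
 using AE_good by eventually_elim (use jac_bounds(1) c_pos(3) in \<open>meson less_imp_le order_trans\<close>)

lemma integral_pullback:
 fixes f :: "'d ambient => real"
 assumes [measurable]: "f : borel_measurable mg"
 shows "(\<integral>x. f x \<partial>mg) = (\<integral>x. jac x * f (cp x) \<partial>mh)"
  "integrable mg f \<longleftrightarrow> integrable mh (%x. jac x * f (cp x))"
proof -
 note [measurable] = jac_measurable cp_measurable
 have "(\<integral>x. f x \<partial>distr (density mh (%x. ennreal (jac x))) mg cp) = (\<integral>x. jac x * f (cp x) \<partial>mh)"
  using jac_nonneg by (simp add: integral_distr integral_density)
 thus "(\<integral>x. f x \<partial>mg) = (\<integral>x. jac x * f (cp x) \<partial>mh)" by (simp only: mg_eq)
 have "integrable (distr (density mh (%x. ennreal (jac x))) mg cp) f \<longleftrightarrow> integrable mh (%x. jac x * f (cp x))"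
  using jac_nonneg by (simp add: integrable_distr_eq integrable_density)
 thus "integrable mg f \<longleftrightarrow> integrable mh (%x. jac x * f (cp x))" by (simp only: mg_eq)
qed

lemma mass_le:
 assumes u: "L2 mg u"
 shows "mass_form mg u u <= (1 + cJ) * mass_form mh (%x. u (cp x)) (%x. u (cp x))"
proof -
 have [measurable]: "u : borel_measurable mg" using u by (simp add: L2_def)
 have i: "integrable mh (%x. jac x * (u (cp x) * u (cp x)))" "integrable mh (%x. u (cp x) * u (cp x))"
  using integral_pullback(2)[of "%x. u x * u x"] L2_mult_integrable[OF u u] L2_mult_integrable[OF L2_pullback[OF u] L2_pullback[OF u]] by auto
 have "mass_form mg u u = (\<integral>x. jac x * (u (cp x) * u (cp x)) \<partial>mh)"
  unfolding mass_form_def by (rule integral_pullback(1)) measurable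
 also have "... <= (\<integral>x. (1 + cJ) * (u (cp x) * u (cp x)) \<partial>mh)"
 proof (rule integral_mono_AE[OF i(1)])
  show "AE x in mh. jac x * (u (cp x) * u (cp x)) <= (1 + cJ) * (u (cp x) * u (cp x))"
   using AE_good by eventually_elim (intro mult_right_mono jac_upper, auto)
 qed (use i(2) in simp)
 finally show ?thesis by (simp add: mass_form_def)
qed

lemma jac_defect: "good x ==> \<bar>jac x - 1\<bar> <= cJ * ce * h ^ (k + 1)"
proof -
 assume g: "good x"
 have "cJ * defect x <= cJ * (ce * h ^ (k + 1))" using goodD(8)[OF g] c_pos(2) by (intro mult_left_mono) auto
 thus ?thesis using jac_bounds(2)[OF g] by simp
qed

lemma mass_compare:
 assumes u: "L2 mg u" and v: "L2 mg v"
 shows "\<bar>mass_form mh (%x. u (cp x)) (%x. v (cp x)) - mass_form mg u v\<bar>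
  <= cJ * ce * h ^ (k + 1) * (mass_norm mh (%x. u (cp x)) * mass_norm mh (%x. v (cp x)))"
proof -
 have [measurable]: "u : borel_measurable mg" "v : borel_measurable mg" using u v by (auto simp: L2_def)
 let ?E = "cJ * ce * h ^ (k + 1)"
 have E0: "0 <= ?E" using c_pos h_bounds by simp
 have uv: "L2 mh (%x. u (cp x))" "L2 mh (%x. v (cp x))" using u v L2_pullback by auto
 have i: "integrable mh (%x. jac x * (u (cp x) * v (cp x)))" "integrable mh (%x. u (cp x) * v (cp x))"
  using integral_pullback(2)[of "%x. u x * v x"] L2_mult_integrable[OF u v] L2_mult_integrable[OF uv] by auto
 have "mass_form mh (%x. u (cp x)) (%x. v (cp x)) - mass_form mg u v
   = (\<integral>x. u (cp x) * v (cp x) - jac x * (u (cp x) * v (cp x)) \<partial>mh)"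
  using i integral_pullback(1)[of "%x. u x * v x"] by (simp add: mass_form_def)
 also have "\<bar>...\<bar> <= (\<integral>x. ?E * \<bar>u (cp x) * v (cp x)\<bar> \<partial>mh)"
 proof (rule integral_abs_le_AE)
  show "AE x in mh. \<bar>u (cp x) * v (cp x) - jac x * (u (cp x) * v (cp x))\<bar> <= ?E * \<bar>u (cp x) * v (cp x)\<bar>"
   using AE_good
  proof eventually_elim
   case (elim x)
   have "\<bar>u (cp x) * v (cp x) - jac x * (u (cp x) * v (cp x))\<bar> = \<bar>jac x - 1\<bar> * \<bar>u (cp x) * v (cp x)\<bar>"
    by (simp add: abs_mult[symmetric] abs_minus_commute algebra_simps)
   thus ?case using mult_right_mono[OF jac_defect[OF elim] abs_ge_zero] by simp
  qed
 qed (use i in auto)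
 also have "... = ?E * (\<integral>x. \<bar>u (cp x) * v (cp x)\<bar> \<partial>mh)" by simp
 also have "... <= ?E * (mass_norm mh (%x. u (cp x)) * mass_norm mh (%x. v (cp x)))"
  using integral_Cauchy_Schwarz[OF uv] E0
  by (intro mult_left_mono) (auto simp: mass_norm_def mass_form_def power2_eq_square)
 finally show ?thesis .
qed

lemma Nh_good:
 assumes "good x"
 shows "norm (Nh x) = 1" "(\<nu> x \<bullet> Nh x)^2 = 1 - tilt_sq x"
proof -
 obtain T u where T: "T : TT" and u: "u : Or" and x: "x = P T u" using assms unfolding good_def by blast
 show "norm (Nh x) = 1" unfolding x using Nh_sign[OF T u] N_unit(1)[OF T u] by (elim disjE) simp_all
 show "(\<nu> x \<bullet> Nh x)^2 = 1 - tilt_sq x"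
  unfolding x tilt_sq_def using Nh_sign[OF T u] by (elim disjE) (simp_all add: inner_commute)
qed

text \<open>The product of the normal components contributes \<open>tilt_sq\<close>, and each of the
  three terms containing the deviation of \<open>adj\<close> from the identity contributes
  \<open>2 * K * infdist x Sg\<close>; together this is the defect. Both gradients have to be
  tangential, as \<open>adj\<close> would lose their normal parts.\<close>

lemma lift_grad_compare:
 assumes x: "good x" and g: "g (cp x) \<bullet> n (cp x) = 0" and g': "g' (cp x) \<bullet> n (cp x) = 0"
 shows "\<bar>lift_grad g x \<bullet> lift_grad g' x - g (cp x) \<bullet> g' (cp x)\<bar> <= defect x * (norm (g (cp x)) * norm (g' (cp x)))"
proof -
 note G = goodD[OF x]
 let ?m = "Nh x" and ?d = "2 * K * infdist x Sg"
 note m1 = Nh_good(1)[OF x]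
 have d0: "0 <= ?d" using K_pos infdist_nonneg[of x Sg] by simp
 have "K * infdist x Sg <= K * \<delta>" using Sh_infdist[OF G(1)] K_pos by simp
 hence d1: "?d <= 1" using \<delta>_small(4) by simp
 define w w' where "w = g (cp x)" and "w' = g' (cp x)"
 define e e' where "e = adj x w - w" and "e' = adj x w' - w'"
 have err: "norm (adj x q - q) <= ?d * norm q" if q: "q \<bullet> n (cp x) = 0" for q
 proof (rule norm_le_dual)
  fix v
  have "(adj x q - q) \<bullet> v = q \<bullet> (dcp x v - (v - (n (cp x) \<bullet> v) *\<^sub>R n (cp x)))"
   using q by (simp add: inner_diff_left inner_diff_right adj_inner[OF G(2)])
  also have "\<bar>...\<bar> <= norm q * norm (dcp x v - (v - (n (cp x) \<bullet> v) *\<^sub>R n (cp x)))" by (rule Cauchy_Schwarz_ineq2)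
  also have "... <= norm q * (?d * norm v)" by (intro mult_left_mono dcp_near_projection G(2)) simp
  finally show "\<bar>(adj x q - q) \<bullet> v\<bar> <= ?d * norm q * norm v" by (simp add: mult_ac)
 qed
 have e: "norm e <= ?d * norm w" "norm e' <= ?d * norm w'"
  using err g g' by (simp_all add: e_def e'_def w_def w'_def)
 have normal: "\<bar>q \<bullet> ?m\<bar> <= sqrt (tilt_sq x) * norm q" if q: "q \<bullet> n (cp x) = 0" for q
 proof -
  have "(q \<bullet> ?m)^2 <= (1 - (\<nu> x \<bullet> ?m)^2) * (norm q)^2"
   by (rule tilt[OF norm_\<nu> m1]) (simp add: \<nu>_def q)
  hence "(q \<bullet> ?m)^2 <= tilt_sq x * (norm q)^2" by (simp add: Nh_good(2)[OF x])
  hence "sqrt ((q \<bullet> ?m)^2) <= sqrt (tilt_sq x * (norm q)^2)" by (rule real_sqrt_le_mono)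
  thus ?thesis by (simp add: real_sqrt_mult)
 qed
 have t1: "\<bar>tang ?m w \<bullet> w' - w \<bullet> w'\<bar> <= tilt_sq x * (norm w * norm w')"
 proof -
  have "tang ?m w \<bullet> w' - w \<bullet> w' = - ((w \<bullet> ?m) * (w' \<bullet> ?m))"
   by (simp add: tang_def inner_diff_left inner_commute[of ?m w'])
  hence "\<bar>tang ?m w \<bullet> w' - w \<bullet> w'\<bar> = \<bar>w \<bullet> ?m\<bar> * \<bar>w' \<bullet> ?m\<bar>" by (simp add: abs_mult)
  also have "... <= (sqrt (tilt_sq x) * norm w) * (sqrt (tilt_sq x) * norm w')"
   using normal g g' G(4) by (intro mult_mono) (auto simp: w_def w'_def)
  also have "... = (sqrt (tilt_sq x))^2 * (norm w * norm w')" by (simp add: power2_eq_square)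
  finally show ?thesis using G(4) by simp
 qed
 have tn: "norm (tang ?m v) <= norm v" for v by (rule norm_tang_le) (simp add: m1)
 have t2: "\<bar>tang ?m e \<bullet> w'\<bar> <= ?d * (norm w * norm w')"
 proof -
  have "\<bar>tang ?m e \<bullet> w'\<bar> <= norm (tang ?m e) * norm w'" by (rule Cauchy_Schwarz_ineq2)
  also have "... <= (?d * norm w) * norm w'" by (intro mult_right_mono order_trans[OF tn e(1)]) simp
  finally show ?thesis by (simp add: mult_ac)
 qed
 have t3: "\<bar>tang ?m w \<bullet> e'\<bar> <= ?d * (norm w * norm w')"
 proof -
  have "\<bar>tang ?m w \<bullet> e'\<bar> <= norm (tang ?m w) * norm e'" by (rule Cauchy_Schwarz_ineq2)
  also have "... <= norm w * (?d * norm w')" by (intro mult_mono tn e(2)) auto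
  finally show ?thesis by (simp add: mult_ac)
 qed
 have t4: "\<bar>tang ?m e \<bullet> e'\<bar> <= ?d * (norm w * norm w')"
 proof -
  have "\<bar>tang ?m e \<bullet> e'\<bar> <= norm (tang ?m e) * norm e'" by (rule Cauchy_Schwarz_ineq2)
  also have "... <= (?d * norm w) * (1 * norm w')"
   using order_trans[OF e(2) mult_right_mono[OF d1 norm_ge_zero]] d0
   by (intro mult_mono order_trans[OF tn e(1)]) auto
  finally show ?thesis by (simp add: mult_ac)
 qed
 \<comment> \<open>The projection is symmetric and idempotent, so it need be kept on one side
   only.\<close>
 have sym: "tang ?m a \<bullet> tang ?m b = tang ?m a \<bullet> b" for a b
  using tang_inner[OF m1, of a] by (simp add: tang_def[of ?m b] inner_diff_right)
 have "lift_grad g x \<bullet> lift_grad g' x = tang ?m (w + e) \<bullet> (w' + e')"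
  unfolding lift_grad_def sym w_def[symmetric] w'_def[symmetric] by (simp add: e_def e'_def)
 hence "lift_grad g x \<bullet> lift_grad g' x - w \<bullet> w'
   = (tang ?m w \<bullet> w' - w \<bullet> w') + tang ?m e \<bullet> w' + tang ?m w \<bullet> e' + tang ?m e \<bullet> e'"
  by (simp add: tang_simps inner_add_left inner_add_right)
 hence "\<bar>lift_grad g x \<bullet> lift_grad g' x - w \<bullet> w'\<bar>
   <= tilt_sq x * (norm w * norm w') + ?d * (norm w * norm w') + ?d * (norm w * norm w') + ?d * (norm w * norm w')"
  using t1 t2 t3 t4 by linarith
 also have "... = defect x * (norm w * norm w')" by (simp add: defect_def algebra_simps)
 finally show ?thesis by (simp add: w_def w'_def)
qed

lemma AE_tangential:
 assumes u: "has_weak_grad mg n u g"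
 shows "AE x in mh. g (cp x) \<bullet> n (cp x) = 0"
proof -
 have [measurable]: "g : borel_measurable mg" "n : borel_measurable mg"
  using u Sg.n_measurable by (auto simp: has_weak_grad_def)
 have "AE x in mg. norm (n x) = 1" using AE_space[of mg] by eventually_elim (simp add: space_mg norm_n)
 from Sg.has_weak_grad_tangential[OF u this]
 have "L2sq mg (%x. g x \<bullet> n x) = (\<integral>\<^sup>+x. 0 \<partial>mg)"
  unfolding L2sq_def by (intro nn_integral_cong_AE) (auto elim: eventually_mono)
 hence "L2sq mh (%x. g (cp x) \<bullet> n (cp x)) <= 0"
  using L2sq_pullback[of "%x. g x \<bullet> n x"] by simp
 hence "AE x in mh. ennreal ((norm (g (cp x) \<bullet> n (cp x)))^2) = 0"
  unfolding L2sq_def by (subst nn_integral_0_iff_AE[symmetric]) simp_all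
 thus ?thesis by eventually_elim simp
qed

text \<open>The integrands differ by the defect of the gradients, which costs \<open>ce\<close>, and
  by the deviation of the Jacobian from 1, which costs \<open>cJ * ce\<close>.\<close>

lemma energy_compare:
 assumes u: "has_weak_grad mg n u g" and v: "has_weak_grad mg n v g'"
 shows "\<bar>energy_form mh Nh (%x. u (cp x)) (%x. v (cp x)) - energy_form mg n u v\<bar>
   <= (1 + cJ) * ce * h ^ (k + 1) * (sqrt (\<integral>x. (norm (g (cp x)))^2 \<partial>mh) * sqrt (\<integral>x. (norm (g' (cp x)))^2 \<partial>mh))"
proof -
 have [measurable]: "g : borel_measurable mg" "g' : borel_measurable mg" and
  sq: "integrable mg (%x. (norm (g x))^2)" "integrable mg (%x. (norm (g' x))^2)"
  using u v by (auto simp: has_weak_grad_def)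
 define E where "E = (1 + cJ) * ce * h ^ (k + 1)"
 have E0: "0 <= E" using c_pos h_bounds by (simp add: E_def)
 have n: "L2 mh (%x. norm (g (cp x)))" "L2 mh (%x. norm (g' (cp x)))"
  using integrable_sq_pullback[OF _ sq(1)] integrable_sq_pullback[OF _ sq(2)] by (auto simp: L2_def)
 note i1 = Sh.grad_inner_integrable[OF has_weak_grad_pullback[OF u] has_weak_grad_pullback[OF v]]
 have i2: "integrable mh (%x. jac x * (g (cp x) \<bullet> g' (cp x)))"
  using integral_pullback(2)[of "%x. g x \<bullet> g' x"] Sg.grad_inner_integrable[OF u v] by simp
 have i3: "integrable mh (%x. norm (g (cp x)) * norm (g' (cp x)))" by (rule L2_mult_integrable[OF n])
 have eq: "energy_form mh Nh (%x. u (cp x)) (%x. v (cp x)) - energy_form mg n u v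
   = (\<integral>x. lift_grad g x \<bullet> lift_grad g' x - jac x * (g (cp x) \<bullet> g' (cp x)) \<partial>mh)"
  unfolding Sh.energy_form_eq[OF has_weak_grad_pullback[OF u] has_weak_grad_pullback[OF v]] Sg.energy_form_eq[OF u v]
  using i1 i2 integral_pullback(1)[of "%x. g x \<bullet> g' x"] by simp
 have "\<bar>\<integral>x. lift_grad g x \<bullet> lift_grad g' x - jac x * (g (cp x) \<bullet> g' (cp x)) \<partial>mh\<bar> <= (\<integral>x. E * (norm (g (cp x)) * norm (g' (cp x))) \<partial>mh)"
 proof (rule integral_abs_le_AE[OF Bochner_Integration.integrable_diff[OF i1 i2] integrable_mult_right[OF i3]])
  show "AE x in mh. \<bar>lift_grad g x \<bullet> lift_grad g' x - jac x * (g (cp x) \<bullet> g' (cp x))\<bar>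
    <= E * (norm (g (cp x)) * norm (g' (cp x)))"
   using AE_good AE_tangential[OF u] AE_tangential[OF v]
  proof eventually_elim
   case (elim x)
   let ?w = "g (cp x)" and ?w' = "g' (cp x)" and ?e = "ce * h ^ (k + 1)"
   have "\<bar>lift_grad g x \<bullet> lift_grad g' x - ?w \<bullet> ?w'\<bar> <= defect x * (norm ?w * norm ?w')"
    by (rule lift_grad_compare[where g = g and g' = g', OF elim])
   also have "... <= ?e * (norm ?w * norm ?w')" using goodD(8)[OF elim(1)] by (intro mult_right_mono) auto
   finally have 1: "\<bar>lift_grad g x \<bullet> lift_grad g' x - ?w \<bullet> ?w'\<bar> <= ?e * (norm ?w * norm ?w')" .
   have "\<bar>(jac x - 1) * (?w \<bullet> ?w')\<bar> <= (cJ * ce * h ^ (k + 1)) * (norm ?w * norm ?w')"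
    unfolding abs_mult using jac_defect[OF elim(1)] Cauchy_Schwarz_ineq2[of ?w ?w'] c_pos h_bounds
    by (intro mult_mono) auto
   moreover have "lift_grad g x \<bullet> lift_grad g' x - jac x * (?w \<bullet> ?w')
     = (lift_grad g x \<bullet> lift_grad g' x - ?w \<bullet> ?w') - (jac x - 1) * (?w \<bullet> ?w')" by (simp add: algebra_simps)
   moreover have "E * (norm ?w * norm ?w') = ?e * (norm ?w * norm ?w') + (cJ * ce * h ^ (k + 1)) * (norm ?w * norm ?w')"
    by (simp add: E_def algebra_simps)
   ultimately show ?case using 1 by linarith
  qed
 qed
 also have "... = E * (\<integral>x. \<bar>norm (g (cp x)) * norm (g' (cp x))\<bar> \<partial>mh)"
  unfolding abs_mult abs_norm_cancel by (rule integral_mult_right_zero)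
 also have "... <= E * (sqrt (\<integral>x. (norm (g (cp x)))^2 \<partial>mh) * sqrt (\<integral>x. (norm (g' (cp x)))^2 \<partial>mh))"
  using integral_Cauchy_Schwarz[OF n] E0 by (rule mult_left_mono)
 finally show ?thesis unfolding eq E_def .
qed

text \<open>The defect is at most 1/2, so the lifted gradient keeps at least half of the squared
  length.\<close>

lemma grad_pullback_coercive:
 assumes v: "has_weak_grad mg n v g"
 shows "(\<integral>x. (norm (g (cp x)))^2 \<partial>mh) <= 2 * energy_form mh Nh (%x. v (cp x)) (%x. v (cp x))"
proof -
 have gm[measurable]: "g : borel_measurable mg" and sq: "integrable mg (%x. (norm (g x))^2)"
  using v by (auto simp: has_weak_grad_def)
 note V = has_weak_grad_pullback[OF v]
 have "(\<integral>x. (norm (g (cp x)))^2 \<partial>mh) <= (\<integral>x. 2 * (lift_grad g x \<bullet> lift_grad g x) \<partial>mh)"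
 proof (rule integral_mono_AE[OF integrable_sq_pullback[OF gm sq] integrable_mult_right[OF Sh.grad_inner_integrable[OF V V]]])
  show "AE x in mh. (norm (g (cp x)))^2 <= 2 * (lift_grad g x \<bullet> lift_grad g x)"
   using AE_good AE_tangential[OF v]
  proof eventually_elim
   case (elim x)
   have "\<bar>lift_grad g x \<bullet> lift_grad g x - g (cp x) \<bullet> g (cp x)\<bar> <= defect x * (norm (g (cp x)) * norm (g (cp x)))"
    by (rule lift_grad_compare[where g = g and g' = g, OF elim elim(2)])
   also have "... <= 1/2 * (norm (g (cp x)) * norm (g (cp x)))" using goodD(7)[OF elim(1)] by (intro mult_right_mono) auto
   finally show ?case unfolding power2_norm_eq_inner power2_eq_square[symmetric] by linarith
  qed
 qed
 thus ?thesis unfolding Sh.energy_form_eq[OF V V] integral_mult_right_zero .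
qed

lemma grad_pullback_le:
 assumes v: "has_weak_grad mg n v g"
 shows "(\<integral>x. (norm (g (cp x)))^2 \<partial>mh) <= 1 / cl * energy_form mg n v v"
proof -
 have gm[measurable]: "g : borel_measurable mg" and sq: "integrable mg (%x. (norm (g x))^2)"
  using v by (auto simp: has_weak_grad_def)
 have i: "integrable mh (%x. jac x * (norm (g (cp x)))^2)" using integral_pullback(2)[of "%x. (norm (g x))^2"] sq by simp
 have "(\<integral>x. (norm (g (cp x)))^2 \<partial>mh) <= (\<integral>x. 1 / cl * (jac x * (norm (g (cp x)))^2) \<partial>mh)"
 proof (rule integral_mono_AE[OF integrable_sq_pullback[OF gm sq] integrable_mult_right[OF i]])
  show "AE x in mh. (norm (g (cp x)))^2 <= 1 / cl * (jac x * (norm (g (cp x)))^2)"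
   using AE_good
  proof eventually_elim
   case (elim x)
   have "cl * (norm (g (cp x)))^2 <= jac x * (norm (g (cp x)))^2" using jac_bounds(1)[OF elim] by (intro mult_right_mono) auto
   thus ?case using c_pos(3) by (simp add: pos_le_divide_eq mult.commute)
  qed
 qed
 also have "... = 1 / cl * energy_form mg n v v"
  unfolding Sg.energy_form_eq[OF v v] power2_norm_eq_inner[symmetric] integral_mult_right_zero
  by (subst integral_pullback(1)) simp_all
 finally show ?thesis .
qed

definition cA :: real where "cA = (1 + cJ) * ce * (sqrt ((1 + cJ) / cl) * sqrt 2)"

text \<open>The energy of \<open>u\<close> is \<open>l\<close> times its mass, so the eigenvalue
  enters as \<open>sqrt l\<close> and the constant stays free of the spectrum. Both factors on the
  right are converted to norms on the approximate surface, where the discrete argument takes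
  place.\<close>

lemma energy_residual:
 assumes u: "u : H1 mg n" and l: "0 <= l" "energy_form mg n u u = l * mass_form mg u u" and v: "v : H1 mg n"
 shows "\<bar>energy_form mh Nh (%x. u (cp x)) (%x. v (cp x)) - energy_form mg n u v\<bar>
  <= cA * h ^ (k + 1) * (sqrt l * mass_norm mh (%x. u (cp x)) * energy_norm mh Nh (%x. v (cp x)))"
proof -
 note gu = Sg.weak_grad[OF u] and gv = Sg.weak_grad[OF v]
 let ?g = "weak_grad mg n u" and ?g' = "weak_grad mg n v"
 have "(\<integral>x. (norm (?g (cp x)))^2 \<partial>mh) <= 1 / cl * (l * mass_form mg u u)"
  using grad_pullback_le[OF gu] l(2) by simp
 also have "... <= 1 / cl * (l * ((1 + cJ) * mass_form mh (%x. u (cp x)) (%x. u (cp x))))"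
  using c_pos l(1) mass_le[OF Sg.H1_L2[OF u]] by (intro mult_left_mono) auto
 finally have "sqrt (\<integral>x. (norm (?g (cp x)))^2 \<partial>mh) <= sqrt ((1 + cJ) / cl * l * mass_form mh (%x. u (cp x)) (%x. u (cp x)))"
  by (intro real_sqrt_le_mono) (simp add: mult_ac)
 hence a: "sqrt (\<integral>x. (norm (?g (cp x)))^2 \<partial>mh) <= sqrt ((1 + cJ) / cl) * sqrt l * mass_norm mh (%x. u (cp x))"
  by (simp only: real_sqrt_mult mass_norm_def)
 have "sqrt (\<integral>x. (norm (?g' (cp x)))^2 \<partial>mh) <= sqrt (2 * energy_form mh Nh (%x. v (cp x)) (%x. v (cp x)))"
  by (intro real_sqrt_le_mono grad_pullback_coercive[OF gv])
 hence b: "sqrt (\<integral>x. (norm (?g' (cp x)))^2 \<partial>mh) <= sqrt 2 * energy_norm mh Nh (%x. v (cp x))"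
  by (simp only: real_sqrt_mult energy_norm_def)
 have m0: "0 <= mass_norm mh (%x. u (cp x))" by (simp add: mass_norm_def mass_form_nonneg)
 have "\<bar>energy_form mh Nh (%x. u (cp x)) (%x. v (cp x)) - energy_form mg n u v\<bar>
   <= (1 + cJ) * ce * h ^ (k + 1) * (sqrt (\<integral>x. (norm (?g (cp x)))^2 \<partial>mh) * sqrt (\<integral>x. (norm (?g' (cp x)))^2 \<partial>mh))"
  by (rule energy_compare[OF gu gv])
 also have "... <= (1 + cJ) * ce * h ^ (k + 1) * ((sqrt ((1 + cJ) / cl) * sqrt l * mass_norm mh (%x. u (cp x))) * (sqrt 2 * energy_norm mh Nh (%x. v (cp x))))"
  using c_pos h_bounds l(1) m0 by (intro mult_left_mono mult_mono a b) auto
 finally show ?thesis by (simp add: cA_def mult_ac)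
qed

end

section \<open>Cluster estimate\<close>

lemma mass_form_sum:
 assumes "finite I" "!!j. j : I ==> L2 M (U j)" "L2 M w"
 shows "mass_form M (%x. \<Sum>j\<in>I. c j * U j x) w = (\<Sum>j\<in>I. c j * mass_form M (U j) w)"
proof -
 have "integrable M (%x. c j * (U j x * w x))" if "j : I" for j
  using L2_mult_integrable[OF assms(2)[OF that] assms(3)] by simp
 hence "(\<integral>x. (\<Sum>j\<in>I. c j * (U j x * w x)) \<partial>M) = (\<Sum>j\<in>I. \<integral>x. c j * (U j x * w x) \<partial>M)"
  by (rule Bochner_Integration.integral_sum)
 thus ?thesis by (simp add: mass_form_def sum_distrib_right mult.assoc)
qed

lemma (in surface_forms) energy_sum:
 assumes "finite I" "!!j. j : I ==> U j : H1 M n" "w : H1 M n"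
 shows "(%x. \<Sum>j\<in>I. c j * U j x) : H1 M n \<and>
  energy_form M n (%x. \<Sum>j\<in>I. c j * U j x) w = (\<Sum>j\<in>I. c j * energy_form M n (U j) w)"
 using assms(1,2)
proof (induction I)
 case empty
 show ?case using H1_const[of 0] energy_const[OF assms(3), of 0] by simp
next
 case (insert j I)
 have IH: "(%x. \<Sum>j\<in>I. c j * U j x) : H1 M n"
  "energy_form M n (%x. \<Sum>j\<in>I. c j * U j x) w = (\<Sum>j\<in>I. c j * energy_form M n (U j) w)"
  using insert by auto
 have "U j : H1 M n" using insert by simp
 from H1_add_scale[OF IH(1) this, of "c j"] energy_add_scale[OF IH(1) this assms(3), of "c j"]
 show ?case using insert.hyps IH(2) by (simp add: add.commute)
qed

lemma sum_fun_apply: "(\<Sum>i\<in>I. f i) x = (\<Sum>i\<in>I. (f i x :: real))"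
 by (induction I rule: infinite_finite_induct) auto

text \<open>Orthonormality gives independence, and with as many members as the dimension the family
  spans.\<close>

lemma orthonormal_span:
 fixes V :: "('a => real) set"
 assumes m: "0 < fun_dim V" and U: "!!j. j : {1..fun_dim V} ==> U j : V"
  and L2: "!!v. v : V ==> L2 M v"
  and orth: "!!i j. i : {1..fun_dim V} ==> j : {1..fun_dim V} ==> mass_form M (U i) (U j) = (if i = j then 1 else 0)"
  and v: "v : V"
 shows "EX c. v = (%x. \<Sum>j\<in>{1..fun_dim V}. c j * U j x)"
proof -
 interpret fs: vector_space "%(c::real) (f::'a => real) x. c * f x"
  by standard (auto simp: fun_eq_iff algebra_simps)
 let ?I = "{1..fun_dim V}"
 have inj: "inj_on U ?I"
 proof (rule inj_onI)
  fix i j assume ij: "i : ?I" "j : ?I" "U i = U j"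
  hence "mass_form M (U i) (U j) = 1" using orth[of i i] by simp
  thus "i = j" using orth[of i j] ij by (auto split: if_splits)
 qed
 have ind: "fs.independent (U ` ?I)"
 proof (rule fs.independent_if_scalars_zero)
  fix f x assume s: "(\<Sum>x\<in>U ` ?I. (%y. f x * x y)) = 0" and x: "x : U ` ?I"
  obtain i where i: "i : ?I" "x = U i" using x by blast
  have "(%y. \<Sum>j\<in>?I. f (U j) * U j y) = (%y. 0)"
   using s unfolding sum.reindex[OF inj] by (simp add: fun_eq_iff sum_fun_apply)
  hence "mass_form M (%y. \<Sum>j\<in>?I. f (U j) * U j y) (U i) = 0" by (simp add: mass_form_def)
  hence "(\<Sum>j\<in>?I. f (U j) * mass_form M (U j) (U i)) = 0"
   using mass_form_sum[of ?I M U "U i" "%j. f (U j)"] U L2 i(1) by simp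
  moreover have "(\<Sum>j\<in>?I. f (U j) * mass_form M (U j) (U i)) = (\<Sum>j\<in>?I. if j = i then f (U i) else 0)"
   using orth i(1) by (intro sum.cong) auto
  ultimately show "f x = 0" using i by simp
 qed simp
 obtain B where B: "B \<subseteq> V" "fs.independent B" "V \<subseteq> fs.span B" "card B = fs.dim V" by (rule fs.basis_exists)
 have dim: "fs.dim V = fun_dim V" by (simp add: fun_dim_def)
 \<comment> \<open>The dimension is the cardinality of a basis and an infinite set has cardinality
   0, so a positive dimension forces the basis to be finite.\<close>
 hence finB: "finite B" using B(4) m card_ge_0_finite by metis
 have "v : fs.span (U ` ?I)"
 proof (rule ccontr)
  assume nv: "v ~: fs.span (U ` ?I)"
  have "insert v (U ` ?I) \<subseteq> V" using U v by blast
  hence "insert v (U ` ?I) \<subseteq> fs.span B" using B(3) by (rule order_trans)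
  from fs.independent_span_bound[OF finB fs.independent_insertI[OF nv ind] this]
  have "card (insert v (U ` ?I)) <= card B" by (rule conjunct2)
  moreover have "v ~: U ` ?I" using nv fs.span_base[of v "U ` ?I"] by (rule contrapos_nn)
  ultimately show False using card_image[OF inj] B(4) dim by simp
 qed
 then obtain c where "v = (\<Sum>x\<in>U ` ?I. (%y. c x * x y))"
  unfolding fs.span_finite[OF finite_imageI[OF finite_atLeastAtMost]] by (elim rangeE)
 hence "v = (%x. \<Sum>j\<in>?I. c (U j) * U j x)" unfolding sum.reindex[OF inj] by (simp add: fun_eq_iff sum_fun_apply)
 thus ?thesis by (rule exI[of _ "%j. c (U j)"])
qed

text \<open>Division of a positive number by zero is infinite in \<open>ennreal\<close>, so
  finiteness of the supremum already excludes a coincidence of \<open>Lam j\<close> and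
  \<open>lam i\<close>.\<close>

lemma cluster_sep_bound:
 assumes fin: "cluster_sep lam Lam m J < \<infinity>" and i: "i : J" and j: "j : {1..m} - J" and l: "0 < lam i"
 shows "Lam j ~= lam i" "\<bar>lam i / (Lam j - lam i)\<bar> <= enn2real (cluster_sep lam Lam m J)"
proof -
 have le: "ennreal \<bar>lam i\<bar> / ennreal \<bar>Lam j - lam i\<bar> <= cluster_sep lam Lam m J"
  unfolding cluster_sep_def by (rule SUP_upper2[OF i], rule SUP_upper[OF j])
 show ne: "Lam j ~= lam i"
 proof
  assume "Lam j = lam i"
  hence "ennreal \<bar>lam i\<bar> / ennreal \<bar>Lam j - lam i\<bar> = \<infinity>" using l by (simp add: ennreal_divide_zero)
  thus False using le fin by simp
 qed
 have "ennreal \<bar>lam i\<bar> / ennreal \<bar>Lam j - lam i\<bar> = ennreal (\<bar>lam i / (Lam j - lam i)\<bar>)"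
  using ne by (simp add: divide_ennreal)
 hence "ennreal (\<bar>lam i / (Lam j - lam i)\<bar>) <= ennreal (enn2real (cluster_sep lam Lam m J))" using le fin by simp
 thus "\<bar>lam i / (Lam j - lam i)\<bar> <= enn2real (cluster_sep lam Lam m J)" by (simp add: ennreal_le_iff enn2real_nonneg)
qed

text \<open>With \<open>t = l / (Lam - l)\<close> the weight is \<open>1 + t\<close> and
  \<open>t * Lam = l * (1 + t)\<close>, whence \<open>l * y^2 = t * (1 + t) * (Lam * w^2)\<close>;
  both \<open>t\<close> and \<open>1 + t\<close> are at most \<open>1 + \<mu>\<close> in absolute
  value.\<close>

lemma cluster_weights:
 fixes l w Lam \<mu> :: real
 assumes l: "0 < l" and Lam: "0 < Lam" "Lam ~= l" and \<mu>: "\<bar>l / (Lam - l)\<bar> <= \<mu>"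
 defines y_eq: "y \<equiv> Lam / (Lam - l) * w"
 shows "Lam * y^2 <= (1 + \<mu>)^2 * (Lam * w^2)" "l * y^2 <= (1 + \<mu>)^2 * (Lam * w^2)" "(Lam - l) * y * w = Lam * w^2"
proof -
 define t where "t = l / (Lam - l)"
 have t: "\<bar>t\<bar> <= \<mu>" using \<mu> by (simp add: t_def)
 have tl: "t * Lam = l * (1 + t)" using Lam(2) by (simp add: t_def field_simps)
 have y: "y = (1 + t) * w" using Lam(2) by (simp add: y_eq t_def field_simps)
 have t1: "\<bar>1 + t\<bar> <= 1 + \<mu>" using t by linarith
 have sq: "(1 + t)^2 <= (1 + \<mu>)^2" using t1 t by (intro power2_le_iff_abs_le[THEN iffD2]) linarith+
 have "(1 + t)^2 * (Lam * w^2) <= (1 + \<mu>)^2 * (Lam * w^2)" using Lam(1) by (intro mult_right_mono sq) simp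
 thus "Lam * y^2 <= (1 + \<mu>)^2 * (Lam * w^2)" unfolding y by (simp add: power_mult_distrib mult_ac)
 have "t * (1 + t) <= \<bar>t\<bar> * \<bar>1 + t\<bar>" by (simp add: abs_mult[symmetric])
 also have "... <= (1 + \<mu>) * (1 + \<mu>)" using t t1 by (intro mult_mono) linarith+
 finally have "t * (1 + t) * (Lam * w^2) <= (1 + \<mu>)^2 * (Lam * w^2)"
  using Lam(1) unfolding power2_eq_square[of "1 + \<mu>"] by (intro mult_right_mono) simp_all
 moreover have "l * y^2 = (l * (1 + t)) * (1 + t) * w^2" unfolding y by (simp add: power2_eq_square)
 hence "l * y^2 = t * (1 + t) * (Lam * w^2)" unfolding tl[symmetric] by simp
 ultimately show "l * y^2 <= (1 + \<mu>)^2 * (Lam * w^2)" by simp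
 show "(Lam - l) * y * w = Lam * w^2" using Lam(2) by (simp add: y_eq power2_eq_square)
qed

section \<open>The estimate for the cluster\<close>

context mesh
begin

text \<open>The definition admits only test functions of mean zero on the smooth surface, which the
  lift of a discrete function need not have. Subtracting the mean changes neither side: constants
  have no energy, and \<open>u\<close> has mean zero.\<close>

lemma eigenfunction_weak:
 assumes e: "eigenfunction mg (normal_ext Sg) l u"
 shows "u : H1 mg n" "!!v. v : H1 mg n ==> energy_form mg n u v = l * mass_form mg u v"
proof -
 have u: "u : H1 mg n" "(\<integral>x. u x \<partial>mg) = 0" "~ (AE x in mg. u x = 0)"
  and eq: "!!v. v : H1 mg n ==> (\<integral>x. v x \<partial>mg) = 0 ==> energy_form mg n u v = l * mass_form mg u v"
  using e unfolding eigenfunction_def H1_mean_zero_def forms_\<nu> by auto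
 show "u : H1 mg n" by (rule u(1))
 interpret finite_measure mg by (rule finite_measures(2))
 fix v assume v: "v : H1 mg n"
 have one: "(%x. 1) : H1 mg n" by (rule Sg.H1_const)
 have m: "measure mg (space mg) ~= 0"
 proof
  assume "measure mg (space mg) = 0"
  hence "space mg : null_sets mg" by (simp add: emeasure_eq_measure null_sets_def)
  hence "AE x in mg. u x = 0" by (rule AE_I') blast
  thus False using u(3) by simp
 qed
 define m0 where "m0 = (\<integral>x. v x \<partial>mg) / measure mg (space mg)"
 let ?v = "%x. v x + (- m0) * 1"
 have v': "?v : H1 mg n" by (rule Sg.H1_add_scale[OF v one])
 have iv: "integrable mg v" using L2_mult_integrable[OF Sg.H1_L2[OF v] Sg.H1_L2[OF one]] by simp
 have "(\<integral>x. ?v x \<partial>mg) = (\<integral>x. v x \<partial>mg) - m0 * measure mg (space mg)" using iv by (simp add: mult.commute)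
 hence "(\<integral>x. ?v x \<partial>mg) = 0" using m by (simp add: m0_def)
 hence e: "energy_form mg n u ?v = l * mass_form mg u ?v" by (rule eq[OF v'])
 have "energy_form mg n u ?v = energy_form mg n u v"
  using Sg.energy_add_scale[OF v one u(1), of "- m0"] Sg.energy_const[OF u(1), of 1]
  by (simp add: Sg.energy_commute[of u])
 moreover have "mass_form mg u ?v = mass_form mg u v"
  using mass_form_add_scale[OF Sg.H1_L2[OF v] Sg.H1_L2[OF one] Sg.H1_L2[OF u(1)], of "- m0"] u(2)
  by (simp add: mass_form_commute[of _ u] mass_form_def[of _ "%x. 1" u])
 ultimately show "energy_form mg n u v = l * mass_form mg u v" using e by simp
qed

lemma cluster_estimate:
 fixes r :: nat and lam Lam :: "nat => real" and U :: "nat => 'd ambient => real" and J :: "nat set" and \<alpha> :: real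
 defines "VV \<equiv> fe_mean_zero r TT L N mh"
 defines "\<mu> \<equiv> enn2real (cluster_sep lam Lam (fun_dim VV) J)"
 assumes ds: "discrete_spectrum mh N VV Lam U"
  and J: "J \<subseteq> {1..fun_dim VV}" and fin: "cluster_sep lam Lam (fun_dim VV) J < \<infinity>"
  and i: "i : J" and l: "0 < lam i"
  and eig: "eigenfunction mg (normal_ext Sg) (lam i) u"
  and Gu: "energy_projection mh N VV (%x. u (cp x)) Gu"
  and Zu: "energy_projection mh N (cluster_space U J) (%x. u (cp x)) Zu"
 shows "energy_norm mh N (%x. u (cp x) - Zu x)
   <= energy_norm mh N (%x. u (cp x) - Gu x)
    + (cA + cJ * ce + 1) * sqrt (lam i) * (1 + \<mu>) * mass_norm mh (%x. u (cp x) - Gu x - \<alpha>)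
    + (cA + cJ * ce + 1) * sqrt (lam i) * (1 + \<mu>) * h ^ (k + 1) * mass_norm mh (%x. u (cp x))"
proof -
 define l where "l = lam i"
 define x where "x = (%z. u (cp z))"
 let ?I = "{1..fun_dim VV}" and ?A = "energy_form mh Nh" and ?B = "mass_form mh"
 have l0: "0 < l" using l by (simp add: l_def)
 have VV: "!!V. V : VV ==> V : H1 mh Nh" "!!V. V : VV ==> (\<integral>z. V z \<partial>mh) = 0"
  "!!V. V : VV ==> V : fe_space r TT L N mh"
  by (auto simp: VV_def fe_mean_zero_def fe_space_def forms_N)
 have U: "!!j. j : ?I ==> 0 < Lam j" "!!j. j : ?I ==> U j : VV"
  "!!i j. i : ?I ==> j : ?I ==> ?B (U i) (U j) = (if i = j then 1 else 0)"
  "!!j W. j : ?I ==> W : VV ==> ?A (U j) W = Lam j * ?B (U j) W"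
  using ds by (auto simp: discrete_spectrum_def Let_def forms_N)
 note UH = VV(1)[OF U(2)]
 note H1L2 = Sh.H1_L2
 have AU: "?A (U i) (U j) = (if i = j then Lam j else 0)" if "i : ?I" "j : ?I" for i j
  using U(3)[OF that] U(4)[OF that(1) U(2)[OF that(2)]] by simp
 have A_sum: "?A (%z. \<Sum>j\<in>S. c j * U j z) (U i) = (if i : S then c i * Lam i else 0)"
  if S: "S \<subseteq> ?I" and i: "i : ?I" for S c i
 proof -
  have fS: "finite S" using S finite_subset by blast
  have "?A (%z. \<Sum>j\<in>S. c j * U j z) (U i) = (\<Sum>j\<in>S. c j * ?A (U j) (U i))"
   using Sh.energy_sum[OF fS _ UH[OF i], of U c] UH S by blast
  also have "... = (\<Sum>j\<in>S. if j = i then c i * Lam i else 0)"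
   using S i AU by (intro sum.cong refl) (auto split: if_splits)
  finally show ?thesis using fS by simp
 qed
 have B_sum: "?B (%z. \<Sum>j\<in>S. c j * U j z) (U i) = (if i : S then c i else 0)"
  if S: "S \<subseteq> ?I" and i: "i : ?I" for S c i
 proof -
  have fS: "finite S" using S finite_subset by blast
  have "?B (%z. \<Sum>j\<in>S. c j * U j z) (U i) = (\<Sum>j\<in>S. c j * ?B (U j) (U i))"
   using mass_form_sum[OF fS _ H1L2[OF UH[OF i]], of U c] H1L2[OF UH] S by blast
  also have "... = (\<Sum>j\<in>S. if j = i then c i else 0)"
   using S i U(3) by (intro sum.cong refl) (auto split: if_splits)
  finally show ?thesis using fS by simp
 qed
 have HS: "(%z. \<Sum>j\<in>S. c j * U j z) : H1 mh Nh" if S: "S \<subseteq> ?I" for S c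
  using Sh.energy_sum[of S U "%_. 0" c] UH S finite_subset[OF S] Sh.H1_const[of 0] by blast
 have u: "u : H1 mg n" "!!v. v : H1 mg n ==> energy_form mg n u v = l * mass_form mg u v"
  using eigenfunction_weak[OF eig] by (auto simp: l_def)
 have xH: "x : H1 mh Nh" unfolding x_def H1_def using has_weak_grad_pullback[OF Sg.weak_grad[OF u(1)]] by blast
 have GV: "Gu : VV" "!!V. V : VV ==> ?A Gu V = ?A x V"
  using Gu by (auto simp: energy_projection_def forms_N x_def)
 have ZV: "Zu : cluster_space U J" "!!V. V : cluster_space U J ==> ?A Zu V = ?A x V"
  using Zu by (auto simp: energy_projection_def forms_N x_def)
 have dim0: "0 < fun_dim VV" using J i by auto
 obtain g where g: "Gu = (%z. \<Sum>j\<in>?I. g j * U j z)"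
  using orthonormal_span[OF dim0 U(2) H1L2[OF VV(1)] U(3) GV(1)] by blast
 obtain z where z: "Zu = (%y. \<Sum>j\<in>J. z j * U j y)" using ZV(1) by (auto simp: cluster_space_def)
 note GH = VV(1)[OF GV(1)]
 have ZH: "Zu : H1 mh Nh" unfolding z by (rule HS[OF J])
 define S where "S = ?I - J"
 have S: "S \<subseteq> ?I" "finite S" by (auto simp: S_def)
 have US: "U j : H1 mh Nh" if "j : S" for j by (rule UH[OF subsetD[OF S(1) that]])
 have UJ: "U j : cluster_space U J" if "j : J" for j
 proof -
  have fJ: "finite J" using J finite_subset by blast
  have "U j = (%y. \<Sum>j'\<in>J. (if j' = j then 1 else 0) * U j' y)"
  proof
   fix y
   have "(\<Sum>j'\<in>J. (if j' = j then 1 else 0) * U j' y) = (\<Sum>j'\<in>J. if j' = j then U j y else 0)"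
    by (intro sum.cong) auto
   thus "U j y = (\<Sum>j'\<in>J. (if j' = j then 1 else 0) * U j' y)" using that fJ by simp
  qed
  thus ?thesis unfolding cluster_space_def mem_Collect_eq by (rule exI[of _ "%j'. if j' = j then 1 else 0"])
 qed
 \<comment> \<open>\<open>Gu\<close> and \<open>Zu\<close> have the same energy products with each
   \<open>U j\<close> of the cluster, and these functions are orthogonal, so the coefficients agree
   and the difference lives on \<open>S\<close>.\<close>
 have gz: "g j = z j" if j: "j : J" for j
 proof -
  have jI: "j : ?I" using j J by blast
  have "?A Gu (U j) = ?A Zu (U j)" using GV(2)[OF U(2)[OF jI]] ZV(2)[OF UJ[OF j]] by simp
  hence "g j * Lam j = z j * Lam j" unfolding g z using A_sum[OF subset_refl jI, of g] A_sum[OF J jI, of z] jI j by auto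
  thus ?thesis using U(1)[OF jI] by simp
 qed
 define W where "W = (%y. \<Sum>j\<in>S. g j * U j y)"
 have W: "Gu y - Zu y = W y" for y
 proof -
  have "Gu y = (\<Sum>j\<in>S. g j * U j y) + (\<Sum>j\<in>J. g j * U j y)"
   unfolding g S_def by (rule sum.subset_diff[OF J]) simp
  thus ?thesis unfolding z W_def using gz by simp
 qed
 have WH: "W : H1 mh Nh" unfolding W_def by (rule HS[OF S(1)])
 have Sprop: "Lam j ~= l" "\<bar>l / (Lam j - l)\<bar> <= \<mu>" "0 < Lam j" if "j : S" for j
  using cluster_sep_bound[OF fin i, of j] l that U(1)[of j] by (auto simp: S_def l_def \<mu>_def)
 \<comment> \<open>Chosen so that \<open>(Lam j - l) * y j = Lam j * g j\<close>; this rewrites the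
   squared energy of \<open>W\<close> in terms of \<open>x\<close> tested with \<open>Y'\<close>,
   where the eigenvalue equation can be used.\<close>
 define y where "y j = Lam j / (Lam j - l) * g j" for j
 define Y' where "Y' = (%z. \<Sum>j\<in>S. y j * U j z)"
 have YH: "Y' : H1 mh Nh" unfolding Y'_def by (rule HS[OF S(1)])
 have wt: "Lam j * (y j)^2 <= (1 + \<mu>)^2 * (Lam j * (g j)^2)"
  "l * (y j)^2 <= (1 + \<mu>)^2 * (Lam j * (g j)^2)"
  "(Lam j - l) * y j * g j = Lam j * (g j)^2" if j: "j : S" for j
  using cluster_weights[OF l0 Sprop(3)[OF j] Sprop(1)[OF j] Sprop(2)[OF j], where w = "g j"] unfolding y_def .
 have AWW: "?A W W = (\<Sum>j\<in>S. Lam j * (g j)^2)"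
 proof -
  have "?A W W = (\<Sum>j\<in>S. g j * ?A (U j) W)"
   using conjunct2[OF Sh.energy_sum[where U = U and c = g, OF S(2) US WH]] unfolding W_def[symmetric] .
  also have "... = (\<Sum>j\<in>S. Lam j * (g j)^2)"
  proof (rule sum.cong[OF refl])
   fix j assume j: "j : S"
   hence "?A (U j) W = g j * Lam j" using A_sum[OF S(1), of j g] S(1) by (simp add: Sh.energy_commute[of "U j"] W_def subset_iff)
   thus "g j * ?A (U j) W = Lam j * (g j)^2" by (simp add: power2_eq_square)
  qed
  finally show ?thesis .
 qed
 have AYY: "?A Y' Y' = (\<Sum>j\<in>S. Lam j * (y j)^2)"
 proof -
  have "?A Y' Y' = (\<Sum>j\<in>S. y j * ?A (U j) Y')"
   using conjunct2[OF Sh.energy_sum[where U = U and c = y, OF S(2) US YH]] unfolding Y'_def[symmetric] .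
  also have "... = (\<Sum>j\<in>S. Lam j * (y j)^2)"
  proof (rule sum.cong[OF refl])
   fix j assume j: "j : S"
   hence "?A (U j) Y' = y j * Lam j" using A_sum[OF S(1), of j y] S(1) by (simp add: Sh.energy_commute[of "U j"] Y'_def subset_iff)
   thus "y j * ?A (U j) Y' = Lam j * (y j)^2" by (simp add: power2_eq_square)
  qed
  finally show ?thesis .
 qed
 have BY: "?B v Y' = (\<Sum>j\<in>S. y j * ?B v (U j))" if v: "L2 mh v" for v
  unfolding Y'_def mass_form_commute[of mh v]
  by (rule mass_form_sum[where U = U, OF S(2) H1L2[OF US] v])
 have BYY: "?B Y' Y' = (\<Sum>j\<in>S. (y j)^2)"
  unfolding BY[OF H1L2[OF YH]]
 proof (rule sum.cong[OF refl])
  fix j assume j: "j : S"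
  hence "?B Y' (U j) = y j" using B_sum[OF S(1), of j y] S(1) by (simp add: Y'_def subset_iff)
  thus "y j * ?B Y' (U j) = (y j)^2" by (simp add: power2_eq_square)
 qed
 define D where "D = energy_norm mh Nh W"
 have D0: "0 <= D" by (simp add: D_def energy_norm_def Sh.energy_nonneg)
 have D2: "D^2 = (\<Sum>j\<in>S. Lam j * (g j)^2)" by (simp add: D_def Sh.energy_norm_sq AWW)
 have \<mu>0: "0 <= \<mu>" by (simp add: \<mu>_def)
 have YA: "energy_norm mh Nh Y' <= (1 + \<mu>) * D"
 proof (rule power2_le_imp_le)
  have "(energy_norm mh Nh Y')^2 <= (\<Sum>j\<in>S. (1 + \<mu>)^2 * (Lam j * (g j)^2))"
   unfolding Sh.energy_norm_sq AYY by (intro sum_mono wt(1))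
  thus "(energy_norm mh Nh Y')^2 <= ((1 + \<mu>) * D)^2" by (simp add: power_mult_distrib D2 sum_distrib_left)
 qed (use \<mu>0 D0 in simp)
 have YM: "sqrt l * mass_norm mh Y' <= (1 + \<mu>) * D"
 proof (rule power2_le_imp_le)
  have "(sqrt l * mass_norm mh Y')^2 = (\<Sum>j\<in>S. l * (y j)^2)"
   using l0 by (simp add: power_mult_distrib mass_norm_def mass_form_nonneg BYY sum_distrib_left sum_nonneg)
  also have "... <= (\<Sum>j\<in>S. (1 + \<mu>)^2 * (Lam j * (g j)^2))" by (intro sum_mono wt(2))
  finally show "(sqrt l * mass_norm mh Y')^2 <= ((1 + \<mu>) * D)^2" by (simp add: power_mult_distrib D2 sum_distrib_left)
 qed (use \<mu>0 D0 in simp)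
 define E where "E = (%z. x z - Gu z - \<alpha>)"
 have EL: "L2 mh E"
 proof -
  have "L2 mh (%z. (x z + (-1) * Gu z) + (-\<alpha>) * 1)"
   by (intro L2_add_scale H1L2 xH GH Sh.H1_const)
  thus ?thesis by (simp add: E_def)
 qed
 have xU: "?A x (U j) = g j * Lam j" "?B E (U j) = ?B x (U j) - g j" if j: "j : S" for j
 proof -
  have jI: "j : ?I" using j S(1) by blast
  show "?A x (U j) = g j * Lam j"
   using GV(2)[OF U(2)[OF jI]] A_sum[OF subset_refl jI, of g] jI unfolding g by simp
  have c1: "L2 mh (%z. 1)" by (rule H1L2[OF Sh.H1_const])
  have "?B (%z. (x z + (-1) * Gu z) + (-\<alpha>) * 1) (U j) = ?B x (U j) + (-1) * ?B Gu (U j) + (-\<alpha>) * ?B (%z. 1) (U j)"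
   by (subst mass_form_add_scale[OF L2_add_scale[OF H1L2[OF xH] H1L2[OF GH]] c1 H1L2[OF UH[OF jI]]],
     subst mass_form_add_scale[OF H1L2[OF xH] H1L2[OF GH] H1L2[OF UH[OF jI]]]) simp
  \<comment> \<open>Here \<alpha> disappears: discrete functions have mean zero on the approximate
    surface.\<close>
  moreover have "?B (%z. 1) (U j) = 0" using VV(2)[OF U(2)[OF jI]] by (simp add: mass_form_def)
  moreover have "?B Gu (U j) = g j" unfolding g using B_sum[OF subset_refl jI, of g] jI by simp
  ultimately show "?B E (U j) = ?B x (U j) - g j" by (simp add: E_def)
 qed
 \<comment> \<open>Lifts of the discrete eigenfunctions; their combination \<open>V'\<close> is the
   lift of \<open>Y'\<close> and an admissible test function for \<open>u\<close>.\<close>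
 have "EX v. ALL j:S. v j : H1 mg n & (ALL z:Sh. U j z = v j (cp z))"
  using fe_lift[OF VV(3)[OF U(2)]] S(1) by (intro bchoice) blast
 then obtain v where v: "!!j. j : S ==> v j : H1 mg n" "!!j z. j : S ==> z : Sh ==> U j z = v j (cp z)" by blast
 define V' where "V' = (%p. \<Sum>j\<in>S. y j * v j p)"
 have V'H: "V' : H1 mg n" unfolding V'_def by (rule conjunct1[OF Sg.energy_sum[where U = v and c = y, OF S(2) v(1) u(1)]])
 have V'Y: "V' (cp z) = Y' z" if "z : space mh" for z
  using v(2) that by (simp add: V'_def Y'_def space_mh)
 have cong: "?A f (%z. V' (cp z)) = ?A f Y'" "?B f (%z. V' (cp z)) = ?B f Y'" for f
 proof -
  have "has_weak_grad mh Nh (%z. V' (cp z)) = has_weak_grad mh Nh Y'"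
   by (intro ext has_weak_grad_cong V'Y)
  thus "?A f (%z. V' (cp z)) = ?A f Y'" by (simp add: energy_form_def weak_grad_def)
  show "?B f (%z. V' (cp z)) = ?B f Y'" unfolding mass_form_def
   by (rule Bochner_Integration.integral_cong) (simp_all add: V'Y)
 qed
 have nA: "energy_norm mh Nh (%z. V' (cp z)) = energy_norm mh Nh Y'"
  unfolding energy_norm_def cong(1) Sh.energy_commute[of "%z. V' (cp z)" Y'] ..
 have nM: "mass_norm mh (%z. V' (cp z)) = mass_norm mh Y'"
  unfolding mass_norm_def cong(2) mass_form_commute[of _ "%z. V' (cp z)" Y'] ..
 let ?X = "mass_norm mh x" and ?H = "h ^ (k + 1)"
 have rA: "\<bar>?A x Y' - energy_form mg n u V'\<bar> <= cA * ?H * (sqrt l * ?X * energy_norm mh Nh Y')"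
  using energy_residual[OF u(1) less_imp_le[OF l0] u(2)[OF u(1)] V'H, unfolded cong nA, folded x_def] .
 have rM: "\<bar>?B x Y' - mass_form mg u V'\<bar> <= cJ * ce * ?H * (?X * mass_norm mh Y')"
  using mass_compare[OF Sg.H1_L2[OF u(1)] Sg.H1_L2[OF V'H], unfolded cong nM, folded x_def] .
 have AxY: "?A x Y' = (\<Sum>j\<in>S. y j * (g j * Lam j))"
 proof -
  have "?A x Y' = (\<Sum>j\<in>S. y j * ?A (U j) x)"
   unfolding Sh.energy_commute[of x] using conjunct2[OF Sh.energy_sum[where U = U and c = y, OF S(2) US xH]] unfolding Y'_def[symmetric] .
  thus ?thesis using xU(1) by (simp add: Sh.energy_commute[of _ x])
 qed
 have BEY: "?B E Y' = ?B x Y' - (\<Sum>j\<in>S. y j * g j)"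
  unfolding BY[OF EL] BY[OF H1L2[OF xH]] using xU(2) by (simp add: right_diff_distrib sum_subtractf)
 have "D^2 = (\<Sum>j\<in>S. (Lam j - l) * y j * g j)" unfolding D2 by (intro sum.cong refl wt(3)[symmetric])
 also have "... = ?A x Y' - l * (\<Sum>j\<in>S. y j * g j)"
  unfolding AxY sum_distrib_left sum_subtractf[symmetric] by (intro sum.cong refl) (simp add: algebra_simps)
 \<comment> \<open>The two forms on the smooth surface are inserted at no cost, since they cancel by
   the eigenvalue equation; they split off the consistency errors and leave \<open>E\<close> tested
   with \<open>Y'\<close>.\<close>
 also have "... = (?A x Y' - energy_form mg n u V') + l * (mass_form mg u V' - ?B x Y') + l * ?B E Y'"
  unfolding u(2)[OF V'H] BEY by (simp add: algebra_simps)
 finally have DD: "D^2 = (?A x Y' - energy_form mg n u V') + l * (mass_form mg u V' - ?B x Y') + l * ?B E Y'" .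
 have X0: "0 <= ?X" "0 <= mass_norm mh E" "0 <= mass_norm mh Y'" by (simp_all add: mass_norm_def mass_form_nonneg)
 have H0: "0 <= ?H" using h_bounds by simp
 have cA0: "0 <= cA" using c_pos by (simp add: cA_def)
 have cM0: "0 <= cJ * ce" using c_pos by simp
 have sl: "l = sqrt l * sqrt l" "0 <= sqrt l" using l0 by simp_all
 \<comment> \<open>A common bound for \<open>sqrt l\<close> times the energy norm and
   \<open>l\<close> times the mass norm of \<open>Y'\<close>, so that one factor \<open>D\<close>
   can be cancelled from all three terms.\<close>
 define Q where "Q = sqrt l * ((1 + \<mu>) * D)"
 have Q1: "cA * ?H * (sqrt l * ?X * energy_norm mh Nh Y') <= cA * ?H * ?X * Q"
 proof -
  have "cA * ?H * (sqrt l * ?X * energy_norm mh Nh Y') = (cA * ?H * ?X * sqrt l) * energy_norm mh Nh Y'" by (simp only: mult_ac)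
  also have "... <= (cA * ?H * ?X * sqrt l) * ((1 + \<mu>) * D)"
   using cA0 H0 X0 sl(2) by (intro mult_left_mono YA) simp
  finally show ?thesis by (simp only: Q_def mult_ac)
 qed
 have lY: "l * mass_norm mh Y' <= Q"
 proof -
  have "l * mass_norm mh Y' = sqrt l * (sqrt l * mass_norm mh Y')" using sl(1) by (simp only: mult.assoc[symmetric])
  also have "... <= Q" unfolding Q_def by (intro mult_left_mono YM sl(2))
  finally show ?thesis .
 qed
 have Q2: "\<bar>l * (mass_form mg u V' - ?B x Y')\<bar> <= cJ * ce * ?H * ?X * Q"
 proof -
  have "\<bar>l * (mass_form mg u V' - ?B x Y')\<bar> <= l * (cJ * ce * ?H * (?X * mass_norm mh Y'))"
   unfolding abs_mult using rM l0 by (simp add: abs_minus_commute)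
  also have "... = (cJ * ce * ?H * ?X) * (l * mass_norm mh Y')" by (simp only: mult_ac)
  also have "... <= (cJ * ce * ?H * ?X) * Q" using cM0 H0 X0 by (intro mult_left_mono lY) simp
  finally show ?thesis .
 qed
 have Q3: "\<bar>l * ?B E Y'\<bar> <= mass_norm mh E * Q"
 proof -
  have "\<bar>l * ?B E Y'\<bar> <= l * (mass_norm mh E * mass_norm mh Y')"
   unfolding abs_mult using mass_form_Cauchy_Schwarz[OF EL H1L2[OF YH]] l0 by simp
  also have "... = mass_norm mh E * (l * mass_norm mh Y')" by (simp only: mult_ac)
  also have "... <= mass_norm mh E * Q" by (intro mult_left_mono lY X0)
  finally show ?thesis .
 qed
 have "D^2 <= cA * ?H * ?X * Q + cJ * ce * ?H * ?X * Q + mass_norm mh E * Q"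
  unfolding DD using rA Q1 Q2 Q3 by linarith
 also have "... = (sqrt l * (1 + \<mu>) * ((cA + cJ * ce) * ?H * ?X + mass_norm mh E)) * D"
  unfolding Q_def by (simp add: algebra_simps)
 finally have DQ: "D * D <= (sqrt l * (1 + \<mu>) * ((cA + cJ * ce) * ?H * ?X + mass_norm mh E)) * D"
  by (simp only: power2_eq_square)
 have R0: "0 <= sqrt l * (1 + \<mu>) * ((cA + cJ * ce) * ?H * ?X + mass_norm mh E)"
  using sl(2) \<mu>0 cA0 cM0 H0 X0 by simp
 have D1: "D <= sqrt l * (1 + \<mu>) * ((cA + cJ * ce) * ?H * ?X + mass_norm mh E)"
 proof (cases "D = 0")
  case True
  thus ?thesis using R0 by simp
 next
  case False
  thus ?thesis using DQ D0 mult_le_cancel_right_pos[of D] by simp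
 qed
 also have "... <= sqrt l * (1 + \<mu>) * ((cA + cJ * ce + 1) * ?H * ?X + (cA + cJ * ce + 1) * mass_norm mh E)"
 proof (intro mult_left_mono add_mono)
  show "(cA + cJ * ce) * ?H * ?X <= (cA + cJ * ce + 1) * ?H * ?X"
   using H0 X0 by (intro mult_right_mono) auto
  have "1 * mass_norm mh E <= (cA + cJ * ce + 1) * mass_norm mh E"
   using cA0 cM0 X0 by (intro mult_right_mono) auto
  thus "mass_norm mh E <= (cA + cJ * ce + 1) * mass_norm mh E" by simp
 qed (use sl(2) \<mu>0 in simp)
 finally have D3: "D <= (cA + cJ * ce + 1) * sqrt l * (1 + \<mu>) * mass_norm mh E
   + (cA + cJ * ce + 1) * sqrt l * (1 + \<mu>) * ?H * ?X" by (simp only: algebra_simps)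
 have "(%z. x z + (-1) * Gu z) : H1 mh Nh" by (rule Sh.H1_add_scale[OF xH GH])
 hence "(%z. x z - Gu z) : H1 mh Nh" by simp
 from Sh.energy_norm_triangle[OF this WH]
 have "energy_norm mh Nh (%z. x z - Zu z) <= energy_norm mh Nh (%z. x z - Gu z) + D"
  unfolding D_def by (simp add: W[symmetric])
 with D3 show ?thesis unfolding forms_N x_def E_def l_def by linarith
qed

end

theorem theorem4p3:
  fixes \<gamma> :: "('d::{finite,wellorder}) ambient set"
    and \<sigma> :: "'d ambient measure"
    and k r :: nat and \<rho> \<eta> c :: real
  assumes "closed_surface \<gamma>"
    and "surface_measure \<gamma> \<sigma>"
    and "1 \<le> k" and "1 \<le> r"
    and "0 < \<rho>" and "0 < \<eta>" and "0 < c"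
  shows "\<exists>\<delta>\<^sub>0>0. \<forall>\<delta>. 0 < \<delta> \<and> \<delta> \<le> \<delta>\<^sub>0 \<longrightarrow> projection_strip \<gamma> \<delta> \<and>
    (\<exists>C>0. \<forall>\<T> F L N \<Sigma> lam \<Lambda> U n M i u Gu Zu \<alpha>.
      let \<nu> = normal_ext \<gamma>;
          h = mesh_size \<T> L;
          VV = fe_mean_zero r \<T> L N \<Sigma>;
          J = {n..n + M};
          \<mu> = cluster_sep lam \<Lambda> (fun_dim VV) J;
          u' = u \<circ> closest_point \<gamma>
      in approx_surface \<gamma> \<delta> k \<rho> \<eta> c \<T> F L N \<Sigma> \<longrightarrow>
         laplace_spectrum \<sigma> \<nu> lam \<longrightarrow>
         discrete_spectrum \<Sigma> N VV \<Lambda> U \<longrightarrow>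
         1 \<le> n \<longrightarrow> n + M \<le> fun_dim VV \<longrightarrow>
         lam (n - 1) < lam n \<longrightarrow> lam (n + M) < lam (n + M + 1) \<longrightarrow>
         \<mu> < \<infinity> \<longrightarrow>
         i \<in> J \<longrightarrow> eigenfunction \<sigma> \<nu> (lam i) u \<longrightarrow>
         energy_projection \<Sigma> N VV u' Gu \<longrightarrow>
         energy_projection \<Sigma> N (cluster_space U J) u' Zu \<longrightarrow>
         energy_norm \<Sigma> N (\<lambda>x. u' x - Zu x)
           \<le> energy_norm \<Sigma> N (\<lambda>x. u' x - Gu x)
             + C * sqrt (lam i) * (1 + enn2real \<mu>) * mass_norm \<Sigma> (\<lambda>x. u' x - Gu x - \<alpha>)
             + C * sqrt (lam i) * (1 + enn2real \<mu>) * h ^ (k + 1) * mass_norm \<Sigma> u')"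
proof -
 obtain nn K where "oriented_tubular \<gamma> nn K" by (rule closed_surface_oriented_tubular[OF assms(1)])
 then interpret oriented_tubular \<gamma> nn K .
 obtain Mk where Mk: "markov_const k Mk"
 proof (rule markov_at_endpoint[of k])
  fix C :: real
  assume "0 < C" "!!(p::real poly) s e. degree p <= k ==> 0 < s ==> (!!t. 0 <= t ==> t <= s ==> \<bar>poly p t\<bar> <= e) ==>
   \<bar>coeff p 1\<bar> * s <= C * e"
  thus thesis by (intro that[of C]) (simp add: markov_const_def)
 qed
 \<comment> \<open>Because \<open>h0 <= 1\<close>, every \<open>h\<close> below it satisfies
   \<open>c * h ^ k <= c * h0 <= 1/2\<close>, the bound on the normals that is used on fine
   meshes.\<close>
 define h0 where "h0 = min 1 (1 / (2 * c))"
 have h0: "0 < h0" "h0 <= 1" "c * h0 <= 1/2"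
 proof -
  show "0 < h0" "h0 <= 1" using assms by (simp_all add: h0_def)
  have "c * h0 <= c * (1 / (2 * c))" using assms by (intro mult_left_mono) (auto simp: h0_def)
  thus "c * h0 <= 1/2" using assms by simp
 qed
 define S where "S = 4 * real CARD('d) * Mk * (16 * K * (extent / \<rho>)^2 + 2)"
 have Mk0: "0 < Mk" using Mk by (simp add: markov_const_def)
 have "0 < 16 * K * (extent / \<rho>)^2 + 2" using K_pos by (intro add_nonneg_pos) simp_all
 hence S0: "0 < S" using Mk0 unfolding S_def by (intro mult_pos_pos) simp_all
 define q where "q = \<rho> * (h0 / \<eta>) / S"
 have q0: "0 < q" using assms h0 S0 by (simp add: q_def)
 \<comment> \<open>The bound \<open>1 / (32 * K)\<close> keeps the distortion of the projection
   below one half, and \<open>q^2\<close> yields \<open>sqrt \<delta> <= q\<close>, the slope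
   condition for coarse meshes, through which \<open>\<rho>\<close> and \<open>\<eta>\<close>
   enter.\<close>
 define \<delta>0 where "\<delta>0 = Min {1, reach, 1 / (32 * K), q^2}"
 have \<delta>0: "0 < \<delta>0" using reach_pos K_pos q0 by (simp add: \<delta>0_def)
 have \<delta>0_le: "\<delta>0 <= 1" "\<delta>0 <= reach" "\<delta>0 <= 1 / (32 * K)" "\<delta>0 <= q^2" by (simp_all add: \<delta>0_def)
 show ?thesis
 proof (rule exI[of _ \<delta>0], rule conjI[OF \<delta>0], rule allI, rule impI, rule conjI, goal_cases)
  case (1 \<delta>)
  thus ?case using projection_strip[of \<delta>] \<delta>0_le(2) by simp
 next
  case (2 \<delta>)
  hence \<delta>: "0 < \<delta>" "\<delta> <= \<delta>0" by simp_all
  have \<delta>1: "\<delta> <= 1" "\<delta> <= reach" "\<delta> <= 1 / (32 * K)" "\<delta> <= q^2" using \<delta>(2) \<delta>0_le by linarith+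
  have \<delta>K: "32 * K * \<delta> <= 1" using \<delta>1(3) K_pos by (simp add: pos_le_divide_eq mult.commute)
  have "sqrt \<delta> <= q" using real_sqrt_le_mono[OF \<delta>1(4)] q0 by simp
  hence "S * sqrt \<delta> <= S * q" using S0 by simp
  hence slope: "S * sqrt \<delta> <= \<rho> * (h0 / \<eta>)" using S0 by (simp add: q_def)
  \<comment> \<open>The constants of the locale take only surface, curvature, degree, dimension and
    \<open>c\<close> as arguments, so they can be named before a mesh is given.\<close>
  define Ce where "Ce = mesh.ce \<gamma> K k c"
  define CA where "CA = mesh.cA \<gamma> K k c"
  define CJ where "CJ = mesh.cJ TYPE('d)"
  show ?case
  \<comment> \<open>The absolute value gives positivity at this point, before the locale with its
    facts on signs can be interpreted.\<close>
  proof (intro exI[of _ "\<bar>CA + CJ * Ce\<bar> + 1"] conjI allI; (unfold Let_def comp_def, intro impI)?)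
   fix \<T> :: "'d ambient set set" and F :: "'d ambient set => (real, 'd) vec => 'd ambient" and L N :: "'d ambient => 'd ambient" and \<Sigma> :: "'d ambient measure" and lam \<Lambda> :: "nat => real"
    and U :: "nat => 'd ambient => real" and n M i :: nat and u Gu Zu :: "'d ambient => real" and \<alpha> :: real
   let ?VV = "fe_mean_zero r \<T> L N \<Sigma>" and ?J = "{n..n + M}"
   assume ap: "approx_surface \<gamma> \<delta> k \<rho> \<eta> c \<T> F L N \<Sigma>"
    and ls: "laplace_spectrum \<sigma> (normal_ext \<gamma>) lam"
    and ds: "discrete_spectrum \<Sigma> N ?VV \<Lambda> U"
    and n: "1 <= n" "n + M <= fun_dim ?VV"
    and fin: "cluster_sep lam \<Lambda> (fun_dim ?VV) ?J < \<infinity>"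
    and i: "i : ?J" and eig: "eigenfunction \<sigma> (normal_ext \<gamma>) (lam i) u"
    and G: "energy_projection \<Sigma> N ?VV (%x. u (cp x)) Gu"
    and Z: "energy_projection \<Sigma> N (cluster_space U ?J) (%x. u (cp x)) Zu"
   interpret m: mesh \<gamma> nn K \<delta> k \<rho> \<eta> c \<T> F L N \<Sigma> \<sigma> Mk h0
    by unfold_locales (use ap assms Mk \<delta>(1) \<delta>1 \<delta>K h0 slope in \<open>simp_all add: S_def\<close>)
   have J: "?J \<subseteq> {1..fun_dim ?VV}" using n by auto
   have lam: "0 < lam i"
   proof -
    have "lam 1 <= lam i" using ls i n by (auto simp: laplace_spectrum_def intro: monoD)
    thus ?thesis using ls by (simp add: laplace_spectrum_def)
   qed
   have C: "\<bar>CA + CJ * Ce\<bar> + 1 = CA + CJ * Ce + 1"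
    using m.c_pos by (simp add: CA_def CJ_def Ce_def m.cA_def)
   show "energy_norm \<Sigma> N (%x. u (cp x) - Zu x)
      <= energy_norm \<Sigma> N (%x. u (cp x) - Gu x)
       + (\<bar>CA + CJ * Ce\<bar> + 1) * sqrt (lam i) * (1 + enn2real (cluster_sep lam \<Lambda> (fun_dim ?VV) ?J)) * mass_norm \<Sigma> (%x. u (cp x) - Gu x - \<alpha>)
       + (\<bar>CA + CJ * Ce\<bar> + 1) * sqrt (lam i) * (1 + enn2real (cluster_sep lam \<Lambda> (fun_dim ?VV) ?J)) * mesh_size \<T> L ^ (k + 1) * mass_norm \<Sigma> (%x. u (cp x))"
    unfolding C unfolding CA_def CJ_def Ce_def
    using m.cluster_estimate[OF ds J fin i lam eig G Z, of \<alpha>] by (simp only: m.h_def)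
  qed simp
 qed
qed

end
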